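(* Let $f:X\to B^{\mathrm{sph}}(G)$ be a (smooth) classifying map and let $P=f^*E^{\mathrm{sph}}(G)$ be the associated principal $G$-bundle over $X$. Then the pullback class $$f^*\mathrm{DD}(D)\in H^3(X;\mathbb Z)$$ is the Dixmier--Douady class of the lifting gerbe of $P$ associated with the central extension $1\to U(1)\to\widehat G_D\to G\to1$.
   Context: $G$ is a regular diffeological Lie group with Lie algebra $\mathfrak g$. $E^{\mathrm{sph}}(G)$ is the set of classes $[(x_i,g_i)]$ of families $(x_i,g_i)_{i\in\mathbb N}$ with $x_i\in\mathbb R$ finitely supported, $\sum_ix_i^2=1$, $g_i\in G$, where two families with the same $(x_i)$ are identified iff $g_i=g_i'$ whenever $x_i\neq0$; it has the final diffeology of the maps $\psi_I:S_I\times G^I\to E^{\mathrm{sph}}(G)$ ($I\subset\mathbb N$ finite, $S_I\subset\mathbb R^I$ the unit sphere, extension by $x_i=0$ outside $I$). $G$ acts by $h\cdot[(x_i,g_i)]=[(x_i,hg_i)]$, and $B^{\mathrm{sph}}(G)=E^{\mathrm{sph}}(G)/G$ with the quotient diffeology; $E^{\mathrm{sph}}(G)\to B^{\mathrm{sph}}(G)$ is the universal principal $G$-bundle. Standing assumptions: $D$ is a Dirac-type operator on a Clifford module over $E^{\mathrm{sph}}(G)$, $H=H_+\oplus H_-$ is a polarized Hilbert space, and the defects $\delta_D(\xi)=[\mathcal L_{\xi^\#},D]$, $\xi\in\mathfrak g$ (with $\xi^\#$ the fundamental vector field), define operators in $\mathfrak{gl}_{\mathrm{res}}(H)$ (bounded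 operators with Hilbert--Schmidt off-diagonal blocks) such that $c_D(\xi,\eta)=\operatorname{Tr}(\delta_D(\xi)_{-+}\delta_D(\eta)_{+-}-\delta_D(\eta)_{-+}\delta_D(\xi)_{+-})$ is a Lie algebra $2$-cocycle (with values in $\mathbb R$ or $i\mathbb R$). The central Lie algebra extension $\mathfrak g\oplus\mathbb R$ with bracket $[(\xi,a),(\eta,b)]=([\xi,\eta],c_D(\xi,\eta))$ is assumed to integrate to a central extension of diffeological Lie groups $1\to U(1)\to\widehat G_D\to G\to1$. The lifting gerbe of a principal $G$-bundle $Q\to Y$ for this extension is the $U(1)$-banded gerbe on $Y$ whose objects over an open $U$ are principal $\widehat G_D$-bundles $\widehat Q$ over $U$ with an isomorphism $\widehat Q/U(1)\simeq Q|_U$; its Dixmier--Douady class is the associated class in $H^3(Y;\mathbb Z)$ (image of its class in $H^2(Y;U(1))$ under the connecting morphism of the exponential sequence). $\mathrm{DD}(D)\in H^3(B^{\mathrm{sph}}(G);\mathbb Z)$ is the Dixmier--Douady class of the lifting gerbe of the universal bundle $E^{\mathrm{sph}}(G)\to B^{\mathrm{sph}}(G)$ (the Schwinger lifting gerbe of $D$). *)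

theory Defs
  imports "HOL-Analysis.Analysis" "HOL-Algebra.Module" "HOL-Algebra.Coset"
begin

section \<open>Smooth maps between open subsets of Euclidean spaces\<close>

text \<open>The dimensions of the parameter domains of plots vary, so the space of \<open>n\<close>-tuples is the
  subspace of \<open>nat \<Rightarrow> real\<close> on which all coordinates with index at least \<open>n\<close> vanish, i.e. the
  library's \<open>Euclidean_space n\<close>.\<close>

type_synonym rvec = "nat \<Rightarrow> real"

fun Ck_on :: "nat \<Rightarrow> nat \<Rightarrow> rvec set \<Rightarrow> (rvec \<Rightarrow> real) \<Rightarrow> bool" where
  "Ck_on 0 n U f \<longleftrightarrow> continuous_map (subtopology (Euclidean_space n) U) euclideanreal f"
| "Ck_on (Suc k) n U f \<longleftrightarrow> Ck_on 0 n U f \<and>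
     (\<exists>f'. \<forall>i<n. (\<forall>v\<in>U. ((\<lambda>t. f (v(i := t))) has_real_derivative f' i v) (at (v i))) \<and>
                 Ck_on k n U (f' i))"

definition smooth_fun :: "nat \<Rightarrow> rvec set \<Rightarrow> (rvec \<Rightarrow> real) \<Rightarrow> bool" where
  "smooth_fun n U f \<longleftrightarrow> openin (Euclidean_space n) U \<and> (\<forall>k. Ck_on k n U f)"

definition smooth_map :: "nat \<Rightarrow> rvec set \<Rightarrow> nat \<Rightarrow> (rvec \<Rightarrow> rvec) \<Rightarrow> bool" where
  "smooth_map m U n F \<longleftrightarrow> openin (Euclidean_space m) U \<and>
     F ` U \<subseteq> topspace (Euclidean_space n) \<and> (\<forall>i<n. smooth_fun m U (\<lambda>v. F v i))"

definition pd :: "nat \<Rightarrow> (rvec \<Rightarrow> real) \<Rightarrow> rvec \<Rightarrow> real" where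
  "pd i f v = deriv (\<lambda>t. f (v(i := t))) (v i)"

section \<open>Diffeological spaces\<close>

text \<open>\<open>plot X n U p\<close> says that \<open>p\<close>, restricted to the open subset \<open>U\<close> of Euclidean \<open>n\<close>-space, is a
  plot of \<open>X\<close>; the values of \<open>p\<close> outside \<open>U\<close> are irrelevant.\<close>

record 'x diffeology =
  pts :: "'x set"
  plot :: "nat \<Rightarrow> rvec set \<Rightarrow> (rvec \<Rightarrow> 'x) \<Rightarrow> bool"

definition diffeological_space :: "'x diffeology \<Rightarrow> bool" where
  "diffeological_space X \<longleftrightarrow>
     (\<forall>n U p. plot X n U p \<longrightarrow> openin (Euclidean_space n) U \<and> p ` U \<subseteq> pts X) \<and>
     (\<forall>n U p q. plot X n U p \<longrightarrow> (\<forall>u\<in>U. q u = p u) \<longrightarrow> plot X n U q) \<and>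
     (\<forall>n U x. openin (Euclidean_space n) U \<longrightarrow> x \<in> pts X \<longrightarrow> plot X n U (\<lambda>_. x)) \<and>
     (\<forall>n U p. openin (Euclidean_space n) U \<longrightarrow>
        (\<forall>u\<in>U. \<exists>V. openin (Euclidean_space n) V \<and> u \<in> V \<and> V \<subseteq> U \<and> plot X n V p) \<longrightarrow>
        plot X n U p) \<and>
     (\<forall>n U p m V F. plot X n U p \<longrightarrow> smooth_map m V n F \<longrightarrow> F ` V \<subseteq> U \<longrightarrow> plot X m V (p \<circ> F))"

definition dsmooth :: "'x diffeology \<Rightarrow> 'y diffeology \<Rightarrow> ('x \<Rightarrow> 'y) \<Rightarrow> bool" where
  "dsmooth X Y f \<longleftrightarrow> f ` pts X \<subseteq> pts Y \<and> (\<forall>n U p. plot X n U p \<longrightarrow> plot Y n U (f \<circ> p))"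

definition diffeo :: "'x diffeology \<Rightarrow> 'y diffeology \<Rightarrow> ('x \<Rightarrow> 'y) \<Rightarrow> bool" where
  "diffeo X Y f \<longleftrightarrow> bij_betw f (pts X) (pts Y) \<and> dsmooth X Y f \<and> dsmooth Y X (inv_into (pts X) f)"

definition sub_diff :: "'x diffeology \<Rightarrow> 'x set \<Rightarrow> 'x diffeology" where
  "sub_diff X A = \<lparr>pts = pts X \<inter> A, plot = (\<lambda>n U p. plot X n U p \<and> p ` U \<subseteq> A)\<rparr>"

definition prod_diff :: "'x diffeology \<Rightarrow> 'y diffeology \<Rightarrow> ('x \<times> 'y) diffeology" where
  "prod_diff X Y = \<lparr>pts = pts X \<times> pts Y,
     plot = (\<lambda>n U p. plot X n U (fst \<circ> p) \<and> plot Y n U (snd \<circ> p))\<rparr>"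

definition power_diff :: "'i set \<Rightarrow> 'x diffeology \<Rightarrow> ('i \<Rightarrow> 'x) diffeology" where
  "power_diff I X = \<lparr>pts = (\<Pi>\<^sub>E i\<in>I. pts X),
     plot = (\<lambda>n U p. openin (Euclidean_space n) U \<and> p ` U \<subseteq> (\<Pi>\<^sub>E i\<in>I. pts X) \<and>
                     (\<forall>i\<in>I. plot X n U (\<lambda>u. p u i)))\<rparr>"

text \<open>The final diffeology on \<open>S\<close> of the family \<open>f j : A j \<rightarrow> S\<close>, for \<open>j \<in> J\<close>: its plots are
  locally constant or locally lift along one of the maps.\<close>

definition final_diff ::
    "'y set \<Rightarrow> 'j set \<Rightarrow> ('j \<Rightarrow> 'x diffeology) \<Rightarrow> ('j \<Rightarrow> 'x \<Rightarrow> 'y) \<Rightarrow> 'y diffeology" where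
  "final_diff S J A f = \<lparr>pts = S,
     plot = (\<lambda>n U p. openin (Euclidean_space n) U \<and> p ` U \<subseteq> S \<and>
       (\<forall>u\<in>U. \<exists>V. openin (Euclidean_space n) V \<and> u \<in> V \<and> V \<subseteq> U \<and>
          ((\<exists>y. \<forall>v\<in>V. p v = y) \<or>
           (\<exists>j\<in>J. \<exists>q. plot (A j) n V q \<and> (\<forall>v\<in>V. p v = f j (q v))))))\<rparr>"

definition quotient_diff :: "'x diffeology \<Rightarrow> ('x \<Rightarrow> 'y) \<Rightarrow> 'y diffeology" where
  "quotient_diff X q = final_diff (q ` pts X) {()} (\<lambda>_. X) (\<lambda>_. q)"

definition euclid_diff :: "nat \<Rightarrow> rvec diffeology" where
  "euclid_diff n = \<lparr>pts = topspace (Euclidean_space n), plot = (\<lambda>m U F. smooth_map m U n F)\<rparr>"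

definition real_diff :: "real diffeology" where
  "real_diff = \<lparr>pts = UNIV, plot = smooth_fun\<rparr>"

definition complex_diff :: "complex diffeology" where
  "complex_diff = \<lparr>pts = UNIV,
     plot = (\<lambda>n U p. smooth_fun n U (\<lambda>u. Re (p u)) \<and> smooth_fun n U (\<lambda>u. Im (p u)))\<rparr>"

definition discrete_diff :: "'x set \<Rightarrow> 'x diffeology" where
  "discrete_diff S = \<lparr>pts = S,
     plot = (\<lambda>n U p. openin (Euclidean_space n) U \<and> p ` U \<subseteq> S \<and>
       (\<forall>u\<in>U. \<exists>V. openin (Euclidean_space n) V \<and> u \<in> V \<and> V \<subseteq> U \<and> (\<forall>v\<in>V. p v = p u)))\<rparr>"

text \<open>Functional diffeology; smooth maps on \<open>X\<close> are made unique by extensionality.\<close>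

definition fun_diff :: "'x diffeology \<Rightarrow> 'y diffeology \<Rightarrow> ('x \<Rightarrow> 'y) diffeology" where
  "fun_diff X Y = \<lparr>pts = {f \<in> extensional (pts X). dsmooth X Y f},
     plot = (\<lambda>n U P. openin (Euclidean_space n) U \<and>
       (\<forall>u\<in>U. P u \<in> extensional (pts X) \<and> dsmooth X Y (P u)) \<and>
       dsmooth (prod_diff (sub_diff (euclid_diff n) U) X) Y (\<lambda>(u, x). P u x))\<rparr>"

definition Cinf :: "'x diffeology \<Rightarrow> ('x \<Rightarrow> real) set" where
  "Cinf X = {\<phi>. dsmooth X real_diff \<phi>}"

definition dtop :: "'x diffeology \<Rightarrow> 'x topology" where
  "dtop X = topology (\<lambda>A. A \<subseteq> pts X \<and>
     (\<forall>n U p. plot X n U p \<longrightarrow> openin (Euclidean_space n) {u \<in> U. p u \<in> A}))"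

section \<open>Diffeological groups and their Lie algebras\<close>

record 'g dgroup = "'g monoid" +
  dspace :: "'g diffeology"

definition diffeological_group :: "'g dgroup \<Rightarrow> bool" where
  "diffeological_group G \<longleftrightarrow> group G \<and> diffeological_space (dspace G) \<and>
     pts (dspace G) = carrier G \<and>
     dsmooth (prod_diff (dspace G) (dspace G)) (dspace G) (\<lambda>(g, h). g \<otimes>\<^bsub>G\<^esub> h) \<and>
     dsmooth (dspace G) (dspace G) (\<lambda>g. inv\<^bsub>G\<^esub> g)"

text \<open>The internal (kinematic) tangent space at the neutral element: two smooth curves through it
  are identified when they have the same derivative at \<open>0\<close> along every smooth function.  A tangent
  vector is represented by the resulting derivation, extended by \<open>0\<close> to non-smooth functions.\<close>

type_synonym 'g tvec = "('g \<Rightarrow> real) \<Rightarrow> real"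

definition tangent :: "'x diffeology \<Rightarrow> (real \<Rightarrow> 'x) \<Rightarrow> 'x tvec" where
  "tangent X c = (\<lambda>\<phi>. if \<phi> \<in> Cinf X then deriv (\<phi> \<circ> c) 0 else 0)"

definition unit_curves :: "'g dgroup \<Rightarrow> (real \<Rightarrow> 'g) diffeology" where
  "unit_curves G = sub_diff (fun_diff real_diff (dspace G)) {c. c 0 = \<one>\<^bsub>G\<^esub>}"

definition lie_diff :: "'g dgroup \<Rightarrow> 'g tvec diffeology" where
  "lie_diff G = quotient_diff (unit_curves G) (tangent (dspace G))"

definition lie_alg :: "'g dgroup \<Rightarrow> 'g tvec set" where
  "lie_alg G = pts (lie_diff G)"

abbreviation tadd :: "'g tvec \<Rightarrow> 'g tvec \<Rightarrow> 'g tvec" where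
  "tadd \<xi> \<eta> \<equiv> (\<lambda>\<phi>. \<xi> \<phi> + \<eta> \<phi>)"

abbreviation tscale :: "real \<Rightarrow> 'g tvec \<Rightarrow> 'g tvec" where
  "tscale a \<xi> \<equiv> (\<lambda>\<phi>. a * \<xi> \<phi>)"

text \<open>The derivative at the neutral element, in the direction \<open>\<xi>\<close>, of the map sending \<open>g\<close> to
  \<open>Ad g \<eta>\<close>; a Lie group is a group for which this stays in the tangent space and is a Lie bracket.\<close>

definition lie_bracket :: "'g dgroup \<Rightarrow> 'g tvec \<Rightarrow> 'g tvec \<Rightarrow> 'g tvec" where
  "lie_bracket G \<xi> \<eta> = (\<lambda>\<phi>. if \<phi> \<in> Cinf (dspace G)
     then \<xi> (\<lambda>g. \<eta> (\<lambda>h. \<phi> (g \<otimes>\<^bsub>G\<^esub> h \<otimes>\<^bsub>G\<^esub> inv\<^bsub>G\<^esub> g))) else 0)"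

definition diffeological_Lie_group :: "'g dgroup \<Rightarrow> bool" where
  "diffeological_Lie_group G \<longleftrightarrow> diffeological_group G \<and>
     (\<forall>\<xi>\<in>lie_alg G. \<forall>\<eta>\<in>lie_alg G. tadd \<xi> \<eta> \<in> lie_alg G) \<and>
     (\<forall>a. \<forall>\<xi>\<in>lie_alg G. tscale a \<xi> \<in> lie_alg G) \<and>
     (\<forall>\<xi>\<in>lie_alg G. \<forall>\<eta>\<in>lie_alg G. lie_bracket G \<xi> \<eta> \<in> lie_alg G) \<and>
     (\<forall>\<xi>\<in>lie_alg G. \<forall>\<eta>\<in>lie_alg G. \<forall>\<zeta>\<in>lie_alg G. \<forall>a b.
        lie_bracket G (tadd (tscale a \<xi>) (tscale b \<eta>)) \<zeta> =
          tadd (tscale a (lie_bracket G \<xi> \<zeta>)) (tscale b (lie_bracket G \<eta> \<zeta>))) \<and>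
     (\<forall>\<xi>\<in>lie_alg G. \<forall>\<eta>\<in>lie_alg G. lie_bracket G \<xi> \<eta> = tscale (-1) (lie_bracket G \<eta> \<xi>)) \<and>
     (\<forall>\<xi>\<in>lie_alg G. \<forall>\<eta>\<in>lie_alg G. \<forall>\<zeta>\<in>lie_alg G.
        tadd (lie_bracket G \<xi> (lie_bracket G \<eta> \<zeta>))
          (tadd (lie_bracket G \<eta> (lie_bracket G \<zeta> \<xi>)) (lie_bracket G \<zeta> (lie_bracket G \<xi> \<eta>)))
        = (\<lambda>_. 0))"

definition log_ode :: "'g dgroup \<Rightarrow> (real \<Rightarrow> 'g tvec) \<Rightarrow> (real \<Rightarrow> 'g) \<Rightarrow> bool" where
  "log_ode G v k \<longleftrightarrow> k 0 = \<one>\<^bsub>G\<^esub> \<and>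
     (\<forall>t\<in>{0..1}. \<forall>\<phi>\<in>Cinf (dspace G).
        ((\<lambda>s. \<phi> (k s \<otimes>\<^bsub>G\<^esub> inv\<^bsub>G\<^esub> (k t))) has_real_derivative v t \<phi>) (at t within {0..1}))"

text \<open>Regularity: for \<open>v\<close> in \<open>C\<^sup>\<infinity>([0,1],\<gg>)\<close> the equation \<open>k' k\<^sup>-\<^sup>1 = v\<close>, \<open>k 0 = 1\<close> has a unique smooth
  solution, depending smoothly on \<open>v\<close>.\<close>

definition regular_Lie_group :: "'g dgroup \<Rightarrow> bool" where
  "regular_Lie_group G \<longleftrightarrow> diffeological_Lie_group G \<and>
     (let I = sub_diff real_diff {0..1};
          Cg = fun_diff I (lie_diff G); CG = fun_diff I (dspace G)
      in \<exists>Exp. dsmooth Cg CG Exp \<and>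
           (\<forall>v\<in>pts Cg. log_ode G v (Exp v) \<and> (\<forall>k\<in>pts CG. log_ode G v k \<longrightarrow> k = Exp v)))"

definition circle :: "complex dgroup" where
  "circle = \<lparr>carrier = {z. cmod z = 1}, mult = (*), one = 1,
     dspace = sub_diff complex_diff {z. cmod z = 1}\<rparr>"

definition real_dgroup :: "real dgroup" where
  "real_dgroup = \<lparr>carrier = UNIV, mult = (+), one = 0, dspace = real_diff\<rparr>"

definition int_dgroup :: "int dgroup" where
  "int_dgroup = \<lparr>carrier = UNIV, mult = (+), one = 0, dspace = discrete_diff UNIV\<rparr>"

section \<open>Principal bundles\<close>

record ('g, 'p, 'y) gbundle =
  tot :: "'p diffeology"
  proj :: "'p \<Rightarrow> 'y"
  gact :: "'g \<Rightarrow> 'p \<Rightarrow> 'p"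

definition smooth_action :: "'g dgroup \<Rightarrow> 'p diffeology \<Rightarrow> ('g \<Rightarrow> 'p \<Rightarrow> 'p) \<Rightarrow> bool" where
  "smooth_action G X a \<longleftrightarrow> dsmooth (prod_diff (dspace G) X) X (\<lambda>(g, x). a g x) \<and>
     (\<forall>x\<in>pts X. a \<one>\<^bsub>G\<^esub> x = x) \<and>
     (\<forall>g\<in>carrier G. \<forall>h\<in>carrier G. \<forall>x\<in>pts X. a g (a h x) = a (g \<otimes>\<^bsub>G\<^esub> h) x)"

text \<open>Groups act on the left; local triviality is with respect to the D-topology of the base.\<close>

definition principal_bundle :: "'g dgroup \<Rightarrow> 'y diffeology \<Rightarrow> ('g, 'p, 'y) gbundle \<Rightarrow> bool" where
  "principal_bundle G Y Q \<longleftrightarrow> diffeological_space (tot Q) \<and> dsmooth (tot Q) Y (proj Q) \<and>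
     smooth_action G (tot Q) (gact Q) \<and>
     (\<forall>y\<in>pts Y. \<exists>U \<tau>. openin (dtop Y) U \<and> y \<in> U \<and>
        diffeo (prod_diff (sub_diff Y U) (dspace G)) (sub_diff (tot Q) (proj Q -` U)) \<tau> \<and>
        (\<forall>u\<in>U. \<forall>g\<in>carrier G. proj Q (\<tau> (u, g)) = u \<and>
           (\<forall>h\<in>carrier G. \<tau> (u, h \<otimes>\<^bsub>G\<^esub> g) = gact Q h (\<tau> (u, g)))))"

definition bundle_restrict :: "('g, 'p, 'y) gbundle \<Rightarrow> 'y set \<Rightarrow> ('g, 'p, 'y) gbundle" where
  "bundle_restrict Q U = \<lparr>tot = sub_diff (tot Q) (proj Q -` U), proj = proj Q, gact = gact Q\<rparr>"

definition bundle_pullback ::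
    "'x diffeology \<Rightarrow> ('x \<Rightarrow> 'y) \<Rightarrow> ('g, 'p, 'y) gbundle \<Rightarrow> ('g, 'x \<times> 'p, 'x) gbundle" where
  "bundle_pullback X f Q =
     \<lparr>tot = sub_diff (prod_diff X (tot Q)) {(x, q). f x = proj Q q},
      proj = fst, gact = (\<lambda>g (x, q). (x, gact Q g q))\<rparr>"

definition orbit_of :: "'g dgroup \<Rightarrow> ('g \<Rightarrow> 'p \<Rightarrow> 'p) \<Rightarrow> 'p \<Rightarrow> 'p set" where
  "orbit_of G a p = (\<lambda>g. a g p) ` carrier G"

section \<open>The universal bundle\<close>

type_synonym 'g fam = "(nat \<Rightarrow> real) \<times> (nat \<Rightarrow> 'g)"

definition fams :: "'g dgroup \<Rightarrow> 'g fam set" where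
  "fams G = {(x, g). finite {i. x i \<noteq> 0} \<and> (\<Sum>i | x i \<noteq> 0. (x i)\<^sup>2) = 1 \<and> (\<forall>i. g i \<in> carrier G)}"

definition fam_rel :: "'g dgroup \<Rightarrow> ('g fam \<times> 'g fam) set" where
  "fam_rel G = {((x, g), (x', g')). (x, g) \<in> fams G \<and> (x', g') \<in> fams G \<and> x = x' \<and>
     (\<forall>i. x i \<noteq> 0 \<longrightarrow> g i = g' i)}"

definition sphere_chart :: "'g dgroup \<Rightarrow> nat set \<Rightarrow> 'g fam diffeology" where
  "sphere_chart G I =
     prod_diff (sub_diff (power_diff I real_diff) {x. (\<Sum>i\<in>I. (x i)\<^sup>2) = 1}) (power_diff I (dspace G))"

definition psi :: "'g dgroup \<Rightarrow> nat set \<Rightarrow> 'g fam \<Rightarrow> 'g fam set" where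
  "psi G I = (\<lambda>(x, g).
     fam_rel G `` {(\<lambda>i. if i \<in> I then x i else 0, \<lambda>i. if i \<in> I then g i else \<one>\<^bsub>G\<^esub>)})"

definition Esph :: "'g dgroup \<Rightarrow> 'g fam set diffeology" where
  "Esph G = final_diff (fams G // fam_rel G) {I. finite I} (sphere_chart G) (psi G)"

definition Esph_act :: "'g dgroup \<Rightarrow> 'g \<Rightarrow> 'g fam set \<Rightarrow> 'g fam set" where
  "Esph_act G h e = fam_rel G `` ((\<lambda>(x, g). (x, \<lambda>i. h \<otimes>\<^bsub>G\<^esub> g i)) ` e)"

definition Bsph :: "'g dgroup \<Rightarrow> 'g fam set set diffeology" where
  "Bsph G = quotient_diff (Esph G) (orbit_of G (Esph_act G))"

definition universal_bundle :: "'g dgroup \<Rightarrow> ('g, 'g fam set, 'g fam set set) gbundle" where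
  "universal_bundle G = \<lparr>tot = Esph G, proj = orbit_of G (Esph_act G), gact = Esph_act G\<rparr>"

section \<open>Differential one-forms, Clifford modules and Dirac-type operators\<close>

text \<open>A one-form assigns to every plot \<open>p\<close> on \<open>U\<close> a smooth one-form on \<open>U\<close>, given by its
  coefficients, compatibly with smooth reparametrisation; it is extended by \<open>0\<close>.\<close>

type_synonym 'm dform = "nat \<Rightarrow> rvec set \<Rightarrow> (rvec \<Rightarrow> 'm) \<Rightarrow> rvec \<Rightarrow> nat \<Rightarrow> real"

definition one_forms :: "'m diffeology \<Rightarrow> 'm dform set" where
  "one_forms M = {\<alpha>.
     (\<forall>n U p v i. \<not> (plot M n U p \<and> v \<in> U \<and> i < n) \<longrightarrow> \<alpha> n U p v i = 0) \<and>
     (\<forall>n U p i. plot M n U p \<longrightarrow> i < n \<longrightarrow> smooth_fun n U (\<lambda>v. \<alpha> n U p v i)) \<and>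
     (\<forall>n U p m V q F. plot M n U p \<longrightarrow> plot M m V q \<longrightarrow> smooth_map m V n F \<longrightarrow> F ` V \<subseteq> U \<longrightarrow>
        (\<forall>v\<in>V. q v = p (F v)) \<longrightarrow>
        (\<forall>v\<in>V. \<forall>j<m. \<alpha> m V q v j = (\<Sum>i<n. \<alpha> n U p (F v) i * pd j (\<lambda>w. F w i) v)))}"

definition form_diff :: "'m diffeology \<Rightarrow> 'm dform diffeology" where
  "form_diff M = \<lparr>pts = one_forms M,
     plot = (\<lambda>n U P. openin (Euclidean_space n) U \<and> P ` U \<subseteq> one_forms M \<and>
       (\<forall>m V q i. plot M m V q \<longrightarrow> i < m \<longrightarrow>
          dsmooth (prod_diff (sub_diff (euclid_diff n) U) (sub_diff (euclid_diff m) V)) real_diff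
            (\<lambda>(u, v). P u m V q v i)))\<rparr>"

definition d_fun :: "'m diffeology \<Rightarrow> ('m \<Rightarrow> real) \<Rightarrow> 'm dform" where
  "d_fun M f = (\<lambda>n U p v i. if plot M n U p \<and> v \<in> U \<and> i < n then pd i (f \<circ> p) v else 0)"

definition form_add :: "'m dform \<Rightarrow> 'm dform \<Rightarrow> 'm dform" where
  "form_add \<alpha> \<beta> = (\<lambda>n U p v i. \<alpha> n U p v i + \<beta> n U p v i)"

definition form_scale :: "('m \<Rightarrow> real) \<Rightarrow> 'm dform \<Rightarrow> 'm dform" where
  "form_scale f \<alpha> = (\<lambda>n U p v i. f (p v) * \<alpha> n U p v i)"

text \<open>Equality of the values of two one-forms in the fibre of the cotangent bundle over \<open>x\<close>.\<close>

definition form_eq_at :: "'m diffeology \<Rightarrow> 'm \<Rightarrow> 'm dform \<Rightarrow> 'm dform \<Rightarrow> bool" where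
  "form_eq_at M x \<alpha> \<beta> \<longleftrightarrow>
     (\<forall>n U p v i. plot M n U p \<longrightarrow> v \<in> U \<longrightarrow> p v = x \<longrightarrow> \<alpha> n U p v i = \<beta> n U p v i)"

record ('v, 'm) cvbundle =
  vtot :: "'v diffeology"
  vproj :: "'v \<Rightarrow> 'm"
  vadd :: "'v \<Rightarrow> 'v \<Rightarrow> 'v"
  vscale :: "complex \<Rightarrow> 'v \<Rightarrow> 'v"
  vzero :: "'m \<Rightarrow> 'v"

definition complex_ring :: "complex ring" where
  "complex_ring = \<lparr>carrier = UNIV, mult = (*), one = 1, zero = 0, add = (+)\<rparr>"

definition vfibre :: "('v, 'm, 'b) cvbundle_scheme \<Rightarrow> 'm \<Rightarrow> 'v set" where
  "vfibre S x = {v \<in> pts (vtot S). vproj S v = x}"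

definition fibre_module :: "('v, 'm, 'b) cvbundle_scheme \<Rightarrow> 'm \<Rightarrow> (complex, 'v) module" where
  "fibre_module S x = \<lparr>carrier = vfibre S x, mult = undefined, one = undefined,
     zero = vzero S x, add = vadd S, smult = vscale S\<rparr>"

text \<open>Diffeological complex vector pseudo-bundle: smooth fibrewise operations, no local triviality.\<close>

definition complex_vector_bundle :: "'m diffeology \<Rightarrow> ('v, 'm, 'b) cvbundle_scheme \<Rightarrow> bool" where
  "complex_vector_bundle M S \<longleftrightarrow> diffeological_space (vtot S) \<and> dsmooth (vtot S) M (vproj S) \<and>
     (\<forall>x\<in>pts M. Module.module complex_ring (fibre_module S x)) \<and>
     dsmooth M (vtot S) (vzero S) \<and>
     dsmooth (sub_diff (prod_diff (vtot S) (vtot S)) {(v, w). vproj S v = vproj S w}) (vtot S)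
       (\<lambda>(v, w). vadd S v w) \<and>
     dsmooth (prod_diff complex_diff (vtot S)) (vtot S) (\<lambda>(c, v). vscale S c v)"

definition fibrewise_linear :: "'m diffeology \<Rightarrow> ('v, 'm, 'b) cvbundle_scheme \<Rightarrow> ('v \<Rightarrow> 'v) \<Rightarrow> bool" where
  "fibrewise_linear M S T \<longleftrightarrow> (\<forall>x\<in>pts M. \<forall>v\<in>vfibre S x. \<forall>w\<in>vfibre S x. \<forall>c.
     T (vadd S v w) = vadd S (T v) (T w) \<and> T (vscale S c v) = vscale S c (T v))"

definition sections :: "'m diffeology \<Rightarrow> ('v, 'm, 'b) cvbundle_scheme \<Rightarrow> ('m \<Rightarrow> 'v) set" where
  "sections M S = {\<sigma> \<in> extensional (pts M). dsmooth M (vtot S) \<sigma> \<and> (\<forall>x\<in>pts M. vproj S (\<sigma> x) = x)}"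

definition sec_add ::
    "'m diffeology \<Rightarrow> ('v, 'm, 'b) cvbundle_scheme \<Rightarrow> ('m \<Rightarrow> 'v) \<Rightarrow> ('m \<Rightarrow> 'v) \<Rightarrow> 'm \<Rightarrow> 'v" where
  "sec_add M S \<sigma> \<tau> = (\<lambda>x\<in>pts M. vadd S (\<sigma> x) (\<tau> x))"

definition sec_scale ::
    "'m diffeology \<Rightarrow> ('v, 'm, 'b) cvbundle_scheme \<Rightarrow> ('m \<Rightarrow> complex) \<Rightarrow> ('m \<Rightarrow> 'v) \<Rightarrow> 'm \<Rightarrow> 'v" where
  "sec_scale M S f \<sigma> = (\<lambda>x\<in>pts M. vscale S (f x) (\<sigma> x))"

definition sec_diff ::
    "'m diffeology \<Rightarrow> ('v, 'm, 'b) cvbundle_scheme \<Rightarrow> ('m \<Rightarrow> 'v) \<Rightarrow> ('m \<Rightarrow> 'v) \<Rightarrow> 'm \<Rightarrow> 'v" where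
  "sec_diff M S \<sigma> \<tau> = sec_add M S \<sigma> (sec_scale M S (\<lambda>_. -1) \<tau>)"

record ('v, 'm) clifford_bundle = "('v, 'm) cvbundle" +
  cometric :: "'m dform \<Rightarrow> 'm dform \<Rightarrow> 'm \<Rightarrow> real"
  cliff :: "'m dform \<Rightarrow> 'v \<Rightarrow> 'v"

definition clifford_module :: "'m diffeology \<Rightarrow> ('v, 'm) clifford_bundle \<Rightarrow> bool" where
  "clifford_module M S \<longleftrightarrow> complex_vector_bundle M S \<and>
     (\<forall>\<alpha>\<in>one_forms M. \<forall>\<beta>\<in>one_forms M. cometric S \<alpha> \<beta> \<in> Cinf M \<and>
        (\<forall>x\<in>pts M. cometric S \<alpha> \<beta> x = cometric S \<beta> \<alpha> x)) \<and>
     (\<forall>\<alpha>\<in>one_forms M. \<forall>\<beta>\<in>one_forms M. \<forall>\<gamma>\<in>one_forms M. \<forall>f\<in>Cinf M. \<forall>x\<in>pts M.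
        cometric S (form_add (form_scale f \<alpha>) \<beta>) \<gamma> x = f x * cometric S \<alpha> \<gamma> x + cometric S \<beta> \<gamma> x) \<and>
     (\<forall>\<alpha>\<in>one_forms M. \<forall>\<beta>\<in>one_forms M. \<forall>\<gamma>\<in>one_forms M. \<forall>x\<in>pts M.
        form_eq_at M x \<alpha> \<beta> \<longrightarrow> cometric S \<alpha> \<gamma> x = cometric S \<beta> \<gamma> x) \<and>
     dsmooth (prod_diff (form_diff M) (vtot S)) (vtot S) (\<lambda>(\<alpha>, v). cliff S \<alpha> v) \<and>
     (\<forall>\<alpha>\<in>one_forms M. fibrewise_linear M S (cliff S \<alpha>) \<and>
        (\<forall>v\<in>pts (vtot S). vproj S (cliff S \<alpha> v) = vproj S v)) \<and>
     (\<forall>\<alpha>\<in>one_forms M. \<forall>\<beta>\<in>one_forms M. \<forall>f\<in>Cinf M. \<forall>x\<in>pts M. \<forall>v\<in>vfibre S x.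
        cliff S (form_add (form_scale f \<alpha>) \<beta>) v =
          vadd S (vscale S (complex_of_real (f x)) (cliff S \<alpha> v)) (cliff S \<beta> v)) \<and>
     (\<forall>\<alpha>\<in>one_forms M. \<forall>\<beta>\<in>one_forms M. \<forall>x\<in>pts M. \<forall>v\<in>vfibre S x.
        (form_eq_at M x \<alpha> \<beta> \<longrightarrow> cliff S \<alpha> v = cliff S \<beta> v) \<and>
        vadd S (cliff S \<alpha> (cliff S \<beta> v)) (cliff S \<beta> (cliff S \<alpha> v)) =
          vscale S (complex_of_real (- 2 * cometric S \<alpha> \<beta> x)) v)"

text \<open>A complex-linear first-order operator whose symbol is Clifford multiplication:
  \<open>[D, f] = c (df)\<close>.\<close>

definition dirac_type ::
    "'m diffeology \<Rightarrow> ('v, 'm) clifford_bundle \<Rightarrow> (('m \<Rightarrow> 'v) \<Rightarrow> 'm \<Rightarrow> 'v) \<Rightarrow> bool" where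
  "dirac_type M S D \<longleftrightarrow> D ` sections M S \<subseteq> sections M S \<and>
     (\<forall>\<sigma>\<in>sections M S. \<forall>\<tau>\<in>sections M S. D (sec_add M S \<sigma> \<tau>) = sec_add M S (D \<sigma>) (D \<tau>)) \<and>
     (\<forall>\<sigma>\<in>sections M S. \<forall>c. D (sec_scale M S (\<lambda>_. c) \<sigma>) = sec_scale M S (\<lambda>_. c) (D \<sigma>)) \<and>
     (\<forall>\<sigma>\<in>sections M S. \<forall>f\<in>Cinf M.
        sec_diff M S (D (sec_scale M S (\<lambda>x. complex_of_real (f x)) \<sigma>))
                     (sec_scale M S (\<lambda>x. complex_of_real (f x)) (D \<sigma>))
        = (\<lambda>x\<in>pts M. cliff S (d_fun M f) (\<sigma> x)))"

definition equivariant_bundle ::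
    "'g dgroup \<Rightarrow> 'm diffeology \<Rightarrow> ('g \<Rightarrow> 'm \<Rightarrow> 'm) \<Rightarrow> ('v, 'm, 'b) cvbundle_scheme
      \<Rightarrow> ('g \<Rightarrow> 'v \<Rightarrow> 'v) \<Rightarrow> bool" where
  "equivariant_bundle G M a S b \<longleftrightarrow> smooth_action G (vtot S) b \<and>
     (\<forall>g\<in>carrier G. fibrewise_linear M S (b g) \<and>
        (\<forall>v\<in>pts (vtot S). vproj S (b g v) = a g (vproj S v)))"

definition fibre_dual :: "('v, 'm, 'b) cvbundle_scheme \<Rightarrow> 'm \<Rightarrow> ('v \<Rightarrow> real) set" where
  "fibre_dual S x = {l. dsmooth (sub_diff (vtot S) (vfibre S x)) real_diff l \<and>
     (\<forall>v\<in>vfibre S x. \<forall>w\<in>vfibre S x. \<forall>t. l (vadd S v w) = l v + l w \<and>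
        l (vscale S (complex_of_real t) v) = t * l v)}"

text \<open>\<open>L \<xi>\<close> is the Lie derivative of sections along the fundamental vector field of \<open>\<xi>\<close>: its value
  at \<open>x\<close> is the derivative at the neutral element, in the direction \<open>\<xi>\<close>, of
  \<open>g \<mapsto> g\<^sup>-\<^sup>1 \<cdot> \<sigma> (g \<cdot> x)\<close>, taken weakly in the fibre over \<open>x\<close>.\<close>

definition lie_derivative ::
    "'g dgroup \<Rightarrow> 'm diffeology \<Rightarrow> ('g \<Rightarrow> 'm \<Rightarrow> 'm) \<Rightarrow> ('v, 'm, 'b) cvbundle_scheme \<Rightarrow> ('g \<Rightarrow> 'v \<Rightarrow> 'v)
      \<Rightarrow> ('g tvec \<Rightarrow> ('m \<Rightarrow> 'v) \<Rightarrow> 'm \<Rightarrow> 'v) \<Rightarrow> bool" where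
  "lie_derivative G M a S b L \<longleftrightarrow> (\<forall>\<xi>\<in>lie_alg G. \<forall>\<sigma>\<in>sections M S. L \<xi> \<sigma> \<in> sections M S \<and>
     (\<forall>x\<in>pts M. \<forall>l\<in>fibre_dual S x. l (L \<xi> \<sigma> x) = \<xi> (\<lambda>g. l (b (inv\<^bsub>G\<^esub> g) (\<sigma> (a g x))))))"

definition dirac_defect ::
    "'m diffeology \<Rightarrow> ('v, 'm, 'b) cvbundle_scheme \<Rightarrow> ('g tvec \<Rightarrow> ('m \<Rightarrow> 'v) \<Rightarrow> 'm \<Rightarrow> 'v)
      \<Rightarrow> (('m \<Rightarrow> 'v) \<Rightarrow> 'm \<Rightarrow> 'v) \<Rightarrow> 'g tvec \<Rightarrow> ('m \<Rightarrow> 'v) \<Rightarrow> 'm \<Rightarrow> 'v" where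
  "dirac_defect M S L D \<xi> \<sigma> = sec_diff M S (L \<xi> (D \<sigma>)) (D (L \<xi> \<sigma>))"

section \<open>Polarized Hilbert spaces and the Schwinger cocycle\<close>

text \<open>A complex Hilbert space is a real Hilbert space with an orthogonal complex structure \<open>J\<close>; a
  polarization is given by the orthogonal projection \<open>P\<close> onto the positive part.\<close>

definition complex_structure :: "('h::{real_inner, complete_space} \<Rightarrow> 'h) \<Rightarrow> bool" where
  "complex_structure J \<longleftrightarrow> bounded_linear J \<and> (\<forall>x. J (J x) = - x) \<and> (\<forall>x y. J x \<bullet> J y = x \<bullet> y)"

definition herm :: "('h::real_inner \<Rightarrow> 'h) \<Rightarrow> 'h \<Rightarrow> 'h \<Rightarrow> complex" where
  "herm J x y = Complex (x \<bullet> y) (J x \<bullet> y)"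

definition complex_linear :: "('h::real_inner \<Rightarrow> 'h) \<Rightarrow> ('h \<Rightarrow> 'h) \<Rightarrow> bool" where
  "complex_linear J T \<longleftrightarrow> bounded_linear T \<and> (\<forall>x. T (J x) = J (T x))"

definition complex_onb :: "('h::real_inner \<Rightarrow> 'h) \<Rightarrow> 'h set \<Rightarrow> bool" where
  "complex_onb J B \<longleftrightarrow> (\<forall>e\<in>B. \<forall>e'\<in>B. herm J e e' = (if e = e' then 1 else 0)) \<and>
     closure (span (B \<union> J ` B)) = UNIV"

definition hilbert_schmidt :: "('h::real_inner \<Rightarrow> 'h) \<Rightarrow> ('h \<Rightarrow> 'h) \<Rightarrow> bool" where
  "hilbert_schmidt J T \<longleftrightarrow> complex_linear J T \<and>
     (\<forall>B. complex_onb J B \<longrightarrow> (\<lambda>e. (norm (T e))\<^sup>2) summable_on B)"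

definition ctrace :: "('h::real_inner \<Rightarrow> 'h) \<Rightarrow> ('h \<Rightarrow> 'h) \<Rightarrow> complex" where
  "ctrace J T = infsum (\<lambda>e. herm J e (T e)) (SOME B. complex_onb J B)"

definition polarization :: "('h::real_inner \<Rightarrow> 'h) \<Rightarrow> ('h \<Rightarrow> 'h) \<Rightarrow> bool" where
  "polarization J P \<longleftrightarrow> complex_linear J P \<and> (\<forall>x. P (P x) = P x) \<and> (\<forall>x y. P x \<bullet> y = x \<bullet> P y)"

definition block_pm :: "('h::real_inner \<Rightarrow> 'h) \<Rightarrow> ('h \<Rightarrow> 'h) \<Rightarrow> 'h \<Rightarrow> 'h" where
  "block_pm P A x = P (A (x - P x))"

definition block_mp :: "('h::real_inner \<Rightarrow> 'h) \<Rightarrow> ('h \<Rightarrow> 'h) \<Rightarrow> 'h \<Rightarrow> 'h" where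
  "block_mp P A x = A (P x) - P (A (P x))"

definition gl_res :: "('h::real_inner \<Rightarrow> 'h) \<Rightarrow> ('h \<Rightarrow> 'h) \<Rightarrow> ('h \<Rightarrow> 'h) set" where
  "gl_res J P = {A. complex_linear J A \<and> hilbert_schmidt J (block_pm P A) \<and> hilbert_schmidt J (block_mp P A)}"

text \<open>The defects, which act on sections, define operators \<open>A \<xi>\<close> on the Hilbert space through a
  complex-linear map \<open>j\<close> with dense image, defined on a space \<open>\<Gamma>\<close> of sections that they preserve.\<close>

definition defects_define ::
    "'g dgroup \<Rightarrow> 'm diffeology \<Rightarrow> ('v, 'm, 'b) cvbundle_scheme \<Rightarrow> ('g tvec \<Rightarrow> ('m \<Rightarrow> 'v) \<Rightarrow> 'm \<Rightarrow> 'v)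
      \<Rightarrow> (('m \<Rightarrow> 'v) \<Rightarrow> 'm \<Rightarrow> 'v) \<Rightarrow> ('h::real_inner \<Rightarrow> 'h) \<Rightarrow> ('h \<Rightarrow> 'h)
      \<Rightarrow> ('m \<Rightarrow> 'v) set \<Rightarrow> (('m \<Rightarrow> 'v) \<Rightarrow> 'h) \<Rightarrow> ('g tvec \<Rightarrow> 'h \<Rightarrow> 'h) \<Rightarrow> bool" where
  "defects_define G M S L D J P \<Gamma> j A \<longleftrightarrow> \<Gamma> \<subseteq> sections M S \<and>
     (\<forall>\<sigma>\<in>\<Gamma>. \<forall>\<tau>\<in>\<Gamma>. sec_add M S \<sigma> \<tau> \<in> \<Gamma> \<and> j (sec_add M S \<sigma> \<tau>) = j \<sigma> + j \<tau>) \<and>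
     (\<forall>\<sigma>\<in>\<Gamma>. \<forall>c. sec_scale M S (\<lambda>_. c) \<sigma> \<in> \<Gamma> \<and>
        j (sec_scale M S (\<lambda>_. c) \<sigma>) = Re c *\<^sub>R j \<sigma> + Im c *\<^sub>R J (j \<sigma>)) \<and>
     closure (j ` \<Gamma>) = UNIV \<and>
     (\<forall>\<xi>\<in>lie_alg G. A \<xi> \<in> gl_res J P \<and>
        (\<forall>\<sigma>\<in>\<Gamma>. dirac_defect M S L D \<xi> \<sigma> \<in> \<Gamma> \<and> j (dirac_defect M S L D \<xi> \<sigma>) = A \<xi> (j \<sigma>)))"

definition schwinger_cocycle ::
    "('h::real_inner \<Rightarrow> 'h) \<Rightarrow> ('h \<Rightarrow> 'h) \<Rightarrow> ('g tvec \<Rightarrow> 'h \<Rightarrow> 'h) \<Rightarrow> 'g tvec \<Rightarrow> 'g tvec \<Rightarrow> complex" where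
  "schwinger_cocycle J P A \<xi> \<eta> = ctrace J (\<lambda>x.
     block_mp P (A \<xi>) (block_pm P (A \<eta>) x) - block_mp P (A \<eta>) (block_pm P (A \<xi>) x))"

definition lie_2_cocycle :: "'g dgroup \<Rightarrow> ('g tvec \<Rightarrow> 'g tvec \<Rightarrow> real) \<Rightarrow> bool" where
  "lie_2_cocycle G \<omega> \<longleftrightarrow>
     (\<forall>\<xi>\<in>lie_alg G. \<forall>\<eta>\<in>lie_alg G. \<forall>\<zeta>\<in>lie_alg G. \<forall>a b.
        \<omega> (tadd (tscale a \<xi>) (tscale b \<eta>)) \<zeta> = a * \<omega> \<xi> \<zeta> + b * \<omega> \<eta> \<zeta> \<and>
        \<omega> \<xi> \<eta> = - \<omega> \<eta> \<xi> \<and>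
        \<omega> (lie_bracket G \<xi> \<eta>) \<zeta> + \<omega> (lie_bracket G \<eta> \<zeta>) \<xi> + \<omega> (lie_bracket G \<zeta> \<xi>) \<eta> = 0)"

section \<open>Central extensions by the circle group\<close>

text \<open>As usual for extensions of smooth groups, \<open>\<pi>\<close> is required to be a principal circle bundle
  (equivalently, to have smooth local sections); this is what makes lifts of a principal bundle
  locally isomorphic.\<close>

definition central_extension ::
    "'g dgroup \<Rightarrow> 'h dgroup \<Rightarrow> (complex \<Rightarrow> 'h) \<Rightarrow> ('h \<Rightarrow> 'g) \<Rightarrow> bool" where
  "central_extension G Gh \<iota> \<pi> \<longleftrightarrow> diffeological_Lie_group G \<and> diffeological_Lie_group Gh \<and>
     \<iota> \<in> hom circle Gh \<and> dsmooth (dspace circle) (dspace Gh) \<iota> \<and> inj_on \<iota> (carrier circle) \<and>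
     \<pi> \<in> hom Gh G \<and> dsmooth (dspace Gh) (dspace G) \<pi> \<and> \<pi> ` carrier Gh = carrier G \<and>
     \<iota> ` carrier circle = kernel Gh G \<pi> \<and>
     (\<forall>z\<in>carrier circle. \<forall>h\<in>carrier Gh. \<iota> z \<otimes>\<^bsub>Gh\<^esub> h = h \<otimes>\<^bsub>Gh\<^esub> \<iota> z) \<and>
     principal_bundle circle (dspace G)
       \<lparr>tot = dspace Gh, proj = \<pi>, gact = (\<lambda>z h. \<iota> z \<otimes>\<^bsub>Gh\<^esub> h)\<rparr>"

text \<open>The extension integrates the Lie algebra extension of \<open>\<gg>\<close> by \<open>\<real>\<close> defined by \<open>\<omega>\<close>.  The nonzero
  constant \<open>\<kappa>\<close> is the choice of an identification of the Lie algebra of the circle group with \<open>\<real>\<close>.\<close>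

definition integrates ::
    "'g dgroup \<Rightarrow> ('g tvec \<Rightarrow> 'g tvec \<Rightarrow> real) \<Rightarrow> 'h dgroup \<Rightarrow> (complex \<Rightarrow> 'h) \<Rightarrow> ('h \<Rightarrow> 'g) \<Rightarrow> bool" where
  "integrates G \<omega> Gh \<iota> \<pi> \<longleftrightarrow> (\<exists>\<Theta> :: 'g tvec \<times> real \<Rightarrow> 'h tvec. \<exists>\<kappa>. \<kappa> \<noteq> 0 \<and>
     bij_betw \<Theta> (lie_alg G \<times> UNIV) (lie_alg Gh) \<and>
     (\<forall>\<xi>\<in>lie_alg G. \<forall>\<eta>\<in>lie_alg G. \<forall>a b s.
        \<Theta> (tadd \<xi> \<eta>, a + b) = tadd (\<Theta> (\<xi>, a)) (\<Theta> (\<eta>, b)) \<and>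
        \<Theta> (tscale s \<xi>, s * a) = tscale s (\<Theta> (\<xi>, a)) \<and>
        \<Theta> (lie_bracket G \<xi> \<eta>, \<omega> \<xi> \<eta>) = lie_bracket Gh (\<Theta> (\<xi>, a)) (\<Theta> (\<eta>, b))) \<and>
     (\<forall>\<xi>\<in>lie_alg G. \<forall>a. \<forall>\<phi>\<in>Cinf (dspace G). \<Theta> (\<xi>, a) (\<phi> \<circ> \<pi>) = \<xi> \<phi>) \<and>
     (\<forall>a. \<Theta> ((\<lambda>_. 0), a) = tangent (dspace Gh) (\<lambda>t. \<iota> (cis (\<kappa> * a * t)))))"

section \<open>Sheaf cohomology\<close>

text \<open>Cohomology of the D-topology of \<open>Y\<close> with coefficients in the sheaf of smooth functions with
  values in an abelian diffeological group \<open>A\<close> (for \<open>int_dgroup\<close> this is the constant sheaf),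
  computed by Godement's canonical flasque cosimplicial resolution.  A global section of its
  \<open>n\<close>-th term assigns a germ at \<open>x\<^sub>n\<close> of a section of the sheaf to all \<open>(x\<^sub>0, \<dots>, x\<^sub>n)\<close> with \<open>x\<^sub>1\<close>
  close to \<open>x\<^sub>0\<close>, \<open>x\<^sub>2\<close> close to \<open>x\<^sub>1\<close>, and so on, two such assignments being equal if they agree
  on all such tuples; the quantification over these tuples is \<open>nested\<close>.  Germs are represented by
  functions, and the Godement coboundary becomes the alternating sum over omitted points.  This
  makes sense, and computes derived-functor cohomology, without paracompactness.\<close>

fun nested_from :: "'y topology \<Rightarrow> nat \<Rightarrow> ('y list \<Rightarrow> bool) \<Rightarrow> 'y list \<Rightarrow> bool" where
  "nested_from T 0 R xs \<longleftrightarrow> R xs"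
| "nested_from T (Suc n) R xs \<longleftrightarrow>
     (\<forall>\<^sub>F y in nhdsin T (last xs). nested_from T n R (xs @ [y]))"

definition nested :: "'y topology \<Rightarrow> nat \<Rightarrow> ('y list \<Rightarrow> bool) \<Rightarrow> bool" where
  "nested T n R \<longleftrightarrow> (\<forall>x\<in>topspace T. nested_from T n R [x])"

type_synonym ('y, 'a) cochain = "'y list \<Rightarrow> 'y \<Rightarrow> 'a"

definition cochains :: "'y diffeology \<Rightarrow> 'a dgroup \<Rightarrow> nat \<Rightarrow> ('y, 'a) cochain set" where
  "cochains Y A n = {s. nested (dtop Y) n (\<lambda>xs. \<exists>W. openin (dtop Y) W \<and> last xs \<in> W \<and>
     dsmooth (sub_diff Y W) (dspace A) (s xs))}"

definition germ_eq :: "'y diffeology \<Rightarrow> nat \<Rightarrow> ('y, 'a) cochain \<Rightarrow> ('y, 'a) cochain \<Rightarrow> bool" where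
  "germ_eq Y n s t \<longleftrightarrow>
     nested (dtop Y) n (\<lambda>xs. \<forall>\<^sub>F y in nhdsin (dtop Y) (last xs). s xs y = t xs y)"

definition omit :: "nat \<Rightarrow> 'y list \<Rightarrow> 'y list" where
  "omit i xs = take i xs @ drop (Suc i) xs"

definition coboundary :: "'a dgroup \<Rightarrow> nat \<Rightarrow> ('y, 'a) cochain \<Rightarrow> ('y, 'a) cochain" where
  "coboundary A n s xs y =
     (\<Otimes>\<^bsub>A\<^esub>i\<in>{..Suc n}. if even i then s (omit i xs) y else inv\<^bsub>A\<^esub> (s (omit i xs) y))"

definition cocycles :: "'y diffeology \<Rightarrow> 'a dgroup \<Rightarrow> nat \<Rightarrow> ('y, 'a) cochain set" where
  "cocycles Y A n = {s \<in> cochains Y A n. germ_eq Y (Suc n) (coboundary A n s) (\<lambda>_ _. \<one>\<^bsub>A\<^esub>)}"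

definition cohomologous :: "'y diffeology \<Rightarrow> 'a dgroup \<Rightarrow> nat \<Rightarrow> ('y, 'a) cochain \<Rightarrow> ('y, 'a) cochain \<Rightarrow> bool" where
  "cohomologous Y A n s t \<longleftrightarrow> (case n of
       0 \<Rightarrow> germ_eq Y 0 s t
     | Suc m \<Rightarrow> (\<exists>b\<in>cochains Y A m. germ_eq Y n s (\<lambda>xs y. t xs y \<otimes>\<^bsub>A\<^esub> coboundary A m b xs y)))"

definition cohomology :: "'y diffeology \<Rightarrow> 'a dgroup \<Rightarrow> nat \<Rightarrow> ('y, 'a) cochain set set" where
  "cohomology Y A n =
     cocycles Y A n // {(s, t). s \<in> cocycles Y A n \<and> t \<in> cocycles Y A n \<and> cohomologous Y A n s t}"

definition cohomology_pullback ::
    "'x diffeology \<Rightarrow> 'a dgroup \<Rightarrow> nat \<Rightarrow> ('x \<Rightarrow> 'y) \<Rightarrow> ('y, 'a) cochain set \<Rightarrow> ('x, 'a) cochain set" where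
  "cohomology_pullback X A n f h =
     {s \<in> cocycles X A n. \<exists>t\<in>h. cohomologous X A n s (\<lambda>xs x. t (map f xs) (f x))}"

text \<open>The connecting morphism from degree \<open>n\<close> with coefficients in \<open>circle\<close> to degree \<open>n + 1\<close> with
  coefficients in \<open>int_dgroup\<close> of the sequence given by \<open>t \<mapsto> exp (2 \<pi> i t)\<close>.\<close>

definition connecting :: "'y diffeology \<Rightarrow> nat \<Rightarrow> ('y, complex) cochain set \<Rightarrow> ('y, int) cochain set" where
  "connecting Y n h = {z \<in> cocycles Y int_dgroup (Suc n).
     \<exists>c\<in>h. \<exists>\<theta>\<in>cochains Y real_dgroup n.
        germ_eq Y n (\<lambda>xs y. cis (2 * pi * \<theta> xs y)) c \<and>
        germ_eq Y (Suc n) (\<lambda>xs y. real_of_int (z xs y)) (coboundary real_dgroup n \<theta>)}"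

section \<open>Gerbes, their classes, and the lifting gerbe\<close>

text \<open>Objects and morphisms over D-open sets, composition, restriction, and the action of smooth
  circle-valued functions on morphisms.  The object argument of \<open>gcomp\<close>, \<open>gmres\<close> and \<open>gband\<close> is
  the source of the (last) morphism argument.\<close>

record ('y, 'o, 'm) gerbe =
  gobj :: "'y set \<Rightarrow> 'o set"
  ghom :: "'y set \<Rightarrow> 'o \<Rightarrow> 'o \<Rightarrow> 'm set"
  gcomp :: "'o \<Rightarrow> 'm \<Rightarrow> 'm \<Rightarrow> 'm"
  gores :: "'y set \<Rightarrow> 'o \<Rightarrow> 'o"
  gmres :: "'y set \<Rightarrow> 'o \<Rightarrow> 'm \<Rightarrow> 'm"
  gband :: "'o \<Rightarrow> ('y \<Rightarrow> complex) \<Rightarrow> 'm \<Rightarrow> 'm"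

text \<open>The class of a circle-banded gerbe in degree two.  Choose an object \<open>Q x\<close> near every point \<open>x\<close>
  and an isomorphism \<open>F x y : Q x \<rightarrow> Q y\<close> near \<open>y\<close> for \<open>y\<close> close to \<open>x\<close>; the cocycle \<open>c\<close> is given
  by \<open>F y z \<circ> F x y = c x y z \<cdot> F x z\<close> near \<open>z\<close>.  As \<open>Q\<close> and \<open>F\<close> vary these cocycles fill out a
  cohomology class.\<close>

definition gerbe_class :: "'y diffeology \<Rightarrow> ('y, 'o, 'm) gerbe \<Rightarrow> ('y, complex) cochain set" where
  "gerbe_class Y K = {c \<in> cocycles Y circle 2. \<exists>U Q V F.
     (\<forall>x\<in>pts Y. openin (dtop Y) (U x) \<and> x \<in> U x \<and> Q x \<in> gobj K (U x)) \<and>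
     (\<forall>x\<in>pts Y. \<forall>y\<in>U x. openin (dtop Y) (V x y) \<and> y \<in> V x y \<and> V x y \<subseteq> U x \<inter> U y \<and>
        F x y \<in> ghom K (V x y) (gores K (V x y) (Q x)) (gores K (V x y) (Q y))) \<and>
     nested (dtop Y) 2 (\<lambda>xs. let x = xs ! 0; y = xs ! 1; z = xs ! 2 in
        \<exists>W. openin (dtop Y) W \<and> z \<in> W \<and> W \<subseteq> V x y \<inter> V y z \<inter> V x z \<and>
          dsmooth (sub_diff Y W) (dspace circle) (c xs) \<and>
          gcomp K (gores K W (Q x))
              (gmres K W (gores K (V y z) (Q y)) (F y z)) (gmres K W (gores K (V x y) (Q x)) (F x y))
            = gband K (gores K W (Q x)) (c xs) (gmres K W (gores K (V x z) (Q x)) (F x z)))}"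

definition dd_class :: "'y diffeology \<Rightarrow> ('y, 'o, 'm) gerbe \<Rightarrow> ('y, int) cochain set" where
  "dd_class Y K = connecting Y 2 (gerbe_class Y K)"

text \<open>An object over \<open>U\<close> is a principal \<open>Gh\<close>-bundle \<open>R\<close> over \<open>U\<close> with an isomorphism \<open>\<alpha>\<close> of
  principal \<open>G\<close>-bundles from \<open>R\<close> modulo the circle group to the restriction of \<open>Q\<close>; here an element
  \<open>\<pi> h\<close> of \<open>G\<close> acts on the orbit of \<open>r\<close> by \<open>h\<close>.  A principal \<open>Gh\<close>-bundle over a subset of \<open>Y\<close> is in
  bijection with that subset times \<open>Gh\<close>, so it is no restriction to let its points have type
  \<open>'y \<times> 'h\<close>.\<close>

type_synonym ('h, 'p, 'y) lift_obj = "('h, 'y \<times> 'h, 'y) gbundle \<times> (('y \<times> 'h) set \<Rightarrow> 'p)"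

definition circle_orbit ::
    "(complex \<Rightarrow> 'h) \<Rightarrow> ('h, 'r, 'y) gbundle \<Rightarrow> 'r \<Rightarrow> 'r set" where
  "circle_orbit \<iota> R = orbit_of circle (\<lambda>z. gact R (\<iota> z))"

definition lift_objects ::
    "'h dgroup \<Rightarrow> (complex \<Rightarrow> 'h) \<Rightarrow> ('h \<Rightarrow> 'g) \<Rightarrow> 'y diffeology \<Rightarrow> ('g, 'p, 'y) gbundle \<Rightarrow> 'y set
      \<Rightarrow> ('h, 'p, 'y) lift_obj set" where
  "lift_objects Gh \<iota> \<pi> Y Q U = {(R, \<alpha>).
     principal_bundle Gh (sub_diff Y U) R \<and>
     diffeo (quotient_diff (tot R) (circle_orbit \<iota> R)) (tot (bundle_restrict Q U)) \<alpha> \<and>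
     (\<forall>r\<in>pts (tot R). proj Q (\<alpha> (circle_orbit \<iota> R r)) = proj R r \<and>
        (\<forall>h\<in>carrier Gh. \<alpha> (circle_orbit \<iota> R (gact R h r)) = gact Q (\<pi> h) (\<alpha> (circle_orbit \<iota> R r))))}"

definition lift_isos ::
    "'h dgroup \<Rightarrow> (complex \<Rightarrow> 'h) \<Rightarrow> ('h, 'p, 'y) lift_obj \<Rightarrow> ('h, 'p, 'y) lift_obj
      \<Rightarrow> ('y \<times> 'h \<Rightarrow> 'y \<times> 'h) set" where
  "lift_isos Gh \<iota> = (\<lambda>(R, \<alpha>) (R', \<alpha>'). {F \<in> extensional (pts (tot R)). diffeo (tot R) (tot R') F \<and>
     (\<forall>r\<in>pts (tot R). proj R' (F r) = proj R r \<and>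
        (\<forall>h\<in>carrier Gh. F (gact R h r) = gact R' h (F r)) \<and>
        \<alpha>' (circle_orbit \<iota> R' (F r)) = \<alpha> (circle_orbit \<iota> R r))})"

definition lifting_gerbe ::
    "'h dgroup \<Rightarrow> (complex \<Rightarrow> 'h) \<Rightarrow> ('h \<Rightarrow> 'g) \<Rightarrow> 'y diffeology \<Rightarrow> ('g, 'p, 'y) gbundle
      \<Rightarrow> ('y, ('h, 'p, 'y) lift_obj, 'y \<times> 'h \<Rightarrow> 'y \<times> 'h) gerbe" where
  "lifting_gerbe Gh \<iota> \<pi> Y Q = \<lparr>
     gobj = lift_objects Gh \<iota> \<pi> Y Q,
     ghom = (\<lambda>U. lift_isos Gh \<iota>),
     gcomp = (\<lambda>(R, \<alpha>) F' F. compose (pts (tot R)) F' F),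
     gores = (\<lambda>U (R, \<alpha>). (bundle_restrict R U, \<alpha>)),
     gmres = (\<lambda>U (R, \<alpha>) F. restrict F (pts (tot (bundle_restrict R U)))),
     gband = (\<lambda>(R, \<alpha>) b F. \<lambda>r\<in>pts (tot R). F (gact R (\<iota> (b (proj R r))) r))\<rparr>"

definition schwinger_DD ::
    "'g dgroup \<Rightarrow> 'h dgroup \<Rightarrow> (complex \<Rightarrow> 'h) \<Rightarrow> ('h \<Rightarrow> 'g) \<Rightarrow> ('g fam set set, int) cochain set" where
  "schwinger_DD G Gh \<iota> \<pi> = dd_class (Bsph G) (lifting_gerbe Gh \<iota> \<pi> (Bsph G) (universal_bundle G))"

end

theory Submission
  imports Defs
begin

text \<open>The Dixmier--Douady class of the lifting gerbe of a principal bundle \<open>Q\<close> can be computed from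
  local sections of \<open>Q\<close> alone.  Choose a smooth section \<open>s x\<close> near every point \<open>x\<close>.  Where two
  sections meet they differ by a transition function with values in \<open>G\<close>, and this lifts locally to a
  function \<open>\<gamma> x y\<close> with values in the central extension, because the extension is a principal circle
  bundle over \<open>G\<close>.  The failure of \<open>\<gamma>\<close> to be multiplicative is a circle-valued cocycle \<open>c\<close>; a real
  logarithm \<open>\<theta>\<close> of \<open>c\<close> has an integral coboundary \<open>z\<close>, and \<open>z\<close> represents the class.  Sections,
  lifts, logarithms and integral cocycles all pull back along a smooth map \<open>f\<close>, and the pulled back
  ones are choices of the same kind for the pulled back bundle.  Hence the pullback of \<open>z\<close> represents
  both sides of the theorem.

  What has to be proved is that \<open>z\<close> computes the class, which is defined through arbitrary lifts of
  \<open>Q\<close>.  On the one hand a section turns the trivial bundle into a lift, and \<open>\<gamma>\<close> into an isomorphism of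
  lifts, so \<open>c\<close> is one of the cocycles of the gerbe (\<open>cech_in_gerbe_class\<close>).  On the other hand every
  lift has, near each point, a smooth group coordinate relative to \<open>s\<close>; in these coordinates an
  arbitrary isomorphism of lifts differs from \<open>\<gamma>\<close> by a circle-valued function, and these functions
  form a cochain whose coboundary compares \<open>c\<close> with any other cocycle of the gerbe
  (\<open>gerbe_class_cohomologous\<close>).  The connecting morphism then takes the gerbe class to the full
  cohomology class of \<open>z\<close> (\<open>connecting_eq_class\<close>).

  This gives naturality for principal bundles over arbitrary diffeological spaces
  (\<open>dd_class_bundle_pullback\<close>).  It applies to the universal bundle, which is locally trivial for the
  D-topology: over the classes whose \<open>i\<close>-th weight is nonzero, the representative with neutral
  \<open>i\<close>-th label is a smooth section (\<open>principal_universal_bundle\<close>).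

  A principal bundle is handled through two facts only: it has smooth local sections, and the group
  element that carries one plot to another plot over the same points of the base is again a plot.
  Together with freeness of the action these are equivalent to local triviality
  (\<open>principal_bundleI\<close>), and they are much easier to transport.\<close>

section \<open>Calculus on Euclidean domains\<close>

lemma openin_Euclidean_sub: "openin (Euclidean_space n) U \<Longrightarrow> u \<in> U \<Longrightarrow> u \<in> topspace (Euclidean_space n)"
  using openin_subset by blast

lemma openin_Euclidean_box:
  assumes "openin (Euclidean_space n) U" "v \<in> U"
  obtains e where "e > 0"
    "\<And>w. w \<in> topspace (Euclidean_space n) \<Longrightarrow> (\<And>i. i < n \<Longrightarrow> \<bar>w i - v i\<bar> < e) \<Longrightarrow> w \<in> U"
proof -
  obtain T where T: "openin (powertop_real UNIV) T" "U = T \<inter> {x. \<forall>i\<ge>n. x i = 0}"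
    using assms(1) unfolding Euclidean_space_def openin_subtopology by blast
  have vT: "v \<in> T" using assms(2) T by auto
  obtain B where B: "\<And>i. open (B i)" "v \<in> Pi\<^sub>E UNIV B" "Pi\<^sub>E UNIV B \<subseteq> T"
    using openin_product_topology_alt[THEN iffD1, OF T(1)] vT by fastforce
  have "\<exists>e>0. \<forall>y. \<bar>y - v i\<bar> < e \<longrightarrow> y \<in> B i" for i
  proof -
    have "v i \<in> B i" using B(2) by auto
    with B(1)[of i] show ?thesis unfolding open_dist dist_real_def by blast
  qed
  then obtain e where e: "\<And>i. e i > 0" "\<And>i y. \<bar>y - v i\<bar> < e i \<Longrightarrow> y \<in> B i" by metis
  define d where "d = Min (insert 1 (e ` {..<n}))"
  have d: "d > 0" "\<And>i. i < n \<Longrightarrow> d \<le> e i" using e(1) by (auto simp: d_def)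
  show thesis
  proof (rule that[OF d(1)])
    fix w assume w: "w \<in> topspace (Euclidean_space n)" "\<And>i. i < n \<Longrightarrow> \<bar>w i - v i\<bar> < d"
    have "w i \<in> B i" for i
    proof (cases "i < n")
      case True
      then show ?thesis using w(2)[OF True] d(2)[OF True] e(2) by auto
    next
      case False
      then have "w i = v i" using w(1) openin_Euclidean_sub[OF assms]
        by (simp add: topspace_Euclidean_space)
      then show ?thesis using B(2) by auto
    qed
    then have "w \<in> T" using B(3) by auto
    then show "w \<in> U" using T w(1) by (auto simp: topspace_Euclidean_space)
  qed
qed

lemma continuous_map_Euclidean_coord:
  "continuous_map (subtopology (Euclidean_space n) U) euclideanreal (\<lambda>v. v j)"
  unfolding Euclidean_space_def
  by (intro continuous_map_from_subtopology) (auto intro: continuous_map_product_projection)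

lemma eventually_line:
  assumes "openin (Euclidean_space n) U" "v \<in> U" "i < n"
  shows "\<forall>\<^sub>F t in nhds (v i). v(i := t) \<in> U"
proof -
  obtain e where e: "e > 0"
    "\<And>w. w \<in> topspace (Euclidean_space n) \<Longrightarrow> (\<And>i. i < n \<Longrightarrow> \<bar>w i - v i\<bar> < e) \<Longrightarrow> w \<in> U"
    using openin_Euclidean_box[OF assms(1,2)] by blast
  have "v(i := t) \<in> U" if "dist t (v i) < e" for t
    using that openin_Euclidean_sub[OF assms(1,2)] assms(3) e
    by (intro e(2)) (auto simp: topspace_Euclidean_space dist_real_def)
  then show ?thesis unfolding eventually_nhds_metric using e(1) by blast
qed

lemma has_deriv_line_cong:
  assumes "openin (Euclidean_space n) U" "\<forall>u\<in>U. f u = g u" "v \<in> U" "i < n"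
    "((\<lambda>t. f (v(i := t))) has_real_derivative d) (at (v i))"
  shows "((\<lambda>t. g (v(i := t))) has_real_derivative d) (at (v i))"
proof -
  have "\<forall>\<^sub>F t in nhds (v i). f (v(i := t)) = g (v(i := t))"
    using eventually_line[OF assms(1,3,4)] by eventually_elim (use assms(2) in blast)
  from DERIV_cong_ev[OF refl this refl] show ?thesis using assms(5) by simp
qed

lemma Ck_on_continuous: "Ck_on k n U f \<Longrightarrow> Ck_on 0 n U f"
  by (cases k) auto

lemma Ck_on_SucI:
  assumes "Ck_on 0 n U f"
    "\<And>i v. i < n \<Longrightarrow> v \<in> U \<Longrightarrow> ((\<lambda>t. f (v(i := t))) has_real_derivative f' i v) (at (v i))"
    "\<And>i. i < n \<Longrightarrow> Ck_on k n U (f' i)"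
  shows "Ck_on (Suc k) n U f"
  unfolding Ck_on.simps(2) using assms by blast

lemma Ck_on_SucD: "Ck_on (Suc k) n U f \<Longrightarrow> Ck_on k n U f"
proof (induction k arbitrary: f)
  case 0 then show ?case by simp
next
  case (Suc k) then show ?case by (metis Ck_on.simps(2))
qed

lemma Ck_on_subset: "Ck_on k n U f \<Longrightarrow> V \<subseteq> U \<Longrightarrow> Ck_on k n V f"
proof (induction k arbitrary: f)
  case 0
  then show ?case by (simp add: continuous_map_from_subtopology_mono)
next
  case (Suc k)
  from Suc.prems(1) obtain f' where "\<forall>i<n. (\<forall>v\<in>U. ((\<lambda>t. f (v(i := t))) has_real_derivative f' i v) (at (v i))) \<and>
                 Ck_on k n U (f' i)" by auto
  then have "\<forall>i<n. (\<forall>v\<in>V. ((\<lambda>t. f (v(i := t))) has_real_derivative f' i v) (at (v i))) \<and>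
                 Ck_on k n V (f' i)" using Suc.IH Suc.prems(2) by blast
  moreover have "Ck_on 0 n V f" using Suc.prems by (auto simp: continuous_map_from_subtopology_mono)
  ultimately show ?case unfolding Ck_on.simps(2) by blast
qed

lemma Ck_on_cong:
  assumes "openin (Euclidean_space n) U" "\<forall>u\<in>U. f u = g u" "Ck_on k n U f"
  shows "Ck_on k n U g"
proof -
  have 0: "Ck_on 0 n U g"
    using Ck_on_continuous[OF assms(3)] assms(2)
    by (auto intro: continuous_map_eq)
  show ?thesis
  proof (cases k)
    case 0 then show ?thesis using \<open>Ck_on 0 n U g\<close> by simp
  next
    case (Suc m)
    obtain f' where f': "\<And>i v. i < n \<Longrightarrow> v \<in> U \<Longrightarrow> ((\<lambda>t. f (v(i := t))) has_real_derivative f' i v) (at (v i))"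
      "\<And>i. i < n \<Longrightarrow> Ck_on m n U (f' i)" using assms(3) Suc by auto
    show ?thesis unfolding Suc
      using 0 has_deriv_line_cong[OF assms(1,2)] f' by (intro Ck_on_SucI[where f' = f']) blast+
  qed
qed

text \<open>Partial derivatives are unique, so the existential quantifier in the definition of \<open>Ck_on\<close> can be
  instantiated by \<open>pd\<close>.  Only with this canonical witness do local derivatives fit together.\<close>

lemma Ck_on_Suc_pd:
  assumes "openin (Euclidean_space n) U"
  shows "Ck_on (Suc k) n U f \<longleftrightarrow> Ck_on 0 n U f \<and>
     (\<forall>i<n. (\<forall>v\<in>U. ((\<lambda>t. f (v(i := t))) has_real_derivative pd i f v) (at (v i))) \<and>
            Ck_on k n U (pd i f))" (is "?L \<longleftrightarrow> ?R")
proof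
  assume ?L
  then obtain f' where f': "Ck_on 0 n U f" "\<And>i v. i < n \<Longrightarrow> v \<in> U \<Longrightarrow> ((\<lambda>t. f (v(i := t))) has_real_derivative f' i v) (at (v i))"
      "\<And>i. i < n \<Longrightarrow> Ck_on k n U (f' i)" by auto
  have eq: "f' i v = pd i f v" if "i < n" "v \<in> U" for i v
    unfolding pd_def using DERIV_imp_deriv[OF f'(2)[OF that]] by simp
  show ?R
    using f' eq Ck_on_cong[OF assms _ f'(3)] by (metis (no_types, lifting))
next
  assume ?R
  then show ?L by (intro Ck_on_SucI[where f' = "\<lambda>i. pd i f"]) auto
qed

lemma Ck_on_local:
  assumes "openin (Euclidean_space n) U"
    "\<forall>u\<in>U. \<exists>V. openin (Euclidean_space n) V \<and> u \<in> V \<and> V \<subseteq> U \<and> Ck_on k n V f"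
  shows "Ck_on k n U f"
  using assms(2)
proof (induction k arbitrary: f)
  case 0
  have "openin (subtopology (Euclidean_space n) U)
          {x \<in> topspace (subtopology (Euclidean_space n) U). f x \<in> A}" if "open A" for A
  proof (subst openin_subopen, intro ballI)
    fix x assume x: "x \<in> {x \<in> topspace (subtopology (Euclidean_space n) U). f x \<in> A}"
    then obtain V where V: "openin (Euclidean_space n) V" "x \<in> V" "V \<subseteq> U" "Ck_on 0 n V f"
      using 0 by auto
    have "openin (subtopology (Euclidean_space n) V) {y \<in> topspace (subtopology (Euclidean_space n) V). f y \<in> A}"
      using V(4) that unfolding Ck_on.simps continuous_map_def by auto
    then have "openin (Euclidean_space n) {y \<in> topspace (subtopology (Euclidean_space n) V). f y \<in> A}"
      using V(1) openin_open_subtopology by blast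
    then have "openin (subtopology (Euclidean_space n) U) {y \<in> topspace (subtopology (Euclidean_space n) V). f y \<in> A}"
      using V(3) by (auto simp: openin_open_subtopology[OF assms(1)] simp del: topspace_subtopology)
        (auto simp: topspace_subtopology)
    then show "\<exists>T. openin (subtopology (Euclidean_space n) U) T \<and> x \<in> T \<and>
        T \<subseteq> {x \<in> topspace (subtopology (Euclidean_space n) U). f x \<in> A}"
      using V x by (intro exI[of _ "{y \<in> topspace (subtopology (Euclidean_space n) V). f y \<in> A}"]) auto
  qed
  then show ?case unfolding Ck_on.simps continuous_map_def by simp
next
  case (Suc k)
  have "Ck_on 0 n U f"
  proof -
    have "\<forall>u\<in>U. \<exists>V. openin (Euclidean_space n) V \<and> u \<in> V \<and> V \<subseteq> U \<and> Ck_on k n V f"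
      using Suc.prems Ck_on_SucD[of k n] by (metis (no_types))
    from Suc.IH[OF this] show ?thesis by (rule Ck_on_continuous)
  qed
  moreover have "((\<lambda>t. f (v(i := t))) has_real_derivative pd i f v) (at (v i))" if "i < n" "v \<in> U" for i v
    using Suc.prems Ck_on_Suc_pd[of n _ k f] that by metis
  moreover have "Ck_on k n U (pd i f)" if "i < n" for i
  proof (rule Suc.IH)
    show "\<forall>u\<in>U. \<exists>V. openin (Euclidean_space n) V \<and> u \<in> V \<and> V \<subseteq> U \<and> Ck_on k n V (pd i f)"
      using Suc.prems Ck_on_Suc_pd[of n _ k f] that by metis
  qed
  ultimately show ?case using Ck_on_Suc_pd[OF assms(1)] by blast
qed

lemma Ck_on_const: "Ck_on k n U (\<lambda>_. c)"
proof (induction k arbitrary: c)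
  case (Suc k)
  show ?case by (rule Ck_on_SucI[where f' = "\<lambda>_ _. 0"]) (simp_all add: Suc)
qed simp

lemma Ck_on_coord: "Ck_on k n U (\<lambda>v. v j)"
proof (cases k)
  case 0 then show ?thesis by (simp add: continuous_map_Euclidean_coord)
next
  case (Suc m)
  have "((\<lambda>t. (v(i := t)) j) has_real_derivative (if i = j then 1 else 0)) (at (v i))" for i and v :: "nat \<Rightarrow> real"
    by auto
  then show ?thesis unfolding Suc
    by (intro Ck_on_SucI[where f' = "\<lambda>i _. if i = j then 1 else 0"])
      (simp_all only: Ck_on_const Ck_on.simps continuous_map_Euclidean_coord)
qed

lemma Ck_on_add: "Ck_on k n U f \<Longrightarrow> Ck_on k n U g \<Longrightarrow> Ck_on k n U (\<lambda>v. f v + g v)"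
proof (induction k arbitrary: f g)
  case 0 then show ?case by (simp add: continuous_map_add)
next
  case (Suc k)
  obtain f' where f': "\<And>i v. i < n \<Longrightarrow> v \<in> U \<Longrightarrow> ((\<lambda>t. f (v(i := t))) has_real_derivative f' i v) (at (v i))"
      "\<And>i. i < n \<Longrightarrow> Ck_on k n U (f' i)" using Suc.prems(1) by auto
  obtain g' where g': "\<And>i v. i < n \<Longrightarrow> v \<in> U \<Longrightarrow> ((\<lambda>t. g (v(i := t))) has_real_derivative g' i v) (at (v i))"
      "\<And>i. i < n \<Longrightarrow> Ck_on k n U (g' i)" using Suc.prems(2) by auto
  have "((\<lambda>t. f (v(i := t)) + g (v(i := t))) has_real_derivative f' i v + g' i v) (at (v i))"
    if "i < n" "v \<in> U" for i v
    by (rule DERIV_add[OF f'(1)[OF that] g'(1)[OF that]])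
  moreover have "Ck_on k n U (\<lambda>v. f' i v + g' i v)" if "i < n" for i
    by (rule Suc.IH[OF f'(2)[OF that] g'(2)[OF that]])
  moreover have "Ck_on 0 n U (\<lambda>v. f v + g v)" using Suc.prems by (simp add: continuous_map_add)
  ultimately show ?case by (intro Ck_on_SucI[where f' = "\<lambda>i v. f' i v + g' i v"])
qed

lemma Ck_on_mult: "Ck_on k n U f \<Longrightarrow> Ck_on k n U g \<Longrightarrow> Ck_on k n U (\<lambda>v. f v * g v)"
proof (induction k arbitrary: f g)
  case 0 then show ?case by (simp add: continuous_map_real_mult)
next
  case (Suc k)
  obtain f' where f': "\<And>i v. i < n \<Longrightarrow> v \<in> U \<Longrightarrow> ((\<lambda>t. f (v(i := t))) has_real_derivative f' i v) (at (v i))"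
      "\<And>i. i < n \<Longrightarrow> Ck_on k n U (f' i)" using Suc.prems(1) by auto
  obtain g' where g': "\<And>i v. i < n \<Longrightarrow> v \<in> U \<Longrightarrow> ((\<lambda>t. g (v(i := t))) has_real_derivative g' i v) (at (v i))"
      "\<And>i. i < n \<Longrightarrow> Ck_on k n U (g' i)" using Suc.prems(2) by auto
  have "((\<lambda>t. f (v(i := t)) * g (v(i := t))) has_real_derivative f' i v * g v + g' i v * f v) (at (v i))"
    if "i < n" "v \<in> U" for i v
    by (rule DERIV_cong[OF DERIV_mult[OF f'(1)[OF that] g'(1)[OF that]]]) simp
  moreover have "Ck_on k n U (\<lambda>v. f' i v * g v + g' i v * f v)" if "i < n" for i
    by (intro Ck_on_add Suc.IH f'(2)[OF that] g'(2)[OF that] Ck_on_SucD[OF Suc.prems(1)] Ck_on_SucD[OF Suc.prems(2)])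
  moreover have "Ck_on 0 n U (\<lambda>v. f v * g v)" using Suc.prems by (simp add: continuous_map_real_mult)
  ultimately show ?case by (intro Ck_on_SucI[where f' = "\<lambda>i v. f' i v * g v + g' i v * f v"])
qed

lemma Ck_on_sum: "finite I \<Longrightarrow> (\<And>i. i \<in> I \<Longrightarrow> Ck_on k n U (f i)) \<Longrightarrow> Ck_on k n U (\<lambda>v. \<Sum>i\<in>I. f i v)"
  by (induction I rule: finite_induct) (auto simp: Ck_on_const Ck_on_add)

declare Ck_on.simps(2) [simp del]

lemma continuous_map_Euclidean_eps:
  assumes "openin (Euclidean_space n) U" "v \<in> U" "Ck_on 0 n U f" "(e::real) > 0"
  obtains d where "d > 0"
    "\<And>w. w \<in> topspace (Euclidean_space n) \<Longrightarrow> (\<And>i. i < n \<Longrightarrow> \<bar>w i - v i\<bar> < d) \<Longrightarrow> w \<in> U \<and> \<bar>f w - f v\<bar> < e"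
proof -
  have "openin (subtopology (Euclidean_space n) U) {x \<in> topspace (subtopology (Euclidean_space n) U). f x \<in> ball (f v) e}"
    using assms(3) unfolding Ck_on.simps continuous_map_def by auto
  then have op: "openin (Euclidean_space n) {x \<in> topspace (subtopology (Euclidean_space n) U). f x \<in> ball (f v) e}"
    using assms(1) openin_open_subtopology by blast
  have "v \<in> {x \<in> topspace (subtopology (Euclidean_space n) U). f x \<in> ball (f v) e}"
    using assms openin_Euclidean_sub by auto
  from openin_Euclidean_box[OF op this] show thesis
    using that by (auto simp: dist_real_def abs_minus_commute)
qed

text \<open>The coordinates can be moved from \<open>\<gamma> t0\<close> to \<open>\<gamma> t\<close> one at a time, and each of these
  moves is controlled by the one-variable mean value theorem, so existence and continuity of the
  partial derivatives suffice.\<close>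

lemma chain_rule_curve:
  assumes U: "openin (Euclidean_space n) U" and v: "\<gamma> t0 \<in> U"
    and \<gamma>: "\<forall>\<^sub>F t in at t0. \<gamma> t \<in> topspace (Euclidean_space n)"
    and \<gamma>': "\<And>i. i < n \<Longrightarrow> ((\<lambda>t. \<gamma> t i) has_real_derivative \<gamma>' i) (at t0)"
    and f': "\<And>i w. i < n \<Longrightarrow> w \<in> U \<Longrightarrow> ((\<lambda>t. f (w(i := t))) has_real_derivative f' i w) (at (w i))"
    and cf': "\<And>i. i < n \<Longrightarrow> Ck_on 0 n U (f' i)"
  shows "((\<lambda>t. f (\<gamma> t)) has_real_derivative (\<Sum>i<n. f' i (\<gamma> t0) * \<gamma>' i)) (at t0)"
proof -
  \<comment> \<open>\<open>h k t\<close> has its first \<open>k\<close> coordinates already at time \<open>t\<close>, the others still at time \<open>t0\<close>.\<close>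
  define h where "h k t = (\<lambda>i. if i < k then \<gamma> t i else \<gamma> t0 i)" for k t
  have v0: "\<gamma> t0 \<in> topspace (Euclidean_space n)" using U v openin_Euclidean_sub by blast
  have ht0: "h k t0 = \<gamma> t0" for k by (auto simp: h_def)
  have close: "\<forall>\<^sub>F t in at t0. \<forall>i<n. \<bar>\<gamma> t i - \<gamma> t0 i\<bar> < d" if "d > 0" for d
  proof -
    have "\<forall>\<^sub>F t in at t0. \<bar>\<gamma> t i - \<gamma> t0 i\<bar> < d" if "i < n" for i
    proof -
      have "((\<lambda>t. \<gamma> t i) \<longlongrightarrow> \<gamma> t0 i) (at t0)"
        using DERIV_isCont[OF \<gamma>'[OF that]] isCont_def by blast
      from tendstoD[OF this \<open>d > 0\<close>] show ?thesis by (simp add: dist_real_def)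
    qed
    then have "\<forall>\<^sub>F t in at t0. \<forall>i\<in>{..<n}. \<bar>\<gamma> t i - \<gamma> t0 i\<bar> < d"
      by (intro eventually_ball_finite) auto
    then show ?thesis by (rule eventually_mono) auto
  qed
  have step: "((\<lambda>t. f (h (Suc k) t) - f (h k t)) has_real_derivative f' k (\<gamma> t0) * \<gamma>' k) (at t0)"
    if k: "k < n" for k
  proof -
    have ev: "\<forall>\<^sub>F t in at t0. \<exists>w. \<bar>f' k w - f' k (\<gamma> t0)\<bar> < e \<and>
        f (h (Suc k) t) - f (h k t) = f' k w * (\<gamma> t k - \<gamma> t0 k)" if "e > 0" for e
    proof -
      obtain d where d: "d > 0"
        "\<And>w. w \<in> topspace (Euclidean_space n) \<Longrightarrow> (\<And>i. i < n \<Longrightarrow> \<bar>w i - \<gamma> t0 i\<bar> < d) \<Longrightarrow>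
           w \<in> U \<and> \<bar>f' k w - f' k (\<gamma> t0)\<bar> < e"
        using continuous_map_Euclidean_eps[OF U v cf'[OF k] \<open>e > 0\<close>] by blast
      show ?thesis using close[OF d(1)] \<gamma>
      proof eventually_elim
        case (elim t)
        define w where "w s = (h k t)(k := s)" for s
        have wd: "w s \<in> U \<and> \<bar>f' k (w s) - f' k (\<gamma> t0)\<bar> < e"
          if "\<bar>s - \<gamma> t0 k\<bar> < d" for s
        proof (rule d(2))
          show "w s \<in> topspace (Euclidean_space n)"
            using v0 elim(2) k by (auto simp: w_def h_def topspace_Euclidean_space)
          show "\<bar>w s i - \<gamma> t0 i\<bar> < d" if "i < n" for i
            using elim(1) that \<open>\<bar>s - \<gamma> t0 k\<bar> < d\<close> d(1) by (auto simp: w_def h_def)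
        qed
        have e1: "h (Suc k) t = w (\<gamma> t k)" "h k t = w (\<gamma> t0 k)"
          by (auto simp: w_def h_def)
        have dw: "((\<lambda>s. f (w s)) has_real_derivative f' k (w s)) (at s)" if "\<bar>s - \<gamma> t0 k\<bar> < d" for s
          using f'[OF k, of "w s"] wd[OF that] by (simp add: w_def)
        have tk: "\<bar>\<gamma> t k - \<gamma> t0 k\<bar> < d" using elim(1) k by blast
        consider "\<gamma> t k = \<gamma> t0 k" | "\<gamma> t0 k < \<gamma> t k" | "\<gamma> t k < \<gamma> t0 k" by linarith
        then obtain s where "\<bar>s - \<gamma> t0 k\<bar> < d" "f (w (\<gamma> t k)) - f (w (\<gamma> t0 k)) = (\<gamma> t k - \<gamma> t0 k) * f' k (w s)"
        proof cases
          case 1 then show ?thesis using that[of "\<gamma> t0 k"] d(1) by auto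
        next
          case 2
          have "\<And>s. \<gamma> t0 k \<le> s \<Longrightarrow> s \<le> \<gamma> t k \<Longrightarrow> ((\<lambda>s. f (w s)) has_real_derivative f' k (w s)) (at s)"
            using dw tk by auto
          from MVT2[OF 2 this] show ?thesis using that tk 2 by (metis abs_of_pos diff_gt_0_iff_gt diff_strict_right_mono order_less_trans)
        next
          case 3
          have "\<And>s. \<gamma> t k \<le> s \<Longrightarrow> s \<le> \<gamma> t0 k \<Longrightarrow> ((\<lambda>s. f (w s)) has_real_derivative f' k (w s)) (at s)"
            using dw tk by auto
          from MVT2[OF 3 this] obtain z where z: "z > \<gamma> t k" "z < \<gamma> t0 k"
            "f (w (\<gamma> t0 k)) - f (w (\<gamma> t k)) = (\<gamma> t0 k - \<gamma> t k) * f' k (w z)" by auto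
          show ?thesis by (rule that[of z]) (use z tk in \<open>auto simp: algebra_simps\<close>)
        qed
        then show ?case using wd[of s] e1 by (auto simp: mult.commute)
      qed
    qed
    have lim: "((\<lambda>t. (\<gamma> t k - \<gamma> t0 k) / (t - t0)) \<longlongrightarrow> \<gamma>' k) (at t0)"
      using \<gamma>'[OF k] by (simp add: has_field_derivative_iff)
    \<comment> \<open>The difference quotient in the \<open>k\<close>-th coordinate, completed by its limit so that it also makes
      sense where that coordinate does not move.\<close>
    define r where "r t = (if \<gamma> t k = \<gamma> t0 k then f' k (\<gamma> t0) else (f (h (Suc k) t) - f (h k t)) / (\<gamma> t k - \<gamma> t0 k))" for t
    have "(r \<longlongrightarrow> f' k (\<gamma> t0)) (at t0)"
    proof (rule tendstoI)
      fix e :: real assume "e > 0"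
      from ev[OF this] show "\<forall>\<^sub>F t in at t0. dist (r t) (f' k (\<gamma> t0)) < e"
        by eventually_elim (use \<open>e > 0\<close> in \<open>auto simp: r_def dist_real_def\<close>)
    qed
    then have "((\<lambda>t. r t * ((\<gamma> t k - \<gamma> t0 k) / (t - t0))) \<longlongrightarrow> f' k (\<gamma> t0) * \<gamma>' k) (at t0)"
      by (intro tendsto_mult lim)
    moreover have "\<forall>\<^sub>F t in at t0. r t * ((\<gamma> t k - \<gamma> t0 k) / (t - t0)) = (f (h (Suc k) t) - f (h k t)) / (t - t0)"
      using ev[OF zero_less_one]
    proof eventually_elim
      case (elim t)
      then obtain w where w: "f (h (Suc k) t) - f (h k t) = f' k w * (\<gamma> t k - \<gamma> t0 k)" by blast
      show ?case
      proof (cases "\<gamma> t k = \<gamma> t0 k")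
        case True
        then show ?thesis using w by simp
      next
        case False
        then show ?thesis unfolding r_def by simp
      qed
    qed
    ultimately have "((\<lambda>t. (f (h (Suc k) t) - f (h k t)) / (t - t0)) \<longlongrightarrow> f' k (\<gamma> t0) * \<gamma>' k) (at t0)"
      by (rule Lim_transform_eventually)
    then show ?thesis by (simp add: has_field_derivative_iff ht0)
  qed
  have main: "k \<le> n \<Longrightarrow> ((\<lambda>t. f (h k t)) has_real_derivative (\<Sum>i<k. f' i (\<gamma> t0) * \<gamma>' i)) (at t0)" for k
  proof (induction k)
    case 0
    have "h 0 t = \<gamma> t0" for t by (auto simp: h_def)
    then show ?case by simp
  next
    case (Suc k)
    then show ?case using DERIV_add[OF Suc.IH step[of k]] by simp
  qed
  have "\<forall>\<^sub>F t in nhds t0. \<gamma> t \<in> topspace (Euclidean_space n)"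
    using \<gamma> v0 by (auto simp: eventually_at_filter elim: eventually_mono)
  then have "\<forall>\<^sub>F t in nhds t0. f (h n t) = f (\<gamma> t)"
  proof eventually_elim
    case (elim t)
    have "h n t = \<gamma> t" using elim v0 by (auto simp: h_def topspace_Euclidean_space)
    then show ?case by simp
  qed
  from DERIV_cong_ev[OF refl this refl] show ?thesis using main[of n] by simp
qed

lemma smooth_map_continuous:
  assumes "smooth_map m V n F"
  shows "continuous_map (subtopology (Euclidean_space m) V) (Euclidean_space n) F"
proof -
  have V: "openin (Euclidean_space m) V" and F: "F ` V \<subseteq> topspace (Euclidean_space n)"
    using assms by (auto simp: smooth_map_def)
  have "continuous_map (subtopology (Euclidean_space m) V) euclideanreal (\<lambda>v. F v i)" for i
  proof (cases "i < n")
    case True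
    then have "Ck_on 0 m V (\<lambda>v. F v i)" using assms unfolding smooth_map_def smooth_fun_def by blast
    then show ?thesis by simp
  next
    case False
    then have "\<forall>v\<in>V. F v i = 0" using F by (auto simp: topspace_Euclidean_space)
    then show ?thesis by (auto intro: continuous_map_eq[of _ _ "\<lambda>_. 0"])
  qed
  then show ?thesis using F
    unfolding Euclidean_space_def continuous_map_in_subtopology continuous_map_componentwise_UNIV
    by (auto simp: topspace_Euclidean_space)
qed

lemma smooth_map_preimage_open:
  assumes "smooth_map m V n F" "openin (Euclidean_space n) W"
  shows "openin (Euclidean_space m) {v \<in> V. F v \<in> W}"
proof -
  have V: "openin (Euclidean_space m) V" using assms by (auto simp: smooth_map_def)
  have "openin (subtopology (Euclidean_space m) V) {v \<in> topspace (subtopology (Euclidean_space m) V). F v \<in> W}"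
    using smooth_map_continuous[OF assms(1)] assms(2) unfolding continuous_map_def by blast
  moreover have "{v \<in> topspace (subtopology (Euclidean_space m) V). F v \<in> W} = {v \<in> V. F v \<in> W}"
    using openin_Euclidean_sub[OF V] by auto
  ultimately show ?thesis using openin_open_subtopology[OF V] by simp
qed

lemma Ck_on_compose:
  assumes F: "smooth_map m V n F" and U: "openin (Euclidean_space n) U" "F ` V \<subseteq> U"
  shows "Ck_on k n U f \<Longrightarrow> Ck_on k m V (f \<circ> F)"
proof (induction k arbitrary: f)
  case 0
  have "continuous_map (subtopology (Euclidean_space m) V) (subtopology (Euclidean_space n) U) F"
    using smooth_map_continuous[OF F] U(2) by (auto simp: continuous_map_in_subtopology)
  then show ?case using 0 continuous_map_compose by (auto simp del: o_apply)
next
  case (Suc k)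
  have V: "openin (Euclidean_space m) V" using F by (auto simp: smooth_map_def)
  have Fi: "Ck_on l m V (\<lambda>v. F v i)" if "i < n" for i l
    using F that by (auto simp: smooth_map_def smooth_fun_def)
  obtain f' where f': "Ck_on 0 n U f" "\<And>i v. i < n \<Longrightarrow> v \<in> U \<Longrightarrow> ((\<lambda>t. f (v(i := t))) has_real_derivative f' i v) (at (v i))"
      "\<And>i. i < n \<Longrightarrow> Ck_on k n U (f' i)" using Suc.prems unfolding Ck_on.simps(2) by auto
  have c0: "Ck_on 0 m V (f \<circ> F)" by (rule Ck_on_continuous[OF Suc.IH[OF Ck_on_SucD[OF Suc.prems]]])
  define g where "g j v = (\<Sum>i<n. (f' i \<circ> F) v * pd j (\<lambda>w. F w i) v)" for j v
  have "Ck_on k m V (g j)" if "j < m" for j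
    unfolding g_def
  proof (intro Ck_on_sum Ck_on_mult finite_lessThan)
    fix i assume "i \<in> {..<n}"
    then show "Ck_on k m V (f' i \<circ> F)" using f'(3) Suc.IH by blast
    show "Ck_on k m V (pd j (\<lambda>w. F w i))"
      using Fi[of i "Suc k"] \<open>i \<in> {..<n}\<close> Ck_on_Suc_pd[OF V, of k] \<open>j < m\<close> by blast
  qed
  moreover have "((\<lambda>t. (f \<circ> F) (v(j := t))) has_real_derivative g j v) (at (v j))" if "j < m" "v \<in> V" for j v
  proof -
    have "((\<lambda>t. f (F (v(j := t)))) has_real_derivative (\<Sum>i<n. f' i (F (v(j := v j))) * pd j (\<lambda>w. F w i) v)) (at (v j))"
    proof (rule chain_rule_curve[OF U(1), where \<gamma> = "\<lambda>t. F (v(j := t))" and f' = f'])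
      show "F (v(j := v j)) \<in> U" using U(2) that by auto
      have "\<forall>\<^sub>F t in at (v j). v(j := t) \<in> V"
        using eventually_line[OF V that(2,1)] by (auto simp: eventually_at_filter elim: eventually_mono)
      then show "\<forall>\<^sub>F t in at (v j). F (v(j := t)) \<in> topspace (Euclidean_space n)"
        by eventually_elim (use U in \<open>auto dest: openin_Euclidean_sub\<close>)
      show "((\<lambda>t. F (v(j := t)) i) has_real_derivative pd j (\<lambda>w. F w i) v) (at (v j))" if "i < n" for i
        using Fi[OF that, of "Suc 0"] Ck_on_Suc_pd[OF V, of 0 "\<lambda>w. F w i"] \<open>j < m\<close> \<open>v \<in> V\<close> by simp
    qed (use f'(2) Ck_on_continuous[OF f'(3)] in blast)+
    then show ?thesis by (simp add: g_def)
  qed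
  ultimately show ?case using c0 by (intro Ck_on_SucI[where f' = g])
qed

lemma smooth_fun_const: "openin (Euclidean_space n) U \<Longrightarrow> smooth_fun n U (\<lambda>_. c)"
  by (simp add: smooth_fun_def Ck_on_const)

lemma smooth_fun_add: "smooth_fun n U f \<Longrightarrow> smooth_fun n U g \<Longrightarrow> smooth_fun n U (\<lambda>v. f v + g v)"
  by (simp add: smooth_fun_def Ck_on_add)

lemma smooth_fun_mult: "smooth_fun n U f \<Longrightarrow> smooth_fun n U g \<Longrightarrow> smooth_fun n U (\<lambda>v. f v * g v)"
  by (simp add: smooth_fun_def Ck_on_mult)

lemma smooth_fun_minus: "smooth_fun n U f \<Longrightarrow> smooth_fun n U (\<lambda>v. - f v)"
  using smooth_fun_mult[OF smooth_fun_const[of n U "-1"], of f] by (simp add: smooth_fun_def)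

lemma smooth_fun_diff: "smooth_fun n U f \<Longrightarrow> smooth_fun n U g \<Longrightarrow> smooth_fun n U (\<lambda>v. f v - g v)"
  using smooth_fun_add[OF _ smooth_fun_minus, of n U f g] by simp

lemma smooth_fun_cong: "smooth_fun n U f \<Longrightarrow> \<forall>u\<in>U. g u = f u \<Longrightarrow> smooth_fun n U g"
  using Ck_on_cong[of n U f g] by (simp add: smooth_fun_def)

lemma smooth_fun_local:
  assumes "openin (Euclidean_space n) U"
    "\<forall>u\<in>U. \<exists>V. openin (Euclidean_space n) V \<and> u \<in> V \<and> V \<subseteq> U \<and> smooth_fun n V f"
  shows "smooth_fun n U f"
proof -
  have "Ck_on k n U f" for k
    by (rule Ck_on_local[OF assms(1)]) (use assms(2) smooth_fun_def in metis)
  then show ?thesis using assms(1) by (simp add: smooth_fun_def)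
qed

lemma smooth_fun_compose:
  "smooth_fun n U f \<Longrightarrow> smooth_map m V n F \<Longrightarrow> F ` V \<subseteq> U \<Longrightarrow> smooth_fun m V (f \<circ> F)"
  using Ck_on_compose[of m V n F U _ f] by (simp add: smooth_fun_def) (simp add: smooth_map_def)

lemma smooth_map_inclusion:
  assumes "openin (Euclidean_space n) V"
  shows "smooth_map n V n (\<lambda>v. v)"
  using assms openin_subset[OF assms] by (auto simp: smooth_map_def smooth_fun_def Ck_on_coord)

lemma smooth_map_subset:
  assumes "smooth_map m V n F" "openin (Euclidean_space m) W" "W \<subseteq> V"
  shows "smooth_map m W n F"
proof -
  have "F ` W \<subseteq> topspace (Euclidean_space n)"
    using assms(1,3) unfolding smooth_map_def by blast
  moreover have "smooth_fun m W (\<lambda>v. F v i)" if "i < n" for i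
    using assms Ck_on_subset[OF _ assms(3)] that by (simp add: smooth_map_def smooth_fun_def)
  ultimately show ?thesis using assms(2) by (simp add: smooth_map_def)
qed

lemma smooth_fun_preimage_open:
  assumes "smooth_fun n U f" "open A"
  shows "openin (Euclidean_space n) {u \<in> U. f u \<in> A}"
proof -
  have U: "openin (Euclidean_space n) U" and "Ck_on 0 n U f"
    using assms(1) unfolding smooth_fun_def by blast+
  then have "continuous_map (subtopology (Euclidean_space n) U) euclideanreal f" by simp
  then have "openin (subtopology (Euclidean_space n) U) {v \<in> topspace (subtopology (Euclidean_space n) U). f v \<in> A}"
    using assms(2) unfolding continuous_map_def by auto
  moreover have "{v \<in> topspace (subtopology (Euclidean_space n) U). f v \<in> A} = {v \<in> U. f v \<in> A}"
    using openin_Euclidean_sub[OF U] by auto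
  ultimately show ?thesis using openin_open_subtopology[OF U] by simp
qed

text \<open>An angle \<open>\<theta>\<close> with cosine \<open>a\<close> and sine \<open>b\<close> satisfies \<open>d\<theta> = a db - b da\<close>.  The right-hand side is
  smooth without any knowledge of \<open>\<theta>\<close>, so \<open>\<theta>\<close> is smooth as soon as it is continuous and has these
  partial derivatives.\<close>

lemma smooth_fun_arcsin:
  assumes a: "smooth_fun n U a" and b: "smooth_fun n U b"
    and ab: "\<And>u. u \<in> U \<Longrightarrow> a u > 0 \<and> (a u)\<^sup>2 + (b u)\<^sup>2 = 1"
  shows "smooth_fun n U (\<lambda>u. arcsin (b u))"
proof -
  have U: "openin (Euclidean_space n) U" using a by (simp add: smooth_fun_def)
  have b1: "-1 < b u \<and> b u < 1" if "u \<in> U" for u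
  proof -
    have "(a u)\<^sup>2 > 0" using ab[OF that] by simp
    then have "(b u)\<^sup>2 < 1" using ab[OF that] by linarith
    then show ?thesis using abs_square_less_1[of "b u"] by (simp add: abs_less_iff)
  qed
  have sq: "sqrt (1 - (b u)\<^sup>2) = a u" if "u \<in> U" for u
    using ab[OF that] by (intro real_sqrt_unique) auto
  have pda: "((\<lambda>t. a (v(i := t))) has_real_derivative pd i a v) (at (v i))"
    and pdb: "((\<lambda>t. b (v(i := t))) has_real_derivative pd i b v) (at (v i))" if "i < n" "v \<in> U" for i v
    using a b Ck_on_Suc_pd[OF U, of 0] that unfolding smooth_fun_def by blast+
  have Ck: "Ck_on k n U (pd i a)" "Ck_on k n U (pd i b)" if "i < n" for i k
    using a b Ck_on_Suc_pd[OF U, of k] that unfolding smooth_fun_def by blast+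
  have c0: "Ck_on 0 n U (\<lambda>u. arcsin (b u))"
  proof -
    have "Ck_on 0 n U b" using b unfolding smooth_fun_def by blast
    then have 1: "continuous_map (subtopology (Euclidean_space n) U) (top_of_set {-1..1}) b"
      using b1 by (auto simp: continuous_map_in_subtopology less_imp_le)
    have 2: "continuous_map (top_of_set {-1..1}) euclideanreal arcsin"
      unfolding continuous_map_iff_continuous by (rule continuous_on_arcsin')
    show ?thesis using continuous_map_compose[OF 1 2] by (simp add: o_def)
  qed
  have der: "((\<lambda>t. arcsin (b (v(i := t)))) has_real_derivative a v * pd i b v + (- b v) * pd i a v) (at (v i))"
    if "i < n" "v \<in> U" for i v
  proof -
    have "((\<lambda>t. (a (v(i := t)))\<^sup>2 + (b (v(i := t)))\<^sup>2) has_real_derivative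
        2 * a v * pd i a v + 2 * b v * pd i b v) (at (v i))"
      using pda[OF that] pdb[OF that] by (auto intro!: derivative_eq_intros)
    moreover have "((\<lambda>t. (a (v(i := t)))\<^sup>2 + (b (v(i := t)))\<^sup>2) has_real_derivative 0) (at (v i))"
      by (rule has_deriv_line_cong[OF U _ that(2,1), of "\<lambda>_. 1"]) (use ab in auto)
    ultimately have "2 * a v * pd i a v + 2 * b v * pd i b v = 0" by (rule DERIV_unique)
    then have z: "a v * pd i a v = - (b v * pd i b v)" by simp
    have av: "a v > 0" "(a v)\<^sup>2 + (b v)\<^sup>2 = 1" using ab[OF that(2)] by auto
    have "(a v * pd i b v + (- b v) * pd i a v) * a v = (a v)\<^sup>2 * pd i b v - b v * (a v * pd i a v)"
      by (simp add: algebra_simps power2_eq_square)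
    also have "\<dots> = ((a v)\<^sup>2 + (b v)\<^sup>2) * pd i b v" unfolding z by (simp add: algebra_simps power2_eq_square)
    finally have e: "pd i b v * inverse (a v) = a v * pd i b v + (- b v) * pd i a v"
      using av by (simp add: field_simps)
    have "((\<lambda>t. arcsin (b (v(i := t)))) has_real_derivative inverse (sqrt (1 - (b (v(i := v i)))\<^sup>2)) * pd i b v) (at (v i))"
      by (rule DERIV_chain2[OF DERIV_arcsin pdb[OF that]]) (use b1[OF that(2)] in auto)
    then show ?thesis using e sq[OF that(2)] by (simp add: mult.commute)
  qed
  have "Ck_on (Suc k) n U (\<lambda>u. arcsin (b u))" for k
  proof (rule Ck_on_SucI[OF c0 der])
    fix i assume i: "i < n"
    have "Ck_on k n U a" "Ck_on k n U b" "Ck_on k n U (\<lambda>_. - 1)"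
      using a b Ck_on_const by (auto simp: smooth_fun_def)
    from Ck_on_add[OF Ck_on_mult[OF this(1) Ck(2)[OF i]] Ck_on_mult[OF Ck_on_mult[OF this(3,2)] Ck(1)[OF i]]]
    show "Ck_on k n U (\<lambda>v. a v * pd i b v + - b v * pd i a v)" by simp
  qed
  then show ?thesis unfolding smooth_fun_def using U Ck_on_SucD[of _ n U "\<lambda>u. arcsin (b u)"] by simp
qed

section \<open>Diffeological spaces and the D-topology\<close>

lemma plot_open: "diffeological_space X \<Longrightarrow> plot X n U p \<Longrightarrow> openin (Euclidean_space n) U"
proof -
  assume *: "diffeological_space X" "plot X n U p"
  have "\<forall>n U p. plot X n U p \<longrightarrow> openin (Euclidean_space n) U \<and> p ` U \<subseteq> pts X"
    using *(1) unfolding diffeological_space_def by (elim conjE)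
  then show ?thesis using *(2) by simp
qed

lemma plot_pts:
  assumes "diffeological_space X" "plot X n U p" "u \<in> U" shows "p u \<in> pts X"
proof -
  have "\<forall>n U p. plot X n U p \<longrightarrow> openin (Euclidean_space n) U \<and> p ` U \<subseteq> pts X"
    using assms(1) unfolding diffeological_space_def by (elim conjE)
  then have "p ` U \<subseteq> pts X" using assms(2) by simp
  then show ?thesis using assms(3) by blast
qed

lemma plot_cong:
  assumes "diffeological_space X" "plot X n U p" "\<And>u. u \<in> U \<Longrightarrow> q u = p u" shows "plot X n U q"
proof -
  have "\<forall>n U p q. plot X n U p \<longrightarrow> (\<forall>u\<in>U. q u = p u) \<longrightarrow> plot X n U q"
    using assms(1) unfolding diffeological_space_def by (elim conjE)
  from this[rule_format, OF assms(2,3)] show ?thesis .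
qed

lemma plot_const:
  assumes "diffeological_space X" "openin (Euclidean_space n) U" "x \<in> pts X" shows "plot X n U (\<lambda>_. x)"
proof -
  have "\<forall>n U x. openin (Euclidean_space n) U \<longrightarrow> x \<in> pts X \<longrightarrow> plot X n U (\<lambda>_. x)"
    using assms(1) unfolding diffeological_space_def by (elim conjE)
  from this[rule_format, OF assms(2,3)] show ?thesis .
qed

lemma plot_local:
  assumes "diffeological_space X" "openin (Euclidean_space n) U"
    "\<And>u. u \<in> U \<Longrightarrow> \<exists>V. openin (Euclidean_space n) V \<and> u \<in> V \<and> V \<subseteq> U \<and> plot X n V p"
  shows "plot X n U p"
proof -
  have "\<forall>n U p. openin (Euclidean_space n) U \<longrightarrow>
        (\<forall>u\<in>U. \<exists>V. openin (Euclidean_space n) V \<and> u \<in> V \<and> V \<subseteq> U \<and> plot X n V p) \<longrightarrow> plot X n U p"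
    using assms(1) unfolding diffeological_space_def by (elim conjE)
  from this[rule_format, OF assms(2,3)] show ?thesis .
qed

lemma plot_compose:
  assumes "diffeological_space X" "plot X n U p" "smooth_map m V n F" "F ` V \<subseteq> U"
  shows "plot X m V (p \<circ> F)"
proof -
  have "\<forall>n U p m V F. plot X n U p \<longrightarrow> smooth_map m V n F \<longrightarrow> F ` V \<subseteq> U \<longrightarrow> plot X m V (p \<circ> F)"
    using assms(1) unfolding diffeological_space_def by (elim conjE)
  from this[rule_format, OF assms(2,3,4)] show ?thesis .
qed

lemma plot_subset:
  assumes "diffeological_space X" "plot X n U p" "openin (Euclidean_space n) V" "V \<subseteq> U"
  shows "plot X n V p"
  using plot_compose[OF assms(1,2) smooth_map_inclusion[OF assms(3)]] assms(4) by (simp add: o_def)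

lemma diffeological_spaceI:
  assumes "\<And>n U p. plot X n U p \<Longrightarrow> openin (Euclidean_space n) U"
    "\<And>n U p u. plot X n U p \<Longrightarrow> u \<in> U \<Longrightarrow> p u \<in> pts X"
    "\<And>n U p q. plot X n U p \<Longrightarrow> \<forall>u\<in>U. q u = p u \<Longrightarrow> plot X n U q"
    "\<And>n U x. openin (Euclidean_space n) U \<Longrightarrow> x \<in> pts X \<Longrightarrow> plot X n U (\<lambda>_. x)"
    "\<And>n U p. openin (Euclidean_space n) U \<Longrightarrow>
        \<forall>u\<in>U. \<exists>V. openin (Euclidean_space n) V \<and> u \<in> V \<and> V \<subseteq> U \<and> plot X n V p \<Longrightarrow> plot X n U p"
    "\<And>n U p m V F. plot X n U p \<Longrightarrow> smooth_map m V n F \<Longrightarrow> F ` V \<subseteq> U \<Longrightarrow> plot X m V (p \<circ> F)"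
  shows "diffeological_space X"
  unfolding diffeological_space_def
  apply (intro conjI allI impI)
  subgoal by (rule assms(1))
  subgoal using assms(2) by (simp add: image_subset_iff)
  subgoal by (rule assms(3))
  subgoal by (rule assms(4))
  subgoal by (rule assms(5))
  subgoal by (rule assms(6))
  done

lemma openin_dtop:
  "openin (dtop X) A \<longleftrightarrow> A \<subseteq> pts X \<and>
     (\<forall>n U p. plot X n U p \<longrightarrow> openin (Euclidean_space n) {u \<in> U. p u \<in> A})"
proof -
  have "istopology (\<lambda>A. A \<subseteq> pts X \<and> (\<forall>n U p. plot X n U p \<longrightarrow> openin (Euclidean_space n) {u \<in> U. p u \<in> A}))"
    unfolding istopology_def
  proof (intro conjI allI impI, goal_cases)
    case (1 S T) then show ?case by blast
  next
    case (2 S T n U p)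
    have "{u \<in> U. p u \<in> S \<inter> T} = {u \<in> U. p u \<in> S} \<inter> {u \<in> U. p u \<in> T}" by blast
    then show ?case using 2 by auto
  next
    case (3 K) then show ?case by blast
  next
    case (4 K n U p)
    have "{u \<in> U. p u \<in> \<Union>K} = (\<Union>S\<in>K. {u \<in> U. p u \<in> S})" by blast
    then show ?case using 4 by auto
  qed
  then show ?thesis unfolding dtop_def by (simp add: topology_inverse')
qed

lemma plot_preimage_open: "plot X n U p \<Longrightarrow> openin (dtop X) A \<Longrightarrow> openin (Euclidean_space n) {u \<in> U. p u \<in> A}"
  by (simp add: openin_dtop)

lemma topspace_dtop [simp]:
  assumes "diffeological_space X" shows "topspace (dtop X) = pts X"
proof -
  have "openin (dtop X) (pts X)" unfolding openin_dtop
  proof (intro conjI allI impI subset_refl)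
    fix n U p assume p: "plot X n U p"
    have "{u \<in> U. p u \<in> pts X} = U" using plot_pts[OF assms p] by auto
    then show "openin (Euclidean_space n) {u \<in> U. p u \<in> pts X}" using plot_open[OF assms p] by simp
  qed
  then show ?thesis
    by (metis openin_dtop openin_subset openin_topspace subset_antisym)
qed

lemma plot_restrict_open:
  assumes "diffeological_space X" "plot X n U p" "openin (dtop X) A"
  shows "plot X n {u \<in> U. p u \<in> A} p"
  using plot_subset[OF assms(1,2) plot_preimage_open[OF assms(2,3)]] by simp

subsection \<open>Smooth maps\<close>

lemma dsmoothI:
  assumes "\<And>x. x \<in> pts X \<Longrightarrow> f x \<in> pts Y" "\<And>n U p. plot X n U p \<Longrightarrow> plot Y n U (\<lambda>u. f (p u))"
  shows "dsmooth X Y f"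
  using assms by (auto simp: dsmooth_def o_def)

lemma dsmooth_plot: "dsmooth X Y f \<Longrightarrow> plot X n U p \<Longrightarrow> plot Y n U (\<lambda>u. f (p u))"
  unfolding dsmooth_def o_def by blast

lemma dsmooth_pts: "dsmooth X Y f \<Longrightarrow> x \<in> pts X \<Longrightarrow> f x \<in> pts Y"
  by (auto simp: dsmooth_def)

lemma dsmooth_compose: "dsmooth X Y f \<Longrightarrow> dsmooth Y Z g \<Longrightarrow> dsmooth X Z (\<lambda>x. g (f x))"
  unfolding dsmooth_def o_def image_subset_iff by simp

lemma dsmooth_cong:
  assumes "diffeological_space X" "diffeological_space Y" "dsmooth X Y f" "\<And>x. x \<in> pts X \<Longrightarrow> g x = f x"
  shows "dsmooth X Y g"
proof (rule dsmoothI)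
  fix n U p assume p: "plot X n U p"
  show "plot Y n U (\<lambda>u. g (p u))"
    by (rule plot_cong[OF assms(2) dsmooth_plot[OF assms(3) p]]) (use plot_pts[OF assms(1) p] assms(4) in auto)
qed (use assms(4) dsmooth_pts[OF assms(3)] in simp)

lemma dsmooth_continuous:
  assumes "diffeological_space X" "dsmooth X Y f" "openin (dtop Y) A"
  shows "openin (dtop X) {x \<in> pts X. f x \<in> A}"
  unfolding openin_dtop
proof (intro conjI allI impI)
  fix n U p assume p: "plot X n U p"
  have "openin (Euclidean_space n) {u \<in> U. f (p u) \<in> A}"
    by (rule plot_preimage_open[OF dsmooth_plot[OF assms(2) p] assms(3)])
  moreover have "{u \<in> U. p u \<in> {x \<in> pts X. f x \<in> A}} = {u \<in> U. f (p u) \<in> A}"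
    using plot_pts[OF assms(1) p] by auto
  ultimately show "openin (Euclidean_space n) {u \<in> U. p u \<in> {x \<in> pts X. f x \<in> A}}" by simp
qed auto

lemma dsmooth_continuous_map:
  assumes "diffeological_space X" "diffeological_space Y" "dsmooth X Y f"
  shows "continuous_map (dtop X) (dtop Y) f"
  unfolding continuous_map_def using assms dsmooth_continuous[OF assms(1,3)] dsmooth_pts[OF assms(3)] by simp

subsection \<open>Subspaces\<close>

lemma pts_sub_diff [simp]: "pts (sub_diff X A) = pts X \<inter> A"
  and plot_sub_diff [simp]: "plot (sub_diff X A) n U p \<longleftrightarrow> plot X n U p \<and> p ` U \<subseteq> A"
  by (simp_all add: sub_diff_def)

lemma sub_diff_sub_diff [simp]: "sub_diff (sub_diff X A) B = sub_diff X (A \<inter> B)"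
  by (auto simp: sub_diff_def fun_eq_iff)

lemma diffeological_sub_diff:
  assumes "diffeological_space X" shows "diffeological_space (sub_diff X A)"
proof (rule diffeological_spaceI)
  fix n U p assume "plot (sub_diff X A) n U p"
  then show "openin (Euclidean_space n) U" using plot_open[OF assms, of n U p] by simp
next
  fix n U p u assume "plot (sub_diff X A) n U p" "u \<in> U"
  then show "p u \<in> pts (sub_diff X A)" using plot_pts[OF assms] by auto
next
  fix n U p q assume "plot (sub_diff X A) n U p" "\<forall>u\<in>U. q u = p u"
  then show "plot (sub_diff X A) n U q" using plot_cong[OF assms, of n U p q] by auto
next
  fix n :: nat and U x assume "openin (Euclidean_space n) U" "x \<in> pts (sub_diff X A)"
  then show "plot (sub_diff X A) n U (\<lambda>_. x)" using plot_const[OF assms] by auto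
next
  fix n :: nat and U p assume "openin (Euclidean_space n) U"
    and *: "\<forall>u\<in>U. \<exists>V. openin (Euclidean_space n) V \<and> u \<in> V \<and> V \<subseteq> U \<and> plot (sub_diff X A) n V p"
  then have "plot X n U p" by (intro plot_local[OF assms]) auto
  moreover have "p ` U \<subseteq> A" using * by fastforce
  ultimately show "plot (sub_diff X A) n U p" by simp
next
  fix n U p m V F assume "plot (sub_diff X A) n U p" "smooth_map m V n F" "F ` V \<subseteq> U"
  then show "plot (sub_diff X A) m V (p \<circ> F)" using plot_compose[OF assms, of n U p m V F] by auto
qed

text \<open>A plot of the whole space restricts, on an open set, to a plot of the subspace.\<close>

lemma openin_dtop_sub:
  assumes "diffeological_space X" "openin (dtop X) U"
  shows "openin (dtop (sub_diff X U)) W \<longleftrightarrow> openin (dtop X) W \<and> W \<subseteq> U"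
proof
  assume L: "openin (dtop (sub_diff X U)) W"
  then have sub: "W \<subseteq> pts X \<inter> U" by (simp add: openin_dtop)
  have "openin (Euclidean_space n) {u \<in> V. p u \<in> W}" if p: "plot X n V p" for n V p
  proof -
    have "plot (sub_diff X U) n {u \<in> V. p u \<in> U} p"
      using plot_restrict_open[OF assms(1) p assms(2)] by auto
    from plot_preimage_open[OF this L]
    have "openin (Euclidean_space n) {u \<in> {u \<in> V. p u \<in> U}. p u \<in> W}" .
    moreover have "{u \<in> {u \<in> V. p u \<in> U}. p u \<in> W} = {u \<in> V. p u \<in> W}" using sub by auto
    ultimately show ?thesis by simp
  qed
  then show "openin (dtop X) W \<and> W \<subseteq> U" using sub by (auto simp: openin_dtop)
next
  assume "openin (dtop X) W \<and> W \<subseteq> U"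
  then show "openin (dtop (sub_diff X U)) W" by (auto simp: openin_dtop)
qed

lemma dsmooth_sub_mono: "dsmooth (sub_diff X A) Y f \<Longrightarrow> B \<subseteq> A \<Longrightarrow> dsmooth (sub_diff X B) Y f"
  unfolding dsmooth_def by auto

lemma dsmooth_sub: "dsmooth X Y f \<Longrightarrow> dsmooth (sub_diff X B) Y f"
  unfolding dsmooth_def by auto

lemma dsmooth_into_sub: "dsmooth X Y f \<Longrightarrow> f ` pts X \<subseteq> B \<Longrightarrow> diffeological_space X \<Longrightarrow> dsmooth X (sub_diff Y B) f"
proof (rule dsmoothI)
  assume f: "dsmooth X Y f" "f ` pts X \<subseteq> B" and X: "diffeological_space X"
  show "f x \<in> pts (sub_diff Y B)" if "x \<in> pts X" for x using f that dsmooth_pts[OF f(1)] by auto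
  show "plot (sub_diff Y B) n U (\<lambda>u. f (p u))" if "plot X n U p" for n U p
    using f dsmooth_plot[OF f(1) that] plot_pts[OF X that] by auto
qed

lemma dsmooth_from_sub: "dsmooth X (sub_diff Y B) f \<Longrightarrow> dsmooth X Y f"
  unfolding dsmooth_def by auto

lemma dsmooth_local:
  assumes X: "diffeological_space X" and Y: "diffeological_space Y"
    and loc: "\<And>x. x \<in> pts X \<Longrightarrow> \<exists>W. openin (dtop X) W \<and> x \<in> W \<and> dsmooth (sub_diff X W) Y f"
  shows "dsmooth X Y f"
proof (rule dsmoothI)
  fix x assume x: "x \<in> pts X"
  then obtain W where "x \<in> W" "dsmooth (sub_diff X W) Y f" using loc by blast
  then show "f x \<in> pts Y" using dsmooth_pts[of "sub_diff X W" Y f x] x by simp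
next
  fix n U p assume p: "plot X n U p"
  show "plot Y n U (\<lambda>u. f (p u))"
  proof (rule plot_local[OF Y plot_open[OF X p]])
    fix u assume u: "u \<in> U"
    obtain W where W: "openin (dtop X) W" "p u \<in> W" "dsmooth (sub_diff X W) Y f"
      using loc plot_pts[OF X p u] by blast
    have "plot (sub_diff X W) n {u \<in> U. p u \<in> W} p" using plot_restrict_open[OF X p W(1)] by auto
    from dsmooth_plot[OF W(3) this]
    show "\<exists>V. openin (Euclidean_space n) V \<and> u \<in> V \<and> V \<subseteq> U \<and> plot Y n V (\<lambda>u. f (p u))"
      using plot_preimage_open[OF p W(1)] u W(2) by (intro exI[of _ "{u \<in> U. p u \<in> W}"]) auto
  qed
qed

subsection \<open>Products and powers\<close>

lemma pts_prod_diff [simp]: "pts (prod_diff X Y) = pts X \<times> pts Y"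
  and plot_prod_diff [simp]: "plot (prod_diff X Y) n U p \<longleftrightarrow> plot X n U (\<lambda>u. fst (p u)) \<and> plot Y n U (\<lambda>u. snd (p u))"
  by (simp_all add: prod_diff_def o_def)

lemma diffeological_prod_diff:
  assumes X: "diffeological_space X" and Y: "diffeological_space Y"
  shows "diffeological_space (prod_diff X Y)"
proof (rule diffeological_spaceI)
  fix n U p assume "plot (prod_diff X Y) n U p"
  then show "openin (Euclidean_space n) U" using plot_open[OF X, of n U "\<lambda>u. fst (p u)"] by simp
next
  fix n U p u assume "plot (prod_diff X Y) n U p" "u \<in> U"
  then show "p u \<in> pts (prod_diff X Y)" using plot_pts[OF X, of n U "\<lambda>u. fst (p u)"] plot_pts[OF Y, of n U "\<lambda>u. snd (p u)"]
    by (auto simp: mem_Times_iff)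
next
  fix n U p q assume "plot (prod_diff X Y) n U p" "\<forall>u\<in>U. q u = p u"
  then show "plot (prod_diff X Y) n U q"
    using plot_cong[OF X, of n U "\<lambda>u. fst (p u)" "\<lambda>u. fst (q u)"] plot_cong[OF Y, of n U "\<lambda>u. snd (p u)" "\<lambda>u. snd (q u)"] by auto
next
  fix n :: nat and U x assume "openin (Euclidean_space n) U" "x \<in> pts (prod_diff X Y)"
  then show "plot (prod_diff X Y) n U (\<lambda>_. x)" using plot_const[OF X] plot_const[OF Y] by auto
next
  fix n :: nat and U p assume U: "openin (Euclidean_space n) U"
    and *: "\<forall>u\<in>U. \<exists>V. openin (Euclidean_space n) V \<and> u \<in> V \<and> V \<subseteq> U \<and> plot (prod_diff X Y) n V p"
  have "plot X n U (\<lambda>u. fst (p u))" by (rule plot_local[OF X U]) (use * in auto)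
  moreover have "plot Y n U (\<lambda>u. snd (p u))" by (rule plot_local[OF Y U]) (use * in auto)
  ultimately show "plot (prod_diff X Y) n U p" by simp
next
  fix n U p m V F assume "plot (prod_diff X Y) n U p" "smooth_map m V n F" "F ` V \<subseteq> U"
  then show "plot (prod_diff X Y) m V (p \<circ> F)"
    using plot_compose[OF X, of n U "\<lambda>u. fst (p u)" m V F] plot_compose[OF Y, of n U "\<lambda>u. snd (p u)" m V F]
    by (simp add: o_def)
qed

lemma pts_power_diff [simp]: "pts (power_diff I X) = (\<Pi>\<^sub>E i\<in>I. pts X)"
  and plot_power_diff: "plot (power_diff I X) n U p \<longleftrightarrow> openin (Euclidean_space n) U \<and>
     p ` U \<subseteq> (\<Pi>\<^sub>E i\<in>I. pts X) \<and> (\<forall>i\<in>I. plot X n U (\<lambda>u. p u i))"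
  by (simp_all add: power_diff_def)

lemma diffeological_power_diff:
  assumes X: "diffeological_space X" shows "diffeological_space (power_diff I X)"
proof (rule diffeological_spaceI)
  fix n U p assume "plot (power_diff I X) n U p"
  then show "openin (Euclidean_space n) U" by (simp add: plot_power_diff)
next
  fix n U p u assume "plot (power_diff I X) n U p" "u \<in> U"
  then show "p u \<in> pts (power_diff I X)" by (auto simp: plot_power_diff)
next
  fix n U p q assume p: "plot (power_diff I X) n U p" and q: "\<forall>u\<in>U. q u = p u"
  have "plot X n U (\<lambda>u. q u i)" if "i \<in> I" for i
    by (rule plot_cong[OF X, of n U "\<lambda>u. p u i"]) (use p q that in \<open>auto simp: plot_power_diff\<close>)
  moreover have "q ` U \<subseteq> (\<Pi>\<^sub>E i\<in>I. pts X)" using p q by (auto simp: plot_power_diff)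
  ultimately show "plot (power_diff I X) n U q" using p by (simp add: plot_power_diff)
next
  fix n :: nat and U x assume "openin (Euclidean_space n) U" "x \<in> pts (power_diff I X)"
  then have "x i \<in> pts X" if "i \<in> I" for i using that by auto
  then show "plot (power_diff I X) n U (\<lambda>_. x)" using plot_const[OF X] \<open>openin (Euclidean_space n) U\<close> \<open>x \<in> _\<close>
    by (simp add: plot_power_diff image_subset_iff)
next
  fix n :: nat and U p assume U: "openin (Euclidean_space n) U"
    and *: "\<forall>u\<in>U. \<exists>V. openin (Euclidean_space n) V \<and> u \<in> V \<and> V \<subseteq> U \<and> plot (power_diff I X) n V p"
  have "plot X n U (\<lambda>u. p u i)" if "i \<in> I" for i
  proof (rule plot_local[OF X U])
    fix u assume "u \<in> U"
    then obtain V where "openin (Euclidean_space n) V" "u \<in> V" "V \<subseteq> U" "plot (power_diff I X) n V p"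
      using * by blast
    then show "\<exists>V. openin (Euclidean_space n) V \<and> u \<in> V \<and> V \<subseteq> U \<and> plot X n V (\<lambda>u. p u i)"
      using that by (intro exI[of _ V]) (simp add: plot_power_diff)
  qed
  moreover have "p u \<in> (\<Pi>\<^sub>E i\<in>I. pts X)" if "u \<in> U" for u
    using *[rule_format, OF that] unfolding plot_power_diff by blast
  ultimately show "plot (power_diff I X) n U p" using U by (auto simp: plot_power_diff)
next
  fix n U p m V F assume p: "plot (power_diff I X) n U p" and F: "smooth_map m V n F" "F ` V \<subseteq> U"
  have "plot X m V (\<lambda>u. (p \<circ> F) u i)" if "i \<in> I" for i
    using plot_compose[OF X, of n U "\<lambda>u. p u i" m V F] p that F by (simp add: plot_power_diff o_def)
  moreover have "openin (Euclidean_space m) V" using F by (simp add: smooth_map_def)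
  moreover have "(p \<circ> F) ` V \<subseteq> (\<Pi>\<^sub>E i\<in>I. pts X)"
    using p F(2) unfolding plot_power_diff image_comp[symmetric] by blast
  ultimately show "plot (power_diff I X) m V (p \<circ> F)" by (simp add: plot_power_diff)
qed

subsection \<open>Final diffeologies and quotients\<close>

lemma pts_final_diff [simp]: "pts (final_diff S J A f) = S"
  by (simp add: final_diff_def)

lemma plot_final_diff:
  "plot (final_diff S J A f) n U p \<longleftrightarrow> openin (Euclidean_space n) U \<and> p ` U \<subseteq> S \<and>
       (\<forall>u\<in>U. \<exists>V. openin (Euclidean_space n) V \<and> u \<in> V \<and> V \<subseteq> U \<and>
          ((\<exists>y. \<forall>v\<in>V. p v = y) \<or>
           (\<exists>j\<in>J. \<exists>q. plot (A j) n V q \<and> (\<forall>v\<in>V. p v = f j (q v)))))"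
  by (simp add: final_diff_def)

lemma diffeological_final_diff:
  assumes A: "\<And>j. j \<in> J \<Longrightarrow> diffeological_space (A j)"
  shows "diffeological_space (final_diff S J A f)"
proof (rule diffeological_spaceI)
  fix n U p assume "plot (final_diff S J A f) n U p"
  then show "openin (Euclidean_space n) U" by (simp add: plot_final_diff)
next
  fix n U p u assume "plot (final_diff S J A f) n U p" "u \<in> U"
  then show "p u \<in> pts (final_diff S J A f)" by (auto simp: plot_final_diff)
next
  fix n U p q assume p: "plot (final_diff S J A f) n U p" and q: "\<forall>u\<in>U. q u = p u"
  show "plot (final_diff S J A f) n U q" unfolding plot_final_diff
  proof (intro conjI ballI)
    show "openin (Euclidean_space n) U" "q ` U \<subseteq> S" using p q by (auto simp: plot_final_diff)
    fix u assume "u \<in> U"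
    then obtain V where V: "openin (Euclidean_space n) V" "u \<in> V" "V \<subseteq> U"
      "(\<exists>y. \<forall>v\<in>V. p v = y) \<or> (\<exists>j\<in>J. \<exists>q. plot (A j) n V q \<and> (\<forall>v\<in>V. p v = f j (q v)))"
      using p unfolding plot_final_diff by blast
    moreover have "\<forall>v\<in>V. q v = p v" using q V(3) by blast
    ultimately show "\<exists>V. openin (Euclidean_space n) V \<and> u \<in> V \<and> V \<subseteq> U \<and>
          ((\<exists>y. \<forall>v\<in>V. q v = y) \<or> (\<exists>j\<in>J. \<exists>r. plot (A j) n V r \<and> (\<forall>v\<in>V. q v = f j (r v))))"
      by (intro exI[of _ V]) simp
  qed
next
  fix n :: nat and U x assume "openin (Euclidean_space n) U" "x \<in> pts (final_diff S J A f)"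
  then show "plot (final_diff S J A f) n U (\<lambda>_. x)" by (auto simp: plot_final_diff)
next
  fix n :: nat and U p assume U: "openin (Euclidean_space n) U"
    and *: "\<forall>u\<in>U. \<exists>V. openin (Euclidean_space n) V \<and> u \<in> V \<and> V \<subseteq> U \<and> plot (final_diff S J A f) n V p"
  show "plot (final_diff S J A f) n U p" unfolding plot_final_diff
  proof (intro conjI ballI U)
    show "p ` U \<subseteq> S" using * unfolding plot_final_diff by blast
    fix u assume "u \<in> U"
    then obtain W where W: "u \<in> W" "W \<subseteq> U" "plot (final_diff S J A f) n W p" using * by blast
    from W(3,1) obtain V where "openin (Euclidean_space n) V" "u \<in> V" "V \<subseteq> W"
      "(\<exists>y. \<forall>v\<in>V. p v = y) \<or> (\<exists>j\<in>J. \<exists>q. plot (A j) n V q \<and> (\<forall>v\<in>V. p v = f j (q v)))"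
      unfolding plot_final_diff by blast
    then show "\<exists>V. openin (Euclidean_space n) V \<and> u \<in> V \<and> V \<subseteq> U \<and>
          ((\<exists>y. \<forall>v\<in>V. p v = y) \<or> (\<exists>j\<in>J. \<exists>r. plot (A j) n V r \<and> (\<forall>v\<in>V. p v = f j (r v))))"
      using W(2) by (intro exI[of _ V]) auto
  qed
next
  fix n U p m V F assume p: "plot (final_diff S J A f) n U p" and F: "smooth_map m V n F" "F ` V \<subseteq> U"
  show "plot (final_diff S J A f) m V (p \<circ> F)" unfolding plot_final_diff
  proof (intro conjI ballI)
    show "openin (Euclidean_space m) V" using F by (simp add: smooth_map_def)
    show "(p \<circ> F) ` V \<subseteq> S" using p F(2) unfolding plot_final_diff by auto
    fix v assume v: "v \<in> V"
    then have "F v \<in> U" using F(2) by blast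
    then obtain W where W: "openin (Euclidean_space n) W" "F v \<in> W" "W \<subseteq> U"
      "(\<exists>y. \<forall>v\<in>W. p v = y) \<or> (\<exists>j\<in>J. \<exists>q. plot (A j) n W q \<and> (\<forall>v\<in>W. p v = f j (q v)))"
      using p unfolding plot_final_diff by blast
    define V' where "V' = {v \<in> V. F v \<in> W}"
    have V': "openin (Euclidean_space m) V'" "v \<in> V'" "V' \<subseteq> V" "F ` V' \<subseteq> W"
      using smooth_map_preimage_open[OF F(1) W(1)] v W(2) by (auto simp: V'_def)
    have F': "smooth_map m V' n F" by (rule smooth_map_subset[OF F(1) V'(1,3)])
    have "(\<exists>y. \<forall>v\<in>V'. (p \<circ> F) v = y) \<or> (\<exists>j\<in>J. \<exists>r. plot (A j) m V' r \<and> (\<forall>v\<in>V'. (p \<circ> F) v = f j (r v)))"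
      using W(4)
    proof (elim disjE exE bexE conjE)
      fix y assume "\<forall>v\<in>W. p v = y"
      then show ?thesis using V'(4) by auto
    next
      fix j q assume j: "j \<in> J" "plot (A j) n W q" "\<forall>v\<in>W. p v = f j (q v)"
      then show ?thesis using plot_compose[OF A[OF j(1)] j(2) F' V'(4)] V'(4)
        by (intro disjI2 bexI[of _ j] exI[of _ "q \<circ> F"]) auto
    qed
    then show "\<exists>V'. openin (Euclidean_space m) V' \<and> v \<in> V' \<and> V' \<subseteq> V \<and>
       ((\<exists>y. \<forall>v\<in>V'. (p \<circ> F) v = y) \<or> (\<exists>j\<in>J. \<exists>r. plot (A j) m V' r \<and> (\<forall>v\<in>V'. (p \<circ> F) v = f j (r v))))"
      using V' by (intro exI[of _ V']) simp
  qed
qed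

lemma pts_quotient_diff [simp]: "pts (quotient_diff X q) = q ` pts X"
  by (simp add: quotient_diff_def)

lemma diffeological_quotient_diff: "diffeological_space X \<Longrightarrow> diffeological_space (quotient_diff X q)"
  unfolding quotient_diff_def by (rule diffeological_final_diff)

text \<open>A constant plot lifts along a quotient map, so every plot of the quotient lifts locally.\<close>

lemma plot_quotient_diff:
  assumes X: "diffeological_space X"
  shows "plot (quotient_diff X q) n U p \<longleftrightarrow> openin (Euclidean_space n) U \<and>
     (\<forall>u\<in>U. \<exists>V r. openin (Euclidean_space n) V \<and> u \<in> V \<and> V \<subseteq> U \<and> plot X n V r \<and> (\<forall>v\<in>V. p v = q (r v)))"
  (is "?L \<longleftrightarrow> _ \<and> ?R")
proof (intro iffI conjI ballI)
  assume p: ?L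
  then show "openin (Euclidean_space n) U" by (simp add: quotient_diff_def plot_final_diff)
  fix u assume u: "u \<in> U"
  then obtain V where V: "openin (Euclidean_space n) V" "u \<in> V" "V \<subseteq> U"
      "(\<exists>y. \<forall>v\<in>V. p v = y) \<or> (\<exists>r. plot X n V r \<and> (\<forall>v\<in>V. p v = q (r v)))"
    using p unfolding quotient_diff_def plot_final_diff by blast
  have "\<exists>r. plot X n V r \<and> (\<forall>v\<in>V. p v = q (r v))"
  proof (cases "\<exists>y. \<forall>v\<in>V. p v = y")
    case True
    have "p u \<in> q ` pts X" using p u by (auto simp: quotient_diff_def plot_final_diff)
    then obtain x where x: "x \<in> pts X" "p u = q x" by (elim imageE)
    have "\<forall>v\<in>V. p v = q x" using True V(2) x(2) by metis
    then show ?thesis using plot_const[OF X V(1) x(1)] by (intro exI[of _ "\<lambda>_. x"] conjI)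
  next
    case False
    from V(4) show ?thesis
    proof (rule disjE)
      assume "\<exists>y. \<forall>v\<in>V. p v = y"
      with False show ?thesis by (rule notE)
    qed
  qed
  then obtain r where r: "plot X n V r" "\<forall>v\<in>V. p v = q (r v)" by (elim exE conjE)
  show "\<exists>V r. openin (Euclidean_space n) V \<and> u \<in> V \<and> V \<subseteq> U \<and> plot X n V r \<and> (\<forall>v\<in>V. p v = q (r v))"
    using V(1-3) r by (intro exI[of _ V] exI[of _ r] conjI)
next
  assume R: "openin (Euclidean_space n) U \<and> ?R"
  have S: "p u \<in> q ` pts X" if "u \<in> U" for u
  proof -
    from bspec[OF conjunct2[OF R] that] obtain V r where "u \<in> V" "plot X n V r" "\<forall>v\<in>V. p v = q (r v)"
      by (elim exE conjE)
    then show ?thesis using plot_pts[OF X, of n V r u] by simp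
  qed
  show ?L unfolding quotient_diff_def plot_final_diff
  proof (intro conjI ballI)
    show "openin (Euclidean_space n) U" "p ` U \<subseteq> q ` pts X" using R S by auto
    fix u assume "u \<in> U"
    from bspec[OF conjunct2[OF R] this]
    obtain V r where "openin (Euclidean_space n) V" "u \<in> V" "V \<subseteq> U" "plot X n V r" "\<forall>v\<in>V. p v = q (r v)"
      by (elim exE conjE)
    then show "\<exists>V. openin (Euclidean_space n) V \<and> u \<in> V \<and> V \<subseteq> U \<and>
       ((\<exists>y. \<forall>v\<in>V. p v = y) \<or> (\<exists>j\<in>{()}. \<exists>qa. plot X n V qa \<and> (\<forall>v\<in>V. p v = q (qa v))))"
      by (intro exI[of _ V] conjI disjI2 bexI[of _ "()"] exI[of _ r]) simp_all
  qed
qed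

lemma dsmooth_quotient_map: "diffeological_space X \<Longrightarrow> dsmooth X (quotient_diff X q) q"
proof (rule dsmoothI)
  assume X: "diffeological_space X"
  show "q x \<in> pts (quotient_diff X q)" if "x \<in> pts X" for x using that by simp
  show "plot (quotient_diff X q) n U (\<lambda>u. q (p u))" if p: "plot X n U p" for n U p
    unfolding plot_quotient_diff[OF X]
    using plot_open[OF X p] p by (intro conjI ballI exI[of _ U] exI[of _ p]) auto
qed

section \<open>Real, integer and circle valued smooth functions\<close>

lemma pts_real_diff [simp]: "pts real_diff = UNIV"
  and plot_real_diff [simp]: "plot real_diff = smooth_fun"
  by (simp_all add: real_diff_def)

lemma diffeological_real_diff: "diffeological_space real_diff"
proof (rule diffeological_spaceI)
  show "openin (Euclidean_space n) U" if "plot real_diff n U p" for n U p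
    using that by (simp add: smooth_fun_def)
  show "plot real_diff n U q" if "plot real_diff n U p" "\<forall>u\<in>U. q u = p u" for n U p q
    using smooth_fun_cong[of n U p q] that by simp
  show "plot real_diff n U (\<lambda>_. x)" if "openin (Euclidean_space n) U" for n U x
    using smooth_fun_const[OF that] by simp
  show "plot real_diff n U p" if "openin (Euclidean_space n) U"
    "\<forall>u\<in>U. \<exists>V. openin (Euclidean_space n) V \<and> u \<in> V \<and> V \<subseteq> U \<and> plot real_diff n V p" for n U p
    using smooth_fun_local[OF that(1), of p] that(2) by simp
  show "plot real_diff m V (p \<circ> F)" if "plot real_diff n U p" "smooth_map m V n F" "F ` V \<subseteq> U" for n U p m V F
    using smooth_fun_compose[of n U p m V F] that by simp
qed simp

lemma pts_complex_diff [simp]: "pts complex_diff = UNIV"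
  and plot_complex_diff [simp]: "plot complex_diff n U p \<longleftrightarrow> smooth_fun n U (\<lambda>u. Re (p u)) \<and> smooth_fun n U (\<lambda>u. Im (p u))"
  by (simp_all add: complex_diff_def)

lemma diffeological_complex_diff: "diffeological_space complex_diff"
proof (rule diffeological_spaceI)
  show "openin (Euclidean_space n) U" if "plot complex_diff n U p" for n U p
    using that by (simp add: smooth_fun_def)
  show "plot complex_diff n U q" if "plot complex_diff n U p" "\<forall>u\<in>U. q u = p u" for n U p q
    using smooth_fun_cong[of n U "\<lambda>u. Re (p u)" "\<lambda>u. Re (q u)"]
      smooth_fun_cong[of n U "\<lambda>u. Im (p u)" "\<lambda>u. Im (q u)"] that by simp
  show "plot complex_diff n U (\<lambda>_. x)" if "openin (Euclidean_space n) U" for n U x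
    using smooth_fun_const[OF that] by simp
  show "plot complex_diff n U p" if U: "openin (Euclidean_space n) U" and
    *: "\<forall>u\<in>U. \<exists>V. openin (Euclidean_space n) V \<and> u \<in> V \<and> V \<subseteq> U \<and> plot complex_diff n V p" for n U p
  proof -
    have "smooth_fun n U (\<lambda>u. Re (p u))" by (rule smooth_fun_local[OF U]) (use * in auto)
    moreover have "smooth_fun n U (\<lambda>u. Im (p u))" by (rule smooth_fun_local[OF U]) (use * in auto)
    ultimately show ?thesis by simp
  qed
  show "plot complex_diff m V (p \<circ> F)" if "plot complex_diff n U p" "smooth_map m V n F" "F ` V \<subseteq> U" for n U p m V F
    using smooth_fun_compose[of n U "\<lambda>u. Re (p u)" m V F] smooth_fun_compose[of n U "\<lambda>u. Im (p u)" m V F] that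
    by (simp add: o_def)
qed simp

lemma dsmooth_real_add:
  "dsmooth X real_diff f \<Longrightarrow> dsmooth X real_diff g \<Longrightarrow> dsmooth X real_diff (\<lambda>x. f x + g x)"
  by (simp add: dsmooth_def o_def smooth_fun_add)

lemma dsmooth_real_minus: "dsmooth X real_diff f \<Longrightarrow> dsmooth X real_diff (\<lambda>x. - f x)"
  by (simp add: dsmooth_def o_def smooth_fun_minus)

lemma dsmooth_real_const: "diffeological_space X \<Longrightarrow> dsmooth X real_diff (\<lambda>_. c)"
  by (rule dsmoothI) (simp_all add: smooth_fun_const[OF plot_open[of X]])

lemma pts_discrete_diff [simp]: "pts (discrete_diff S) = S"
  by (simp add: discrete_diff_def)

text \<open>A continuous real function with integer values is locally constant, so smooth functions into
  the discrete space of integers are the same as integer-valued smooth real functions.\<close>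

lemma dsmooth_int_iff:
  assumes X: "diffeological_space X"
  shows "dsmooth X (discrete_diff UNIV) f \<longleftrightarrow> dsmooth X real_diff (\<lambda>x. real_of_int (f x))"
proof
  assume f: "dsmooth X (discrete_diff UNIV) f"
  show "dsmooth X real_diff (\<lambda>x. real_of_int (f x))"
  proof (rule dsmoothI)
    fix n U p assume p: "plot X n U p"
    from dsmooth_plot[OF f p] have U: "openin (Euclidean_space n) U"
      and *: "\<And>u. u \<in> U \<Longrightarrow> \<exists>V. openin (Euclidean_space n) V \<and> u \<in> V \<and> V \<subseteq> U \<and> (\<forall>v\<in>V. f (p v) = f (p u))"
      by (simp_all add: discrete_diff_def)
    have "smooth_fun n U (\<lambda>u. real_of_int (f (p u)))"
    proof (rule smooth_fun_local[OF U], intro ballI)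
      fix u assume "u \<in> U"
      then obtain V where V: "openin (Euclidean_space n) V" "u \<in> V" "V \<subseteq> U" "\<forall>v\<in>V. f (p v) = f (p u)"
        using * by blast
      have "smooth_fun n V (\<lambda>u. real_of_int (f (p u)))"
        by (rule smooth_fun_cong[OF smooth_fun_const[OF V(1), of "real_of_int (f (p u))"]]) (use V(4) in simp)
      then show "\<exists>V. openin (Euclidean_space n) V \<and> u \<in> V \<and> V \<subseteq> U \<and> smooth_fun n V (\<lambda>u. real_of_int (f (p u)))"
        using V by blast
    qed
    then show "plot real_diff n U (\<lambda>u. real_of_int (f (p u)))" by simp
  qed simp
next
  assume f: "dsmooth X real_diff (\<lambda>x. real_of_int (f x))"
  show "dsmooth X (discrete_diff UNIV) f"
  proof (rule dsmoothI)
    fix n U p assume p: "plot X n U p"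
    have sm: "smooth_fun n U (\<lambda>u. real_of_int (f (p u)))" using dsmooth_plot[OF f p] by simp
    have "\<exists>V. openin (Euclidean_space n) V \<and> u \<in> V \<and> V \<subseteq> U \<and> (\<forall>v\<in>V. f (p v) = f (p u))" if "u \<in> U" for u
    proof (intro exI conjI)
      let ?V = "{v \<in> U. real_of_int (f (p v)) \<in> ball (real_of_int (f (p u))) 1}"
      show "openin (Euclidean_space n) ?V" by (rule smooth_fun_preimage_open[OF sm]) simp
      show "u \<in> ?V" "?V \<subseteq> U" using that by auto
      show "\<forall>v\<in>?V. f (p v) = f (p u)" by (auto simp: dist_real_def)
    qed
    then show "plot (discrete_diff UNIV) n U (\<lambda>u. f (p u))"
      using plot_open[OF X p] by (simp add: discrete_diff_def)
  qed simp
qed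

lemma circle_simps [simp]:
  "carrier circle = {z. cmod z = 1}" "x \<otimes>\<^bsub>circle\<^esub> y = x * y" "\<one>\<^bsub>circle\<^esub> = 1"
  "dspace circle = sub_diff complex_diff {z. cmod z = 1}"
  by (simp_all add: circle_def)

lemma comm_group_circle: "comm_group circle"
proof (rule comm_groupI)
  show "\<exists>y\<in>carrier circle. y \<otimes>\<^bsub>circle\<^esub> x = \<one>\<^bsub>circle\<^esub>" if "x \<in> carrier circle" for x
    using that by (intro bexI[of _ "inverse x"]) (auto simp: norm_inverse intro!: left_inverse)
qed (auto simp: norm_mult)

lemma group_circle: "group circle"
  using comm_group_circle by (simp add: comm_group_def)

lemma inv_circle [simp]: "cmod z = 1 \<Longrightarrow> inv\<^bsub>circle\<^esub> z = inverse z"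
  by (rule group.inv_equality[OF group_circle]) (auto simp: norm_inverse intro!: left_inverse)

lemma inverse_circle: "cmod z = 1 \<Longrightarrow> inverse z = cnj z"
  using complex_norm_square[of z] by (intro inverse_unique) simp

lemma diffeological_group_circle: "diffeological_group circle"
  unfolding diffeological_group_def
proof (intro conjI)
  show "group circle" by (rule group_circle)
  show dg: "diffeological_space (dspace circle)"
    by (simp add: diffeological_sub_diff diffeological_complex_diff)
  show "pts (dspace circle) = carrier circle" by simp
  show "dsmooth (prod_diff (dspace circle) (dspace circle)) (dspace circle) (\<lambda>(g, h). g \<otimes>\<^bsub>circle\<^esub> h)"
    by (rule dsmoothI) (auto simp: norm_mult split_beta image_subset_iff intro!: smooth_fun_diff smooth_fun_add smooth_fun_mult)
  have "dsmooth (dspace circle) (dspace circle) cnj"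
    by (rule dsmoothI) (auto intro!: smooth_fun_minus)
  then show "dsmooth (dspace circle) (dspace circle) (\<lambda>g. inv\<^bsub>circle\<^esub> g)"
    by (rule dsmooth_cong[OF dg dg]) (simp add: inverse_circle)
qed

text \<open>Near \<open>z0\<close> the angle relative to \<open>z0\<close> is the arcsine
  of the imaginary part of \<open>z / z0\<close>.\<close>

lemma circle_local_log:
  assumes z0: "cmod z0 = 1"
  obtains A l where "openin (dtop (dspace circle)) A" "z0 \<in> A"
    "dsmooth (sub_diff (dspace circle) A) real_diff l" "\<And>z. z \<in> A \<Longrightarrow> cis (2 * pi * l z) = z"
proof -
  define A where "A = {z. cmod z = 1 \<and> Re (z * cnj z0) > 0}"
  define l where "l z = (Arg z0 + arcsin (Im (z * cnj z0))) * inverse (2 * pi)" for z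
  have sm: "smooth_fun n U (\<lambda>u. Re (p u * cnj z0))" "smooth_fun n U (\<lambda>u. Im (p u * cnj z0))"
    if "plot complex_diff n U p" for n U p
  proof -
    have U: "openin (Euclidean_space n) U" using that by (simp add: smooth_fun_def)
    show "smooth_fun n U (\<lambda>u. Re (p u * cnj z0))" "smooth_fun n U (\<lambda>u. Im (p u * cnj z0))"
      using that by (auto intro!: smooth_fun_add smooth_fun_diff smooth_fun_mult smooth_fun_minus smooth_fun_const[OF U])
  qed
  have n1: "(Re (z * cnj z0))\<^sup>2 + (Im (z * cnj z0))\<^sup>2 = 1" if "cmod z = 1" for z
    using z0 that by (simp add: cmod_power2[symmetric] norm_mult del: times_complex.sel)
  have "openin (dtop (dspace circle)) A" unfolding openin_dtop
  proof (intro conjI allI impI)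
    fix n U p assume p: "plot (dspace circle) n U p"
    then have "openin (Euclidean_space n) {u \<in> U. Re (p u * cnj z0) \<in> {0<..}}"
      using sm(1)[of n U p] by (intro smooth_fun_preimage_open) auto
    moreover have "{u \<in> U. Re (p u * cnj z0) \<in> {0<..}} = {u \<in> U. p u \<in> A}"
      using p by (auto simp: A_def)
    ultimately show "openin (Euclidean_space n) {u \<in> U. p u \<in> A}" by simp
  qed (auto simp: A_def)
  moreover have "z0 \<in> A"
  proof -
    have "z0 * cnj z0 = 1" using z0 complex_norm_square[of z0] by simp
    then show ?thesis using z0 by (simp add: A_def del: times_complex.sel)
  qed
  moreover have "dsmooth (sub_diff (dspace circle) A) real_diff l"
  proof (rule dsmoothI)
    fix n U p assume p: "plot (sub_diff (dspace circle) A) n U p"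
    then have U: "openin (Euclidean_space n) U" by (simp add: smooth_fun_def)
    have "smooth_fun n U (\<lambda>u. arcsin (Im (p u * cnj z0)))"
    proof (rule smooth_fun_arcsin)
      show "smooth_fun n U (\<lambda>u. Re (p u * cnj z0))" using sm p by simp
      show "smooth_fun n U (\<lambda>u. Im (p u * cnj z0))" using sm p by simp
      show "Re (p u * cnj z0) > 0 \<and> (Re (p u * cnj z0))\<^sup>2 + (Im (p u * cnj z0))\<^sup>2 = 1" if "u \<in> U" for u
      proof -
        have "p u \<in> A" using p that by auto
        then show ?thesis using n1[of "p u"] unfolding A_def by blast
      qed
    qed
    then have "smooth_fun n U (\<lambda>u. (Arg z0 + arcsin (Im (p u * cnj z0))) * inverse (2 * pi))"
      by (intro smooth_fun_mult smooth_fun_add smooth_fun_const[OF U])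
    then show "plot real_diff n U (\<lambda>u. l (p u))" by (simp add: l_def)
  qed simp
  moreover have "cis (2 * pi * l z) = z" if "z \<in> A" for z
  proof -
    define w where "w = z * cnj z0"
    have w: "Re w > 0" "(Re w)\<^sup>2 + (Im w)\<^sup>2 = 1" "cmod z = 1" using n1[of z] that unfolding A_def w_def by auto
    have "(Im w)\<^sup>2 \<le> 1" using w(2) by (smt (verit) zero_le_power2)
    then have i: "-1 \<le> Im w" "Im w \<le> 1" using abs_square_le_1[of "Im w"] by (auto simp: abs_le_iff)
    have "sqrt (1 - (Im w)\<^sup>2) = Re w" using w by (intro real_sqrt_unique) auto
    then have c: "cis (arcsin (Im w)) = w"
      using i by (simp add: complex_eq_iff cos_arcsin)
    have "z0 \<noteq> 0" using z0 by auto
    then have a: "cis (Arg z0) = z0" using cis_Arg[of z0] z0 by (simp add: sgn_eq)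
    have "2 * pi * l z = Arg z0 + arcsin (Im w)" by (simp add: l_def w_def)
    then have "cis (2 * pi * l z) = z0 * w" using a c by (simp add: cis_mult[symmetric])
    also have "\<dots> = z * (z0 * cnj z0)" by (simp add: w_def)
    also have "\<dots> = z" using z0 complex_norm_square[of z0] by simp
    finally show ?thesis .
  qed
  ultimately show thesis by (rule that)
qed

section \<open>Principal bundles\<close>

lemma openin_dtop_subset: "openin (dtop X) A \<Longrightarrow> A \<subseteq> pts X"
  unfolding openin_dtop by (rule conjunct1)

lemma diffeological_groupD:
  assumes "diffeological_group G"
  shows "group G" "diffeological_space (dspace G)" "pts (dspace G) = carrier G"
  using assms by (simp_all add: diffeological_group_def)

lemma gplot_mult:
  assumes "diffeological_group G" "plot (dspace G) n U g" "plot (dspace G) n U h"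
  shows "plot (dspace G) n U (\<lambda>u. g u \<otimes>\<^bsub>G\<^esub> h u)"
proof -
  have "dsmooth (prod_diff (dspace G) (dspace G)) (dspace G) (\<lambda>(g, h). g \<otimes>\<^bsub>G\<^esub> h)"
    using assms(1) by (simp add: diffeological_group_def)
  from dsmooth_plot[OF this, of n U "\<lambda>u. (g u, h u)"] show ?thesis using assms(2,3) by simp
qed

lemma gplot_inv:
  assumes "diffeological_group G" "plot (dspace G) n U g"
  shows "plot (dspace G) n U (\<lambda>u. inv\<^bsub>G\<^esub> (g u))"
proof -
  have "dsmooth (dspace G) (dspace G) (\<lambda>g. inv\<^bsub>G\<^esub> g)"
    using assms(1) by (simp add: diffeological_group_def)
  from dsmooth_plot[OF this assms(2)] show ?thesis .
qed

lemma gplot_carrier: "diffeological_group G \<Longrightarrow> plot (dspace G) n U g \<Longrightarrow> u \<in> U \<Longrightarrow> g u \<in> carrier G"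
  using plot_pts[OF diffeological_groupD(2)] diffeological_groupD(3) by metis

lemma action_plot:
  assumes "smooth_action G X a" "plot (dspace G) n U g" "plot X n U p"
  shows "plot X n U (\<lambda>u. a (g u) (p u))"
proof -
  have "dsmooth (prod_diff (dspace G) X) X (\<lambda>(g, x). a g x)"
    using assms(1) by (simp add: smooth_action_def)
  from dsmooth_plot[OF this, of n U "\<lambda>u. (g u, p u)"] show ?thesis using assms(2,3) by simp
qed

lemma action_pts:
  assumes "smooth_action G X a" "diffeological_group G" "g \<in> carrier G" "x \<in> pts X"
  shows "a g x \<in> pts X"
proof -
  have "dsmooth (prod_diff (dspace G) X) X (\<lambda>(g, x). a g x)"
    using assms(1) by (simp add: smooth_action_def)
  from dsmooth_pts[OF this, of "(g, x)"] show ?thesis using assms(3,4) diffeological_groupD(3)[OF assms(2)] by simp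
qed

definition translation :: "'g dgroup \<Rightarrow> ('g, 'p, 'y) gbundle \<Rightarrow> 'p \<Rightarrow> 'p \<Rightarrow> 'g" where
  "translation G Q q q' = (THE g. g \<in> carrier G \<and> gact Q g q = q')"

text \<open>A local trivialisation in curried form, together with the group coordinate \<open>\<kappa>\<close> of its inverse.\<close>

definition trivialised ::
    "'g dgroup \<Rightarrow> 'y diffeology \<Rightarrow> ('g, 'p, 'y) gbundle \<Rightarrow> 'y set \<Rightarrow> ('y \<Rightarrow> 'g \<Rightarrow> 'p) \<Rightarrow> ('p \<Rightarrow> 'g) \<Rightarrow> bool" where
  "trivialised G Y Q U \<tau> \<kappa> \<longleftrightarrow>
    (\<forall>u\<in>U. \<forall>g\<in>carrier G. \<tau> u g \<in> pts (tot Q) \<and> proj Q (\<tau> u g) = u \<and> \<kappa> (\<tau> u g) = g \<and>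
       (\<forall>h\<in>carrier G. \<tau> u (h \<otimes>\<^bsub>G\<^esub> g) = gact Q h (\<tau> u g))) \<and>
    (\<forall>q\<in>pts (tot Q). proj Q q \<in> U \<longrightarrow> \<kappa> q \<in> carrier G \<and> \<tau> (proj Q q) (\<kappa> q) = q) \<and>
    dsmooth (sub_diff (tot Q) (proj Q -` U)) (dspace G) \<kappa> \<and>
    dsmooth (sub_diff Y U) (tot Q) (\<lambda>u. \<tau> u \<one>\<^bsub>G\<^esub>)"

lemma trivialisedD:
  assumes "trivialised G Y Q U \<tau> \<kappa>"
  shows "\<And>u g. u \<in> U \<Longrightarrow> g \<in> carrier G \<Longrightarrow> \<tau> u g \<in> pts (tot Q)"
    "\<And>u g. u \<in> U \<Longrightarrow> g \<in> carrier G \<Longrightarrow> proj Q (\<tau> u g) = u"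
    "\<And>u g h. u \<in> U \<Longrightarrow> g \<in> carrier G \<Longrightarrow> h \<in> carrier G \<Longrightarrow> \<tau> u (h \<otimes>\<^bsub>G\<^esub> g) = gact Q h (\<tau> u g)"
    "\<And>q. q \<in> pts (tot Q) \<Longrightarrow> proj Q q \<in> U \<Longrightarrow> \<kappa> q \<in> carrier G"
    "\<And>q. q \<in> pts (tot Q) \<Longrightarrow> proj Q q \<in> U \<Longrightarrow> \<tau> (proj Q q) (\<kappa> q) = q"
    "\<And>u g. u \<in> U \<Longrightarrow> g \<in> carrier G \<Longrightarrow> \<kappa> (\<tau> u g) = g"
    "dsmooth (sub_diff (tot Q) (proj Q -` U)) (dspace G) \<kappa>"
    "dsmooth (sub_diff Y U) (tot Q) (\<lambda>u. \<tau> u \<one>\<^bsub>G\<^esub>)"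
  using assms unfolding trivialised_def by simp_all

locale principal =
  fixes G :: "'g dgroup" and Y :: "'y diffeology" and Q :: "('g, 'p, 'y) gbundle"
  assumes G: "diffeological_group G" and Y: "diffeological_space Y" and Q: "principal_bundle G Y Q"
begin

sublocale group G using G by (rule diffeological_groupD)

lemma tot: "diffeological_space (tot Q)" and proj_smooth: "dsmooth (tot Q) Y (proj Q)"
  and action: "smooth_action G (tot Q) (gact Q)"
  using Q by (simp_all add: principal_bundle_def)

lemma proj_pts: "q \<in> pts (tot Q) \<Longrightarrow> proj Q q \<in> pts Y"
  using dsmooth_pts[OF proj_smooth] .

lemma act_pts: "g \<in> carrier G \<Longrightarrow> q \<in> pts (tot Q) \<Longrightarrow> gact Q g q \<in> pts (tot Q)"
  using action_pts[OF action G] .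

lemma act_one: "q \<in> pts (tot Q) \<Longrightarrow> gact Q \<one>\<^bsub>G\<^esub> q = q"
  and act_act: "g \<in> carrier G \<Longrightarrow> h \<in> carrier G \<Longrightarrow> q \<in> pts (tot Q) \<Longrightarrow> gact Q g (gact Q h q) = gact Q (g \<otimes>\<^bsub>G\<^esub> h) q"
  using action by (simp_all add: smooth_action_def)

lemmas act_plot = action_plot[OF action]

lemma local_trivialisation:
  assumes "y \<in> pts Y"
  obtains U \<tau> \<kappa> where "openin (dtop Y) U" "y \<in> U" "trivialised G Y Q U \<tau> \<kappa>"
proof -
  obtain U t where U: "openin (dtop Y) U" "y \<in> U"
    and d: "diffeo (prod_diff (sub_diff Y U) (dspace G)) (sub_diff (tot Q) (proj Q -` U)) t"
    and t': "\<forall>u\<in>U. \<forall>g\<in>carrier G. proj Q (t (u, g)) = u \<and>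
           (\<forall>h\<in>carrier G. t (u, h \<otimes>\<^bsub>G\<^esub> g) = gact Q h (t (u, g)))"
  proof -
    have "\<forall>y\<in>pts Y. \<exists>U \<tau>. openin (dtop Y) U \<and> y \<in> U \<and>
        diffeo (prod_diff (sub_diff Y U) (dspace G)) (sub_diff (tot Q) (proj Q -` U)) \<tau> \<and>
        (\<forall>u\<in>U. \<forall>g\<in>carrier G. proj Q (\<tau> (u, g)) = u \<and>
           (\<forall>h\<in>carrier G. \<tau> (u, h \<otimes>\<^bsub>G\<^esub> g) = gact Q h (\<tau> (u, g))))"
      using Q unfolding principal_bundle_def by (elim conjE)
    from bspec[OF this assms] show thesis by (elim exE conjE) (rule that)
  qed
  have t: "proj Q (t (u, g)) = u" "h \<in> carrier G \<Longrightarrow> t (u, h \<otimes>\<^bsub>G\<^esub> g) = gact Q h (t (u, g))"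
    if "u \<in> U" "g \<in> carrier G" for u g h
    using t' that by simp_all
  have UY: "U \<subseteq> pts Y" using openin_dtop_subset[OF U(1)] .
  have PG: "pts (dspace G) = carrier G" using G by (rule diffeological_groupD)
  let ?A = "prod_diff (sub_diff Y U) (dspace G)" and ?B = "sub_diff (tot Q) (proj Q -` U)"
  have ptsA: "pts ?A = U \<times> carrier G" using UY PG by auto
  have bij: "bij_betw t (U \<times> carrier G) (pts (tot Q) \<inter> proj Q -` U)"
    and sm: "dsmooth ?A ?B t" and sm': "dsmooth ?B ?A (inv_into (U \<times> carrier G) t)"
    using d[unfolded diffeo_def ptsA pts_sub_diff] by - (elim conjE, assumption)+
  define \<kappa> where "\<kappa> q = snd (inv_into (U \<times> carrier G) t q)" for q
  have inv: "inv_into (U \<times> carrier G) t q \<in> U \<times> carrier G" "t (inv_into (U \<times> carrier G) t q) = q"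
    if "q \<in> pts (tot Q)" "proj Q q \<in> U" for q
  proof -
    have "q \<in> t ` (U \<times> carrier G)" using bij that by (auto simp: bij_betw_def)
    then show "inv_into (U \<times> carrier G) t q \<in> U \<times> carrier G" "t (inv_into (U \<times> carrier G) t q) = q"
      by (rule inv_into_into) (rule f_inv_into_f[OF \<open>q \<in> t ` (U \<times> carrier G)\<close>])
  qed
  have "trivialised G Y Q U (\<lambda>u g. t (u, g)) \<kappa>" unfolding trivialised_def
  proof (intro conjI ballI impI)
    fix u g assume ug: "u \<in> U" "g \<in> carrier G"
    have "t (u, g) \<in> t ` (U \<times> carrier G)" using ug by blast
    then show "t (u, g) \<in> pts (tot Q)" using bij unfolding bij_betw_def by simp
    show "proj Q (t (u, g)) = u" by (rule t(1)[OF ug])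
    show "\<kappa> (t (u, g)) = g"
      using bij ug by (simp add: \<kappa>_def bij_betw_def inv_into_f_f)
    show "t (u, h \<otimes>\<^bsub>G\<^esub> g) = gact Q h (t (u, g))" if "h \<in> carrier G" for h by (rule t(2)[OF ug that])
  next
    have k: "\<kappa> q \<in> carrier G \<and> t (proj Q q, \<kappa> q) = q" if q: "q \<in> pts (tot Q)" "proj Q q \<in> U" for q
    proof -
      obtain u g where ug: "inv_into (U \<times> carrier G) t q = (u, g)" "u \<in> U" "g \<in> carrier G"
        using inv(1)[OF q] by blast
      then show ?thesis using inv(2)[OF q] t(1)[of u g] by (auto simp: \<kappa>_def)
    qed
    then show "\<kappa> q \<in> carrier G" "t (proj Q q, \<kappa> q) = q" if "q \<in> pts (tot Q)" "proj Q q \<in> U" for q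
      using that by simp_all
    show "dsmooth (sub_diff (tot Q) (proj Q -` U)) (dspace G) \<kappa>"
    proof (rule dsmoothI)
      show "\<kappa> q \<in> pts (dspace G)" if "q \<in> pts ?B" for q using k[of q] that PG by simp
      show "plot (dspace G) n V (\<lambda>v. \<kappa> (p v))" if "plot ?B n V p" for n V p
        using dsmooth_plot[OF sm' that] by (simp add: \<kappa>_def)
    qed
    have one: "\<one>\<^bsub>G\<^esub> \<in> carrier G" by simp
    show "dsmooth (sub_diff Y U) (tot Q) (\<lambda>u. t (u, \<one>\<^bsub>G\<^esub>))"
    proof (rule dsmoothI)
      show "t (x, \<one>\<^bsub>G\<^esub>) \<in> pts (tot Q)" if "x \<in> pts (sub_diff Y U)" for x
        using dsmooth_pts[OF sm, of "(x, \<one>\<^bsub>G\<^esub>)"] that PG by simp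
      show "plot (tot Q) n V (\<lambda>u. t (p u, \<one>\<^bsub>G\<^esub>))" if "plot (sub_diff Y U) n V p" for n V p
        using dsmooth_plot[OF sm, of n V "\<lambda>v. (p v, \<one>\<^bsub>G\<^esub>)"] that plot_const[OF diffeological_groupD(2)[OF G], of n V "\<one>\<^bsub>G\<^esub>"]
          plot_open[OF Y, of n V p] PG by simp
    qed
  qed
  then show thesis by (rule that[OF U])
qed

lemma proj_act: "g \<in> carrier G \<Longrightarrow> q \<in> pts (tot Q) \<Longrightarrow> proj Q (gact Q g q) = proj Q q"
proof -
  assume g: "g \<in> carrier G" and q: "q \<in> pts (tot Q)"
  obtain U \<tau> \<kappa> where "openin (dtop Y) U" and 1: "proj Q q \<in> U" and t: "trivialised G Y Q U \<tau> \<kappa>"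
    by (rule local_trivialisation[OF proj_pts[OF q]])
  note D = trivialisedD[OF t]
  have "gact Q g q = \<tau> (proj Q q) (g \<otimes>\<^bsub>G\<^esub> \<kappa> q)" by (simp only: D(3)[OF 1 D(4)[OF q 1] g] D(5)[OF q 1])
  then show ?thesis by (simp only: D(2)[OF 1 m_closed[OF g D(4)[OF q 1]]])
qed

lemma act_free:
  assumes g: "g \<in> carrier G" and h: "h \<in> carrier G" and q: "q \<in> pts (tot Q)" and eq: "gact Q g q = gact Q h q"
  shows "g = h"
proof -
  obtain U \<tau> \<kappa> where "openin (dtop Y) U" and 1: "proj Q q \<in> U" and t: "trivialised G Y Q U \<tau> \<kappa>"
    by (rule local_trivialisation[OF proj_pts[OF q]])
  note D = trivialisedD[OF t]
  have k: "\<kappa> q \<in> carrier G" using D(4)[OF q 1] .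
  have "\<tau> (proj Q q) (g \<otimes>\<^bsub>G\<^esub> \<kappa> q) = \<tau> (proj Q q) (h \<otimes>\<^bsub>G\<^esub> \<kappa> q)"
    by (simp only: D(3)[OF 1 k g] D(3)[OF 1 k h] D(5)[OF q 1] eq)
  then have "\<kappa> (\<tau> (proj Q q) (g \<otimes>\<^bsub>G\<^esub> \<kappa> q)) = \<kappa> (\<tau> (proj Q q) (h \<otimes>\<^bsub>G\<^esub> \<kappa> q))" by (rule arg_cong)
  then have "g \<otimes>\<^bsub>G\<^esub> \<kappa> q = h \<otimes>\<^bsub>G\<^esub> \<kappa> q"
    by (simp only: D(6)[OF 1 m_closed[OF g k]] D(6)[OF 1 m_closed[OF h k]])
  then show ?thesis by (simp only: right_cancel[OF k g h])
qed

lemma translation_eq: "g \<in> carrier G \<Longrightarrow> q \<in> pts (tot Q) \<Longrightarrow> translation G Q q (gact Q g q) = g"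
proof -
  assume g: "g \<in> carrier G" and q: "q \<in> pts (tot Q)"
  show ?thesis unfolding translation_def
  proof (rule the_equality)
    show "h = g" if "h \<in> carrier G \<and> gact Q h q = gact Q g q" for h
      by (rule act_free[OF _ g q]) (simp_all add: that)
  qed (simp add: g)
qed

lemma translation:
  assumes q: "q \<in> pts (tot Q)" "q' \<in> pts (tot Q)" "proj Q q = proj Q q'"
  shows "translation G Q q q' \<in> carrier G" "gact Q (translation G Q q q') q = q'"
proof -
  obtain U \<tau> \<kappa> where "openin (dtop Y) U" and 1: "proj Q q \<in> U" and t: "trivialised G Y Q U \<tau> \<kappa>"
    by (rule local_trivialisation[OF proj_pts[OF q(1)]])
  note D = trivialisedD[OF t]
  have k: "\<kappa> q \<in> carrier G" "\<kappa> q' \<in> carrier G" using D(4)[OF q(1)] D(4)[OF q(2)] 1 q(3) by auto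
  define g where "g = \<kappa> q' \<otimes>\<^bsub>G\<^esub> inv\<^bsub>G\<^esub> (\<kappa> q)"
  have g: "g \<in> carrier G" using k by (simp add: g_def)
  have "gact Q g q = \<tau> (proj Q q) (g \<otimes>\<^bsub>G\<^esub> \<kappa> q)" using D(3)[OF 1 k(1) g] D(5)[OF q(1) 1] by simp
  also have "g \<otimes>\<^bsub>G\<^esub> \<kappa> q = \<kappa> q'" using k by (simp add: g_def m_assoc)
  also have "\<tau> (proj Q q) (\<kappa> q') = q'" using D(5)[OF q(2)] 1 q(3) by simp
  finally have e: "gact Q g q = q'" .
  have "translation G Q q q' = g" using translation_eq[OF g q(1)] e by simp
  then show "translation G Q q q' \<in> carrier G" "gact Q (translation G Q q q') q = q'" using g e by auto
qed

text \<open>In a local trivialisation the translation is a quotient of group coordinates, which makes it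
  smooth.\<close>

lemma translation_plot:
  assumes p: "plot (tot Q) n U p" "plot (tot Q) n U p'" "\<And>u. u \<in> U \<Longrightarrow> proj Q (p u) = proj Q (p' u)"
  shows "plot (dspace G) n U (\<lambda>u. translation G Q (p u) (p' u))"
proof (rule plot_local[OF diffeological_groupD(2)[OF G] plot_open[OF tot p(1)]])
  fix u assume u: "u \<in> U"
  have pu: "p u \<in> pts (tot Q)" using plot_pts[OF tot p(1) u] .
  obtain W \<tau> \<kappa> where W: "openin (dtop Y) W" "proj Q (p u) \<in> W" and t: "trivialised G Y Q W \<tau> \<kappa>"
    by (rule local_trivialisation[OF proj_pts[OF pu]])
  note D = trivialisedD[OF t]
  define V where "V = {v \<in> U. proj Q (p v) \<in> W}"
  have V: "openin (Euclidean_space n) V" "u \<in> V" "V \<subseteq> U"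
    using plot_preimage_open[OF dsmooth_plot[OF proj_smooth p(1)] W(1)] W(2) u by (auto simp: V_def)
  have pV: "plot (sub_diff (tot Q) (proj Q -` W)) n V p" "plot (sub_diff (tot Q) (proj Q -` W)) n V p'"
    using plot_subset[OF tot p(1) V(1,3)] plot_subset[OF tot p(2) V(1,3)] p(3) by (auto simp: V_def)
  have "plot (dspace G) n V (\<lambda>v. \<kappa> (p' v) \<otimes>\<^bsub>G\<^esub> inv\<^bsub>G\<^esub> (\<kappa> (p v)))"
    by (intro gplot_mult[OF G] gplot_inv[OF G] dsmooth_plot[OF D(7)] pV)
  then have "plot (dspace G) n V (\<lambda>v. translation G Q (p v) (p' v))"
  proof (rule plot_cong[OF diffeological_groupD(2)[OF G]])
    fix v assume v: "v \<in> V"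
    then have q: "p v \<in> pts (tot Q)" "p' v \<in> pts (tot Q)" "proj Q (p v) = proj Q (p' v)" "proj Q (p v) \<in> W"
      using plot_pts[OF tot p(1)] plot_pts[OF tot p(2)] p(3) by (auto simp: V_def)
    let ?g = "translation G Q (p v) (p' v)"
    have q': "proj Q (p' v) \<in> W" using q by simp
    have k: "\<kappa> (p v) \<in> carrier G" "\<kappa> (p' v) \<in> carrier G" using D(4)[OF q(1,4)] D(4)[OF q(2) q'] by auto
    have g: "?g \<in> carrier G" by (rule translation(1)[OF q(1-3)])
    have "\<tau> (proj Q (p v)) (?g \<otimes>\<^bsub>G\<^esub> \<kappa> (p v)) = p' v"
      using D(3)[OF q(4) k(1) g] D(5)[OF q(1,4)] translation(2)[OF q(1-3)] by simp
    then have "\<kappa> (p' v) = ?g \<otimes>\<^bsub>G\<^esub> \<kappa> (p v)" using D(6)[OF q(4) m_closed[OF g k(1)]] by simp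
    then show "?g = \<kappa> (p' v) \<otimes>\<^bsub>G\<^esub> inv\<^bsub>G\<^esub> (\<kappa> (p v))"
      using k g by (simp add: m_assoc)
  qed
  then show "\<exists>V. openin (Euclidean_space n) V \<and> u \<in> V \<and> V \<subseteq> U \<and> plot (dspace G) n V (\<lambda>u. translation G Q (p u) (p' u))"
    using V by (intro exI[of _ V] conjI)
qed

lemma local_section:
  assumes "y \<in> pts Y"
  obtains U \<sigma> where "openin (dtop Y) U" "y \<in> U" "dsmooth (sub_diff Y U) (tot Q) \<sigma>" "\<And>u. u \<in> U \<Longrightarrow> proj Q (\<sigma> u) = u"
proof -
  obtain U \<tau> \<kappa> where U: "openin (dtop Y) U" "y \<in> U" and t: "trivialised G Y Q U \<tau> \<kappa>"
    by (rule local_trivialisation[OF assms])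
  show thesis
    by (rule that[OF U trivialisedD(8)[OF t]]) (simp add: trivialisedD(2)[OF t])
qed

end

text \<open>Conversely, a free action with smooth translations and with smooth local sections is
  locally trivial: a section \<open>\<sigma>\<close> gives the trivialisation sending \<open>(u, g)\<close> to \<open>g \<cdot> \<sigma> u\<close>.\<close>

lemma principal_bundleI:
  assumes G: "diffeological_group G" and Y: "diffeological_space Y"
    and tot: "diffeological_space (tot Q)" and pr: "dsmooth (tot Q) Y (proj Q)"
    and act: "smooth_action G (tot Q) (gact Q)"
    and pr_act: "\<And>g q. g \<in> carrier G \<Longrightarrow> q \<in> pts (tot Q) \<Longrightarrow> proj Q (gact Q g q) = proj Q q"
    and free: "\<And>g h q. g \<in> carrier G \<Longrightarrow> h \<in> carrier G \<Longrightarrow> q \<in> pts (tot Q) \<Longrightarrow> gact Q g q = gact Q h q \<Longrightarrow> g = h"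
    and trans: "\<And>n U p p'. plot (tot Q) n U p \<Longrightarrow> plot (tot Q) n U p' \<Longrightarrow> (\<And>u. u \<in> U \<Longrightarrow> proj Q (p u) = proj Q (p' u)) \<Longrightarrow>
        \<exists>d. plot (dspace G) n U d \<and> (\<forall>u\<in>U. gact Q (d u) (p u) = p' u)"
    and sect: "\<And>y. y \<in> pts Y \<Longrightarrow> \<exists>U \<sigma>. openin (dtop Y) U \<and> y \<in> U \<and> dsmooth (sub_diff Y U) (tot Q) \<sigma> \<and> (\<forall>u\<in>U. proj Q (\<sigma> u) = u)"
  shows "principal_bundle G Y Q"
  unfolding principal_bundle_def
proof (intro conjI tot pr act ballI)
  interpret group G using G by (rule diffeological_groupD)
  have PG: "pts (dspace G) = carrier G" using G by (rule diffeological_groupD)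
  have DG: "diffeological_space (dspace G)" using G by (rule diffeological_groupD)
  fix y assume "y \<in> pts Y"
  from sect[OF this] obtain U \<sigma> where U: "openin (dtop Y) U" "y \<in> U" "dsmooth (sub_diff Y U) (tot Q) \<sigma>"
    and \<sigma>': "\<forall>u\<in>U. proj Q (\<sigma> u) = u" by (elim exE conjE)
  note \<sigma> = bspec[OF \<sigma>']
  have UY: "U \<subseteq> pts Y" using openin_dtop_subset[OF U(1)] .
  have \<sigma>p: "\<sigma> u \<in> pts (tot Q)" if "u \<in> U" for u using dsmooth_pts[OF U(3)] that UY by auto
  let ?A = "prod_diff (sub_diff Y U) (dspace G)" and ?B = "sub_diff (tot Q) (proj Q -` U)"
  define t where "t = (\<lambda>(u, g). gact Q g (\<sigma> u))"
  have ptsA: "pts ?A = U \<times> carrier G" using UY PG by auto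
  have into: "t x \<in> pts ?B" if "x \<in> U \<times> carrier G" for x
    using that action_pts[OF act G] \<sigma>p \<sigma> pr_act by (auto simp: t_def)
  have inj: "inj_on t (U \<times> carrier G)"
  proof (rule inj_onI, clarsimp simp: t_def)
    fix u g u' g' assume a: "u \<in> U" "g \<in> carrier G" "u' \<in> U" "g' \<in> carrier G" "gact Q g (\<sigma> u) = gact Q g' (\<sigma> u')"
    then have "u = u'" using pr_act[OF a(2) \<sigma>p[OF a(1)]] pr_act[OF a(4) \<sigma>p[OF a(3)]] \<sigma> by simp
    then show "u = u' \<and> g = g'" using free a \<sigma>p by auto
  qed
  have lift: "\<exists>d. plot (dspace G) n V d \<and> (\<forall>v\<in>V. p v = t (proj Q (p v), d v))" if p: "plot ?B n V p" for n V p
  proof -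
    have pU: "\<And>v. v \<in> V \<Longrightarrow> proj Q (p v) \<in> U" and p': "plot (tot Q) n V p" using p by auto
    have "plot (sub_diff Y U) n V (\<lambda>v. proj Q (p v))" using dsmooth_plot[OF pr p'] pU by auto
    from dsmooth_plot[OF U(3) this] have s: "plot (tot Q) n V (\<lambda>v. \<sigma> (proj Q (p v)))" .
    have "\<exists>d. plot (dspace G) n V d \<and> (\<forall>u\<in>V. gact Q (d u) (\<sigma> (proj Q (p u))) = p u)"
      by (rule trans[OF s p']) (use pU \<sigma> in auto)
    then obtain d where "plot (dspace G) n V d" "\<forall>u\<in>V. gact Q (d u) (\<sigma> (proj Q (p u))) = p u" by (elim exE conjE)
    then show ?thesis by (intro exI[of _ d]) (simp add: t_def)
  qed
  have surj: "t ` (U \<times> carrier G) = pts ?B"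
  proof (intro equalityI subsetI)
    fix q assume q: "q \<in> pts ?B"
    \<comment> \<open>Smooth translations between constant plots on the one-point domain give transitivity on fibres.\<close>
    let ?V = "topspace (Euclidean_space 0)"
    have "plot ?B 0 ?V (\<lambda>_. q)" using plot_const[OF diffeological_sub_diff[OF tot] openin_topspace q] .
    from lift[OF this] obtain d where d: "plot (dspace G) 0 ?V d" "\<forall>v\<in>?V. q = t (proj Q q, d v)" by (elim exE conjE)
    have z: "(\<lambda>_. 0) \<in> ?V" by (simp add: topspace_Euclidean_space)
    have "d (\<lambda>_. 0) \<in> carrier G" using gplot_carrier[OF G d(1) z] .
    then show "q \<in> t ` (U \<times> carrier G)" using d(2) z q by (intro image_eqI[of _ _ "(proj Q q, d (\<lambda>_. 0))"]) auto
  qed (use into in auto)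
  have sm: "dsmooth ?A ?B t"
  proof (rule dsmoothI)
    show "t x \<in> pts ?B" if "x \<in> pts ?A" for x using into ptsA that by blast
    show "plot ?B n V (\<lambda>v. t (p v))" if p: "plot ?A n V p" for n V p
    proof -
      have p1: "plot (sub_diff Y U) n V (\<lambda>v. fst (p v))" and p2: "plot (dspace G) n V (\<lambda>v. snd (p v))" using p by auto
      have "plot (tot Q) n V (\<lambda>v. gact Q (snd (p v)) (\<sigma> (fst (p v))))"
        by (rule action_plot[OF act p2 dsmooth_plot[OF U(3) p1]])
      moreover have "t (p v) \<in> pts ?B" if "v \<in> V" for v
        using into[of "p v"] gplot_carrier[OF G p2 that] p1 that by (auto simp: mem_Times_iff)
      ultimately show ?thesis by (auto simp: t_def split_beta)
    qed
  qed
  have sm': "dsmooth ?B ?A (inv_into (pts ?A) t)"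
  proof (rule dsmoothI)
    show "inv_into (pts ?A) t q \<in> pts ?A" if "q \<in> pts ?B" for q
      using inv_into_into[of q t "pts ?A"] that surj unfolding ptsA by simp
    show "plot ?A n V (\<lambda>v. inv_into (pts ?A) t (p v))" if p: "plot ?B n V p" for n V p
    proof -
      obtain d where d: "plot (dspace G) n V d" "\<forall>v\<in>V. p v = t (proj Q (p v), d v)" using lift[OF p] by (elim exE conjE)
      have pU: "\<And>v. v \<in> V \<Longrightarrow> proj Q (p v) \<in> U" and p': "plot (tot Q) n V p" using p by auto
      have "plot ?A n V (\<lambda>v. (proj Q (p v), d v))" using dsmooth_plot[OF pr p'] pU d(1) by auto
      then show ?thesis
      proof (rule plot_cong[OF diffeological_prod_diff[OF diffeological_sub_diff[OF Y] DG]])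
        fix v assume v: "v \<in> V"
        have "inv_into (U \<times> carrier G) t (t (proj Q (p v), d v)) = (proj Q (p v), d v)"
          by (rule inv_into_f_f[OF inj]) (use pU[OF v] gplot_carrier[OF G d(1) v] in simp)
        then show "inv_into (pts ?A) t (p v) = (proj Q (p v), d v)" using d(2) v ptsA by simp
      qed
    qed
  qed
  have dt: "diffeo ?A ?B t" unfolding diffeo_def bij_betw_def ptsA using inj surj sm sm'[unfolded ptsA] by simp
  have eq: "\<forall>u\<in>U. \<forall>g\<in>carrier G. proj Q (t (u, g)) = u \<and> (\<forall>h\<in>carrier G. t (u, h \<otimes>\<^bsub>G\<^esub> g) = gact Q h (t (u, g)))"
    using pr_act \<sigma> \<sigma>p act by (simp add: t_def smooth_action_def)
  show "\<exists>U \<tau>. openin (dtop Y) U \<and> y \<in> U \<and> diffeo (prod_diff (sub_diff Y U) (dspace G)) (sub_diff (tot Q) (proj Q -` U)) \<tau> \<and>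
        (\<forall>u\<in>U. \<forall>g\<in>carrier G. proj Q (\<tau> (u, g)) = u \<and> (\<forall>h\<in>carrier G. \<tau> (u, h \<otimes>\<^bsub>G\<^esub> g) = gact Q h (\<tau> (u, g))))"
    by (rule exI[of _ U], rule exI[of _ t], intro conjI U(1,2) dt eq)
qed

section \<open>Germs along nested tuples of points\<close>

lemma eventually_nhdsin_topspace: "\<forall>\<^sub>F y in nhdsin T a. y \<in> topspace T"
  unfolding eventually_nhdsin by (metis openin_topspace)

lemma eventually_eventually_nhdsin:
  assumes "\<forall>\<^sub>F y in nhdsin T a. P y"
  shows "\<forall>\<^sub>F y in nhdsin T a. \<forall>\<^sub>F z in nhdsin T y. P z"
  using assms unfolding eventually_nhdsin by metis

lemma eventually_nhdsin_continuous:
  assumes f: "continuous_map T T' f" and a: "a \<in> topspace T" and P: "\<forall>\<^sub>F y in nhdsin T' (f a). P y"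
  shows "\<forall>\<^sub>F x in nhdsin T a. P (f x)"
proof -
  have "f a \<in> topspace T'" using f a by (auto simp: continuous_map_def)
  then obtain S where S: "openin T' S" "f a \<in> S" "\<forall>y\<in>S. P y" using P unfolding eventually_nhdsin by metis
  have "openin T {x \<in> topspace T. f x \<in> S}" using f S(1) by (auto simp: continuous_map_def)
  then show ?thesis unfolding eventually_nhdsin using S a by (intro disjI2 exI[of _ "{x \<in> topspace T. f x \<in> S}"]) auto
qed

lemma nested_from_mono:
  assumes "nested_from T n R xs"
    "\<And>ys. length ys = n \<Longrightarrow> set ys \<subseteq> topspace T \<Longrightarrow> R (xs @ ys) \<Longrightarrow> S (xs @ ys)"
  shows "nested_from T n S xs"
  using assms
proof (induction n arbitrary: xs)
  case 0 then show ?case using "0.prems"(2)[of "[]"] by simp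
next
  case (Suc n)
  have "\<forall>\<^sub>F y in nhdsin T (last xs). nested_from T n R (xs @ [y])" using Suc.prems(1) by simp
  then have "\<forall>\<^sub>F y in nhdsin T (last xs). nested_from T n S (xs @ [y])"
    using eventually_nhdsin_topspace[of T "last xs"]
  proof eventually_elim
    case (elim y)
    show ?case
    proof (rule Suc.IH[OF elim(1)])
      fix ys :: "'a list" assume "length ys = n" "set ys \<subseteq> topspace T" "R ((xs @ [y]) @ ys)"
      then show "S ((xs @ [y]) @ ys)" using Suc.prems(2)[of "y # ys"] elim(2) by simp
    qed
  qed
  then show ?case by simp
qed

lemma nested_from_conj:
  "nested_from T n (\<lambda>xs. R xs \<and> S xs) xs \<longleftrightarrow> nested_from T n R xs \<and> nested_from T n S xs"
  by (induction n arbitrary: xs) (simp_all add: eventually_conj_iff)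

lemma nested_mono:
  assumes "nested T n R" "\<And>xs. length xs = Suc n \<Longrightarrow> set xs \<subseteq> topspace T \<Longrightarrow> R xs \<Longrightarrow> S xs"
  shows "nested T n S"
  unfolding nested_def
proof
  fix x assume x: "x \<in> topspace T"
  show "nested_from T n S [x]"
  proof (rule nested_from_mono)
    show "nested_from T n R [x]" using assms(1) x by (simp add: nested_def)
    show "S ([x] @ ys)" if "length ys = n" "set ys \<subseteq> topspace T" "R ([x] @ ys)" for ys
      by (rule assms(2)) (use that x in simp_all)
  qed
qed

lemma nested_conj: "nested T n (\<lambda>xs. R xs \<and> S xs) \<longleftrightarrow> nested T n R \<and> nested T n S"
  by (auto simp: nested_def nested_from_conj)

lemma nested_True: "nested T n (\<lambda>_. True)"
proof -
  have "nested_from T n (\<lambda>_. True) xs" for xs by (induction n arbitrary: xs) simp_all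
  then show ?thesis by (simp add: nested_def)
qed

lemma nested_ball:
  assumes "finite I" "\<And>i. i \<in> I \<Longrightarrow> nested T n (R i)"
  shows "nested T n (\<lambda>xs. \<forall>i\<in>I. R i xs)"
  using assms by (induction I rule: finite_induct) (simp_all add: nested_True nested_conj)

lemma omit_simps [simp]: "omit i [] = []" "omit 0 (x # xs) = xs" "omit (Suc i) (x # xs) = x # omit i xs"
  by (simp_all add: omit_def)

lemma omit_append: "omit (length ps) (ps @ z # ys) = ps @ ys"
  by (simp add: omit_def)

lemma map_omit: "map f (omit i xs) = omit i (map f xs)"
  by (simp add: omit_def take_map drop_map)

lemma omit_omit: "i < j \<Longrightarrow> omit i (omit j xs) = omit (j - 1) (omit i xs)"
proof (induction xs arbitrary: i j)
  case (Cons x xs)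
  obtain j' where j: "j = Suc j'" using Cons.prems by (cases j) auto
  show ?case
  proof (cases i)
    case (Suc i')
    then obtain j'' where "j' = Suc j''" using Cons.prems j by (cases j') auto
    then show ?thesis using Suc j Cons.IH[of i' j'] Cons.prems by simp
  qed (simp add: j)
qed simp

text \<open>Later points of a nested tuple are only compared with its last point, so an earlier point that is
  omitted from the condition has no influence.\<close>

lemma nested_from_omit_seen:
  assumes "ys \<noteq> []"
  shows "nested_from T n (\<lambda>xs. Q (omit (length ps) xs) (last xs)) (ps @ z # ys)
    \<longleftrightarrow> nested_from T n (\<lambda>xs. Q xs (last xs)) (ps @ ys)"
  using assms
proof (induction n arbitrary: ys)
  case 0 then show ?case by (simp add: omit_append)
next
  case (Suc n)
  have "nested_from T n (\<lambda>xs. Q (omit (length ps) xs) (last xs)) (ps @ z # (ys @ [y]))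
    \<longleftrightarrow> nested_from T n (\<lambda>xs. Q xs (last xs)) (ps @ (ys @ [y]))" for y
    by (rule Suc.IH) simp
  then show ?case using Suc.prems by simp
qed

text \<open>A condition on nested tuples that is open in the last point survives the insertion of a
  further point: if \<open>z\<close> is close to \<open>y\<close>, and \<open>y\<close> is close to \<open>x\<close>, then \<open>z\<close> is close to \<open>x\<close>.\<close>

lemma nested_from_omit:
  assumes Q: "\<And>xs v. Q xs v \<Longrightarrow> \<forall>\<^sub>F w in nhdsin T v. Q xs w"
  shows "nested_from T n (\<lambda>xs. Q xs (last xs)) (ps @ [x]) \<Longrightarrow> 1 \<le> i \<Longrightarrow> i \<le> Suc n \<Longrightarrow>
    nested_from T (Suc n) (\<lambda>xs. Q (omit (length ps + i) xs) (last xs)) (ps @ [x])"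
proof (induction n arbitrary: ps x i)
  case 0
  have "i = Suc 0" using "0.prems" by simp
  then have "omit (length ps + i) (ps @ [x, y]) = ps @ [x]" for y
    using omit_append[of "ps @ [x]" y "[]"] by simp
  then have "\<forall>\<^sub>F y in nhdsin T x. Q (omit (length ps + i) (ps @ [x, y])) y"
    using Q[of "ps @ [x]" x] "0.prems"(1) by simp
  then show ?case by simp
next
  case (Suc n)
  have *: "\<forall>\<^sub>F y in nhdsin T x. nested_from T n (\<lambda>xs. Q xs (last xs)) ((ps @ [x]) @ [y])"
    using Suc.prems(1) by simp
  have "\<forall>\<^sub>F y in nhdsin T x. nested_from T (Suc n) (\<lambda>xs. Q (omit (length ps + i) xs) (last xs)) ((ps @ [x]) @ [y])"
  proof (cases "i = 1")
    case True
    have eq: "nested_from T n (\<lambda>xs. Q (omit (length ps + i) xs) (last xs)) (((ps @ [x]) @ [y]) @ [z])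
        \<longleftrightarrow> nested_from T n (\<lambda>xs. Q xs (last xs)) ((ps @ [x]) @ [z])" for y z
      using nested_from_omit_seen[of "[z]" T n Q "ps @ [x]" y] True by simp
    show ?thesis using eventually_eventually_nhdsin[OF *] unfolding nested_from.simps(2) eq by simp
  next
    case False
    show ?thesis using *
    proof eventually_elim
      case (elim y)
      have "nested_from T (Suc n) (\<lambda>xs. Q (omit (length (ps @ [x]) + (i - 1)) xs) (last xs)) ((ps @ [x]) @ [y])"
        by (rule Suc.IH[OF elim]) (use False Suc.prems in auto)
      moreover have "length (ps @ [x]) + (i - 1) = length ps + i" using Suc.prems(2) by simp
      ultimately show ?case by (simp only:)
    qed
  qed
  then show ?case by (subst nested_from.simps(2)) simp
qed

lemma nested_omit:
  assumes Q: "\<And>xs v. Q xs v \<Longrightarrow> \<forall>\<^sub>F w in nhdsin T v. Q xs w"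
    and n: "nested T n (\<lambda>xs. Q xs (last xs))" and i: "i \<le> Suc n"
  shows "nested T (Suc n) (\<lambda>xs. Q (omit i xs) (last xs))"
  unfolding nested_def
proof
  fix x assume x: "x \<in> topspace T"
  show "nested_from T (Suc n) (\<lambda>xs. Q (omit i xs) (last xs)) [x]"
  proof (cases "i = 0")
    case True
    have "nested_from T n (\<lambda>xs. Q (omit 0 xs) (last xs)) ([x] @ [y])" if "y \<in> topspace T" for y
      using nested_from_omit_seen[of "[y]" T n Q "[]" x] n that by (simp add: nested_def)
    then show ?thesis using eventually_nhdsin_topspace[of T x] True by (auto elim: eventually_mono)
  next
    case False
    have "nested_from T n (\<lambda>xs. Q xs (last xs)) ([] @ [x])" using n x by (simp add: nested_def)
    from nested_from_omit[of Q, OF Q this, of i] False i show ?thesis by simp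
  qed
qed

lemma nested_from_map:
  assumes f: "continuous_map T T' f"
  shows "nested_from T' n R (map f xs) \<Longrightarrow> xs \<noteq> [] \<Longrightarrow> set xs \<subseteq> topspace T \<Longrightarrow> nested_from T n (\<lambda>xs. R (map f xs)) xs"
proof (induction n arbitrary: xs)
  case (Suc n)
  have l: "last xs \<in> topspace T" using Suc.prems by auto
  have "\<forall>\<^sub>F y in nhdsin T' (f (last xs)). nested_from T' n R (map f xs @ [y])"
    using Suc.prems by (simp add: last_map)
  from eventually_nhdsin_continuous[OF f l this]
  have "\<forall>\<^sub>F y in nhdsin T (last xs). nested_from T n (\<lambda>xs. R (map f xs)) (xs @ [y])"
    using eventually_nhdsin_topspace[of T "last xs"]
  proof eventually_elim
    case (elim y)
    show ?case by (rule Suc.IH) (use elim Suc.prems in simp_all)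
  qed
  then show ?case by simp
qed simp

lemma nested_map:
  assumes f: "continuous_map T T' f" and "nested T' n R"
  shows "nested T n (\<lambda>xs. R (map f xs))"
  unfolding nested_def
proof
  fix x assume x: "x \<in> topspace T"
  then have "f x \<in> topspace T'" using f by (auto simp: continuous_map_def)
  then have "nested_from T' n R (map f [x])" using assms(2) by (simp add: nested_def)
  then show "nested_from T n (\<lambda>xs. R (map f xs)) [x]" by (rule nested_from_map[OF f]) (use x in simp_all)
qed

text \<open>Equality of germs is the special case of an equation.  Arbitrary conditions on the values near the
  end of a nested tuple can be combined and weakened, which equations cannot.\<close>

definition germs :: "'y diffeology \<Rightarrow> nat \<Rightarrow> ('y list \<Rightarrow> 'y \<Rightarrow> bool) \<Rightarrow> bool" where
  "germs Y n P \<longleftrightarrow> nested (dtop Y) n (\<lambda>xs. \<forall>\<^sub>F y in nhdsin (dtop Y) (last xs). P xs y)"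

lemma germ_eq_germs: "germ_eq Y n s t \<longleftrightarrow> germs Y n (\<lambda>xs y. s xs y = t xs y)"
  by (simp add: germ_eq_def germs_def)

lemma germs_conj: "germs Y n P \<Longrightarrow> germs Y n P' \<Longrightarrow> germs Y n (\<lambda>xs y. P xs y \<and> P' xs y)"
  by (simp add: germs_def eventually_conj_iff nested_conj)

lemma germs_mono:
  assumes Y: "diffeological_space Y" and P: "germs Y n P"
    and imp: "\<And>xs y. length xs = Suc n \<Longrightarrow> set xs \<subseteq> pts Y \<Longrightarrow> y \<in> pts Y \<Longrightarrow> P xs y \<Longrightarrow> P' xs y"
  shows "germs Y n P'"
  unfolding germs_def
proof (rule nested_mono[OF P[unfolded germs_def]])
  fix xs assume xs: "length xs = Suc n" "set xs \<subseteq> topspace (dtop Y)"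
    and P: "\<forall>\<^sub>F y in nhdsin (dtop Y) (last xs). P xs y"
  show "\<forall>\<^sub>F y in nhdsin (dtop Y) (last xs). P' xs y"
    using P eventually_nhdsin_topspace[of "dtop Y" "last xs"]
    by eventually_elim (rule imp, use xs Y in simp_all)
qed

text \<open>This is how an identity between cochains is used inside a coboundary of the next degree.\<close>

lemma germs_ball_omit:
  assumes P: "germs Y n P"
  shows "germs Y (Suc n) (\<lambda>xs y. \<forall>i\<le>Suc n. P (omit i xs) y)"
proof -
  have "nested (dtop Y) (Suc n) (\<lambda>xs. \<forall>\<^sub>F y in nhdsin (dtop Y) (last xs). P (omit i xs) y)" if "i \<le> Suc n" for i
    by (rule nested_omit[where Q = "\<lambda>xs v. \<forall>\<^sub>F y in nhdsin (dtop Y) v. P xs y",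
          OF eventually_eventually_nhdsin P[unfolded germs_def] that])
  then have "nested (dtop Y) (Suc n) (\<lambda>xs. \<forall>i\<in>{..Suc n}. \<forall>\<^sub>F y in nhdsin (dtop Y) (last xs). P (omit i xs) y)"
    by (intro nested_ball) auto
  then show ?thesis unfolding germs_def by (simp add: eventually_ball_finite_distrib flip: atMost_iff Ball_def)
qed

lemma germs_map:
  assumes "diffeological_space X" "diffeological_space Y" and f: "dsmooth X Y f" and P: "germs Y n P"
  shows "germs X n (\<lambda>xs x. P (map f xs) (f x))"
proof -
  note c = dsmooth_continuous_map[OF assms(1,2) f]
  from nested_map[OF c P[unfolded germs_def]]
  show ?thesis unfolding germs_def
  proof (rule nested_mono)
    fix xs assume xs: "length xs = Suc n" "set xs \<subseteq> topspace (dtop X)"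
      and ev: "\<forall>\<^sub>F y in nhdsin (dtop Y) (last (map f xs)). P (map f xs) y"
    have "xs \<noteq> []" using xs by auto
    then show "\<forall>\<^sub>F x in nhdsin (dtop X) (last xs). P (map f xs) (f x)"
      using eventually_nhdsin_continuous[OF c _ ev[unfolded last_map[OF \<open>xs \<noteq> []\<close>]]] xs
      by (metis last_in_set subsetD)
  qed
qed

definition smooth_germ :: "'y diffeology \<Rightarrow> 'a dgroup \<Rightarrow> ('y \<Rightarrow> 'a) \<Rightarrow> 'y \<Rightarrow> bool" where
  "smooth_germ Y A f y \<longleftrightarrow> (\<exists>W. openin (dtop Y) W \<and> y \<in> W \<and> dsmooth (sub_diff Y W) (dspace A) f)"

lemma cochains_smooth_germ: "s \<in> cochains Y A n \<longleftrightarrow> nested (dtop Y) n (\<lambda>xs. smooth_germ Y A (s xs) (last xs))"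
  by (simp add: cochains_def smooth_germ_def)

lemma smooth_germ_open: "smooth_germ Y A f v \<Longrightarrow> \<forall>\<^sub>F w in nhdsin (dtop Y) v. smooth_germ Y A f w"
  unfolding smooth_germ_def eventually_nhdsin by blast

lemma cochain_omit: "s \<in> cochains Y A n \<Longrightarrow> i \<le> Suc n \<Longrightarrow> (\<lambda>xs. s (omit i xs)) \<in> cochains Y A (Suc n)"
  unfolding cochains_smooth_germ
  by (rule nested_omit[where Q = "\<lambda>xs. smooth_germ Y A (s xs)", OF smooth_germ_open])

lemma cochain_map:
  assumes X: "diffeological_space X" and Y: "diffeological_space Y" and f: "dsmooth X Y f" and s: "s \<in> cochains Y A n"
  shows "(\<lambda>xs x. s (map f xs) (f x)) \<in> cochains X A n"
proof -
  note c = dsmooth_continuous_map[OF X Y f]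
  from nested_map[OF c s[unfolded cochains_smooth_germ]]
  show ?thesis unfolding cochains_smooth_germ
  proof (rule nested_mono)
    fix xs assume xs: "length xs = Suc n" "set xs \<subseteq> topspace (dtop X)" "smooth_germ Y A (s (map f xs)) (last (map f xs))"
    then have ne: "xs \<noteq> []" by auto
    obtain W where W: "openin (dtop Y) W" "f (last xs) \<in> W" "dsmooth (sub_diff Y W) (dspace A) (s (map f xs))"
      using xs(3) ne unfolding smooth_germ_def by (auto simp: last_map)
    let ?V = "{x \<in> pts X. f x \<in> W}"
    have "dsmooth (sub_diff X ?V) (sub_diff Y W) f"
      by (rule dsmooth_into_sub[OF dsmooth_sub[OF f] _ diffeological_sub_diff[OF X]]) auto
    from dsmooth_compose[OF this W(3)]
    have "dsmooth (sub_diff X ?V) (dspace A) (\<lambda>x. s (map f xs) (f x))" .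
    moreover have "openin (dtop X) ?V" by (rule dsmooth_continuous[OF X f W(1)])
    moreover have "last xs \<in> ?V" using W(2) xs(2) ne X by auto
    ultimately show "smooth_germ X A (\<lambda>x. s (map f xs) (f x)) (last xs)" unfolding smooth_germ_def by blast
  qed
qed

section \<open>Cochains with values in the reals, the integers and the circle\<close>

lemma real_dgroup_simps [simp]: "carrier real_dgroup = UNIV" "x \<otimes>\<^bsub>real_dgroup\<^esub> y = x + y"
  "\<one>\<^bsub>real_dgroup\<^esub> = 0" "dspace real_dgroup = real_diff"
  by (simp_all add: real_dgroup_def)

lemma int_dgroup_simps [simp]: "carrier int_dgroup = UNIV" "x \<otimes>\<^bsub>int_dgroup\<^esub> y = x + y"
  "\<one>\<^bsub>int_dgroup\<^esub> = 0" "dspace int_dgroup = discrete_diff UNIV"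
  by (simp_all add: int_dgroup_def)

lemma comm_group_real: "comm_group real_dgroup"
  by (rule comm_groupI) (auto intro: exI[of _ "- x" for x])

lemma comm_group_int: "comm_group int_dgroup"
  by (rule comm_groupI) (auto intro: exI[of _ "- x" for x])

lemma inv_real [simp]: "inv\<^bsub>real_dgroup\<^esub> x = - x"
  by (rule group.inv_equality[OF comm_group.axioms(2)[OF comm_group_real]]) auto

lemma inv_int [simp]: "inv\<^bsub>int_dgroup\<^esub> x = - x"
  by (rule group.inv_equality[OF comm_group.axioms(2)[OF comm_group_int]]) auto

lemma finprod_real: "finite I \<Longrightarrow> finprod real_dgroup f I = sum f I"
proof (induction I rule: finite_induct)
  case empty show ?case using comm_monoid.finprod_empty[OF comm_group.axioms(1)[OF comm_group_real]] by simp
next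
  case (insert i I)
  then show ?case using comm_monoid.finprod_insert[OF comm_group.axioms(1)[OF comm_group_real], of I i f] by simp
qed

lemma finprod_int: "finite I \<Longrightarrow> finprod int_dgroup f I = sum f I"
proof (induction I rule: finite_induct)
  case empty show ?case using comm_monoid.finprod_empty[OF comm_group.axioms(1)[OF comm_group_int]] by simp
next
  case (insert i I)
  then show ?case using comm_monoid.finprod_insert[OF comm_group.axioms(1)[OF comm_group_int], of I i f] by simp
qed

lemma finprod_circle: "finite I \<Longrightarrow> (\<And>i. i \<in> I \<Longrightarrow> cmod (f i) = 1) \<Longrightarrow> finprod circle f I = prod f I"
proof (induction I rule: finite_induct)
  case empty show ?case using comm_monoid.finprod_empty[OF comm_group.axioms(1)[OF comm_group_circle]] by simp
next
  case (insert i I)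
  then show ?case using comm_monoid.finprod_insert[OF comm_group.axioms(1)[OF comm_group_circle], of I i f]
    by (simp add: Pi_iff)
qed

lemma coboundary_real: "coboundary real_dgroup n s xs y = (\<Sum>i\<le>Suc n. (- 1) ^ i * s (omit i xs) y)"
  unfolding coboundary_def by (subst finprod_real) (auto intro!: sum.cong)

lemma coboundary_int: "coboundary int_dgroup n s xs y = (\<Sum>i\<le>Suc n. (- 1) ^ i * s (omit i xs) y)"
  unfolding coboundary_def by (subst finprod_int) (auto intro!: sum.cong)

lemma coboundary_circle:
  assumes "\<And>i. i \<le> Suc n \<Longrightarrow> cmod (s (omit i xs) y) = 1"
  shows "coboundary circle n s xs y = (\<Prod>i\<le>Suc n. if even i then s (omit i xs) y else inverse (s (omit i xs) y))"
  unfolding coboundary_def using assms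
  by (subst finprod_circle) (auto intro!: prod.cong simp: norm_inverse)

text \<open>The terms in which \<open>j\<close> and then \<open>i \<ge> j\<close> are omitted cancel those in which \<open>i + 1\<close> and then \<open>j\<close> are
  omitted.\<close>

lemma coboundary_coboundary_real: "coboundary real_dgroup (Suc n) (coboundary real_dgroup n s) xs y = 0"
proof -
  define a where "a i j = s (omit i (omit j xs)) y" for i j
  define t where "t = (\<lambda>(j, i). (- 1) ^ (j + i) * a i j)"
  define L where "L = {(j, i). j \<le> Suc (Suc n) \<and> i \<le> Suc n \<and> i < j}"
  define R where "R = {(j, i). j \<le> Suc (Suc n) \<and> i \<le> Suc n \<and> \<not> i < j}"
  have fin: "finite L" "finite R"
    by (rule finite_subset[of _ "{..Suc (Suc n)} \<times> {..Suc n}"], auto simp: L_def R_def)+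
  have "coboundary real_dgroup (Suc n) (coboundary real_dgroup n s) xs y
      = (\<Sum>j\<le>Suc (Suc n). \<Sum>i\<le>Suc n. t (j, i))"
    unfolding coboundary_real t_def a_def by (simp add: sum_distrib_left power_add mult.assoc del: sum.atMost_Suc)
  also have "\<dots> = sum t ({..Suc (Suc n)} \<times> {..Suc n})"
    by (simp add: sum.cartesian_product del: sum.atMost_Suc)
  also have "{..Suc (Suc n)} \<times> {..Suc n} = L \<union> R" by (auto simp: L_def R_def)
  also have "sum t (L \<union> R) = sum t L + sum t R"
    by (rule sum.union_disjoint) (use fin in \<open>auto simp: L_def R_def\<close>)
  also have "sum t R = sum (\<lambda>p. - t p) L"
  proof (rule sum.reindex_bij_witness[where i = "\<lambda>(j, i). (i, j - 1)" and j = "\<lambda>(j, i). (Suc i, j)"])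
    fix p assume "p \<in> R"
    then obtain j i where p: "p = (j, i)" "j \<le> i" "i \<le> Suc n" by (auto simp: R_def)
    have "a j (Suc i) = a i j" using omit_omit[of j "Suc i" xs] p(2) by (simp add: a_def)
    then show "- t (case p of (j, i) \<Rightarrow> (Suc i, j)) = t p" using p by (simp add: t_def add.commute)
  qed (auto simp: L_def R_def)
  finally show ?thesis by (simp add: sum_negf)
qed

lemma coboundary_map: "coboundary A n (\<lambda>xs x. s (map f xs) (f x)) xs x = coboundary A n s (map f xs) (f x)"
  unfolding coboundary_def map_omit ..

lemma coboundary_real_cong:
  "(\<And>i. i \<le> Suc n \<Longrightarrow> s (omit i xs) y = t (omit i xs) y) \<Longrightarrow>
    coboundary real_dgroup n s xs y = coboundary real_dgroup n t xs y"
  unfolding coboundary_real by (rule sum.cong) simp_all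

lemma coboundary_int_real: "real_of_int (coboundary int_dgroup n z xs y) = coboundary real_dgroup n (\<lambda>xs y. real_of_int (z xs y)) xs y"
  unfolding coboundary_int coboundary_real by (simp del: sum.atMost_Suc)

lemma smooth_germ_real_add:
  assumes "smooth_germ Y real_dgroup f v" "smooth_germ Y real_dgroup g v"
  shows "smooth_germ Y real_dgroup (\<lambda>y. f y + g y) v"
proof -
  obtain W where W: "openin (dtop Y) W" "v \<in> W" "dsmooth (sub_diff Y W) real_diff f"
    using assms(1) unfolding smooth_germ_def by auto
  obtain W' where W': "openin (dtop Y) W'" "v \<in> W'" "dsmooth (sub_diff Y W') real_diff g"
    using assms(2) unfolding smooth_germ_def by auto
  have "dsmooth (sub_diff Y (W \<inter> W')) real_diff (\<lambda>y. f y + g y)"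
    by (intro dsmooth_real_add dsmooth_sub_mono[OF W(3)] dsmooth_sub_mono[OF W'(3)]) auto
  then show ?thesis unfolding smooth_germ_def using W W' by (intro exI[of _ "W \<inter> W'"]) auto
qed

lemma cochain_real_add:
  assumes "s \<in> cochains Y real_dgroup n" "t \<in> cochains Y real_dgroup n"
  shows "(\<lambda>xs y. s xs y + t xs y) \<in> cochains Y real_dgroup n"
proof -
  have "nested (dtop Y) n (\<lambda>xs. smooth_germ Y real_dgroup (s xs) (last xs) \<and> smooth_germ Y real_dgroup (t xs) (last xs))"
    using assms by (simp add: cochains_smooth_germ nested_conj)
  then show ?thesis unfolding cochains_smooth_germ by (rule nested_mono) (simp add: smooth_germ_real_add)
qed

lemma cochain_real_minus:
  assumes "s \<in> cochains Y real_dgroup n"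
  shows "(\<lambda>xs y. - s xs y) \<in> cochains Y real_dgroup n"
  using assms unfolding cochains_smooth_germ
proof (rule nested_mono)
  fix xs assume "smooth_germ Y real_dgroup (s xs) (last xs)"
  then obtain W where W: "openin (dtop Y) W" "last xs \<in> W" "dsmooth (sub_diff Y W) real_diff (s xs)"
    unfolding smooth_germ_def by auto
  show "smooth_germ Y real_dgroup (\<lambda>y. - s xs y) (last xs)"
    unfolding smooth_germ_def using W(1,2) dsmooth_real_minus[OF W(3)] by auto
qed

lemma cochain_real_diff:
  assumes "s \<in> cochains Y real_dgroup n" "t \<in> cochains Y real_dgroup n"
  shows "(\<lambda>xs y. s xs y - t xs y) \<in> cochains Y real_dgroup n"
  using cochain_real_add[OF assms(1) cochain_real_minus[OF assms(2)]] by simp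

lemma cochain_real_sum:
  assumes Y: "diffeological_space Y" and "finite I" "\<And>i. i \<in> I \<Longrightarrow> s i \<in> cochains Y real_dgroup n"
  shows "(\<lambda>xs y. \<Sum>i\<in>I. s i xs y) \<in> cochains Y real_dgroup n"
  using assms(2,3)
proof (induction I rule: finite_induct)
  case empty
  have "smooth_germ Y real_dgroup (\<lambda>_. 0) y" if "y \<in> topspace (dtop Y)" for y
    unfolding smooth_germ_def using that dsmooth_real_const[OF diffeological_sub_diff[OF Y]]
    by (intro exI[of _ "topspace (dtop Y)"]) simp
  show ?case unfolding cochains_smooth_germ
  proof (rule nested_mono[OF nested_True])
    fix xs :: "'a list" assume "length xs = Suc n" "set xs \<subseteq> topspace (dtop Y)"
    then have "last xs \<in> topspace (dtop Y)" by (metis last_in_set length_0_conv nat.distinct(1) subsetD)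
    from \<open>\<And>y. y \<in> topspace (dtop Y) \<Longrightarrow> smooth_germ Y real_dgroup (\<lambda>_. 0) y\<close>[OF this]
    show "smooth_germ Y real_dgroup (\<lambda>y. \<Sum>i\<in>{}. s i xs y) (last xs)" by simp
  qed
next
  case (insert i I)
  then show ?case using cochain_real_add[of "s i" Y n "\<lambda>xs y. \<Sum>i\<in>I. s i xs y"] by simp
qed

lemma cochain_coboundary_real:
  assumes Y: "diffeological_space Y" and s: "s \<in> cochains Y real_dgroup n"
  shows "coboundary real_dgroup n s \<in> cochains Y real_dgroup (Suc n)"
proof -
  have "(\<lambda>xs y. (- 1) ^ i * s (omit i xs) y) \<in> cochains Y real_dgroup (Suc n)" if "i \<in> {..Suc n}" for i
    using cochain_omit[OF s, of i] cochain_real_minus[OF cochain_omit[OF s, of i]] that by (cases "even i") auto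
  from cochain_real_sum[OF Y _ this, of "{..Suc n}" "\<lambda>i. i"]
  show ?thesis unfolding coboundary_real[abs_def] by simp
qed

lemma cochain_int_iff:
  assumes Y: "diffeological_space Y"
  shows "z \<in> cochains Y int_dgroup n \<longleftrightarrow> (\<lambda>xs y. real_of_int (z xs y)) \<in> cochains Y real_dgroup n"
  unfolding cochains_smooth_germ smooth_germ_def by (simp add: dsmooth_int_iff[OF diffeological_sub_diff[OF Y]])

lemma cochain_germ_eq:
  assumes Y: "diffeological_space Y" and A: "diffeological_space (dspace A)"
    and s: "s \<in> cochains Y A n" and eq: "germ_eq Y n t s"
  shows "t \<in> cochains Y A n"
proof -
  have "nested (dtop Y) n (\<lambda>xs. smooth_germ Y A (s xs) (last xs) \<and> (\<forall>\<^sub>F y in nhdsin (dtop Y) (last xs). t xs y = s xs y))"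
    using s eq by (simp add: cochains_smooth_germ germ_eq_def nested_conj)
  then show ?thesis unfolding cochains_smooth_germ
  proof (rule nested_mono)
    fix xs assume xs: "length xs = Suc n" "set xs \<subseteq> topspace (dtop Y)"
      "smooth_germ Y A (s xs) (last xs) \<and> (\<forall>\<^sub>F y in nhdsin (dtop Y) (last xs). t xs y = s xs y)"
    have "last xs \<in> topspace (dtop Y)" using xs(1,2) by (metis last_in_set length_0_conv nat.distinct(1) subsetD)
    then obtain W V where W: "openin (dtop Y) W" "last xs \<in> W" "dsmooth (sub_diff Y W) (dspace A) (s xs)"
      and V: "openin (dtop Y) V" "last xs \<in> V" "\<forall>y\<in>V. t xs y = s xs y"
      using xs(3) unfolding smooth_germ_def eventually_nhdsin by blast
    have "dsmooth (sub_diff Y (W \<inter> V)) (dspace A) (t xs)"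
      by (rule dsmooth_cong[OF diffeological_sub_diff[OF Y] A dsmooth_sub_mono[OF W(3)]]) (use V in auto)
    then show "smooth_germ Y A (t xs) (last xs)" unfolding smooth_germ_def using W V by (intro exI[of _ "W \<inter> V"]) auto
  qed
qed

text \<open>Integers are isolated among the reals, so a smooth cochain with integral values can be rounded
  without losing smoothness.\<close>

lemma cochain_floor:
  assumes Y: "diffeological_space Y" and m: "m \<in> cochains Y real_dgroup n" and i: "germs Y n (\<lambda>xs y. m xs y \<in> \<int>)"
  shows "(\<lambda>xs y. \<lfloor>m xs y\<rfloor>) \<in> cochains Y int_dgroup n" "germ_eq Y n (\<lambda>xs y. real_of_int \<lfloor>m xs y\<rfloor>) m"
proof -
  show eq: "germ_eq Y n (\<lambda>xs y. real_of_int \<lfloor>m xs y\<rfloor>) m"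
    unfolding germ_eq_germs by (rule germs_mono[OF Y i]) auto
  have "(\<lambda>xs y. real_of_int \<lfloor>m xs y\<rfloor>) \<in> cochains Y real_dgroup n"
    by (rule cochain_germ_eq[OF Y _ m eq]) (simp add: diffeological_real_diff)
  then show "(\<lambda>xs y. \<lfloor>m xs y\<rfloor>) \<in> cochains Y int_dgroup n" by (simp add: cochain_int_iff[OF Y])
qed

lemma smooth_germ_log:
  assumes Y: "diffeological_space Y" and f: "smooth_germ Y circle f y"
  shows "\<exists>l. smooth_germ Y real_dgroup l y \<and> (\<forall>\<^sub>F w in nhdsin (dtop Y) y. cis (2 * pi * l w) = f w)"
proof -
  obtain W where W: "openin (dtop Y) W" "y \<in> W" "dsmooth (sub_diff Y W) (dspace circle) f"
    using f unfolding smooth_germ_def by blast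
  note WY = openin_dtop_subset[OF W(1)]
  have f1: "cmod (f y) = 1" using dsmooth_pts[OF W(3), of y] W(2) WY by auto
  obtain A l where A: "openin (dtop (dspace circle)) A" "f y \<in> A"
    and l: "dsmooth (sub_diff (dspace circle) A) real_diff l" "\<And>z. z \<in> A \<Longrightarrow> cis (2 * pi * l z) = z"
    by (rule circle_local_log[OF f1]) (rule that)
  define V where "V = {w \<in> pts (sub_diff Y W). f w \<in> A}"
  have "openin (dtop (sub_diff Y W)) V"
    unfolding V_def by (rule dsmooth_continuous[OF diffeological_sub_diff[OF Y] W(3) A(1)])
  then have V: "openin (dtop Y) V" "V \<subseteq> W" using openin_dtop_sub[OF Y W(1)] by auto
  have yV: "y \<in> V" using W(2) WY A(2) by (auto simp: V_def)
  have "dsmooth (sub_diff Y V) (sub_diff (dspace circle) A) f"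
    by (rule dsmooth_into_sub[OF dsmooth_sub_mono[OF W(3) V(2)] _ diffeological_sub_diff[OF Y]]) (auto simp: V_def)
  from dsmooth_compose[OF this l(1)] have "dsmooth (sub_diff Y V) real_diff (\<lambda>w. l (f w))" .
  then have "smooth_germ Y real_dgroup (\<lambda>w. l (f w)) y" unfolding smooth_germ_def using V(1) yV by auto
  moreover have "\<forall>\<^sub>F w in nhdsin (dtop Y) y. cis (2 * pi * l (f w)) = f w"
    unfolding eventually_nhdsin using V(1) yV l(2) by (intro disjI2 exI[of _ V]) (auto simp: V_def)
  ultimately show ?thesis by blast
qed

lemma cochain_log:
  assumes Y: "diffeological_space Y" and c: "c \<in> cochains Y circle n"
  obtains \<theta> where "\<theta> \<in> cochains Y real_dgroup n" "germ_eq Y n (\<lambda>xs y. cis (2 * pi * \<theta> xs y)) c"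
proof -
  have "\<exists>l. smooth_germ Y circle (c xs) (last xs) \<longrightarrow> smooth_germ Y real_dgroup l (last xs) \<and>
      (\<forall>\<^sub>F w in nhdsin (dtop Y) (last xs). cis (2 * pi * l w) = c xs w)" for xs
    using smooth_germ_log[OF Y, of "c xs" "last xs"] by blast
  then obtain \<theta> where \<theta>: "\<And>xs. smooth_germ Y circle (c xs) (last xs) \<longrightarrow> smooth_germ Y real_dgroup (\<theta> xs) (last xs) \<and>
      (\<forall>\<^sub>F w in nhdsin (dtop Y) (last xs). cis (2 * pi * \<theta> xs w) = c xs w)" by metis
  note n = c[unfolded cochains_smooth_germ]
  show thesis
  proof (rule that)
    show "\<theta> \<in> cochains Y real_dgroup n" unfolding cochains_smooth_germ
      by (rule nested_mono[OF n]) (simp add: \<theta>)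
    show "germ_eq Y n (\<lambda>xs y. cis (2 * pi * \<theta> xs y)) c" unfolding germ_eq_def
      by (rule nested_mono[OF n]) (simp add: \<theta>)
  qed
qed

lemma cis_sum: "finite I \<Longrightarrow> cis (\<Sum>i\<in>I. f i) = (\<Prod>i\<in>I. cis (f i))"
  by (induction I rule: finite_induct) (simp_all add: cis_mult[symmetric])

lemma cis_coboundary:
  assumes "\<And>i. i \<le> Suc n \<Longrightarrow> cis (2 * pi * \<theta> (omit i xs) y) = c (omit i xs) y"
  shows "cis (2 * pi * coboundary real_dgroup n \<theta> xs y) = coboundary circle n c xs y"
proof -
  have "cis (2 * pi * coboundary real_dgroup n \<theta> xs y) = (\<Prod>i\<le>Suc n. cis (2 * pi * ((- 1) ^ i * \<theta> (omit i xs) y)))"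
    unfolding coboundary_real sum_distrib_left by (rule cis_sum) simp
  also have "\<dots> = (\<Prod>i\<le>Suc n. if even i then c (omit i xs) y else inverse (c (omit i xs) y))"
    by (rule prod.cong) (auto simp: cis_inverse simp flip: assms)
  also have "\<dots> = coboundary circle n c xs y"
    by (rule coboundary_circle[symmetric]) (simp flip: assms)
  finally show ?thesis .
qed

lemma cis_eq_one_imp_Ints: "cis (2 * pi * t) = 1 \<Longrightarrow> t \<in> \<int>"
proof -
  assume "cis (2 * pi * t) = 1"
  then have "cos (2 * pi * t) = 1" by (simp add: complex_eq_iff)
  then obtain k :: int where "2 * pi * t = of_int k * (2 * pi)" unfolding cos_one_2pi_int by (auto simp: mult_ac)
  then have "t = of_int k" by simp
  then show ?thesis by simp
qed

section \<open>The connecting morphism\<close>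

text \<open>The coboundary of a logarithm of a cocycle is a logarithm of \<open>1\<close>.\<close>

lemma integral_cochain:
  assumes Y: "diffeological_space Y" and c: "c \<in> cocycles Y circle n"
    and \<theta>: "\<theta> \<in> cochains Y real_dgroup n" "germ_eq Y n (\<lambda>xs y. cis (2 * pi * \<theta> xs y)) c"
  shows "germs Y (Suc n) (\<lambda>xs y. coboundary real_dgroup n \<theta> xs y \<in> \<int>)"
proof (rule germs_mono[OF Y germs_conj])
  show "germs Y (Suc n) (\<lambda>xs y. coboundary circle n c xs y = 1)"
    using c by (simp add: cocycles_def germ_eq_germs)
  show "germs Y (Suc n) (\<lambda>xs y. \<forall>i\<le>Suc n. cis (2 * pi * \<theta> (omit i xs) y) = c (omit i xs) y)"
    using germs_ball_omit[OF \<theta>(2)[unfolded germ_eq_germs]] .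
  fix xs y assume *: "coboundary circle n c xs y = 1 \<and> (\<forall>i\<le>Suc n. cis (2 * pi * \<theta> (omit i xs) y) = c (omit i xs) y)"
  then have "cis (2 * pi * coboundary real_dgroup n \<theta> xs y) = 1" using cis_coboundary[of n \<theta> xs y c] by simp
  then show "coboundary real_dgroup n \<theta> xs y \<in> \<int>" by (rule cis_eq_one_imp_Ints)
qed

lemma integral_cocycle:
  assumes Y: "diffeological_space Y" and z: "z \<in> cochains Y int_dgroup (Suc n)"
    and eq: "germ_eq Y (Suc n) (\<lambda>xs y. real_of_int (z xs y)) (coboundary real_dgroup n \<theta>)"
  shows "z \<in> cocycles Y int_dgroup (Suc n)"
proof -
  have "germs Y (Suc (Suc n)) (\<lambda>xs y. coboundary int_dgroup (Suc n) z xs y = 0)"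
  proof (rule germs_mono[OF Y germs_ball_omit[OF eq[unfolded germ_eq_germs]]])
    fix xs y assume "\<forall>i\<le>Suc (Suc n). real_of_int (z (omit i xs) y) = coboundary real_dgroup n \<theta> (omit i xs) y"
    then have "real_of_int (coboundary int_dgroup (Suc n) z xs y) = coboundary real_dgroup (Suc n) (coboundary real_dgroup n \<theta>) xs y"
      unfolding coboundary_int_real by (intro coboundary_real_cong) simp
    then show "coboundary int_dgroup (Suc n) z xs y = 0" by (simp add: coboundary_coboundary_real)
  qed
  then show ?thesis using z by (simp add: cocycles_def germ_eq_germs)
qed

lemma exists_integral_lift:
  assumes Y: "diffeological_space Y" and c: "c \<in> cocycles Y circle n"
  obtains \<theta> z where "\<theta> \<in> cochains Y real_dgroup n" "germ_eq Y n (\<lambda>xs y. cis (2 * pi * \<theta> xs y)) c"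
    "z \<in> cochains Y int_dgroup (Suc n)" "germ_eq Y (Suc n) (\<lambda>xs y. real_of_int (z xs y)) (coboundary real_dgroup n \<theta>)"
proof -
  have "c \<in> cochains Y circle n" using c by (simp add: cocycles_def)
  then obtain \<theta> where \<theta>: "\<theta> \<in> cochains Y real_dgroup n" "germ_eq Y n (\<lambda>xs y. cis (2 * pi * \<theta> xs y)) c"
    by (rule cochain_log[OF Y])
  from that[OF \<theta> cochain_floor[OF Y cochain_coboundary_real[OF Y \<theta>(1)] integral_cochain[OF Y c \<theta>]]] show thesis .
qed

text \<open>Two choices of real lifts differ, up to the coboundary
  of a lift of the comparing circle cochain, by an integral cochain; conversely every integral
  cochain can be absorbed into the real lift.\<close>

lemma connecting_eq_class:
  assumes Y: "diffeological_space Y" and h: "h \<subseteq> cocycles Y circle (Suc m)" and c: "c \<in> h"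
    and hc: "\<And>c'. c' \<in> h \<Longrightarrow> cohomologous Y circle (Suc m) c c'"
    and \<theta>: "\<theta> \<in> cochains Y real_dgroup (Suc m)" "germ_eq Y (Suc m) (\<lambda>xs y. cis (2 * pi * \<theta> xs y)) c"
    and z: "z \<in> cochains Y int_dgroup (Suc (Suc m))"
      "germ_eq Y (Suc (Suc m)) (\<lambda>xs y. real_of_int (z xs y)) (coboundary real_dgroup (Suc m) \<theta>)"
  shows "connecting Y (Suc m) h = {z' \<in> cocycles Y int_dgroup (Suc (Suc m)). cohomologous Y int_dgroup (Suc (Suc m)) z z'}"
proof (intro equalityI subsetI)
  fix z' assume "z' \<in> connecting Y (Suc m) h"
  then obtain c' \<theta>' where z': "z' \<in> cocycles Y int_dgroup (Suc (Suc m))" and c': "c' \<in> h"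
    and \<theta>': "\<theta>' \<in> cochains Y real_dgroup (Suc m)" "germ_eq Y (Suc m) (\<lambda>xs y. cis (2 * pi * \<theta>' xs y)) c'"
      "germ_eq Y (Suc (Suc m)) (\<lambda>xs y. real_of_int (z' xs y)) (coboundary real_dgroup (Suc m) \<theta>')"
    unfolding connecting_def by blast
  obtain b where b: "b \<in> cochains Y circle m" "germ_eq Y (Suc m) c (\<lambda>xs y. c' xs y * coboundary circle m b xs y)"
    using hc[OF c'] unfolding cohomologous_def by auto
  obtain \<beta> where \<beta>: "\<beta> \<in> cochains Y real_dgroup m" "germ_eq Y m (\<lambda>xs y. cis (2 * pi * \<beta> xs y)) b"
    by (rule cochain_log[OF Y b(1)])
  \<comment> \<open>The difference of the two lifts, corrected by a lift of the cochain that compares \<open>c\<close> with \<open>c'\<close>;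
    it exponentiates to \<open>1\<close>.\<close>
  define \<mu> where "\<mu> = (\<lambda>xs y. \<theta> xs y - \<theta>' xs y - coboundary real_dgroup m \<beta> xs y)"
  have \<mu>: "\<mu> \<in> cochains Y real_dgroup (Suc m)"
    unfolding \<mu>_def by (intro cochain_real_diff \<theta>(1) \<theta>'(1) cochain_coboundary_real[OF Y \<beta>(1)])
  have "germs Y (Suc m) (\<lambda>xs y. \<mu> xs y \<in> \<int>)"
  proof (rule germs_mono[OF Y germs_conj[OF germs_conj germs_conj]])
    show "germs Y (Suc m) (\<lambda>xs y. cis (2 * pi * \<theta> xs y) = c xs y)" using \<theta>(2) by (simp add: germ_eq_germs)
    show "germs Y (Suc m) (\<lambda>xs y. cis (2 * pi * \<theta>' xs y) = c' xs y)" using \<theta>'(2) by (simp add: germ_eq_germs)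
    show "germs Y (Suc m) (\<lambda>xs y. c xs y = c' xs y * coboundary circle m b xs y)" using b(2) by (simp add: germ_eq_germs)
    show "germs Y (Suc m) (\<lambda>xs y. \<forall>i\<le>Suc m. cis (2 * pi * \<beta> (omit i xs) y) = b (omit i xs) y)"
      using germs_ball_omit[OF \<beta>(2)[unfolded germ_eq_germs]] .
    fix xs y assume *: "(cis (2 * pi * \<theta> xs y) = c xs y \<and> cis (2 * pi * \<theta>' xs y) = c' xs y) \<and>
      c xs y = c' xs y * coboundary circle m b xs y \<and> (\<forall>i\<le>Suc m. cis (2 * pi * \<beta> (omit i xs) y) = b (omit i xs) y)"
    then have db: "cis (2 * pi * coboundary real_dgroup m \<beta> xs y) = coboundary circle m b xs y"
      by (intro cis_coboundary) simp
    have "2 * pi * \<theta> xs y = 2 * pi * \<mu> xs y + (2 * pi * \<theta>' xs y + 2 * pi * coboundary real_dgroup m \<beta> xs y)"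
      by (simp add: \<mu>_def algebra_simps)
    then have "cis (2 * pi * \<theta> xs y) = cis (2 * pi * \<mu> xs y) * (cis (2 * pi * \<theta>' xs y) * cis (2 * pi * coboundary real_dgroup m \<beta> xs y))"
      by (simp only: cis_mult)
    then have "cis (2 * pi * \<theta> xs y) = cis (2 * pi * \<mu> xs y) * cis (2 * pi * \<theta> xs y)" using * db by simp
    then have "cis (2 * pi * \<mu> xs y) = 1" by simp
    then show "\<mu> xs y \<in> \<int>" by (rule cis_eq_one_imp_Ints)
  qed
  note M = cochain_floor[OF Y \<mu> this]
  have "germs Y (Suc (Suc m)) (\<lambda>xs y. z xs y = z' xs y + coboundary int_dgroup (Suc m) (\<lambda>xs y. \<lfloor>\<mu> xs y\<rfloor>) xs y)"
  proof (rule germs_mono[OF Y germs_conj[OF z(2)[unfolded germ_eq_germs] germs_conj[OF \<theta>'(3)[unfolded germ_eq_germs]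
          germs_ball_omit[OF M(2)[unfolded germ_eq_germs]]]]])
    fix xs y assume *: "real_of_int (z xs y) = coboundary real_dgroup (Suc m) \<theta> xs y \<and>
      real_of_int (z' xs y) = coboundary real_dgroup (Suc m) \<theta>' xs y \<and>
      (\<forall>i\<le>Suc (Suc m). real_of_int \<lfloor>\<mu> (omit i xs) y\<rfloor> = \<mu> (omit i xs) y)"
    have "real_of_int (coboundary int_dgroup (Suc m) (\<lambda>xs y. \<lfloor>\<mu> xs y\<rfloor>) xs y) = coboundary real_dgroup (Suc m) \<mu> xs y"
      unfolding coboundary_int_real by (rule coboundary_real_cong) (use * in simp)
    also have "\<dots> = coboundary real_dgroup (Suc m) \<theta> xs y - coboundary real_dgroup (Suc m) \<theta>' xs y
        - coboundary real_dgroup (Suc m) (coboundary real_dgroup m \<beta>) xs y"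
      unfolding \<mu>_def coboundary_real[of "Suc m"] by (simp add: right_diff_distrib sum_subtractf del: sum.atMost_Suc)
    finally have "real_of_int (z xs y) = real_of_int (z' xs y + coboundary int_dgroup (Suc m) (\<lambda>xs y. \<lfloor>\<mu> xs y\<rfloor>) xs y)"
      using * by (simp add: coboundary_coboundary_real)
    then show "z xs y = z' xs y + coboundary int_dgroup (Suc m) (\<lambda>xs y. \<lfloor>\<mu> xs y\<rfloor>) xs y" by (simp only: of_int_eq_iff)
  qed
  then have "cohomologous Y int_dgroup (Suc (Suc m)) z z'"
    using M(1) by (auto simp: cohomologous_def germ_eq_germs)
  with z' show "z' \<in> {z' \<in> cocycles Y int_dgroup (Suc (Suc m)). cohomologous Y int_dgroup (Suc (Suc m)) z z'}" by simp
next
  fix z' assume "z' \<in> {z' \<in> cocycles Y int_dgroup (Suc (Suc m)). cohomologous Y int_dgroup (Suc (Suc m)) z z'}"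
  then obtain b where z': "z' \<in> cocycles Y int_dgroup (Suc (Suc m))" and b: "b \<in> cochains Y int_dgroup (Suc m)"
      "germ_eq Y (Suc (Suc m)) z (\<lambda>xs y. z' xs y + coboundary int_dgroup (Suc m) b xs y)"
    unfolding cohomologous_def by auto
  \<comment> \<open>Subtracting an integral cochain changes the coboundary but not the exponential.\<close>
  define \<theta>' where "\<theta>' = (\<lambda>xs y. \<theta> xs y - real_of_int (b xs y))"
  have "\<theta>' \<in> cochains Y real_dgroup (Suc m)"
    unfolding \<theta>'_def by (intro cochain_real_diff \<theta>(1)) (use b(1) in \<open>simp add: cochain_int_iff[OF Y]\<close>)
  moreover have "germ_eq Y (Suc m) (\<lambda>xs y. cis (2 * pi * \<theta>' xs y)) c"
    unfolding germ_eq_germs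
  proof (rule germs_mono[OF Y \<theta>(2)[unfolded germ_eq_germs]])
    fix xs y assume "cis (2 * pi * \<theta> xs y) = c xs y"
    moreover have "cis (2 * pi * \<theta>' xs y) * cis (2 * pi * real_of_int (b xs y)) = cis (2 * pi * \<theta> xs y)"
      unfolding cis_mult by (simp add: \<theta>'_def right_diff_distrib)
    moreover have "cis (2 * pi * real_of_int (b xs y)) = 1" by (rule cis_multiple_2pi) simp
    ultimately show "cis (2 * pi * \<theta>' xs y) = c xs y" by simp
  qed
  moreover have "germ_eq Y (Suc (Suc m)) (\<lambda>xs y. real_of_int (z' xs y)) (coboundary real_dgroup (Suc m) \<theta>')"
    unfolding germ_eq_germs
  proof (rule germs_mono[OF Y germs_conj[OF z(2)[unfolded germ_eq_germs] b(2)[unfolded germ_eq_germs]]])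
    fix xs y assume *: "real_of_int (z xs y) = coboundary real_dgroup (Suc m) \<theta> xs y \<and>
      z xs y = z' xs y + coboundary int_dgroup (Suc m) b xs y"
    have "coboundary real_dgroup (Suc m) \<theta>' xs y = coboundary real_dgroup (Suc m) \<theta> xs y - real_of_int (coboundary int_dgroup (Suc m) b xs y)"
      unfolding \<theta>'_def coboundary_int_real coboundary_real by (simp add: right_diff_distrib sum_subtractf del: sum.atMost_Suc)
    also have "\<dots> = real_of_int (z xs y - coboundary int_dgroup (Suc m) b xs y)" using * by simp
    also have "z xs y - coboundary int_dgroup (Suc m) b xs y = z' xs y" using * by simp
    finally show "real_of_int (z' xs y) = coboundary real_dgroup (Suc m) \<theta>' xs y" by simp
  qed
  ultimately show "z' \<in> connecting Y (Suc m) h" unfolding connecting_def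
    by (intro CollectI conjI z' bexI[of _ c] bexI[of _ \<theta>'] c)
qed

section \<open>Central extensions and transition functions\<close>

locale circle_extension =
  fixes G :: "'g dgroup" and Gh :: "'h dgroup" and \<iota> :: "complex \<Rightarrow> 'h" and \<pi> :: "'h \<Rightarrow> 'g"
  assumes ext: "central_extension G Gh \<iota> \<pi>"
begin

abbreviation gh_mult (infixl "\<cdot>" 70) where "h \<cdot> k \<equiv> h \<otimes>\<^bsub>Gh\<^esub> k"

lemma dgroups: "diffeological_group G" "diffeological_group Gh"
  using ext by (simp_all add: central_extension_def diffeological_Lie_group_def)

sublocale base: group G by (rule diffeological_groupD[OF dgroups(1)])
sublocale gh: group Gh by (rule diffeological_groupD[OF dgroups(2)])

text \<open>The circle bundle by which the extension fibres over \<open>G\<close>.\<close>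

definition extension_bundle where
  "extension_bundle = \<lparr>tot = dspace Gh, proj = \<pi>, gact = (\<lambda>z h. \<iota> z \<cdot> h)\<rparr>"

lemma extension_bundle_simps [simp]: "tot extension_bundle = dspace Gh" "proj extension_bundle = \<pi>" "gact extension_bundle = (\<lambda>z h. \<iota> z \<cdot> h)"
  by (simp_all add: extension_bundle_def)

sublocale fib: principal circle "dspace G" extension_bundle
proof
  show "diffeological_group circle" by (rule diffeological_group_circle)
  show "diffeological_space (dspace G)" by (rule diffeological_groupD[OF dgroups(1)])
  show "principal_bundle circle (dspace G) extension_bundle" using ext by (simp add: central_extension_def extension_bundle_def)
qed

lemma pts_G [simp]: "pts (dspace G) = carrier G" and pts_Gh [simp]: "pts (dspace Gh) = carrier Gh"
  using diffeological_groupD dgroups by blast+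

lemma pi_smooth: "dsmooth (dspace Gh) (dspace G) \<pi>"
  using ext by (simp add: central_extension_def)

lemma pi_closed [simp]: "h \<in> carrier Gh \<Longrightarrow> \<pi> h \<in> carrier G"
  and pi_mult [simp]: "h \<in> carrier Gh \<Longrightarrow> k \<in> carrier Gh \<Longrightarrow> \<pi> (h \<cdot> k) = \<pi> h \<otimes>\<^bsub>G\<^esub> \<pi> k"
proof -
  have "\<pi> \<in> hom Gh G" using ext by (simp add: central_extension_def)
  then show "h \<in> carrier Gh \<Longrightarrow> \<pi> h \<in> carrier G"
    "h \<in> carrier Gh \<Longrightarrow> k \<in> carrier Gh \<Longrightarrow> \<pi> (h \<cdot> k) = \<pi> h \<otimes>\<^bsub>G\<^esub> \<pi> k"
    by (auto simp: hom_def)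
qed

lemma pi_one [simp]: "\<pi> \<one>\<^bsub>Gh\<^esub> = \<one>\<^bsub>G\<^esub>"
proof -
  have "\<pi> \<one>\<^bsub>Gh\<^esub> \<otimes>\<^bsub>G\<^esub> \<pi> \<one>\<^bsub>Gh\<^esub> = \<pi> \<one>\<^bsub>Gh\<^esub>" using pi_mult[of "\<one>\<^bsub>Gh\<^esub>" "\<one>\<^bsub>Gh\<^esub>"] by simp
  then show ?thesis using base.r_cancel_one[of "\<pi> \<one>\<^bsub>Gh\<^esub>" "\<pi> \<one>\<^bsub>Gh\<^esub>"] by simp
qed

lemma iota_closed [simp]: "cmod z = 1 \<Longrightarrow> \<iota> z \<in> carrier Gh"
  and iota_mult: "cmod z = 1 \<Longrightarrow> cmod w = 1 \<Longrightarrow> \<iota> (z * w) = \<iota> z \<cdot> \<iota> w"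
  and iota_central: "cmod z = 1 \<Longrightarrow> h \<in> carrier Gh \<Longrightarrow> h \<cdot> \<iota> z = \<iota> z \<cdot> h"
  and iota_inj: "cmod z = 1 \<Longrightarrow> cmod w = 1 \<Longrightarrow> \<iota> z = \<iota> w \<Longrightarrow> z = w"
  and pi_iota [simp]: "cmod z = 1 \<Longrightarrow> \<pi> (\<iota> z) = \<one>\<^bsub>G\<^esub>"
proof -
  have h: "\<iota> \<in> hom circle Gh" and k: "\<iota> ` carrier circle = kernel Gh G \<pi>"
    and inj: "inj_on \<iota> (carrier circle)"
    and c: "\<forall>z\<in>carrier circle. \<forall>h\<in>carrier Gh. \<iota> z \<cdot> h = h \<cdot> \<iota> z"
    using ext by (simp_all add: central_extension_def)
  show "cmod z = 1 \<Longrightarrow> \<iota> z \<in> carrier Gh"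
    "cmod z = 1 \<Longrightarrow> cmod w = 1 \<Longrightarrow> \<iota> (z * w) = \<iota> z \<cdot> \<iota> w"
    using h by (auto simp: hom_def)
  show "cmod z = 1 \<Longrightarrow> h \<in> carrier Gh \<Longrightarrow> h \<cdot> \<iota> z = \<iota> z \<cdot> h"
    using c by simp
  show "cmod z = 1 \<Longrightarrow> cmod w = 1 \<Longrightarrow> \<iota> z = \<iota> w \<Longrightarrow> z = w"
    using inj by (simp add: inj_on_def)
  show "\<pi> (\<iota> z) = \<one>\<^bsub>G\<^esub>" if "cmod z = 1"
  proof -
    have "\<iota> z \<in> \<iota> ` carrier circle" using that by simp
    then show ?thesis unfolding k by (simp add: kernel_def)
  qed
qed

lemma iota_one [simp]: "\<iota> 1 = \<one>\<^bsub>Gh\<^esub>"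
proof -
  have "\<iota> 1 \<cdot> \<iota> 1 = \<iota> 1" using iota_mult[of 1 1] by simp
  then show ?thesis using gh.r_cancel_one[of "\<iota> 1" "\<iota> 1"] by simp
qed

lemma iota_cancel:
  assumes "cmod z = 1" "cmod w = 1" "h \<in> carrier Gh" "\<iota> z \<cdot> h = \<iota> w \<cdot> h"
  shows "z = w"
  by (rule iota_inj) (use assms in simp_all)

text \<open>The circle element by which two elements over the same point of \<open>G\<close> differ.\<close>

definition circle_quotient :: "'h \<Rightarrow> 'h \<Rightarrow> complex" where
  "circle_quotient h k = translation circle extension_bundle k h"

lemma circle_quotient:
  assumes "h \<in> carrier Gh" "k \<in> carrier Gh" "\<pi> h = \<pi> k"
  shows "cmod (circle_quotient h k) = 1" "h = \<iota> (circle_quotient h k) \<cdot> k"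
  using fib.translation[of k h] assms by (simp_all add: circle_quotient_def)

lemma circle_quotient_smooth:
  assumes Y: "diffeological_space Y"
    and h: "dsmooth Y (dspace Gh) h" and k: "dsmooth Y (dspace Gh) k" and eq: "\<And>y. y \<in> pts Y \<Longrightarrow> \<pi> (h y) = \<pi> (k y)"
  shows "dsmooth Y (dspace circle) (\<lambda>y. circle_quotient (h y) (k y))"
proof (rule dsmoothI)
  show "circle_quotient (h y) (k y) \<in> pts (dspace circle)" if "y \<in> pts Y" for y
    using circle_quotient(1)[of "h y" "k y"] dsmooth_pts[OF h that] dsmooth_pts[OF k that] eq[OF that] by simp
  show "plot (dspace circle) n U (\<lambda>u. circle_quotient (h (p u)) (k (p u)))" if p: "plot Y n U p" for n U p
    unfolding circle_quotient_def
  proof (rule fib.translation_plot)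
    show "plot (tot extension_bundle) n U (\<lambda>u. k (p u))" using dsmooth_plot[OF k p] by simp
    show "plot (tot extension_bundle) n U (\<lambda>u. h (p u))" using dsmooth_plot[OF h p] by simp
    show "proj extension_bundle (k (p u)) = proj extension_bundle (h (p u))" if "u \<in> U" for u using eq[OF plot_pts[OF Y p that]] by simp
  qed
qed

lemma local_section_pi:
  assumes "g \<in> carrier G"
  obtains A \<sigma> where "openin (dtop (dspace G)) A" "g \<in> A" "dsmooth (sub_diff (dspace G) A) (dspace Gh) \<sigma>" "\<And>a. a \<in> A \<Longrightarrow> \<pi> (\<sigma> a) = a"
proof -
  have "g \<in> pts (dspace G)" using assms by simp
  then show thesis by (rule fib.local_section[unfolded extension_bundle_simps]) (rule that)
qed

lemma lift_smooth:
  assumes Y: "diffeological_space Y" and W: "openin (dtop Y) W" "y \<in> W" and g: "dsmooth (sub_diff Y W) (dspace G) g"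
  obtains V \<gamma> where "openin (dtop Y) V" "y \<in> V" "V \<subseteq> W" "dsmooth (sub_diff Y V) (dspace Gh) \<gamma>" "\<And>v. v \<in> V \<Longrightarrow> \<pi> (\<gamma> v) = g v"
proof -
  note WY = openin_dtop_subset[OF W(1)]
  have "g y \<in> carrier G" using dsmooth_pts[OF g, of y] W(2) WY by auto
  then obtain A \<sigma> where A: "openin (dtop (dspace G)) A" "g y \<in> A"
    and \<sigma>: "dsmooth (sub_diff (dspace G) A) (dspace Gh) \<sigma>" "\<And>a. a \<in> A \<Longrightarrow> \<pi> (\<sigma> a) = a"
    by (rule local_section_pi) (rule that)
  define V where "V = {w \<in> pts (sub_diff Y W). g w \<in> A}"
  have "openin (dtop (sub_diff Y W)) V"
    unfolding V_def by (rule dsmooth_continuous[OF diffeological_sub_diff[OF Y] g A(1)])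
  then have V: "openin (dtop Y) V" "V \<subseteq> W" using openin_dtop_sub[OF Y W(1)] by auto
  have "dsmooth (sub_diff Y V) (sub_diff (dspace G) A) g"
    by (rule dsmooth_into_sub[OF dsmooth_sub_mono[OF g V(2)] _ diffeological_sub_diff[OF Y]]) (auto simp: V_def)
  from dsmooth_compose[OF this \<sigma>(1)] have "dsmooth (sub_diff Y V) (dspace Gh) (\<lambda>v. \<sigma> (g v))" .
  moreover have "y \<in> V" using W(2) WY A(2) by (auto simp: V_def)
  ultimately show thesis using that[of V "\<lambda>v. \<sigma> (g v)"] V \<sigma>(2) by (simp add: V_def)
qed

lemma lift_plot:
  assumes g: "plot (dspace G) n U g" and u: "u \<in> U"
  obtains V \<gamma> where "openin (Euclidean_space n) V" "u \<in> V" "V \<subseteq> U" "plot (dspace Gh) n V \<gamma>" "\<And>v. v \<in> V \<Longrightarrow> \<pi> (\<gamma> v) = g v"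
proof -
  have "g u \<in> carrier G" by (rule gplot_carrier[OF dgroups(1) g u])
  then obtain A \<sigma> where A: "openin (dtop (dspace G)) A" "g u \<in> A"
    and \<sigma>: "dsmooth (sub_diff (dspace G) A) (dspace Gh) \<sigma>" "\<And>a. a \<in> A \<Longrightarrow> \<pi> (\<sigma> a) = a"
    by (rule local_section_pi) (rule that)
  define V where "V = {v \<in> U. g v \<in> A}"
  have V: "openin (Euclidean_space n) V" "u \<in> V" "V \<subseteq> U"
    using plot_preimage_open[OF g A(1)] u A(2) by (auto simp: V_def)
  have "plot (sub_diff (dspace G) A) n V g"
    using plot_restrict_open[OF diffeological_groupD(2)[OF dgroups(1)] g A(1)] by (auto simp: V_def)
  from dsmooth_plot[OF \<sigma>(1) this] show thesis using that[of V "\<lambda>v. \<sigma> (g v)"] V \<sigma>(2) by (simp add: V_def)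
qed

end

text \<open>The choices from which the class is computed: sections \<open>s x\<close> on neighbourhoods \<open>U x\<close>, lifts
  \<open>\<gamma> x y\<close> of the transition functions to the extension, defined near \<open>y\<close> only, and the circle-valued
  function \<open>c\<close> by which the lifts fail to be multiplicative.  The neighbourhoods \<open>V x y\<close> depend on \<open>y\<close>
  because a transition function need not lift on all of \<open>U x \<inter> U y\<close>.\<close>

definition cech_data ::
    "'h dgroup \<Rightarrow> (complex \<Rightarrow> 'h) \<Rightarrow> ('h \<Rightarrow> 'g) \<Rightarrow> 'y diffeology \<Rightarrow> ('g, 'p, 'y) gbundle \<Rightarrow>
      ('y \<Rightarrow> 'y set) \<Rightarrow> ('y \<Rightarrow> 'y \<Rightarrow> 'p) \<Rightarrow> ('y \<Rightarrow> 'y \<Rightarrow> 'y set) \<Rightarrow> ('y \<Rightarrow> 'y \<Rightarrow> 'y \<Rightarrow> 'h) \<Rightarrow> ('y, complex) cochain \<Rightarrow> bool" where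
  "cech_data Gh \<iota> \<pi> Y Q U s V \<gamma> c \<longleftrightarrow>
    (\<forall>x\<in>pts Y. openin (dtop Y) (U x) \<and> x \<in> U x \<and> dsmooth (sub_diff Y (U x)) (tot Q) (s x) \<and>
       (\<forall>u\<in>U x. proj Q (s x u) = u)) \<and>
    (\<forall>x\<in>pts Y. \<forall>y\<in>U x. openin (dtop Y) (V x y) \<and> y \<in> V x y \<and> V x y \<subseteq> U x \<inter> U y \<and>
       dsmooth (sub_diff Y (V x y)) (dspace Gh) (\<gamma> x y) \<and>
       (\<forall>u\<in>V x y. s x u = gact Q (\<pi> (\<gamma> x y u)) (s y u))) \<and>
    (\<forall>x\<in>pts Y. \<forall>y\<in>U x. \<forall>z\<in>V x y.
       dsmooth (sub_diff Y (V x y \<inter> V y z \<inter> V x z)) (dspace circle) (c [x, y, z]) \<and>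
       (\<forall>u\<in>V x y \<inter> V y z \<inter> V x z. \<gamma> x y u \<otimes>\<^bsub>Gh\<^esub> \<gamma> y z u = \<iota> (c [x, y, z] u) \<otimes>\<^bsub>Gh\<^esub> \<gamma> x z u))"

lemma cech_dataD:
  assumes "cech_data Gh \<iota> \<pi> Y Q U s V \<gamma> c" and x: "x \<in> pts Y"
  shows cech_U: "openin (dtop Y) (U x)" "x \<in> U x"
    and cech_s: "dsmooth (sub_diff Y (U x)) (tot Q) (s x)" "\<And>u. u \<in> U x \<Longrightarrow> proj Q (s x u) = u"
    and cech_V: "\<And>y. y \<in> U x \<Longrightarrow> openin (dtop Y) (V x y)" "\<And>y. y \<in> U x \<Longrightarrow> y \<in> V x y"
      "\<And>y u. y \<in> U x \<Longrightarrow> u \<in> V x y \<Longrightarrow> u \<in> U x" "\<And>y u. y \<in> U x \<Longrightarrow> u \<in> V x y \<Longrightarrow> u \<in> U y"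
    and cech_gamma: "\<And>y. y \<in> U x \<Longrightarrow> dsmooth (sub_diff Y (V x y)) (dspace Gh) (\<gamma> x y)"
      "\<And>y u. y \<in> U x \<Longrightarrow> u \<in> V x y \<Longrightarrow> s x u = gact Q (\<pi> (\<gamma> x y u)) (s y u)"
    and cech_c: "\<And>y z. y \<in> U x \<Longrightarrow> z \<in> V x y \<Longrightarrow> dsmooth (sub_diff Y (V x y \<inter> V y z \<inter> V x z)) (dspace circle) (c [x, y, z])"
      "\<And>y z u. y \<in> U x \<Longrightarrow> z \<in> V x y \<Longrightarrow> u \<in> V x y \<Longrightarrow> u \<in> V y z \<Longrightarrow> u \<in> V x z \<Longrightarrow>
         \<gamma> x y u \<otimes>\<^bsub>Gh\<^esub> \<gamma> y z u = \<iota> (c [x, y, z] u) \<otimes>\<^bsub>Gh\<^esub> \<gamma> x z u"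
proof -
  note A = assms(1)[unfolded cech_data_def]
  have 1: "openin (dtop Y) (U x) \<and> x \<in> U x \<and> dsmooth (sub_diff Y (U x)) (tot Q) (s x) \<and> (\<forall>u\<in>U x. proj Q (s x u) = u)"
    and 2: "\<forall>y\<in>U x. openin (dtop Y) (V x y) \<and> y \<in> V x y \<and> V x y \<subseteq> U x \<inter> U y \<and>
       dsmooth (sub_diff Y (V x y)) (dspace Gh) (\<gamma> x y) \<and> (\<forall>u\<in>V x y. s x u = gact Q (\<pi> (\<gamma> x y u)) (s y u))"
    and 3: "\<forall>y\<in>U x. \<forall>z\<in>V x y. dsmooth (sub_diff Y (V x y \<inter> V y z \<inter> V x z)) (dspace circle) (c [x, y, z]) \<and>
       (\<forall>u\<in>V x y \<inter> V y z \<inter> V x z. \<gamma> x y u \<otimes>\<^bsub>Gh\<^esub> \<gamma> y z u = \<iota> (c [x, y, z] u) \<otimes>\<^bsub>Gh\<^esub> \<gamma> x z u)"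
    by (rule bspec[OF conjunct1[OF A] x] bspec[OF conjunct1[OF conjunct2[OF A]] x] bspec[OF conjunct2[OF conjunct2[OF A]] x])+
  from 1 show "openin (dtop Y) (U x)" "x \<in> U x" "dsmooth (sub_diff Y (U x)) (tot Q) (s x)"
    "\<And>u. u \<in> U x \<Longrightarrow> proj Q (s x u) = u" by simp_all
  fix y assume y: "y \<in> U x"
  note 2 = bspec[OF 2 y] and 3 = bspec[OF 3 y]
  from 2 show "openin (dtop Y) (V x y)" "y \<in> V x y" "\<And>u. u \<in> V x y \<Longrightarrow> u \<in> U x" "\<And>u. u \<in> V x y \<Longrightarrow> u \<in> U y"
    "dsmooth (sub_diff Y (V x y)) (dspace Gh) (\<gamma> x y)" by auto
  from 2 have "\<forall>u\<in>V x y. s x u = gact Q (\<pi> (\<gamma> x y u)) (s y u)" by (elim conjE)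
  then show "\<And>u. u \<in> V x y \<Longrightarrow> s x u = gact Q (\<pi> (\<gamma> x y u)) (s y u)" by (rule bspec)
  fix z assume z: "z \<in> V x y"
  note 3 = bspec[OF 3 z]
  from conjunct1[OF 3] show "dsmooth (sub_diff Y (V x y \<inter> V y z \<inter> V x z)) (dspace circle) (c [x, y, z])" .
  fix u assume "u \<in> V x y" "u \<in> V y z" "u \<in> V x z"
  then have "u \<in> V x y \<inter> V y z \<inter> V x z" by simp
  from bspec[OF conjunct2[OF 3] this]
  show "\<gamma> x y u \<otimes>\<^bsub>Gh\<^esub> \<gamma> y z u = \<iota> (c [x, y, z] u) \<otimes>\<^bsub>Gh\<^esub> \<gamma> x z u" .
qed

lemma eventually_nhdsin_open: "openin T S \<Longrightarrow> a \<in> S \<Longrightarrow> (\<And>y. y \<in> S \<Longrightarrow> P y) \<Longrightarrow> \<forall>\<^sub>F y in nhdsin T a. P y"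
  unfolding eventually_nhdsin by blast

text \<open>Short nested tuples may be assumed to lie in prescribed neighbourhoods.\<close>

lemma nested1I:
  assumes Y: "diffeological_space Y" and U: "\<And>x. x \<in> pts Y \<Longrightarrow> openin (dtop Y) (U x) \<and> x \<in> U x"
    and R: "\<And>x y. x \<in> pts Y \<Longrightarrow> y \<in> U x \<Longrightarrow> R [x, y]"
  shows "nested (dtop Y) (Suc 0) R"
  unfolding nested_def topspace_dtop[OF Y]
proof
  fix x assume x: "x \<in> pts Y"
  have "\<forall>\<^sub>F y in nhdsin (dtop Y) x. R [x, y]"
    using U[OF x] by (intro eventually_nhdsin_open[of _ "U x"]) (auto intro: R x)
  then show "nested_from (dtop Y) (Suc 0) R [x]" by simp
qed

lemma nested2I:
  assumes Y: "diffeological_space Y" and U: "\<And>x. x \<in> pts Y \<Longrightarrow> openin (dtop Y) (U x) \<and> x \<in> U x"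
    and V: "\<And>x y. x \<in> pts Y \<Longrightarrow> y \<in> U x \<Longrightarrow> openin (dtop Y) (V x y) \<and> y \<in> V x y"
    and R: "\<And>x y z. x \<in> pts Y \<Longrightarrow> y \<in> U x \<Longrightarrow> z \<in> V x y \<Longrightarrow> R [x, y, z]"
  shows "nested (dtop Y) (Suc (Suc 0)) R"
  unfolding nested_def topspace_dtop[OF Y]
proof
  fix x assume x: "x \<in> pts Y"
  have "\<forall>\<^sub>F y in nhdsin (dtop Y) x. \<forall>\<^sub>F z in nhdsin (dtop Y) y. R [x, y, z]"
  proof (rule eventually_nhdsin_open[of _ "U x"])
    fix y assume y: "y \<in> U x"
    show "\<forall>\<^sub>F z in nhdsin (dtop Y) y. R [x, y, z]"
      using V[OF x y] by (intro eventually_nhdsin_open[of _ "V x y"]) (auto intro: R x y)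
  qed (use U[OF x] in auto)
  then show "nested_from (dtop Y) (Suc (Suc 0)) R [x]" by simp
qed

lemma nested3I:
  assumes Y: "diffeological_space Y" and U: "\<And>x. x \<in> pts Y \<Longrightarrow> openin (dtop Y) (U x) \<and> x \<in> U x"
    and V: "\<And>x y. x \<in> pts Y \<Longrightarrow> y \<in> U x \<Longrightarrow> openin (dtop Y) (V x y) \<and> y \<in> V x y"
    and W: "\<And>x y z. x \<in> pts Y \<Longrightarrow> y \<in> U x \<Longrightarrow> z \<in> V x y \<Longrightarrow> openin (dtop Y) (W x y z) \<and> z \<in> W x y z"
    and R: "\<And>x y z w. x \<in> pts Y \<Longrightarrow> y \<in> U x \<Longrightarrow> z \<in> V x y \<Longrightarrow> w \<in> W x y z \<Longrightarrow> R [x, y, z, w]"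
  shows "nested (dtop Y) (Suc (Suc (Suc 0))) R"
  unfolding nested_def topspace_dtop[OF Y]
proof
  fix x assume x: "x \<in> pts Y"
  have "\<forall>\<^sub>F y in nhdsin (dtop Y) x. \<forall>\<^sub>F z in nhdsin (dtop Y) y. \<forall>\<^sub>F w in nhdsin (dtop Y) z. R [x, y, z, w]"
  proof (rule eventually_nhdsin_open[of _ "U x"])
    fix y assume y: "y \<in> U x"
    show "\<forall>\<^sub>F z in nhdsin (dtop Y) y. \<forall>\<^sub>F w in nhdsin (dtop Y) z. R [x, y, z, w]"
    proof (rule eventually_nhdsin_open[of _ "V x y"])
      fix z assume z: "z \<in> V x y"
      show "\<forall>\<^sub>F w in nhdsin (dtop Y) z. R [x, y, z, w]"
        using W[OF x y z] by (intro eventually_nhdsin_open[of _ "W x y z"]) (auto intro: R x y z)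
    qed (use V[OF x y] in auto)
  qed (use U[OF x] in auto)
  then show "nested_from (dtop Y) (Suc (Suc (Suc 0))) R [x]" by simp
qed

locale lifting_problem = circle_extension G Gh \<iota> \<pi> + pb: principal G Y Q
  for G :: "'g dgroup" and Gh :: "'h dgroup" and \<iota> :: "complex \<Rightarrow> 'h" and \<pi> :: "'h \<Rightarrow> 'g"
    and Y :: "'y diffeology" and Q :: "('g, 'p, 'y) gbundle"
begin

lemma transition_smooth:
  assumes s: "dsmooth (sub_diff Y W) (tot Q) s" "dsmooth (sub_diff Y W) (tot Q) t"
    and eq: "\<And>u. u \<in> W \<Longrightarrow> u \<in> pts Y \<Longrightarrow> proj Q (s u) = proj Q (t u)"
  shows "dsmooth (sub_diff Y W) (dspace G) (\<lambda>u. translation G Q (s u) (t u))"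
proof (rule dsmoothI)
  show "translation G Q (s u) (t u) \<in> pts (dspace G)" if "u \<in> pts (sub_diff Y W)" for u
    using pb.translation(1)[OF dsmooth_pts[OF s(1) that] dsmooth_pts[OF s(2) that] eq] that by simp
  show "plot (dspace G) n U (\<lambda>u. translation G Q (s (p u)) (t (p u)))" if p: "plot (sub_diff Y W) n U p" for n U p
  proof (rule pb.translation_plot[OF dsmooth_plot[OF s(1) p] dsmooth_plot[OF s(2) p]])
    fix u assume "u \<in> U"
    from plot_pts[OF diffeological_sub_diff[OF pb.Y] p this]
    show "proj Q (s (p u)) = proj Q (t (p u))" using eq by simp
  qed
qed

text \<open>Transition functions are translations between sections, hence smooth, and the local sections of the
  extension lift them near any given point.\<close>

lemma exists_cech_data: "\<exists>U s V \<gamma> c. cech_data Gh \<iota> \<pi> Y Q U s V \<gamma> c"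
proof -
  define P where "P x p \<longleftrightarrow> openin (dtop Y) (fst p) \<and> x \<in> fst p \<and> dsmooth (sub_diff Y (fst p)) (tot Q) (snd p) \<and>
       (\<forall>u\<in>fst p. proj Q (snd p u) = u)" for x p
  have "\<forall>x\<in>pts Y. \<exists>p. P x p"
  proof
    fix x assume "x \<in> pts Y"
    then obtain U \<sigma> where "openin (dtop Y) U" "x \<in> U" "dsmooth (sub_diff Y U) (tot Q) \<sigma>" "\<And>u. u \<in> U \<Longrightarrow> proj Q (\<sigma> u) = u"
      by (rule pb.local_section) (rule that)
    then have "P x (U, \<sigma>)" by (simp add: P_def)
    then show "\<exists>p. P x p" by (rule exI)
  qed
  then obtain us where us: "\<forall>x\<in>pts Y. P x (us x)" by (rule bchoice[elim_format]) (elim exE)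
  define U where "U x = fst (us x)" for x
  define s where "s x = snd (us x)" for x
  have U: "openin (dtop Y) (U x)" "x \<in> U x" and s: "dsmooth (sub_diff Y (U x)) (tot Q) (s x)"
    and ps: "\<And>u. u \<in> U x \<Longrightarrow> proj Q (s x u) = u" if "x \<in> pts Y" for x
    using us that by (simp_all add: P_def U_def s_def)
  have UY: "U x \<subseteq> pts Y" if "x \<in> pts Y" for x using openin_dtop_subset[OF U(1)[OF that]] .
  have sp: "s x u \<in> pts (tot Q)" if "x \<in> pts Y" "u \<in> U x" for x u
    using dsmooth_pts[OF s[OF that(1)], of u] that UY by auto
  define P2 where "P2 xy p \<longleftrightarrow> (case xy of (x, y) \<Rightarrow> openin (dtop Y) (fst p) \<and> y \<in> fst p \<and> fst p \<subseteq> U x \<inter> U y \<and>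
      dsmooth (sub_diff Y (fst p)) (dspace Gh) (snd p) \<and> (\<forall>u\<in>fst p. s x u = gact Q (\<pi> (snd p u)) (s y u)))" for xy p
  have "\<forall>xy\<in>Sigma (pts Y) U. \<exists>p. P2 xy p"
  proof
    fix xy assume "xy \<in> Sigma (pts Y) U"
    then obtain x y where xy: "xy = (x, y)" "x \<in> pts Y" "y \<in> U x" by blast
    have y: "y \<in> pts Y" using UY xy by blast
    let ?W = "U x \<inter> U y"
    have W: "openin (dtop Y) ?W" "y \<in> ?W" using U[OF xy(2)] U[OF y] xy(3) by auto
    have "dsmooth (sub_diff Y ?W) (dspace G) (\<lambda>u. translation G Q (s y u) (s x u))"
      by (rule transition_smooth[OF dsmooth_sub_mono[OF s[OF y]] dsmooth_sub_mono[OF s[OF xy(2)]]])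
        (use ps xy y in auto)
    from lift_smooth[OF pb.Y W this] obtain V \<gamma> where V: "openin (dtop Y) V" "y \<in> V" "V \<subseteq> ?W"
      "dsmooth (sub_diff Y V) (dspace Gh) \<gamma>" and g: "\<And>v. v \<in> V \<Longrightarrow> \<pi> (\<gamma> v) = translation G Q (s y v) (s x v)"
      by blast
    have "s x u = gact Q (\<pi> (\<gamma> u)) (s y u)" if "u \<in> V" for u
    proof -
      have "u \<in> U x" "u \<in> U y" using that V(3) by auto
      then show ?thesis using g[OF that] pb.translation(2)[of "s y u" "s x u"] sp ps xy(2) y by simp
    qed
    then have "P2 xy (V, \<gamma>)" using V by (simp add: P2_def xy(1))
    then show "\<exists>p. P2 xy p" by (rule exI)
  qed
  then obtain vg where vg: "\<forall>xy\<in>Sigma (pts Y) U. P2 xy (vg xy)" by (rule bchoice[elim_format]) (elim exE)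
  define V where "V x y = fst (vg (x, y))" for x y
  define \<gamma> where "\<gamma> x y = snd (vg (x, y))" for x y
  have V: "openin (dtop Y) (V x y)" "y \<in> V x y" "V x y \<subseteq> U x \<inter> U y"
    and g: "dsmooth (sub_diff Y (V x y)) (dspace Gh) (\<gamma> x y)"
    and sg: "\<forall>u\<in>V x y. s x u = gact Q (\<pi> (\<gamma> x y u)) (s y u)" if "x \<in> pts Y" "y \<in> U x" for x y
  proof -
    have "(x, y) \<in> Sigma (pts Y) U" using that by blast
    from bspec[OF vg this] show "openin (dtop Y) (V x y)" "y \<in> V x y" "V x y \<subseteq> U x \<inter> U y"
      "dsmooth (sub_diff Y (V x y)) (dspace Gh) (\<gamma> x y)" "\<forall>u\<in>V x y. s x u = gact Q (\<pi> (\<gamma> x y u)) (s y u)"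
      by (simp_all add: P2_def V_def \<gamma>_def)
  qed
  define c where "c xs u = circle_quotient (\<gamma> (xs ! 0) (xs ! 1) u \<cdot> \<gamma> (xs ! 1) (xs ! 2) u) (\<gamma> (xs ! 0) (xs ! 2) u)" for xs u
  have "cech_data Gh \<iota> \<pi> Y Q U s V \<gamma> c"
    unfolding cech_data_def
  proof (intro conjI ballI)
    fix x y z assume x: "x \<in> pts Y" and y: "y \<in> U x" and z: "z \<in> V x y"
    have yp: "y \<in> pts Y" and zx: "z \<in> U x" and zy: "z \<in> U y" and zp: "z \<in> pts Y"
      using UY x y z V(3)[OF x y] by blast+
    let ?W = "V x y \<inter> V y z \<inter> V x z"
    have gp: "\<gamma> x y u \<in> carrier Gh" "\<gamma> y z u \<in> carrier Gh" "\<gamma> x z u \<in> carrier Gh" if "u \<in> ?W" for u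
    proof -
      have u: "u \<in> pts Y" using that V(3)[OF x y] UY[OF x] by blast
      show "\<gamma> x y u \<in> carrier Gh" using dsmooth_pts[OF g[OF x y], of u] that u by simp
      show "\<gamma> y z u \<in> carrier Gh" using dsmooth_pts[OF g[OF yp zy], of u] that u by simp
      show "\<gamma> x z u \<in> carrier Gh" using dsmooth_pts[OF g[OF x zx], of u] that u by simp
    qed
    have eq: "\<pi> (\<gamma> x y u \<cdot> \<gamma> y z u) = \<pi> (\<gamma> x z u)" if u: "u \<in> ?W" for u
    proof (rule pb.act_free)
      have uU: "u \<in> U z" using u V(3)[OF yp zy] by auto
      show sz: "s z u \<in> pts (tot Q)" by (rule sp[OF zp uU])
      have "s x u = gact Q (\<pi> (\<gamma> x y u)) (s y u)" using bspec[OF sg[OF x y], of u] u by simp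
      also have "s y u = gact Q (\<pi> (\<gamma> y z u)) (s z u)" using bspec[OF sg[OF yp zy], of u] u by simp
      also have "gact Q (\<pi> (\<gamma> x y u)) (gact Q (\<pi> (\<gamma> y z u)) (s z u)) = gact Q (\<pi> (\<gamma> x y u \<cdot> \<gamma> y z u)) (s z u)"
        using pb.act_act[OF _ _ sz] gp[OF u] by simp
      finally have "s x u = gact Q (\<pi> (\<gamma> x y u \<cdot> \<gamma> y z u)) (s z u)" .
      moreover have "s x u = gact Q (\<pi> (\<gamma> x z u)) (s z u)" using bspec[OF sg[OF x zx], of u] u by simp
      ultimately show "gact Q (\<pi> (\<gamma> x y u \<cdot> \<gamma> y z u)) (s z u) = gact Q (\<pi> (\<gamma> x z u)) (s z u)" by simp
    qed (use gp[OF u] in simp_all)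
    show "\<gamma> x y u \<cdot> \<gamma> y z u = \<iota> (c [x, y, z] u) \<cdot> \<gamma> x z u" if u: "u \<in> ?W" for u
      using circle_quotient(2)[OF _ _ eq[OF u]] gp[OF u] by (simp add: c_def)
    have gW: "dsmooth (sub_diff Y ?W) (dspace Gh) (\<gamma> x y)" "dsmooth (sub_diff Y ?W) (dspace Gh) (\<gamma> y z)"
      "dsmooth (sub_diff Y ?W) (dspace Gh) (\<gamma> x z)"
      by (rule dsmooth_sub_mono[OF g[OF x y]] dsmooth_sub_mono[OF g[OF yp zy]] dsmooth_sub_mono[OF g[OF x zx]], blast)+
    have prod: "dsmooth (sub_diff Y ?W) (dspace Gh) (\<lambda>u. \<gamma> x y u \<cdot> \<gamma> y z u)"
    proof (rule dsmoothI)
      show "\<gamma> x y u \<cdot> \<gamma> y z u \<in> pts (dspace Gh)" if "u \<in> pts (sub_diff Y ?W)" for u using gp[of u] that by simp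
      show "plot (dspace Gh) n N (\<lambda>u. \<gamma> x y (p u) \<cdot> \<gamma> y z (p u))" if p: "plot (sub_diff Y ?W) n N p" for n N p
        by (rule gplot_mult[OF dgroups(2) dsmooth_plot[OF gW(1) p] dsmooth_plot[OF gW(2) p]])
    qed
    have "dsmooth (sub_diff Y ?W) (dspace circle) (\<lambda>u. circle_quotient (\<gamma> x y u \<cdot> \<gamma> y z u) (\<gamma> x z u))"
      by (rule circle_quotient_smooth[OF diffeological_sub_diff[OF pb.Y] prod gW(3)]) (use eq in simp)
    then show "dsmooth (sub_diff Y ?W) (dspace circle) (c [x, y, z])" by (simp add: c_def[abs_def])
  qed (use U s ps V(1,2) g sg in \<open>simp_all\<close>, use V(3) in blast)
  then show ?thesis by (intro exI)
qed

text \<open>The product \<open>\<gamma> x y \<cdot> \<gamma> y z \<cdot> \<gamma> z w\<close>, bracketed in two ways and simplified by centrality, gives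
  \<open>c x y z * c x z w = c y z w * c x y w\<close>.\<close>

lemma cech_cocycle:
  assumes cd: "cech_data Gh \<iota> \<pi> Y Q U s V \<gamma> c"
  shows "c \<in> cocycles Y circle 2"
proof -
  note D = cech_dataD[OF cd]
  have UY: "y \<in> pts Y" if "x \<in> pts Y" "y \<in> U x" for x y using openin_dtop_subset[OF D(1)[OF that(1)]] that(2) by blast
  have oU: "openin (dtop Y) (U x) \<and> x \<in> U x" if "x \<in> pts Y" for x using D(1,2)[OF that] by simp
  have oV: "openin (dtop Y) (V x y) \<and> y \<in> V x y" if "x \<in> pts Y" "y \<in> U x" for x y using D(5,6)[OF that] by simp
  have "c \<in> cochains Y circle (Suc (Suc 0))"
    unfolding cochains_smooth_germ
  proof (rule nested2I[of Y U V, OF pb.Y oU oV])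
    fix x y z assume x: "x \<in> pts Y" and y: "y \<in> U x" and z: "z \<in> V x y"
    have yp: "y \<in> pts Y" and zx: "z \<in> U x" and zy: "z \<in> U y" using UY[OF x y] D(7,8)[OF x y z] by auto
    show "smooth_germ Y circle (c [x, y, z]) (last [x, y, z])"
      unfolding smooth_germ_def
      using D(11)[OF x y z] D(5)[OF x y] D(5,6)[OF yp zy] D(5,6)[OF x zx] z
      by (intro exI[of _ "V x y \<inter> V y z \<inter> V x z"]) auto
  qed
  moreover have "germ_eq Y (Suc (Suc (Suc 0))) (coboundary circle (Suc (Suc 0)) c) (\<lambda>_ _. 1)"
    unfolding germ_eq_def
  proof (rule nested3I[of Y U V "\<lambda>x y z. V x y \<inter> V y z \<inter> V x z", OF pb.Y oU oV])
    fix x y z assume x: "x \<in> pts Y" and y: "y \<in> U x" and z: "z \<in> V x y"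
    have yp: "y \<in> pts Y" and zx: "z \<in> U x" and zy: "z \<in> U y" using UY[OF x y] D(7,8)[OF x y z] by auto
    show "openin (dtop Y) (V x y \<inter> V y z \<inter> V x z) \<and> z \<in> V x y \<inter> V y z \<inter> V x z"
      using D(5)[OF x y] D(5,6)[OF yp zy] D(5,6)[OF x zx] z by auto
    have zp: "z \<in> pts Y" by (rule UY[OF x zx])
    fix w assume "w \<in> V x y \<inter> V y z \<inter> V x z"
    then have w: "w \<in> V x y" "w \<in> V y z" "w \<in> V x z" by auto
    have wx: "w \<in> U x" and wy: "w \<in> U y" and wz: "w \<in> U z"
      using D(7,8)[OF x y w(1)] D(8)[OF yp zy w(2)] by auto
    let ?N = "V x y \<inter> V y z \<inter> V x z \<inter> V x w \<inter> V y w \<inter> V z w"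
    have N: "openin (dtop Y) ?N"
      by (intro openin_Int D(5)[OF x y] D(5)[OF yp zy] D(5)[OF x zx] D(5)[OF x wx] D(5)[OF yp wy] D(5)[OF zp wz])
    have wN: "w \<in> ?N" using D(6)[OF x wx] D(6)[OF yp wy] D(6)[OF zp wz] w by simp
    show "\<forall>\<^sub>F u in nhdsin (dtop Y) (last [x, y, z, w]). coboundary circle (Suc (Suc 0)) c [x, y, z, w] u = 1"
    proof (rule eventually_nhdsin_open[OF N])
      show "last [x, y, z, w] \<in> ?N" using wN by simp
      fix u assume u: "u \<in> ?N"
      have up: "u \<in> pts Y" using u D(7)[OF x y] UY[OF x] by blast
      have gp: "\<gamma> a b u \<in> carrier Gh" if "a \<in> pts Y" "b \<in> U a" "u \<in> V a b" for a b
        using dsmooth_pts[OF D(9)[OF that(1,2)], of u] up that(3) by simp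
      have g: "\<gamma> x y u \<in> carrier Gh" "\<gamma> y z u \<in> carrier Gh" "\<gamma> x z u \<in> carrier Gh"
        "\<gamma> x w u \<in> carrier Gh" "\<gamma> y w u \<in> carrier Gh" "\<gamma> z w u \<in> carrier Gh"
        using gp[OF x y] gp[OF yp zy] gp[OF x zx] gp[OF x wx] gp[OF yp wy] gp[OF zp wz] u by simp_all
      have n: "cmod (c [x, y, z] u) = 1" "cmod (c [x, y, w] u) = 1" "cmod (c [x, z, w] u) = 1" "cmod (c [y, z, w] u) = 1"
        using dsmooth_pts[OF D(11)[OF x y z], of u] dsmooth_pts[OF D(11)[OF x y w(1)], of u]
          dsmooth_pts[OF D(11)[OF x zx w(3)], of u] dsmooth_pts[OF D(11)[OF yp zy w(2)], of u] u up by simp_all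
      have e: "\<gamma> x y u \<cdot> \<gamma> y z u = \<iota> (c [x, y, z] u) \<cdot> \<gamma> x z u"
        "\<gamma> x y u \<cdot> \<gamma> y w u = \<iota> (c [x, y, w] u) \<cdot> \<gamma> x w u"
        "\<gamma> x z u \<cdot> \<gamma> z w u = \<iota> (c [x, z, w] u) \<cdot> \<gamma> x w u"
        "\<gamma> y z u \<cdot> \<gamma> z w u = \<iota> (c [y, z, w] u) \<cdot> \<gamma> y w u"
        using D(12)[OF x y z] D(12)[OF x y w(1)] D(12)[OF x zx w(3)] D(12)[OF yp zy w(2)] u by simp_all
      have "(\<gamma> x y u \<cdot> \<gamma> y z u) \<cdot> \<gamma> z w u = \<iota> (c [x, y, z] u * c [x, z, w] u) \<cdot> \<gamma> x w u"
        unfolding e(1) using e(3) g n by (simp add: gh.m_assoc iota_mult)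
      moreover have "\<gamma> x y u \<cdot> (\<gamma> y z u \<cdot> \<gamma> z w u) = \<iota> (c [y, z, w] u * c [x, y, w] u) \<cdot> \<gamma> x w u"
      proof -
        have "\<gamma> x y u \<cdot> (\<iota> (c [y, z, w] u) \<cdot> \<gamma> y w u) = (\<gamma> x y u \<cdot> \<iota> (c [y, z, w] u)) \<cdot> \<gamma> y w u"
          using g n by (simp add: gh.m_assoc)
        also have "\<dots> = \<iota> (c [y, z, w] u) \<cdot> (\<gamma> x y u \<cdot> \<gamma> y w u)"
          using g n iota_central[of "c [y, z, w] u" "\<gamma> x y u"] by (simp add: gh.m_assoc)
        finally show ?thesis unfolding e(4) e(2) using g n by (simp add: gh.m_assoc iota_mult)
      qed
      ultimately have "\<iota> (c [x, y, z] u * c [x, z, w] u) \<cdot> \<gamma> x w u = \<iota> (c [y, z, w] u * c [x, y, w] u) \<cdot> \<gamma> x w u"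
        using g by (simp add: gh.m_assoc)
      then have k: "c [x, y, z] u * c [x, z, w] u = c [y, z, w] u * c [x, y, w] u"
        by (rule iota_cancel[rotated -1]) (use g n in \<open>simp_all add: norm_mult\<close>)
      have nz: "c [x, y, z] u \<noteq> 0" "c [x, z, w] u \<noteq> 0" "c [x, y, w] u \<noteq> 0" "c [y, z, w] u \<noteq> 0" using n by auto
      have "coboundary circle (Suc (Suc 0)) c [x, y, z, w] u
          = c [y, z, w] u * inverse (c [x, z, w] u) * c [x, y, w] u * inverse (c [x, y, z] u)"
      proof (subst coboundary_circle)
        show "cmod (c (omit i [x, y, z, w]) u) = 1" if "i \<le> Suc (Suc (Suc 0))" for i
        proof -
          consider "i = 0" | "i = Suc 0" | "i = Suc (Suc 0)" | "i = Suc (Suc (Suc 0))" using \<open>i \<le> _\<close> by linarith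
          then show ?thesis by cases (simp_all add: n)
        qed
      qed simp
      also have "\<dots> = 1" using k nz by (simp add: field_simps)
      finally show "coboundary circle (Suc (Suc 0)) c [x, y, z, w] u = 1" .
    qed
  qed
  ultimately show ?thesis by (simp add: cocycles_def numeral_2_eq_2)
qed

end

section \<open>Pulled back bundles\<close>

text \<open>Every ingredient of the data is composed with \<open>f\<close>; a section \<open>\<sigma>\<close> becomes \<open>u \<mapsto> (u, \<sigma> (f u))\<close>.\<close>

lemma cech_data_pullback:
  assumes X: "diffeological_space X" and Y: "diffeological_space Y" and f: "dsmooth X Y f"
    and tot: "diffeological_space (tot Q)" and cd: "cech_data Gh \<iota> \<pi> Y Q U s V \<gamma> c"
  shows "cech_data Gh \<iota> \<pi> X (bundle_pullback X f Q) (\<lambda>x. {u \<in> pts X. f u \<in> U (f x)}) (\<lambda>x u. (u, s (f x) (f u)))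
    (\<lambda>x y. {u \<in> pts X. f u \<in> V (f x) (f y)}) (\<lambda>x y u. \<gamma> (f x) (f y) (f u)) (\<lambda>xs u. c (map f xs) (f u))"
proof -
  note D = cech_dataD[OF cd]
  have fx: "f x \<in> pts Y" if "x \<in> pts X" for x by (rule dsmooth_pts[OF f that])
  have fW: "dsmooth (sub_diff X {u \<in> pts X. f u \<in> W}) (sub_diff Y W) f" for W
    by (rule dsmooth_into_sub[OF dsmooth_sub[OF f] _ diffeological_sub_diff[OF X]]) auto
  have UY: "y \<in> pts Y" if "x \<in> pts Y" "y \<in> U x" for x y using openin_dtop_subset[OF D(1)[OF that(1)]] that(2) by blast
  show ?thesis unfolding cech_data_def
  proof (intro conjI ballI)
    fix x assume x: "x \<in> pts X"
    note fx' = fx[OF x]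
    show "openin (dtop X) {u \<in> pts X. f u \<in> U (f x)}" by (rule dsmooth_continuous[OF X f D(1)[OF fx']])
    show "x \<in> {u \<in> pts X. f u \<in> U (f x)}" using x D(2)[OF fx'] by simp
    let ?U = "{u \<in> pts X. f u \<in> U (f x)}"
    note sm = dsmooth_compose[OF fW D(3)[OF fx']]
    show "dsmooth (sub_diff X ?U) (tot (bundle_pullback X f Q)) (\<lambda>u. (u, s (f x) (f u)))"
    proof (rule dsmoothI)
      show "(u, s (f x) (f u)) \<in> pts (tot (bundle_pullback X f Q))" if "u \<in> pts (sub_diff X ?U)" for u
        using dsmooth_pts[OF sm that] that D(4)[OF fx', of "f u"] by (simp add: bundle_pullback_def)
      show "plot (tot (bundle_pullback X f Q)) n W (\<lambda>w. (p w, s (f x) (f (p w))))" if p: "plot (sub_diff X ?U) n W p" for n W p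
        using dsmooth_plot[OF sm p] p D(4)[OF fx'] by (auto simp: bundle_pullback_def)
    qed
    show "proj (bundle_pullback X f Q) (u, s (f x) (f u)) = u" for u by (simp add: bundle_pullback_def)
    fix y assume "y \<in> ?U"
    then have y: "y \<in> pts X" "f y \<in> U (f x)" by auto
    let ?V = "{u \<in> pts X. f u \<in> V (f x) (f y)}"
    show "openin (dtop X) ?V" by (rule dsmooth_continuous[OF X f D(5)[OF fx' y(2)]])
    show "y \<in> ?V" using y D(6)[OF fx' y(2)] by simp
    show "?V \<subseteq> ?U \<inter> {u \<in> pts X. f u \<in> U (f y)}" using D(7,8)[OF fx' y(2)] by auto
    show "dsmooth (sub_diff X ?V) (dspace Gh) (\<lambda>u. \<gamma> (f x) (f y) (f u))"
      by (rule dsmooth_compose[OF fW D(9)[OF fx' y(2)]])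
    show "(u, s (f x) (f u)) = gact (bundle_pullback X f Q) (\<pi> (\<gamma> (f x) (f y) (f u))) (u, s (f y) (f u))" if "u \<in> ?V" for u
      using D(10)[OF fx' y(2), of "f u"] that by (simp add: bundle_pullback_def)
    fix z assume "z \<in> ?V"
    then have z: "z \<in> pts X" "f z \<in> V (f x) (f y)" by auto
    let ?W = "V (f x) (f y) \<inter> V (f y) (f z) \<inter> V (f x) (f z)"
    let ?W' = "?V \<inter> {u \<in> pts X. f u \<in> V (f y) (f z)} \<inter> {u \<in> pts X. f u \<in> V (f x) (f z)}"
    have "?W' = {u \<in> pts X. f u \<in> ?W}" by auto
    then show "dsmooth (sub_diff X ?W') (dspace circle) (\<lambda>u. c (map f [x, y, z]) (f u))"
      using dsmooth_compose[OF fW D(11)[OF fx' y(2) z(2)]] by simp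
    show "\<gamma> (f x) (f y) (f u) \<otimes>\<^bsub>Gh\<^esub> \<gamma> (f y) (f z) (f u) = \<iota> (c (map f [x, y, z]) (f u)) \<otimes>\<^bsub>Gh\<^esub> \<gamma> (f x) (f z) (f u)"
      if "u \<in> ?W'" for u
      using D(12)[OF fx' y(2) z(2), of "f u"] that by simp
  qed
qed

lemma principal_bundle_pullback:
  assumes X: "diffeological_space X" and f: "dsmooth X Y f" and Q: "principal G Y Q"
  shows "principal_bundle G X (bundle_pullback X f Q)"
proof -
  interpret principal G Y Q by (rule Q)
  let ?P = "bundle_pullback X f Q"
  have ptsP: "pts (tot ?P) = {(x, q). x \<in> pts X \<and> q \<in> pts (tot Q) \<and> f x = proj Q q}"
    by (auto simp: bundle_pullback_def)
  have plotP: "plot (tot ?P) n U p \<longleftrightarrow> plot X n U (\<lambda>u. fst (p u)) \<and> plot (tot Q) n U (\<lambda>u. snd (p u)) \<and>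
      (\<forall>u\<in>U. f (fst (p u)) = proj Q (snd (p u)))" for n U p
    by (simp add: bundle_pullback_def image_subset_iff split_beta)
  have projP: "proj ?P = fst" and actP: "gact ?P g r = (fst r, gact Q g (snd r))" for g r
    by (simp_all add: bundle_pullback_def split_beta)
  show ?thesis
  proof (rule principal_bundleI[OF G X])
    show "diffeological_space (tot ?P)"
      by (simp add: bundle_pullback_def diffeological_sub_diff diffeological_prod_diff X tot)
    show "dsmooth (tot ?P) X (proj ?P)" by (rule dsmoothI) (auto simp: ptsP plotP projP)
    show "smooth_action G (tot ?P) (gact ?P)" unfolding smooth_action_def
    proof (intro conjI ballI)
      show "dsmooth (prod_diff (dspace G) (tot ?P)) (tot ?P) (\<lambda>(g, x). gact ?P g x)"
      proof (rule dsmoothI)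
        show "(case r of (g, x) \<Rightarrow> gact ?P g x) \<in> pts (tot ?P)" if "r \<in> pts (prod_diff (dspace G) (tot ?P))" for r
          using that act_pts proj_act diffeological_groupD(3)[OF G] by (auto simp: ptsP actP)
        fix n U p assume p: "plot (prod_diff (dspace G) (tot ?P)) n U p"
        then have p': "plot (dspace G) n U (\<lambda>u. fst (p u))" "plot X n U (\<lambda>u. fst (snd (p u)))" "plot (tot Q) n U (\<lambda>u. snd (snd (p u)))"
          "\<And>u. u \<in> U \<Longrightarrow> f (fst (snd (p u))) = proj Q (snd (snd (p u)))" by (simp_all add: plotP)
        have "proj Q (gact Q (fst (p u)) (snd (snd (p u)))) = proj Q (snd (snd (p u)))" if "u \<in> U" for u
          by (rule proj_act[OF gplot_carrier[OF G p'(1) that] plot_pts[OF tot p'(3) that]])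
        then show "plot (tot ?P) n U (\<lambda>u. case p u of (g, x) \<Rightarrow> gact ?P g x)"
          using act_plot[OF p'(1,3)] p'(2,4) by (simp add: plotP actP split_beta)
      qed
      show "gact ?P \<one>\<^bsub>G\<^esub> r = r" if "r \<in> pts (tot ?P)" for r
        using that act_one by (auto simp: ptsP actP)
      show "gact ?P g (gact ?P h r) = gact ?P (g \<otimes>\<^bsub>G\<^esub> h) r" if "g \<in> carrier G" "h \<in> carrier G" "r \<in> pts (tot ?P)" for g h r
        using that act_act by (auto simp: ptsP actP)
    qed
    show "proj ?P (gact ?P g r) = proj ?P r" for g r by (simp add: projP actP)
    show "g = h" if "g \<in> carrier G" "h \<in> carrier G" "r \<in> pts (tot ?P)" "gact ?P g r = gact ?P h r" for g h r
      by (rule act_free[OF that(1,2), of "snd r"]) (use that in \<open>auto simp: ptsP actP\<close>)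
    show "\<exists>d. plot (dspace G) n U d \<and> (\<forall>u\<in>U. gact ?P (d u) (p u) = p' u)"
      if p: "plot (tot ?P) n U p" and p': "plot (tot ?P) n U p'" and eq: "\<And>u. u \<in> U \<Longrightarrow> proj ?P (p u) = proj ?P (p' u)" for n U p p'
    proof (intro exI conjI ballI)
      have pQ: "plot (tot Q) n U (\<lambda>u. snd (p u))" "plot (tot Q) n U (\<lambda>u. snd (p' u))"
        "\<And>u. u \<in> U \<Longrightarrow> proj Q (snd (p u)) = f (fst (p u)) \<and> proj Q (snd (p' u)) = f (fst (p' u))"
        using p p' by (simp_all add: plotP)
      have eq': "proj Q (snd (p u)) = proj Q (snd (p' u))" if "u \<in> U" for u using pQ(3)[OF that] eq[OF that] by (simp add: projP)
      show "plot (dspace G) n U (\<lambda>u. translation G Q (snd (p u)) (snd (p' u)))"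
        by (rule translation_plot[OF pQ(1,2) eq'])
      show "gact ?P (translation G Q (snd (p u)) (snd (p' u))) (p u) = p' u" if "u \<in> U" for u
        using translation(2)[OF plot_pts[OF tot pQ(1) that] plot_pts[OF tot pQ(2) that] eq'[OF that]] eq[OF that]
        by (simp add: actP projP prod_eq_iff)
    qed
    fix x assume x: "x \<in> pts X"
    obtain U \<sigma> where U: "openin (dtop Y) U" "f x \<in> U" "dsmooth (sub_diff Y U) (tot Q) \<sigma>" and \<sigma>: "\<And>u. u \<in> U \<Longrightarrow> proj Q (\<sigma> u) = u"
      by (rule local_section[OF dsmooth_pts[OF f x]]) (rule that)
    let ?V = "{u \<in> pts X. f u \<in> U}"
    have fU: "dsmooth (sub_diff X ?V) (sub_diff Y U) f"
      by (rule dsmooth_into_sub[OF dsmooth_sub[OF f] _ diffeological_sub_diff[OF X]]) auto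
    note sm = dsmooth_compose[OF fU U(3)]
    have "dsmooth (sub_diff X ?V) (tot ?P) (\<lambda>u. (u, \<sigma> (f u)))"
    proof (rule dsmoothI)
      show "(u, \<sigma> (f u)) \<in> pts (tot ?P)" if "u \<in> pts (sub_diff X ?V)" for u
        using dsmooth_pts[OF sm that] that \<sigma>[of "f u"] by (simp add: ptsP)
      show "plot (tot ?P) n W (\<lambda>w. (p w, \<sigma> (f (p w))))" if p: "plot (sub_diff X ?V) n W p" for n W p
        using dsmooth_plot[OF sm p] p \<sigma> by (auto simp: plotP)
    qed
    then show "\<exists>V \<sigma>. openin (dtop X) V \<and> x \<in> V \<and> dsmooth (sub_diff X V) (tot ?P) \<sigma> \<and> (\<forall>u\<in>V. proj ?P (\<sigma> u) = u)"
      using dsmooth_continuous[OF X f U(1)] x U(2)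
      by (intro exI[of _ ?V] exI[of _ "\<lambda>u. (u, \<sigma> (f u))"] conjI) (simp_all add: projP)
  qed
qed

section \<open>Trivial local lifts\<close>

lemma diffeoI:
  assumes X: "diffeological_space X" and Y: "diffeological_space Y"
    and f: "dsmooth X Y f" and g: "dsmooth Y X g"
    and gf: "\<And>x. x \<in> pts X \<Longrightarrow> g (f x) = x" and fg: "\<And>y. y \<in> pts Y \<Longrightarrow> f (g y) = y"
  shows "diffeo X Y f"
proof -
  have inj: "inj_on f (pts X)" by (rule inj_on_inverseI[of _ g]) (rule gf)
  have surj: "f ` pts X = pts Y"
  proof (intro equalityI subsetI)
    fix y assume "y \<in> f ` pts X" then show "y \<in> pts Y" using dsmooth_pts[OF f] by auto
  next
    fix y assume y: "y \<in> pts Y"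
    then show "y \<in> f ` pts X" using fg[OF y] dsmooth_pts[OF g y] by (intro image_eqI[of _ _ "g y"]) simp_all
  qed
  have "inv_into (pts X) f y = g y" if y: "y \<in> pts Y" for y
    using inv_into_f_f[OF inj dsmooth_pts[OF g y]] fg[OF y] by simp
  then have "dsmooth Y X (inv_into (pts X) f)" by (rule dsmooth_cong[OF Y X g])
  then show ?thesis using f inj surj by (simp add: diffeo_def bij_betw_def)
qed

lemma bundle_restrict_simps [simp]:
  "tot (bundle_restrict R U) = sub_diff (tot R) (proj R -` U)" "proj (bundle_restrict R U) = proj R"
  "gact (bundle_restrict R U) = gact R"
  by (simp_all add: bundle_restrict_def)

definition trivial_bundle :: "'h dgroup \<Rightarrow> 'y diffeology \<Rightarrow> ('h, 'y \<times> 'h, 'y) gbundle" where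
  "trivial_bundle H Y = \<lparr>tot = prod_diff Y (dspace H), proj = fst, gact = (\<lambda>h (u, k). (u, h \<otimes>\<^bsub>H\<^esub> k))\<rparr>"

lemma trivial_bundle_simps [simp]:
  "tot (trivial_bundle H Y) = prod_diff Y (dspace H)" "proj (trivial_bundle H Y) = fst"
  "gact (trivial_bundle H Y) h r = (fst r, h \<otimes>\<^bsub>H\<^esub> snd r)"
  by (simp_all add: trivial_bundle_def split_beta)

lemma principal_trivial_bundle:
  assumes H: "diffeological_group H" and Y: "diffeological_space Y"
  shows "principal_bundle H Y (trivial_bundle H Y)"
proof -
  interpret group H using H by (rule diffeological_groupD)
  have DH: "diffeological_space (dspace H)" and PH: "pts (dspace H) = carrier H" using H by (simp_all add: diffeological_groupD)
  show ?thesis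
  proof (rule principal_bundleI[OF H Y])
    show "diffeological_space (tot (trivial_bundle H Y))" by (simp add: diffeological_prod_diff Y DH)
    show "dsmooth (tot (trivial_bundle H Y)) Y (proj (trivial_bundle H Y))" by (rule dsmoothI) auto
    show "smooth_action H (tot (trivial_bundle H Y)) (gact (trivial_bundle H Y))" unfolding smooth_action_def
    proof (intro conjI ballI)
      show "dsmooth (prod_diff (dspace H) (tot (trivial_bundle H Y))) (tot (trivial_bundle H Y)) (\<lambda>(g, x). gact (trivial_bundle H Y) g x)"
        by (rule dsmoothI) (auto simp: split_beta PH intro: gplot_mult[OF H])
    qed (auto simp: PH m_assoc)
    show "proj (trivial_bundle H Y) (gact (trivial_bundle H Y) g q) = proj (trivial_bundle H Y) q" for g q by simp
    show "g = h" if "g \<in> carrier H" "h \<in> carrier H" "q \<in> pts (tot (trivial_bundle H Y))"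
      "gact (trivial_bundle H Y) g q = gact (trivial_bundle H Y) h q" for g h q
      using that by (auto simp: PH)
    show "\<exists>d. plot (dspace H) n U d \<and> (\<forall>u\<in>U. gact (trivial_bundle H Y) (d u) (p u) = p' u)"
      if p: "plot (tot (trivial_bundle H Y)) n U p" and p': "plot (tot (trivial_bundle H Y)) n U p'"
        and eq: "\<And>u. u \<in> U \<Longrightarrow> proj (trivial_bundle H Y) (p u) = proj (trivial_bundle H Y) (p' u)" for n U p p'
    proof (intro exI conjI ballI)
      have s: "plot (dspace H) n U (\<lambda>u. snd (p u))" "plot (dspace H) n U (\<lambda>u. snd (p' u))" using p p' by simp_all
      show "plot (dspace H) n U (\<lambda>u. snd (p' u) \<otimes>\<^bsub>H\<^esub> inv\<^bsub>H\<^esub> (snd (p u)))"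
        by (intro gplot_mult[OF H] gplot_inv[OF H] s)
      show "gact (trivial_bundle H Y) (snd (p' u) \<otimes>\<^bsub>H\<^esub> inv\<^bsub>H\<^esub> (snd (p u))) (p u) = p' u" if "u \<in> U" for u
        using gplot_carrier[OF H s(1) that] gplot_carrier[OF H s(2) that] eq[OF that]
        by (simp add: m_assoc prod_eq_iff)
    qed
    fix y assume y: "y \<in> pts Y"
    have "dsmooth (sub_diff Y (pts Y)) (tot (trivial_bundle H Y)) (\<lambda>u. (u, \<one>\<^bsub>H\<^esub>))"
    proof (rule dsmoothI)
      fix n U p assume "plot (sub_diff Y (pts Y)) n U p"
      then show "plot (tot (trivial_bundle H Y)) n U (\<lambda>u. (p u, \<one>\<^bsub>H\<^esub>))"
        using plot_const[OF DH plot_open[OF Y, of n U p], of "\<one>\<^bsub>H\<^esub>"] by (simp add: PH)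
    qed (simp add: PH)
    moreover have "openin (dtop Y) (pts Y)" using openin_topspace[of "dtop Y"] Y by simp
    ultimately show "\<exists>U \<sigma>. openin (dtop Y) U \<and> y \<in> U \<and> dsmooth (sub_diff Y U) (tot (trivial_bundle H Y)) \<sigma> \<and>
        (\<forall>u\<in>U. proj (trivial_bundle H Y) (\<sigma> u) = u)"
      using y by (intro exI[of _ "pts Y"] exI[of _ "\<lambda>u. (u, \<one>\<^bsub>H\<^esub>)"]) simp
  qed
qed

text \<open>The comparison map of the trivial lift: the orbit of \<open>(u, k)\<close> goes to \<open>\<pi> k \<cdot> s u\<close>.  The choice of a
  point in the orbit is harmless because \<open>\<pi>\<close> is trivial on the circle.\<close>

definition orbit_map :: "('h \<Rightarrow> 'g) \<Rightarrow> ('g, 'p, 'y) gbundle \<Rightarrow> ('y \<Rightarrow> 'p) \<Rightarrow> ('y \<times> 'h) set \<Rightarrow> 'p" where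
  "orbit_map \<pi> Q s orb = (let r = (SOME r. r \<in> orb) in gact Q (\<pi> (snd r)) (s (fst r)))"

definition trivial_lift ::
    "'h dgroup \<Rightarrow> ('h \<Rightarrow> 'g) \<Rightarrow> 'y diffeology \<Rightarrow> ('g, 'p, 'y) gbundle \<Rightarrow> 'y set \<Rightarrow> ('y \<Rightarrow> 'p) \<Rightarrow> ('h, 'p, 'y) lift_obj" where
  "trivial_lift Gh \<pi> Y Q U s = (trivial_bundle Gh (sub_diff Y U), orbit_map \<pi> Q s)"

lemma lifting_gerbe_simps:
  "gobj (lifting_gerbe Gh \<iota> \<pi> Y Q) = lift_objects Gh \<iota> \<pi> Y Q"
  "ghom (lifting_gerbe Gh \<iota> \<pi> Y Q) U = lift_isos Gh \<iota>"
  "gcomp (lifting_gerbe Gh \<iota> \<pi> Y Q) (R, \<alpha>) F' F = compose (pts (tot R)) F' F"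
  "gores (lifting_gerbe Gh \<iota> \<pi> Y Q) U (R, \<alpha>) = (bundle_restrict R U, \<alpha>)"
  "gmres (lifting_gerbe Gh \<iota> \<pi> Y Q) U (R, \<alpha>) F = restrict F (pts (tot (bundle_restrict R U)))"
  "gband (lifting_gerbe Gh \<iota> \<pi> Y Q) (R, \<alpha>) b F = (\<lambda>r\<in>pts (tot R). F (gact R (\<iota> (b (proj R r))) r))"
  by (simp_all add: lifting_gerbe_def)

lemma circle_orbit_cong: "gact R = gact R' \<Longrightarrow> circle_orbit \<iota> R = circle_orbit \<iota> R'"
  by (simp add: circle_orbit_def)

lemma circle_orbit_restrict [simp]: "circle_orbit \<iota> (bundle_restrict R U) = circle_orbit \<iota> R"
  by (rule circle_orbit_cong) simp

context lifting_problem
begin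

lemma orbit_map_orbit:
  assumes k: "k \<in> carrier Gh"
  shows "orbit_map \<pi> Q s (circle_orbit \<iota> (trivial_bundle Gh Z) (u, k)) = gact Q (\<pi> k) (s u)"
proof -
  let ?O = "circle_orbit \<iota> (trivial_bundle Gh Z) (u, k)"
  have orb: "?O = (\<lambda>z. (u, \<iota> z \<cdot> k)) ` {z. cmod z = 1}"
    by (simp add: circle_orbit_def orbit_of_def)
  have "(u, \<iota> 1 \<cdot> k) \<in> ?O" unfolding orb by (rule imageI) simp
  then have "(SOME r. r \<in> ?O) \<in> ?O" by (rule someI)
  then obtain z where z: "cmod z = 1" "(SOME r. r \<in> ?O) = (u, \<iota> z \<cdot> k)" unfolding orb by blast
  have "\<pi> (\<iota> z \<cdot> k) = \<pi> k" using z(1) k by simp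
  then show ?thesis unfolding orbit_map_def Let_def z(2) by simp
qed

text \<open>A smooth section of \<open>Q\<close> turns the trivial bundle into a lift of \<open>Q\<close>.  The inverse of the
  comparison map is smooth because plots of \<open>G\<close> lift locally to the extension.\<close>

lemma trivial_lift_object:
  assumes U: "openin (dtop Y) U" and s: "dsmooth (sub_diff Y U) (tot Q) s" and ps: "\<And>u. u \<in> U \<Longrightarrow> proj Q (s u) = u"
  shows "trivial_lift Gh \<pi> Y Q U s \<in> lift_objects Gh \<iota> \<pi> Y Q U"
proof -
  let ?Y = "sub_diff Y U" and ?R = "trivial_bundle Gh (sub_diff Y U)"
  let ?q = "circle_orbit \<iota> ?R" and ?\<alpha> = "orbit_map \<pi> Q s"
  note UY = openin_dtop_subset[OF U]
  have dY: "diffeological_space ?Y" by (rule diffeological_sub_diff[OF pb.Y])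
  have dGh: "diffeological_space (dspace Gh)" by (rule diffeological_groupD[OF dgroups(2)])
  have dR: "diffeological_space (tot ?R)" by (simp add: diffeological_prod_diff dY dGh)
  have ptsR: "pts (tot ?R) = U \<times> carrier Gh" using UY by auto
  have sp: "s u \<in> pts (tot Q)" if "u \<in> U" for u using dsmooth_pts[OF s, of u] that UY by auto
  have dQ: "diffeological_space (tot (bundle_restrict Q U))" by (simp add: diffeological_sub_diff pb.tot)
  have \<alpha>q: "?\<alpha> (?q r) = gact Q (\<pi> (snd r)) (s (fst r))" if "r \<in> pts (tot ?R)" for r
  proof -
    from that have "snd r \<in> carrier Gh" unfolding ptsR by (rule mem_Times_iff[THEN iffD1, THEN conjunct2])
    from orbit_map_orbit[OF this, of s ?Y "fst r"] show ?thesis unfolding prod.collapse .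
  qed
  have \<alpha>p: "gact Q (\<pi> k) (s u) \<in> pts (tot Q)" "proj Q (gact Q (\<pi> k) (s u)) = u" if "u \<in> U" "k \<in> carrier Gh" for u k
    using pb.act_pts[of "\<pi> k"] pb.proj_act[of "\<pi> k"] sp ps that by simp_all
  let ?O = "quotient_diff (tot ?R) ?q"
  have \<alpha>sm: "dsmooth ?O (tot (bundle_restrict Q U)) ?\<alpha>"
  proof (rule dsmoothI)
    fix orb assume "orb \<in> pts ?O"
    then obtain r where r: "orb = ?q r" "r \<in> pts (tot ?R)" unfolding pts_quotient_diff by (elim imageE)
    then have "fst r \<in> U" "snd r \<in> carrier Gh" unfolding ptsR mem_Times_iff by simp_all
    from \<alpha>p[OF this] this(1) show "?\<alpha> orb \<in> pts (tot (bundle_restrict Q U))"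
      unfolding r(1) \<alpha>q[OF r(2)] by simp
  next
    fix n W p assume p: "plot ?O n W p"
    note p' = p[unfolded plot_quotient_diff[OF dR]]
    show "plot (tot (bundle_restrict Q U)) n W (\<lambda>w. ?\<alpha> (p w))"
    proof (rule plot_local[OF dQ conjunct1[OF p']])
      fix w assume "w \<in> W"
      from bspec[OF conjunct2[OF p'] this] obtain V r where V: "openin (Euclidean_space n) V" "w \<in> V" "V \<subseteq> W"
        and r: "plot (tot ?R) n V r" and pr: "\<forall>v\<in>V. p v = ?q (r v)" by (elim exE conjE)
      have r1: "plot ?Y n V (\<lambda>v. fst (r v))" and r2: "plot (dspace Gh) n V (\<lambda>v. snd (r v))" using r by simp_all
      have rp: "fst (r v) \<in> U" "snd (r v) \<in> carrier Gh" if "v \<in> V" for v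
        using plot_pts[OF dR r that] unfolding ptsR mem_Times_iff by simp_all
      have "plot (tot Q) n V (\<lambda>v. gact Q (\<pi> (snd (r v))) (s (fst (r v))))"
        by (rule pb.act_plot[OF dsmooth_plot[OF pi_smooth r2] dsmooth_plot[OF s r1]])
      then have "plot (tot (bundle_restrict Q U)) n V (\<lambda>v. gact Q (\<pi> (snd (r v))) (s (fst (r v))))"
        using \<alpha>p(2)[OF rp] rp(1) by (simp add: image_subset_iff)
      then have "plot (tot (bundle_restrict Q U)) n V (\<lambda>v. ?\<alpha> (p v))"
      proof (rule plot_cong[OF dQ])
        show "?\<alpha> (p v) = gact Q (\<pi> (snd (r v))) (s (fst (r v)))" if "v \<in> V" for v
          using \<alpha>q[OF plot_pts[OF dR r that]] bspec[OF pr that] by simp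
      qed
      then show "\<exists>V. openin (Euclidean_space n) V \<and> w \<in> V \<and> V \<subseteq> W \<and> plot (tot (bundle_restrict Q U)) n V (\<lambda>v. ?\<alpha> (p v))"
        using V by (intro exI[of _ V] conjI)
    qed
  qed
  \<comment> \<open>The inverse of the comparison map: \<open>q = g \<cdot> s u\<close> comes from the orbit of \<open>(u, k)\<close> for any lift
    \<open>k\<close> of \<open>g\<close>.\<close>
  define \<beta> where "\<beta> q = ?q (proj Q q, SOME k. k \<in> carrier Gh \<and> \<pi> k = translation G Q (s (proj Q q)) q)" for q
  have q_eq: "?q (u, k) = ?q (u, k')" if k: "k \<in> carrier Gh" "k' \<in> carrier Gh" "\<pi> k = \<pi> k'" for u k k'
  proof -
    have sub: "?q (u, a) \<subseteq> ?q (u, b)" if ab: "a \<in> carrier Gh" "b \<in> carrier Gh" "\<pi> a = \<pi> b" for a b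
    proof
      fix r assume "r \<in> ?q (u, a)"
      then obtain z where z: "cmod z = 1" "r = (u, \<iota> z \<cdot> a)" by (auto simp: circle_orbit_def orbit_of_def)
      let ?w = "circle_quotient a b"
      have w: "cmod ?w = 1" "a = \<iota> ?w \<cdot> b" by (rule circle_quotient[OF ab])+
      have "\<iota> z \<cdot> a = \<iota> (z * ?w) \<cdot> b"
        using z(1) w(1) ab by (subst w(2)) (simp add: iota_mult gh.m_assoc)
      then show "r \<in> ?q (u, b)" using z w(1) by (auto simp: circle_orbit_def orbit_of_def norm_mult intro!: image_eqI[of _ _ "z * ?w"])
    qed
    show ?thesis using sub[OF k] sub[OF k(2,1) k(3)[symmetric]] by simp
  qed
  have tr: "translation G Q (s (proj Q q)) q \<in> carrier G" "gact Q (translation G Q (s (proj Q q)) q) (s (proj Q q)) = q"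
    if "q \<in> pts (tot Q)" "proj Q q \<in> U" for q
    using pb.translation[of "s (proj Q q)" q] sp ps that by simp_all
  have lft: "\<exists>k. k \<in> carrier Gh \<and> \<pi> k = g" if "g \<in> carrier G" for g
  proof -
    have "g \<in> \<pi> ` carrier Gh" using ext that by (simp add: central_extension_def)
    then show ?thesis by blast
  qed
  have \<beta>: "\<beta> q = ?q (proj Q q, k)" if "q \<in> pts (tot Q)" "proj Q q \<in> U" "k \<in> carrier Gh" "\<pi> k = translation G Q (s (proj Q q)) q" for q k
  proof -
    let ?P = "\<lambda>k. k \<in> carrier Gh \<and> \<pi> k = translation G Q (s (proj Q q)) q"
    have "?P (SOME k. ?P k)" by (rule someI[of ?P k]) (use that in simp)
    then show ?thesis unfolding \<beta>_def using that by (intro q_eq) simp_all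
  qed
  have \<beta>sm: "dsmooth (tot (bundle_restrict Q U)) ?O \<beta>"
  proof (rule dsmoothI)
    fix q assume "q \<in> pts (tot (bundle_restrict Q U))"
    then have q: "q \<in> pts (tot Q)" "proj Q q \<in> U" by simp_all
    obtain k where k: "k \<in> carrier Gh" "\<pi> k = translation G Q (s (proj Q q)) q" using lft[OF tr(1)[OF q]] by blast
    show "\<beta> q \<in> pts ?O" unfolding \<beta>[OF q k] pts_quotient_diff using q k ptsR by (intro imageI) simp
  next
    fix n W p assume "plot (tot (bundle_restrict Q U)) n W p"
    then have p: "plot (tot Q) n W p" and pU: "\<And>w. w \<in> W \<Longrightarrow> proj Q (p w) \<in> U" by (auto simp: image_subset_iff)
    have pY: "plot ?Y n W (\<lambda>w. proj Q (p w))" using dsmooth_plot[OF pb.proj_smooth p] pU by auto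
    have d: "plot (dspace G) n W (\<lambda>w. translation G Q (s (proj Q (p w))) (p w))"
      by (rule pb.translation_plot[OF dsmooth_plot[OF s pY] p]) (simp add: ps pU)
    show "plot ?O n W (\<lambda>w. \<beta> (p w))" unfolding plot_quotient_diff[OF dR]
    proof (intro conjI ballI)
      show "openin (Euclidean_space n) W" by (rule plot_open[OF pb.tot p])
      fix w assume w: "w \<in> W"
      obtain V \<gamma> where V: "openin (Euclidean_space n) V" "w \<in> V" "V \<subseteq> W"
        and \<gamma>: "plot (dspace Gh) n V \<gamma>" and \<pi>\<gamma>: "\<And>v. v \<in> V \<Longrightarrow> \<pi> (\<gamma> v) = translation G Q (s (proj Q (p v))) (p v)"
        by (rule lift_plot[OF d w]) (rule that)
      have "plot ?Y n V (\<lambda>w. proj Q (p w))" by (rule plot_subset[OF dY pY V(1,3)])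
      then have "plot (tot ?R) n V (\<lambda>v. (proj Q (p v), \<gamma> v))" using \<gamma> by simp
      moreover have "\<forall>v\<in>V. \<beta> (p v) = ?q (proj Q (p v), \<gamma> v)"
      proof
        fix v assume v: "v \<in> V"
        then have vW: "v \<in> W" using V(3) by blast
        show "\<beta> (p v) = ?q (proj Q (p v), \<gamma> v)"
          by (rule \<beta>[OF plot_pts[OF pb.tot p vW] pU[OF vW] gplot_carrier[OF dgroups(2) \<gamma> v] \<pi>\<gamma>[OF v]])
      qed
      ultimately show "\<exists>V r. openin (Euclidean_space n) V \<and> w \<in> V \<and> V \<subseteq> W \<and> plot (tot ?R) n V r \<and> (\<forall>v\<in>V. \<beta> (p v) = ?q (r v))"
        using V by (intro exI[of _ V] exI[of _ "\<lambda>v. (proj Q (p v), \<gamma> v)"] conjI)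
    qed
  qed
  have df: "diffeo ?O (tot (bundle_restrict Q U)) ?\<alpha>"
  proof (rule diffeoI[OF diffeological_quotient_diff[OF dR] dQ \<alpha>sm \<beta>sm])
    fix orb assume "orb \<in> pts ?O"
    then obtain r where r: "orb = ?q r" "r \<in> pts (tot ?R)" unfolding pts_quotient_diff by (elim imageE)
    obtain u k where uk: "r = (u, k)" "u \<in> U" "k \<in> carrier Gh" using r(2) ptsR by auto
    have e: "?\<alpha> orb = gact Q (\<pi> k) (s u)" using \<alpha>q[OF r(2)] r(1) uk(1) by simp
    have pr: "proj Q (?\<alpha> orb) = u" and pt: "?\<alpha> orb \<in> pts (tot Q)" using e \<alpha>p[OF uk(2,3)] by simp_all
    have "translation G Q (s u) (?\<alpha> orb) = \<pi> k" unfolding e by (rule pb.translation_eq[OF pi_closed[OF uk(3)] sp[OF uk(2)]])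
    then have "\<beta> (?\<alpha> orb) = ?q (u, k)" using \<beta>[OF pt _ uk(3)] pr uk(2) by simp
    then show "\<beta> (?\<alpha> orb) = orb" using r(1) uk(1) by simp
  next
    fix q assume "q \<in> pts (tot (bundle_restrict Q U))"
    then have q: "q \<in> pts (tot Q)" "proj Q q \<in> U" by simp_all
    obtain k where k: "k \<in> carrier Gh" "\<pi> k = translation G Q (s (proj Q q)) q" using lft[OF tr(1)[OF q]] by blast
    have "(proj Q q, k) \<in> pts (tot ?R)" using q k ptsR by simp
    from \<alpha>q[OF this] show "?\<alpha> (\<beta> q) = q" unfolding \<beta>[OF q k] using k(2) tr(2)[OF q] by simp
  qed
  have rest: "proj Q (?\<alpha> (?q r)) = proj ?R r \<and> (\<forall>h\<in>carrier Gh. ?\<alpha> (?q (gact ?R h r)) = gact Q (\<pi> h) (?\<alpha> (?q r)))"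
    if r: "r \<in> pts (tot ?R)" for r
  proof (intro conjI ballI)
    obtain u k where uk: "r = (u, k)" "u \<in> U" "k \<in> carrier Gh" using r ptsR by auto
    show "proj Q (?\<alpha> (?q r)) = proj ?R r" using \<alpha>q[OF r] \<alpha>p[OF uk(2,3)] uk(1) by simp
    fix h assume h: "h \<in> carrier Gh"
    have "gact ?R h r \<in> pts (tot ?R)" using uk h ptsR by simp
    from \<alpha>q[OF this] show "?\<alpha> (?q (gact ?R h r)) = gact Q (\<pi> h) (?\<alpha> (?q r))"
      unfolding \<alpha>q[OF r] using uk h pb.act_act[OF pi_closed[OF h] pi_closed[OF uk(3)] sp[OF uk(2)]] by simp
  qed
  show ?thesis unfolding trivial_lift_def lift_objects_def mem_Collect_eq case_prod_conv
    by (rule conjI[OF principal_trivial_bundle[OF dgroups(2) dY] conjI[OF df ballI[OF rest]]])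
qed

text \<open>Right translation by a lift of the transition function is an isomorphism of trivial lifts.\<close>

definition shift :: "'y set \<Rightarrow> ('y \<Rightarrow> 'h) \<Rightarrow> 'y \<times> 'h \<Rightarrow> 'y \<times> 'h" where
  "shift W \<gamma> = (\<lambda>r\<in>W \<times> carrier Gh. (fst r, snd r \<cdot> \<gamma> (fst r)))"

lemma shift_iso:
  assumes V: "V \<subseteq> pts Y" "V \<subseteq> U" "V \<subseteq> U'"
    and \<gamma>: "dsmooth (sub_diff Y V) (dspace Gh) \<gamma>" and st: "\<And>u. u \<in> V \<Longrightarrow> s u = gact Q (\<pi> (\<gamma> u)) (t u)"
    and t: "\<And>u. u \<in> V \<Longrightarrow> t u \<in> pts (tot Q)"
  shows "shift V \<gamma> \<in> lift_isos Gh \<iota>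
     (bundle_restrict (trivial_bundle Gh (sub_diff Y U)) V, orbit_map \<pi> Q s)
     (bundle_restrict (trivial_bundle Gh (sub_diff Y U')) V, orbit_map \<pi> Q t)"
proof -
  let ?R = "trivial_bundle Gh (sub_diff Y U)" and ?R' = "trivial_bundle Gh (sub_diff Y U')"
  have dGh: "diffeological_space (dspace Gh)" by (rule diffeological_groupD[OF dgroups(2)])
  let ?A = "tot (bundle_restrict ?R V)" and ?B = "tot (bundle_restrict ?R' V)"
  have dA: "diffeological_space ?A" "diffeological_space ?B"
    by (simp_all add: diffeological_sub_diff diffeological_prod_diff pb.Y dGh)
  have ptsA: "pts ?A = V \<times> carrier Gh" and ptsB: "pts ?B = V \<times> carrier Gh" using V by auto
  have plotA: "plot ?A n W p \<longleftrightarrow> plot (sub_diff Y V) n W (\<lambda>w. fst (p w)) \<and> plot (dspace Gh) n W (\<lambda>w. snd (p w))"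
    and plotB: "plot ?B n W p \<longleftrightarrow> plot (sub_diff Y V) n W (\<lambda>w. fst (p w)) \<and> plot (dspace Gh) n W (\<lambda>w. snd (p w))" for n W p
    using V by (auto simp: image_subset_iff)
  have \<gamma>c: "\<gamma> u \<in> carrier Gh" if "u \<in> V" for u using dsmooth_pts[OF \<gamma>, of u] that V by auto
  define F where "F r = (fst r, snd r \<cdot> \<gamma> (fst r))" for r :: "'y \<times> 'h"
  define F' where "F' r = (fst r, snd r \<cdot> inv\<^bsub>Gh\<^esub> (\<gamma> (fst r)))" for r :: "'y \<times> 'h"
  have sh: "shift V \<gamma> r = F r" if "r \<in> pts ?A" for r using that unfolding ptsA shift_def F_def by simp
  have Fsm: "dsmooth ?A ?B F"
  proof (rule dsmoothI)
    show "F r \<in> pts ?B" if "r \<in> pts ?A" for r using that \<gamma>c unfolding ptsA ptsB F_def by auto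
    show "plot ?B n W (\<lambda>w. F (p w))" if p: "plot ?A n W p" for n W p
    proof -
      have 1: "plot (sub_diff Y V) n W (\<lambda>w. fst (p w))" and 2: "plot (dspace Gh) n W (\<lambda>w. snd (p w))"
        using p unfolding plotA by (rule conjunct1, rule conjunct2)
      show ?thesis unfolding plotB F_def fst_conv snd_conv
        using 1 gplot_mult[OF dgroups(2) 2 dsmooth_plot[OF \<gamma> 1]] by (rule conjI)
    qed
  qed
  have F'sm: "dsmooth ?B ?A F'"
  proof (rule dsmoothI)
    show "F' r \<in> pts ?A" if "r \<in> pts ?B" for r using that \<gamma>c unfolding ptsA ptsB F'_def by auto
    show "plot ?A n W (\<lambda>w. F' (p w))" if p: "plot ?B n W p" for n W p
    proof -
      have 1: "plot (sub_diff Y V) n W (\<lambda>w. fst (p w))" and 2: "plot (dspace Gh) n W (\<lambda>w. snd (p w))"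
        using p unfolding plotB by (rule conjunct1, rule conjunct2)
      show ?thesis unfolding plotA F'_def fst_conv snd_conv
        using 1 gplot_mult[OF dgroups(2) 2 gplot_inv[OF dgroups(2) dsmooth_plot[OF \<gamma> 1]]] by (rule conjI)
    qed
  qed
  have "dsmooth ?A ?B (shift V \<gamma>)" by (rule dsmooth_cong[OF dA Fsm sh])
  then have df: "diffeo ?A ?B (shift V \<gamma>)"
  proof (rule diffeoI[OF dA _ F'sm])
    show "F' (shift V \<gamma> r) = r" if "r \<in> pts ?A" for r
      unfolding sh[OF that] using that \<gamma>c unfolding ptsA by (auto simp: F_def F'_def gh.m_assoc)
    show "shift V \<gamma> (F' r) = r" if "r \<in> pts ?B" for r
    proof -
      have "F' r \<in> pts ?A" by (rule dsmooth_pts[OF F'sm that])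
      from sh[OF this] show ?thesis using that \<gamma>c unfolding ptsB by (auto simp: F_def F'_def gh.m_assoc)
    qed
  qed
  have rest: "proj ?R' (shift V \<gamma> r) = proj ?R r \<and>
     (\<forall>h\<in>carrier Gh. shift V \<gamma> (gact ?R h r) = gact ?R' h (shift V \<gamma> r)) \<and>
     orbit_map \<pi> Q t (circle_orbit \<iota> ?R' (shift V \<gamma> r)) = orbit_map \<pi> Q s (circle_orbit \<iota> ?R r)"
    if r: "r \<in> pts ?A" for r
  proof -
    obtain u k where uk: "r = (u, k)" "u \<in> V" "k \<in> carrier Gh" using r unfolding ptsA by blast
    note g = \<gamma>c[OF uk(2)]
    have e: "shift V \<gamma> r = (u, k \<cdot> \<gamma> u)" using sh[OF r] uk(1) by (simp add: F_def)
    have "orbit_map \<pi> Q t (circle_orbit \<iota> ?R' (shift V \<gamma> r)) = gact Q (\<pi> k) (gact Q (\<pi> (\<gamma> u)) (t u))"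
      unfolding e using orbit_map_orbit[of "k \<cdot> \<gamma> u" t "sub_diff Y U'" u] uk(3) g
        pb.act_act[OF pi_closed[OF uk(3)] pi_closed[OF g] t[OF uk(2)]] by simp
    moreover have "orbit_map \<pi> Q s (circle_orbit \<iota> ?R r) = gact Q (\<pi> k) (s u)"
      unfolding uk(1) by (rule orbit_map_orbit[OF uk(3)])
    ultimately show ?thesis
      using e uk g st[OF uk(2)] by (simp add: shift_def gh.m_assoc)
  qed
  have "shift V \<gamma> \<in> extensional (pts ?A)" unfolding ptsA shift_def by simp
  then show ?thesis unfolding lift_isos_def using df rest by simp
qed

text \<open>The trivial lifts and the translations by \<open>\<gamma>\<close> are admissible choices of objects and isomorphisms.
  As translations act on the right, composing them multiplies the \<open>\<gamma>\<close> in the order of the equation that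
  defines \<open>c\<close>.\<close>

lemma cech_in_gerbe_class:
  assumes cd: "cech_data Gh \<iota> \<pi> Y Q U s V \<gamma> c"
  shows "c \<in> gerbe_class Y (lifting_gerbe Gh \<iota> \<pi> Y Q)"
proof -
  note D = cech_dataD[OF cd]
  let ?K = "lifting_gerbe Gh \<iota> \<pi> Y Q"
  define Ob where "Ob x = trivial_lift Gh \<pi> Y Q (U x) (s x)" for x
  define F where "F x y = shift (V x y) (\<gamma> x y)" for x y
  have UY: "y \<in> pts Y" if "x \<in> pts Y" "y \<in> U x" for x y using openin_dtop_subset[OF D(1)[OF that(1)]] that(2) by blast
  have oU: "openin (dtop Y) (U x) \<and> x \<in> U x" if "x \<in> pts Y" for x using D(1,2)[OF that] by simp
  have oV: "openin (dtop Y) (V x y) \<and> y \<in> V x y" if "x \<in> pts Y" "y \<in> U x" for x y using D(5,6)[OF that] by simp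
  have VY: "V x y \<subseteq> pts Y" "V x y \<subseteq> U x" "V x y \<subseteq> U y" if "x \<in> pts Y" "y \<in> U x" for x y
    using UY[OF that(1)] D(7,8)[OF that] by blast+
  have sp: "s x u \<in> pts (tot Q)" if "x \<in> pts Y" "u \<in> U x" for x u
    using dsmooth_pts[OF D(3)[OF that(1)], of u] that UY by auto
  have res: "gores ?K W (Ob x) = (bundle_restrict (trivial_bundle Gh (sub_diff Y (U x))) W, orbit_map \<pi> Q (s x))" for W x
    by (simp add: lifting_gerbe_def Ob_def trivial_lift_def)
  have ob: "\<forall>x\<in>pts Y. openin (dtop Y) (U x) \<and> x \<in> U x \<and> Ob x \<in> gobj ?K (U x)"
    using oU trivial_lift_object[OF D(1,3,4)] by (simp add: lifting_gerbe_def Ob_def)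
  have mo: "\<forall>x\<in>pts Y. \<forall>y\<in>U x. openin (dtop Y) (V x y) \<and> y \<in> V x y \<and> V x y \<subseteq> U x \<inter> U y \<and>
        F x y \<in> ghom ?K (V x y) (gores ?K (V x y) (Ob x)) (gores ?K (V x y) (Ob y))"
  proof (intro ballI conjI)
    fix x y assume x: "x \<in> pts Y" and y: "y \<in> U x"
    show "openin (dtop Y) (V x y)" "y \<in> V x y" using oV[OF x y] by simp_all
    show "V x y \<subseteq> U x \<inter> U y" using VY[OF x y] by simp
    show "F x y \<in> ghom ?K (V x y) (gores ?K (V x y) (Ob x)) (gores ?K (V x y) (Ob y))"
      unfolding res F_def
      using shift_iso[OF VY[OF x y] D(9)[OF x y] D(10)[OF x y]] sp[OF UY[OF x y]] VY(3)[OF x y]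
      by (simp add: lifting_gerbe_def subset_iff)
  qed
  have co: "nested (dtop Y) (Suc (Suc 0)) (\<lambda>xs. let x = xs ! 0; y = xs ! 1; z = xs ! 2 in
        \<exists>W. openin (dtop Y) W \<and> z \<in> W \<and> W \<subseteq> V x y \<inter> V y z \<inter> V x z \<and>
          dsmooth (sub_diff Y W) (dspace circle) (c xs) \<and>
          gcomp ?K (gores ?K W (Ob x))
              (gmres ?K W (gores ?K (V y z) (Ob y)) (F y z)) (gmres ?K W (gores ?K (V x y) (Ob x)) (F x y))
            = gband ?K (gores ?K W (Ob x)) (c xs) (gmres ?K W (gores ?K (V x z) (Ob x)) (F x z)))"
    (is "nested _ _ ?C")
  proof (rule nested2I[of Y U V, OF pb.Y oU oV])
    fix x y z assume x: "x \<in> pts Y" and y: "y \<in> U x" and z: "z \<in> V x y"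
    have yp: "y \<in> pts Y" and zx: "z \<in> U x" and zy: "z \<in> U y" using UY[OF x y] D(7,8)[OF x y z] by auto
    let ?W = "V x y \<inter> V y z \<inter> V x z"
    have W: "openin (dtop Y) ?W" "z \<in> ?W" using oV[OF x y] oV[OF yp zy] oV[OF x zx] z by auto
    have WU: "?W \<subseteq> pts Y" "?W \<subseteq> U x" "?W \<subseteq> U y" using VY[OF x y] by auto
    note sm = D(11)[OF x y z]
    have gc: "\<gamma> a b u \<in> carrier Gh" if "a \<in> pts Y" "b \<in> U a" "u \<in> V a b" for a b u
      using dsmooth_pts[OF D(9)[OF that(1,2)], of u] VY(1)[OF that(1,2)] that(3) by auto
    have cc: "cmod (c [x, y, z] u) = 1" if "u \<in> ?W" for u
      using dsmooth_pts[OF sm, of u] that WU by auto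
    have sh: "restrict (shift N g) (M \<times> carrier Gh) = shift M g" if "M \<subseteq> N" for M N g
      using that by (auto simp: shift_def restrict_def fun_eq_iff)
    have P0: "pts (sub_diff (prod_diff (sub_diff Y A) (dspace Gh)) (fst -` ?W)) = ?W \<times> carrier Gh"
      if "?W \<subseteq> A" for A using that WU by auto
    have W_sub: "?W \<subseteq> V x y" "?W \<subseteq> V y z" "?W \<subseteq> V x z" by auto
    have P: "pts (sub_diff (prod_diff (sub_diff Y A) (dspace Gh)) (fst -` N \<inter> fst -` ?W)) = ?W \<times> carrier Gh"
      if "?W \<subseteq> A" "?W \<subseteq> N" for A N using that WU by auto
    have "compose (?W \<times> carrier Gh) (shift ?W (\<gamma> y z)) (shift ?W (\<gamma> x y))
        = (\<lambda>r\<in>?W \<times> carrier Gh. shift ?W (\<gamma> x z) (fst r, \<iota> (c [x, y, z] (fst r)) \<cdot> snd r))" (is "?L = ?R")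
    proof
      fix r
      show "?L r = ?R r"
      proof (cases "r \<in> ?W \<times> carrier Gh")
        case True
        then obtain u k where uk: "r = (u, k)" "u \<in> ?W" "k \<in> carrier Gh" by blast
        have g: "\<gamma> x y u \<in> carrier Gh" "\<gamma> y z u \<in> carrier Gh" "\<gamma> x z u \<in> carrier Gh"
          using gc[OF x y] gc[OF yp zy] gc[OF x zx] uk(2) by auto
        note c1 = cc[OF uk(2)]
        have "?L r = (u, (k \<cdot> \<gamma> x y u) \<cdot> \<gamma> y z u)"
          using uk g by (simp add: compose_def shift_def)
        also have "(k \<cdot> \<gamma> x y u) \<cdot> \<gamma> y z u = k \<cdot> (\<iota> (c [x, y, z] u) \<cdot> \<gamma> x z u)"
          using D(12)[OF x y z, of u] uk g by (simp add: gh.m_assoc)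
        also have "\<dots> = (\<iota> (c [x, y, z] u) \<cdot> k) \<cdot> \<gamma> x z u"
          using uk(3) g c1 by (simp add: iota_central flip: gh.m_assoc)
        also have "(u, \<dots>) = ?R r" using uk g c1 by (simp add: shift_def)
        finally show ?thesis .
      next
        case False
        then show ?thesis unfolding compose_def by simp
      qed
    qed
    moreover have "(\<lambda>r\<in>?W \<times> carrier Gh. shift ?W (\<gamma> x z) (fst r, \<iota> (c [x, y, z] (fst r)) \<cdot> snd r))
      = gband ?K (gores ?K ?W (Ob x)) (c [x, y, z]) (gmres ?K ?W (gores ?K (V x z) (Ob x)) (F x z))"
      by (simp only: res F_def lifting_gerbe_simps bundle_restrict_simps sub_diff_sub_diff trivial_bundle_simps
          P0[OF WU(2)] P[OF WU(2) W_sub(3)] sh[OF W_sub(3)])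
    moreover have "gcomp ?K (gores ?K ?W (Ob x))
              (gmres ?K ?W (gores ?K (V y z) (Ob y)) (F y z)) (gmres ?K ?W (gores ?K (V x y) (Ob x)) (F x y))
        = compose (?W \<times> carrier Gh) (shift ?W (\<gamma> y z)) (shift ?W (\<gamma> x y))"
      by (simp only: res F_def lifting_gerbe_simps bundle_restrict_simps sub_diff_sub_diff trivial_bundle_simps
          P0[OF WU(2)] P[OF WU(2) W_sub(1)] P[OF WU(3) W_sub(2)] sh[OF W_sub(1)] sh[OF W_sub(2)])
    ultimately have "gcomp ?K (gores ?K ?W (Ob x))
              (gmres ?K ?W (gores ?K (V y z) (Ob y)) (F y z)) (gmres ?K ?W (gores ?K (V x y) (Ob x)) (F x y))
            = gband ?K (gores ?K ?W (Ob x)) (c [x, y, z]) (gmres ?K ?W (gores ?K (V x z) (Ob x)) (F x z))" by simp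
    then show "?C [x, y, z]"
      using W sm unfolding Let_def nth_Cons_0
      by (intro exI[of _ ?W]) (simp add: numeral_2_eq_2)
  qed
  show ?thesis unfolding gerbe_class_def
  proof (intro CollectI conjI exI)
    show "c \<in> cocycles Y circle 2" by (rule cech_cocycle[OF cd])
    show "\<forall>x\<in>pts Y. openin (dtop Y) (U x) \<and> x \<in> U x \<and> Ob x \<in> gobj ?K (U x)" by (rule ob)
    show "\<forall>x\<in>pts Y. \<forall>y\<in>U x. openin (dtop Y) (V x y) \<and> y \<in> V x y \<and> V x y \<subseteq> U x \<inter> U y \<and>
        F x y \<in> ghom ?K (V x y) (gores ?K (V x y) (Ob x)) (gores ?K (V x y) (Ob y))" by (rule mo)
    show "nested (dtop Y) 2 (\<lambda>xs. let x = xs ! 0; y = xs ! 1; z = xs ! 2 in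
        \<exists>W. openin (dtop Y) W \<and> z \<in> W \<and> W \<subseteq> V x y \<inter> V y z \<inter> V x z \<and>
          dsmooth (sub_diff Y W) (dspace circle) (c xs) \<and>
          gcomp ?K (gores ?K W (Ob x))
              (gmres ?K W (gores ?K (V y z) (Ob y)) (F y z)) (gmres ?K W (gores ?K (V x y) (Ob x)) (F x y))
            = gband ?K (gores ?K W (Ob x)) (c xs) (gmres ?K W (gores ?K (V x z) (Ob x)) (F x z)))"
      using co by (simp only: numeral_2_eq_2)
  qed
qed

end

section \<open>Uniqueness of the gerbe class\<close>

context lifting_problem
begin

text \<open>A local frame of a lift \<open>(R, \<alpha>)\<close> covers some multiple of the section \<open>s\<close> of \<open>Q\<close>; after the
  multiplier is lifted to the extension, the frame can be corrected so as to cover \<open>s\<close> itself.  The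
  coordinate \<open>k\<close> is the group coordinate with respect to the corrected frame.\<close>

definition lift_coordinate :: "('y \<Rightarrow> 'p) \<Rightarrow> ('h, 'p, 'y) lift_obj \<Rightarrow> 'y set \<Rightarrow> ('y \<times> 'h \<Rightarrow> 'h) \<Rightarrow> bool" where
  "lift_coordinate s Ra N k \<longleftrightarrow>
    (\<forall>r\<in>pts (tot (fst Ra)). proj (fst Ra) r \<in> N \<longrightarrow> k r \<in> carrier Gh \<and>
       snd Ra (circle_orbit \<iota> (fst Ra) r) = gact Q (\<pi> (k r)) (s (proj (fst Ra) r)) \<and>
       (\<forall>h\<in>carrier Gh. k (gact (fst Ra) h r) = h \<cdot> k r)) \<and>
    dsmooth (sub_diff (tot (fst Ra)) (proj (fst Ra) -` N)) (dspace Gh) k"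

lemma exists_lift_coordinate:
  assumes U: "openin (dtop Y) U" "x \<in> U" and s: "dsmooth (sub_diff Y U) (tot Q) s" and ps: "\<And>u. u \<in> U \<Longrightarrow> proj Q (s u) = u"
    and U': "openin (dtop Y) U'" "x \<in> U'" and Ra: "Ra \<in> lift_objects Gh \<iota> \<pi> Y Q U'"
  shows "\<exists>N k. openin (dtop Y) N \<and> x \<in> N \<and> N \<subseteq> U \<inter> U' \<and> lift_coordinate s Ra N k"
proof -
  obtain R \<alpha> where R\<alpha>: "Ra = (R, \<alpha>)" by (cases Ra)
  note Ra' = Ra[unfolded R\<alpha> lift_objects_def mem_Collect_eq case_prod_conv]
  note pR = conjunct1[OF Ra'] and df = conjunct1[OF conjunct2[OF Ra']] and eqv = conjunct2[OF conjunct2[OF Ra']]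
  let ?Y = "sub_diff Y U'" and ?q = "circle_orbit \<iota> R"
  interpret R: principal Gh ?Y R
    by unfold_locales (rule dgroups(2), rule diffeological_sub_diff[OF pb.Y], rule pR)
  have aq: "dsmooth (tot R) (tot (bundle_restrict Q U')) (\<lambda>r. \<alpha> (?q r))"
    by (rule dsmooth_compose[OF dsmooth_quotient_map[OF R.tot]]) (use df in \<open>simp only: diffeo_def\<close>)
  have aqQ: "dsmooth (tot R) (tot Q) (\<lambda>r. \<alpha> (?q r))"
    using aq unfolding bundle_restrict_simps by (rule dsmooth_from_sub)
  have paq: "proj Q (\<alpha> (?q r)) = proj R r" if "r \<in> pts (tot R)" for r
    using bspec[OF eqv that] by (rule conjunct1)
  have eaq: "\<alpha> (?q (gact R h r)) = gact Q (\<pi> h) (\<alpha> (?q r))" if "r \<in> pts (tot R)" "h \<in> carrier Gh" for r h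
    using bspec[OF conjunct2[OF bspec[OF eqv that(1)]] that(2)] .
  have U'Y: "U' \<subseteq> pts Y" by (rule openin_dtop_subset[OF U'(1)])
  have "x \<in> pts ?Y" using U'(2) U'Y by auto
  then obtain N0 \<rho> where N0: "openin (dtop ?Y) N0" "x \<in> N0" and \<rho>: "dsmooth (sub_diff ?Y N0) (tot R) \<rho>"
    and p\<rho>: "\<And>u. u \<in> N0 \<Longrightarrow> proj R (\<rho> u) = u"
    by (rule R.local_section) (rule that)
  have N0': "openin (dtop Y) N0" "N0 \<subseteq> U'" using N0(1) openin_dtop_sub[OF pb.Y U'(1)] by simp_all
  define N1 where "N1 = N0 \<inter> U"
  have N1: "openin (dtop Y) N1" "x \<in> N1" "N1 \<subseteq> N0" "N1 \<subseteq> U" "N1 \<subseteq> U'" "N1 \<subseteq> pts Y"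
    using N0'(1) U N0(2) N0'(2) U'Y by (auto simp: N1_def)
  have "sub_diff ?Y N0 = sub_diff Y N0" using N0'(2) by (simp add: Int_absorb1)
  then have \<rho>1: "dsmooth (sub_diff Y N1) (tot R) \<rho>" using dsmooth_sub_mono[OF _ N1(3)] \<rho> by simp
  have \<rho>p: "\<rho> u \<in> pts (tot R)" if "u \<in> N1" for u using dsmooth_pts[OF \<rho>1, of u] that N1(6) by auto
  have sp: "s u \<in> pts (tot Q)" if "u \<in> N1" for u using dsmooth_pts[OF s, of u] that N1(4,6) by auto
  have pa: "proj Q (\<alpha> (?q (\<rho> u))) = u" if "u \<in> N1" for u
    using paq[OF \<rho>p[OF that]] p\<rho> that N1(3) by auto
  have "dsmooth (sub_diff Y N1) (dspace G) (\<lambda>u. translation G Q (s u) (\<alpha> (?q (\<rho> u))))"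
    by (rule transition_smooth[OF dsmooth_sub_mono[OF s N1(4)] dsmooth_compose[OF \<rho>1 aqQ]]) (use pa ps N1(4) in auto)
  from lift_smooth[OF pb.Y N1(1,2) this] obtain N \<gamma> where N: "openin (dtop Y) N" "x \<in> N" "N \<subseteq> N1"
    and \<gamma>: "dsmooth (sub_diff Y N) (dspace Gh) \<gamma>" and \<pi>\<gamma>: "\<And>v. v \<in> N \<Longrightarrow> \<pi> (\<gamma> v) = translation G Q (s v) (\<alpha> (?q (\<rho> v)))"
    by blast
  have \<gamma>c: "\<gamma> u \<in> carrier Gh" if "u \<in> N" for u using dsmooth_pts[OF \<gamma>, of u] that N(3) N1(6) by auto
  have \<gamma>s: "gact Q (\<pi> (\<gamma> u)) (s u) = \<alpha> (?q (\<rho> u))" if "u \<in> N" for u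
  proof -
    have u: "u \<in> N1" "u \<in> U" using that N(3) N1(4) by auto
    show ?thesis unfolding \<pi>\<gamma>[OF that]
      by (rule pb.translation(2)[OF sp[OF u(1)] dsmooth_pts[OF aqQ \<rho>p[OF u(1)]]]) (simp add: pa[OF u(1)] ps[OF u(2)])
  qed
  \<comment> \<open>If \<open>r = t \<cdot> \<rho> u\<close> then \<open>r = (t \<cdot> \<gamma> u) \<cdot> (\<gamma> u)\<^sup>-\<^sup>1 \<cdot> \<rho> u\<close>, and the frame \<open>(\<gamma> u)\<^sup>-\<^sup>1 \<cdot> \<rho> u\<close> covers \<open>s u\<close>.\<close>
  define k where "k r = translation Gh R (\<rho> (proj R r)) r \<cdot> \<gamma> (proj R r)" for r
  have tr: "translation Gh R (\<rho> (proj R r)) r \<in> carrier Gh" "gact R (translation Gh R (\<rho> (proj R r)) r) (\<rho> (proj R r)) = r"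
    if "r \<in> pts (tot R)" "proj R r \<in> N" for r
  proof -
    have u: "proj R r \<in> N1" using that(2) N(3) by auto
    show "translation Gh R (\<rho> (proj R r)) r \<in> carrier Gh" "gact R (translation Gh R (\<rho> (proj R r)) r) (\<rho> (proj R r)) = r"
      by (rule R.translation[OF \<rho>p[OF u] that(1)], use p\<rho> u N1(3) in auto)+
  qed
  have kN: "k r \<in> carrier Gh \<and> \<alpha> (?q r) = gact Q (\<pi> (k r)) (s (proj R r)) \<and>
       (\<forall>h\<in>carrier Gh. k (gact R h r) = h \<cdot> k r)"
    if r: "r \<in> pts (tot R)" "proj R r \<in> N" for r
  proof (intro conjI ballI)
    let ?u = "proj R r" and ?t = "translation Gh R (\<rho> (proj R r)) r"
    have u: "?u \<in> N1" using r(2) N(3) by auto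
    note t = tr[OF r] and g = \<gamma>c[OF r(2)]
    show "k r \<in> carrier Gh" unfolding k_def by (rule gh.m_closed[OF t(1) g])
    have "\<alpha> (?q r) = \<alpha> (?q (gact R ?t (\<rho> ?u)))" unfolding t(2) ..
    also have "\<dots> = gact Q (\<pi> ?t) (\<alpha> (?q (\<rho> ?u)))" by (rule eaq[OF \<rho>p[OF u] t(1)])
    also have "\<dots> = gact Q (\<pi> ?t) (gact Q (\<pi> (\<gamma> ?u)) (s ?u))" unfolding \<gamma>s[OF r(2)] ..
    also have "\<dots> = gact Q (\<pi> (k r)) (s ?u)"
      unfolding k_def pi_mult[OF t(1) g] by (rule pb.act_act[OF pi_closed[OF t(1)] pi_closed[OF g] sp[OF u]])
    finally show "\<alpha> (?q r) = gact Q (\<pi> (k r)) (s ?u)" .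
    fix h assume h: "h \<in> carrier Gh"
    have "gact R h r = gact R (h \<cdot> ?t) (\<rho> ?u)"
      using R.act_act[OF h t(1) \<rho>p[OF u]] t(2) by simp
    then have "translation Gh R (\<rho> ?u) (gact R h r) = h \<cdot> ?t"
      using R.translation_eq[OF gh.m_closed[OF h t(1)] \<rho>p[OF u]] by simp
    then show "k (gact R h r) = h \<cdot> k r"
      unfolding k_def R.proj_act[OF h r(1)] using h t(1) g by (simp add: gh.m_assoc)
  qed
  have ksm: "dsmooth (sub_diff (tot R) (proj R -` N)) (dspace Gh) k"
  proof (rule dsmoothI)
    show "k r \<in> pts (dspace Gh)" if "r \<in> pts (sub_diff (tot R) (proj R -` N))" for r
      using kN[of r] that by simp
    fix n W p assume "plot (sub_diff (tot R) (proj R -` N)) n W p"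
    then have p: "plot (tot R) n W p" and pN: "\<And>w. w \<in> W \<Longrightarrow> proj R (p w) \<in> N" by (auto simp: image_subset_iff)
    have pY: "plot (sub_diff Y N) n W (\<lambda>w. proj R (p w))"
      using dsmooth_plot[OF R.proj_smooth p] pN by auto
    have pY1: "plot (sub_diff Y N1) n W (\<lambda>w. proj R (p w))" using pY N(3) by auto
    have "plot (dspace Gh) n W (\<lambda>w. translation Gh R (\<rho> (proj R (p w))) (p w))"
      by (rule R.translation_plot[OF dsmooth_plot[OF \<rho>1 pY1] p]) (use p\<rho> pN N(3) N1(3) in auto)
    from gplot_mult[OF dgroups(2) this dsmooth_plot[OF \<gamma> pY]]
    show "plot (dspace Gh) n W (\<lambda>w. k (p w))" unfolding k_def .
  qed
  have "lift_coordinate s Ra N k"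
    unfolding lift_coordinate_def R\<alpha> fst_conv snd_conv using kN ksm by simp
  then show ?thesis using N N1(4,5) by (intro exI[of _ N] exI[of _ k]) auto
qed

lemma lift_coordinateD:
  assumes "lift_coordinate s (R, \<alpha>) N k"
  shows "\<And>r. r \<in> pts (tot R) \<Longrightarrow> proj R r \<in> N \<Longrightarrow> k r \<in> carrier Gh"
    "\<And>r. r \<in> pts (tot R) \<Longrightarrow> proj R r \<in> N \<Longrightarrow> \<alpha> (circle_orbit \<iota> R r) = gact Q (\<pi> (k r)) (s (proj R r))"
    "\<And>r h. r \<in> pts (tot R) \<Longrightarrow> proj R r \<in> N \<Longrightarrow> h \<in> carrier Gh \<Longrightarrow> k (gact R h r) = h \<cdot> k r"
    "dsmooth (sub_diff (tot R) (proj R -` N)) (dspace Gh) k"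
  using assms unfolding lift_coordinate_def fst_conv snd_conv by simp_all

lemma lift_isosD:
  assumes F: "F \<in> lift_isos Gh \<iota> (bundle_restrict R V, \<alpha>) (bundle_restrict R' V, \<alpha>')"
    and r: "r \<in> pts (tot R)" "proj R r \<in> V"
  shows "F r \<in> pts (tot R')" "proj R' (F r) = proj R r"
    "\<alpha>' (circle_orbit \<iota> R' (F r)) = \<alpha> (circle_orbit \<iota> R r)"
    "\<And>h. h \<in> carrier Gh \<Longrightarrow> F (gact R h r) = gact R' h (F r)"
proof -
  have Fd: "dsmooth (sub_diff (tot R) (proj R -` V)) (sub_diff (tot R') (proj R' -` V)) F"
    using F unfolding lift_isos_def by (simp add: diffeo_def)
  have r': "r \<in> pts (tot (bundle_restrict R V))" using r by simp
  show "F r \<in> pts (tot R')" using dsmooth_pts[OF Fd, of r] r by simp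
  have "\<forall>r\<in>pts (tot (bundle_restrict R V)). proj R' (F r) = proj R r \<and>
     (\<forall>h\<in>carrier Gh. F (gact R h r) = gact R' h (F r)) \<and> \<alpha>' (circle_orbit \<iota> R' (F r)) = \<alpha> (circle_orbit \<iota> R r)"
    using F unfolding lift_isos_def mem_Collect_eq case_prod_conv bundle_restrict_simps(2,3) circle_orbit_restrict by (elim conjE)
  note A = bspec[OF this r']
  show "proj R' (F r) = proj R r" by (rule conjunct1[OF A])
  show "\<alpha>' (circle_orbit \<iota> R' (F r)) = \<alpha> (circle_orbit \<iota> R r)" by (rule conjunct2[OF conjunct2[OF A]])
  show "F (gact R h r) = gact R' h (F r)" if "h \<in> carrier Gh" for h by (rule bspec[OF conjunct1[OF conjunct2[OF A]] that])
qed

lemma lift_object_principal: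
  assumes "Ob \<in> lift_objects Gh \<iota> \<pi> Y Q U"
  shows "principal Gh (sub_diff Y U) (fst Ob)"
proof -
  have "principal_bundle Gh (sub_diff Y U) (fst Ob)" using assms by (auto simp: lift_objects_def)
  then show ?thesis by unfold_locales (rule dgroups(2), rule diffeological_sub_diff[OF pb.Y])
qed

text \<open>In these coordinates every isomorphism of lifts differs from the chosen lift of the transition
  function by a smooth circle-valued function.\<close>

lemma compare_isomorphism:
  assumes Ra: "(R, \<alpha>) \<in> lift_objects Gh \<iota> \<pi> Y Q Ux" and Rb: "(R', \<alpha>') \<in> lift_objects Gh \<iota> \<pi> Y Q Uy"
    and V: "openin (dtop Y) V" "V \<subseteq> Ux" "openin (dtop Y) Ux"
    and F: "F \<in> lift_isos Gh \<iota> (bundle_restrict R V, \<alpha>) (bundle_restrict R' V, \<alpha>')"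
    and k: "lift_coordinate s (R, \<alpha>) N k" and k': "lift_coordinate t (R', \<alpha>') N' k'"
    and M: "openin (dtop Y) M" "M \<subseteq> V" "M \<subseteq> N" "M \<subseteq> N'"
    and \<gamma>: "dsmooth (sub_diff Y M) (dspace Gh) \<gamma>"
    and st: "\<And>u. u \<in> M \<Longrightarrow> s u = gact Q (\<pi> (\<gamma> u)) (t u)" and t: "\<And>u. u \<in> M \<Longrightarrow> t u \<in> pts (tot Q)"
  shows "\<exists>b. (\<forall>u\<in>M. cmod (b u) = 1) \<and>
     (\<forall>r\<in>pts (tot R). proj R r \<in> M \<longrightarrow> k r \<cdot> \<gamma> (proj R r) = \<iota> (b (proj R r)) \<cdot> k' (F r)) \<and>
     dsmooth (sub_diff Y M) (dspace circle) b"
proof -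
  note Ra' = Ra[unfolded lift_objects_def mem_Collect_eq case_prod_conv]
  let ?Y = "sub_diff Y Ux"
  interpret R: principal Gh ?Y R
    by unfold_locales (rule dgroups(2), rule diffeological_sub_diff[OF pb.Y], rule conjunct1[OF Ra'])
  note k = lift_coordinateD[OF k] and k' = lift_coordinateD[OF k']
  have MY: "M \<subseteq> pts Y" by (rule openin_dtop_subset[OF M(1)])
  have Fd: "dsmooth (sub_diff (tot R) (proj R -` V)) (sub_diff (tot R') (proj R' -` V)) F"
    using F unfolding lift_isos_def by (simp add: diffeo_def)
  note Fp = lift_isosD(1,2)[OF F] and Fa = lift_isosD(3)[OF F] and Fh = lift_isosD(4)[OF F]
  have \<gamma>c: "\<gamma> u \<in> carrier Gh" if "u \<in> M" for u using dsmooth_pts[OF \<gamma>, of u] that MY by auto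
  have c: "k r \<cdot> \<gamma> (proj R r) \<in> carrier Gh" "k' (F r) \<in> carrier Gh"
    and eq: "\<pi> (k r \<cdot> \<gamma> (proj R r)) = \<pi> (k' (F r))"
    if r: "r \<in> pts (tot R)" and u: "proj R r \<in> M" for r
  proof -
    have uV: "proj R r \<in> V" "proj R r \<in> N" "proj R r \<in> N'" using u M by auto
    note kr = k(1)[OF r uV(2)] and g = \<gamma>c[OF u]
    have u': "proj R' (F r) \<in> N'" unfolding Fp(2)[OF r uV(1)] by (rule uV(3))
    note k'r = k'(1)[OF Fp(1)[OF r uV(1)] u']
    show "k r \<cdot> \<gamma> (proj R r) \<in> carrier Gh" "k' (F r) \<in> carrier Gh" using kr g k'r by simp_all
    show "\<pi> (k r \<cdot> \<gamma> (proj R r)) = \<pi> (k' (F r))"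
    proof (rule pb.act_free[OF _ _ t[OF u]])
      have "gact Q (\<pi> (k r \<cdot> \<gamma> (proj R r))) (t (proj R r)) = gact Q (\<pi> (k r)) (gact Q (\<pi> (\<gamma> (proj R r))) (t (proj R r)))"
        unfolding pi_mult[OF kr g] by (rule pb.act_act[OF pi_closed[OF kr] pi_closed[OF g] t[OF u], symmetric])
      also have "\<dots> = \<alpha> (circle_orbit \<iota> R r)" unfolding st[OF u, symmetric] k(2)[OF r uV(2)] ..
      also have "\<dots> = \<alpha>' (circle_orbit \<iota> R' (F r))" by (rule Fa[OF r uV(1), symmetric])
      also have "\<dots> = gact Q (\<pi> (k' (F r))) (t (proj R' (F r)))" by (rule k'(2)[OF Fp(1)[OF r uV(1)] u'])
      finally show "gact Q (\<pi> (k r \<cdot> \<gamma> (proj R r))) (t (proj R r)) = gact Q (\<pi> (k' (F r))) (t (proj R r))"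
        unfolding Fp(2)[OF r uV(1)] .
    qed (use kr g k'r in simp_all)
  qed
  define B where "B r = circle_quotient (k r \<cdot> \<gamma> (proj R r)) (k' (F r))" for r
  have B: "cmod (B r) = 1" "k r \<cdot> \<gamma> (proj R r) = \<iota> (B r) \<cdot> k' (F r)"
    if "r \<in> pts (tot R)" "proj R r \<in> M" for r
    unfolding B_def by (rule circle_quotient[OF c[OF that] eq[OF that]])+
  have inv: "B (gact R h r) = B r" if r: "r \<in> pts (tot R)" "proj R r \<in> M" and h: "h \<in> carrier Gh" for r h
  proof (rule iota_cancel)
    have uV: "proj R r \<in> V" "proj R r \<in> N" "proj R r \<in> N'" using r(2) M by auto
    have hr: "gact R h r \<in> pts (tot R)" "proj R (gact R h r) \<in> M"
      using R.act_pts[OF h r(1)] R.proj_act[OF h r(1)] r(2) by simp_all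
    show "cmod (B (gact R h r)) = 1" "cmod (B r) = 1" by (rule B(1)[OF hr], rule B(1)[OF r])
    show K: "k' (F (gact R h r)) \<in> carrier Gh" by (rule c(2)[OF hr])
    have u': "proj R' (F r) \<in> N'" unfolding Fp(2)[OF r(1) uV(1)] by (rule uV(3))
    have K': "k' (F (gact R h r)) = h \<cdot> k' (F r)"
      unfolding Fh[OF r(1) uV(1) h] by (rule k'(3)[OF Fp(1)[OF r(1) uV(1)] u' h])
    have "\<iota> (B (gact R h r)) \<cdot> k' (F (gact R h r)) = k (gact R h r) \<cdot> \<gamma> (proj R r)"
      using B(2)[OF hr] R.proj_act[OF h r(1)] by simp
    also have "\<dots> = h \<cdot> (k r \<cdot> \<gamma> (proj R r))"
      unfolding k(3)[OF r(1) uV(2) h] using h k(1)[OF r(1) uV(2)] \<gamma>c[OF r(2)] by (simp add: gh.m_assoc)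
    also have "\<dots> = h \<cdot> (\<iota> (B r) \<cdot> k' (F r))" unfolding B(2)[OF r] ..
    also have "\<dots> = \<iota> (B r) \<cdot> k' (F (gact R h r))"
      unfolding K' using h c(2)[OF r] B(1)[OF r] iota_central[OF B(1)[OF r] h] by (simp flip: gh.m_assoc)
    finally show "\<iota> (B (gact R h r)) \<cdot> k' (F (gact R h r)) = \<iota> (B r) \<cdot> k' (F (gact R h r))" .
  qed
  \<comment> \<open>By equivariance \<open>B\<close> is constant on fibres, so it descends to the base.\<close>
  define b where "b u = B (SOME r. r \<in> pts (tot R) \<and> proj R r = u)" for u
  have bB: "b (proj R r) = B r" if r: "r \<in> pts (tot R)" "proj R r \<in> M" for r
  proof -
    let ?r = "SOME r'. r' \<in> pts (tot R) \<and> proj R r' = proj R r"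
    have r': "?r \<in> pts (tot R) \<and> proj R ?r = proj R r" by (rule someI[of _ r]) (use r in simp)
    then have "gact R (translation Gh R r ?r) r = ?r" "translation Gh R r ?r \<in> carrier Gh"
      using R.translation[OF r(1), of ?r] by simp_all
    then show ?thesis unfolding b_def using inv[OF r, of "translation Gh R r ?r"] by simp
  qed
  have bsm: "dsmooth (sub_diff Y M) (dspace circle) b"
  proof (rule dsmooth_local)
    show "diffeological_space (sub_diff Y M)" by (rule diffeological_sub_diff[OF pb.Y])
    show "diffeological_space (dspace circle)" by (rule diffeological_groupD[OF diffeological_group_circle])
    fix x assume "x \<in> pts (sub_diff Y M)"
    then have x: "x \<in> M" by simp
    then have "x \<in> pts ?Y" using MY M(2) V(2) by auto
    then obtain N0 \<rho> where N0: "openin (dtop ?Y) N0" "x \<in> N0" and \<rho>: "dsmooth (sub_diff ?Y N0) (tot R) \<rho>"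
      and p\<rho>: "\<And>u. u \<in> N0 \<Longrightarrow> proj R (\<rho> u) = u"
      by (rule R.local_section) (rule that)
    have N0': "openin (dtop Y) N0" "N0 \<subseteq> Ux" using N0(1) openin_dtop_sub[OF pb.Y V(3)] by simp_all
    define W where "W = N0 \<inter> M"
    have W: "openin (dtop Y) W" "x \<in> W" "W \<subseteq> M" "W \<subseteq> N0" using N0'(1) M(1) N0(2) x by (auto simp: W_def)
    have "sub_diff ?Y N0 = sub_diff Y N0" using N0'(2) by (simp add: Int_absorb1)
    then have \<rho>1: "dsmooth (sub_diff Y W) (tot R) \<rho>" using dsmooth_sub_mono[OF _ W(4)] \<rho> by simp
    have \<rho>p: "\<rho> u \<in> pts (tot R)" "proj R (\<rho> u) = u" if "u \<in> W" for u
      using dsmooth_pts[OF \<rho>1, of u] that W(3,4) MY p\<rho> by auto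
    have dW: "diffeological_space (sub_diff Y W)" by (rule diffeological_sub_diff[OF pb.Y])
    have \<rho>N: "dsmooth (sub_diff Y W) (sub_diff (tot R) (proj R -` N)) \<rho>"
      by (rule dsmooth_into_sub[OF \<rho>1 _ dW]) (use \<rho>p(2) W(3) M(3) in auto)
    have \<rho>V: "dsmooth (sub_diff Y W) (sub_diff (tot R) (proj R -` V)) \<rho>"
      by (rule dsmooth_into_sub[OF \<rho>1 _ dW]) (use \<rho>p(2) W(3) M(2) in auto)
    have "dsmooth (sub_diff Y W) (sub_diff (tot R') (proj R' -` V)) (\<lambda>u. F (\<rho> u))"
      by (rule dsmooth_compose[OF \<rho>V Fd])
    then have "dsmooth (sub_diff Y W) (tot R') (\<lambda>u. F (\<rho> u))" by (rule dsmooth_from_sub)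
    moreover have "proj R' (F (\<rho> u)) \<in> N'" if "u \<in> W" for u
    proof -
      have u: "u \<in> V" "u \<in> N'" using that W(3) M(2,4) by auto
      then have "proj R (\<rho> u) \<in> V" unfolding \<rho>p(2)[OF that] by simp
      from Fp(2)[OF \<rho>p(1)[OF that] this] show ?thesis unfolding \<rho>p(2)[OF that] using u(2) by simp
    qed
    ultimately have FN: "dsmooth (sub_diff Y W) (sub_diff (tot R') (proj R' -` N')) (\<lambda>u. F (\<rho> u))"
      by (intro dsmooth_into_sub dW) auto
    have k1: "dsmooth (sub_diff Y W) (dspace Gh) (\<lambda>u. k (\<rho> u))" by (rule dsmooth_compose[OF \<rho>N k(4)])
    have k2: "dsmooth (sub_diff Y W) (dspace Gh) (\<lambda>u. k' (F (\<rho> u)))" by (rule dsmooth_compose[OF FN k'(4)])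
    have g1: "dsmooth (sub_diff Y W) (dspace Gh) \<gamma>" by (rule dsmooth_sub_mono[OF \<gamma> W(3)])
    have pr: "dsmooth (sub_diff Y W) (dspace Gh) (\<lambda>u. k (\<rho> u) \<cdot> \<gamma> u)"
    proof (rule dsmoothI)
      show "k (\<rho> u) \<cdot> \<gamma> u \<in> pts (dspace Gh)" if "u \<in> pts (sub_diff Y W)" for u
        using dsmooth_pts[OF k1 that] dsmooth_pts[OF g1 that] by simp
      show "plot (dspace Gh) n A (\<lambda>w. k (\<rho> (p w)) \<cdot> \<gamma> (p w))" if p: "plot (sub_diff Y W) n A p" for n A p
        by (rule gplot_mult[OF dgroups(2) dsmooth_plot[OF k1 p] dsmooth_plot[OF g1 p]])
    qed
    have "dsmooth (sub_diff Y W) (dspace circle) (\<lambda>u. circle_quotient (k (\<rho> u) \<cdot> \<gamma> u) (k' (F (\<rho> u))))"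
    proof (rule circle_quotient_smooth[OF dW pr k2])
      fix u assume "u \<in> pts (sub_diff Y W)"
      then have u: "u \<in> W" by simp
      from eq[OF \<rho>p(1)[OF u]] show "\<pi> (k (\<rho> u) \<cdot> \<gamma> u) = \<pi> (k' (F (\<rho> u)))"
        unfolding \<rho>p(2)[OF u] using u W(3) by auto
    qed
    then have "dsmooth (sub_diff Y W) (dspace circle) b"
    proof (rule dsmooth_cong[OF dW diffeological_groupD(2)[OF diffeological_group_circle]])
      fix u assume "u \<in> pts (sub_diff Y W)"
      then have u: "u \<in> W" by simp
      from bB[OF \<rho>p(1)[OF u]] show "b u = circle_quotient (k (\<rho> u) \<cdot> \<gamma> u) (k' (F (\<rho> u)))"
        unfolding \<rho>p(2)[OF u] B_def using u W(3) by auto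
    qed
    moreover have "openin (dtop (sub_diff Y M)) W" using openin_dtop_sub[OF pb.Y M(1)] W(1,3) by simp
    moreover have "sub_diff (sub_diff Y M) W = sub_diff Y W" using W(3) by (simp add: Int_absorb1)
    ultimately show "\<exists>W. openin (dtop (sub_diff Y M)) W \<and> x \<in> W \<and> dsmooth (sub_diff (sub_diff Y M) W) (dspace circle) b"
      using W(2) by (intro exI[of _ W]) simp
  qed
  have "cmod (b u) = 1" if "u \<in> M" for u using dsmooth_pts[OF bsm, of u] that MY by auto
  moreover have "k r \<cdot> \<gamma> (proj R r) = \<iota> (b (proj R r)) \<cdot> k' (F r)"
    if "r \<in> pts (tot R)" "proj R r \<in> M" for r unfolding bB[OF that] by (rule B(2)[OF that])
  ultimately show ?thesis using bsm by (intro exI[of _ b]) simp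
qed

text \<open>Let \<open>k x\<close> be coordinates of the objects of another choice and \<open>F x y\<close> its isomorphisms, so that
  \<open>k x r \<cdot> \<gamma> x y = b x y \<cdot> k y (F x y r)\<close> with circle-valued \<open>b\<close>.  Evaluating
  \<open>k x r \<cdot> \<gamma> x y \<cdot> \<gamma> y z\<close> through \<open>F y z \<circ> F x y\<close> and through \<open>F x z\<close> yields
  \<open>c x y z * b x z = b x y * b y z * c' x y z\<close>.\<close>

lemma gerbe_class_cohomologous:
  assumes cd: "cech_data Gh \<iota> \<pi> Y Q U s V \<gamma> c" and c': "c' \<in> gerbe_class Y (lifting_gerbe Gh \<iota> \<pi> Y Q)"
  shows "cohomologous Y circle (Suc (Suc 0)) c c'"
proof -
  let ?K = "lifting_gerbe Gh \<iota> \<pi> Y Q"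
  note D = cech_dataD[OF cd]
  obtain U' Ob V' F' where
    A: "\<forall>x\<in>pts Y. openin (dtop Y) (U' x) \<and> x \<in> U' x \<and> Ob x \<in> gobj ?K (U' x)"
    and B: "\<forall>x\<in>pts Y. \<forall>y\<in>U' x. openin (dtop Y) (V' x y) \<and> y \<in> V' x y \<and> V' x y \<subseteq> U' x \<inter> U' y \<and>
        F' x y \<in> ghom ?K (V' x y) (gores ?K (V' x y) (Ob x)) (gores ?K (V' x y) (Ob y))"
    and C: "nested (dtop Y) 2 (\<lambda>xs. let x = xs ! 0; y = xs ! 1; z = xs ! 2 in
        \<exists>W. openin (dtop Y) W \<and> z \<in> W \<and> W \<subseteq> V' x y \<inter> V' y z \<inter> V' x z \<and>
          dsmooth (sub_diff Y W) (dspace circle) (c' xs) \<and>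
          gcomp ?K (gores ?K W (Ob x))
              (gmres ?K W (gores ?K (V' y z) (Ob y)) (F' y z)) (gmres ?K W (gores ?K (V' x y) (Ob x)) (F' x y))
            = gband ?K (gores ?K W (Ob x)) (c' xs) (gmres ?K W (gores ?K (V' x z) (Ob x)) (F' x z)))"
    using c' unfolding gerbe_class_def by (elim CollectE conjE exE)
  define R where "R x = fst (Ob x)" for x
  define al where "al x = snd (Ob x)" for x
  have Ob: "Ob x = (R x, al x)" for x by (simp add: R_def al_def)
  have U': "openin (dtop Y) (U' x)" "x \<in> U' x" and ob: "(R x, al x) \<in> lift_objects Gh \<iota> \<pi> Y Q (U' x)" if "x \<in> pts Y" for x
    using bspec[OF A that] by (simp_all add: lifting_gerbe_simps Ob)
  have V': "openin (dtop Y) (V' x y)" "y \<in> V' x y" "V' x y \<subseteq> U' x"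
    and F': "F' x y \<in> lift_isos Gh \<iota> (bundle_restrict (R x) (V' x y), al x) (bundle_restrict (R y) (V' x y), al y)"
    if "x \<in> pts Y" "y \<in> U' x" for x y
    using bspec[OF bspec[OF B that(1)] that(2)] by (simp_all add: lifting_gerbe_simps Ob)
  have UY: "y \<in> pts Y" if "x \<in> pts Y" "y \<in> U x" for x y using openin_dtop_subset[OF D(1)[OF that(1)]] that(2) by blast
  have sp: "s x u \<in> pts (tot Q)" if "x \<in> pts Y" "u \<in> U x" for x u
    using dsmooth_pts[OF D(3)[OF that(1)], of u] that UY by auto
  define P where "P x p \<longleftrightarrow> openin (dtop Y) (fst p) \<and> x \<in> fst p \<and> fst p \<subseteq> U x \<inter> U' x \<and> lift_coordinate (s x) (R x, al x) (fst p) (snd p)" for x p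
  have "\<forall>x\<in>pts Y. \<exists>p. P x p"
  proof
    fix x assume x: "x \<in> pts Y"
    have "\<exists>N k. openin (dtop Y) N \<and> x \<in> N \<and> N \<subseteq> U x \<inter> U' x \<and> lift_coordinate (s x) (R x, al x) N k"
      by (rule exists_lift_coordinate[OF D(1,2,3)[OF x] D(4)[OF x] U'[OF x] ob[OF x]])
    then obtain N k where "openin (dtop Y) N" "x \<in> N" "N \<subseteq> U x \<inter> U' x" "lift_coordinate (s x) (R x, al x) N k" by (elim exE conjE)
    then have "P x (N, k)" by (simp add: P_def)
    then show "\<exists>p. P x p" by (rule exI)
  qed
  then obtain Nk where Nk: "\<forall>x\<in>pts Y. P x (Nk x)" by (rule bchoice[elim_format]) (elim exE)
  define N where "N x = fst (Nk x)" for x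
  define k where "k x = snd (Nk x)" for x
  have N: "openin (dtop Y) (N x)" "x \<in> N x" "N x \<subseteq> U x" "N x \<subseteq> U' x" and k: "lift_coordinate (s x) (R x, al x) (N x) (k x)"
    if "x \<in> pts Y" for x using bspec[OF Nk that] by (simp_all add: P_def N_def k_def)
  define M where "M x y = N x \<inter> N y \<inter> V x y \<inter> V' x y" for x y
  have NY: "y \<in> pts Y" "y \<in> U x" "y \<in> U' x" if "x \<in> pts Y" "y \<in> N x" for x y
    using UY[OF that(1)] N(3,4)[OF that(1)] that(2) by auto
  have M: "openin (dtop Y) (M x y)" "y \<in> M x y" if x: "x \<in> pts Y" and y: "y \<in> N x" for x y
    using N(1)[OF x] N(1,2)[OF NY(1)[OF x y]] D(5,6)[OF x NY(2)[OF x y]] V'(1,2)[OF x NY(3)[OF x y]] y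
    unfolding M_def by auto
  define P2 where "P2 xy b \<longleftrightarrow> (case xy of (x, y) \<Rightarrow> (\<forall>u\<in>M x y. cmod (b u) = 1) \<and>
     (\<forall>r\<in>pts (tot (R x)). proj (R x) r \<in> M x y \<longrightarrow>
        k x r \<cdot> \<gamma> x y (proj (R x) r) = \<iota> (b (proj (R x) r)) \<cdot> k y (F' x y r)) \<and>
     dsmooth (sub_diff Y (M x y)) (dspace circle) b)" for xy b
  have "\<forall>xy\<in>Sigma (pts Y) N. \<exists>b. P2 xy b"
  proof
    fix xy assume "xy \<in> Sigma (pts Y) N"
    then obtain x y where xy: "xy = (x, y)" and x: "x \<in> pts Y" and y: "y \<in> N x" by blast
    note yy = NY[OF x y]
    have Ms: "M x y \<subseteq> V' x y" "M x y \<subseteq> N x" "M x y \<subseteq> N y" "M x y \<subseteq> V x y" by (auto simp: M_def)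
    have "\<exists>b. (\<forall>u\<in>M x y. cmod (b u) = 1) \<and>
       (\<forall>r\<in>pts (tot (R x)). proj (R x) r \<in> M x y \<longrightarrow>
          k x r \<cdot> \<gamma> x y (proj (R x) r) = \<iota> (b (proj (R x) r)) \<cdot> k y (F' x y r)) \<and>
       dsmooth (sub_diff Y (M x y)) (dspace circle) b"
    proof (rule compare_isomorphism[OF ob[OF x] ob[OF yy(1)] V'(1,3)[OF x yy(3)] U'(1)[OF x] F'[OF x yy(3)] k[OF x] k[OF yy(1)] M(1)[OF x y] Ms(1,2,3)])
      show "dsmooth (sub_diff Y (M x y)) (dspace Gh) (\<gamma> x y)" by (rule dsmooth_sub_mono[OF D(9)[OF x yy(2)] Ms(4)])
      show "s x u = gact Q (\<pi> (\<gamma> x y u)) (s y u)" if "u \<in> M x y" for u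
        by (rule D(10)[OF x yy(2)]) (use that Ms(4) in blast)
      show "s y u \<in> pts (tot Q)" if "u \<in> M x y" for u
        by (rule sp[OF yy(1)]) (use that Ms(3) N(3)[OF yy(1)] in blast)
    qed
    then show "\<exists>b. P2 xy b" unfolding xy P2_def case_prod_conv .
  qed
  then obtain bb where bb: "\<forall>xy\<in>Sigma (pts Y) N. P2 xy (bb xy)" by (rule bchoice[elim_format]) (elim exE)
  define b where "b xs = bb (xs ! 0, xs ! 1)" for xs
  have b: "\<And>u. u \<in> M x y \<Longrightarrow> cmod (b [x, y] u) = 1"
    "\<And>r. r \<in> pts (tot (R x)) \<Longrightarrow> proj (R x) r \<in> M x y \<Longrightarrow>
        k x r \<cdot> \<gamma> x y (proj (R x) r) = \<iota> (b [x, y] (proj (R x) r)) \<cdot> k y (F' x y r)"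
    "dsmooth (sub_diff Y (M x y)) (dspace circle) (b [x, y])" if x: "x \<in> pts Y" and y: "y \<in> N x" for x y
  proof -
    have "(x, y) \<in> Sigma (pts Y) N" using x y by blast
    note B = bspec[OF bb this, unfolded P2_def case_prod_conv]
    have e: "b [x, y] = bb (x, y)" by (simp add: b_def)
    show "cmod (b [x, y] u) = 1" if "u \<in> M x y" for u unfolding e by (rule bspec[OF conjunct1[OF B] that])
    show "k x r \<cdot> \<gamma> x y (proj (R x) r) = \<iota> (b [x, y] (proj (R x) r)) \<cdot> k y (F' x y r)"
      if "r \<in> pts (tot (R x))" "proj (R x) r \<in> M x y" for r
      unfolding e by (rule mp[OF bspec[OF conjunct1[OF conjunct2[OF B]] that(1)] that(2)])
    show "dsmooth (sub_diff Y (M x y)) (dspace circle) (b [x, y])" unfolding e by (rule conjunct2[OF conjunct2[OF B]])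
  qed
  have oN: "openin (dtop Y) (N x) \<and> x \<in> N x" if "x \<in> pts Y" for x using N(1,2)[OF that] by simp
  have oM: "openin (dtop Y) (M x y) \<and> y \<in> M x y" if "x \<in> pts Y" "y \<in> N x" for x y using M[OF that] by simp
  have "b \<in> cochains Y circle (Suc 0)" unfolding cochains_smooth_germ
  proof (rule nested1I[of Y N, OF pb.Y oN])
    fix x y assume x: "x \<in> pts Y" and y: "y \<in> N x"
    show "smooth_germ Y circle (b [x, y]) (last [x, y])"
      unfolding smooth_germ_def using M[OF x y] b(3)[OF x y] by (intro exI[of _ "M x y"]) simp
  qed
  moreover have "germ_eq Y (Suc (Suc 0)) c (\<lambda>xs u. c' xs u * coboundary circle (Suc 0) b xs u)"
    unfolding germ_eq_def
  proof (rule nested_mono)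
    show "nested (dtop Y) (Suc (Suc 0)) (\<lambda>xs. (let x = xs ! 0; y = xs ! 1; z = xs ! 2 in
        \<exists>W. openin (dtop Y) W \<and> z \<in> W \<and> W \<subseteq> V' x y \<inter> V' y z \<inter> V' x z \<and>
          dsmooth (sub_diff Y W) (dspace circle) (c' xs) \<and>
          gcomp ?K (gores ?K W (Ob x))
              (gmres ?K W (gores ?K (V' y z) (Ob y)) (F' y z)) (gmres ?K W (gores ?K (V' x y) (Ob x)) (F' x y))
            = gband ?K (gores ?K W (Ob x)) (c' xs) (gmres ?K W (gores ?K (V' x z) (Ob x)) (F' x z))) \<and>
        (\<exists>x y z. xs = [x, y, z] \<and> x \<in> pts Y \<and> y \<in> N x \<and> z \<in> M x y))" (is "nested _ _ (\<lambda>xs. ?C xs \<and> ?I xs)")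
      unfolding nested_conj
    proof
      show "nested (dtop Y) (Suc (Suc 0)) ?C" using C by (simp only: numeral_2_eq_2)
      show "nested (dtop Y) (Suc (Suc 0)) ?I" by (rule nested2I[of Y N M, OF pb.Y oN oM]) simp_all
    qed
    fix xs assume "?C xs \<and> ?I xs"
    then obtain x y z where xs: "xs = [x, y, z]" and x: "x \<in> pts Y" and y: "y \<in> N x" and z: "z \<in> M x y" and Cx: "?C xs"
      by (elim conjE exE)
    have n: "xs ! 0 = x" "xs ! 1 = y" "xs ! 2 = z" by (simp_all add: xs)
    from Cx[unfolded n Let_def] obtain W where W: "openin (dtop Y) W" "z \<in> W" "W \<subseteq> V' x y \<inter> V' y z \<inter> V' x z"
      and cW: "dsmooth (sub_diff Y W) (dspace circle) (c' xs)"
      and eq: "gcomp ?K (gores ?K W (Ob x))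
              (gmres ?K W (gores ?K (V' y z) (Ob y)) (F' y z)) (gmres ?K W (gores ?K (V' x y) (Ob x)) (F' x y))
            = gband ?K (gores ?K W (Ob x)) (c' xs) (gmres ?K W (gores ?K (V' x z) (Ob x)) (F' x z))"
      by (elim exE conjE)
    note yp = NY[OF x y]
    have zx: "z \<in> N x" and zy: "z \<in> N y" and zV: "z \<in> V x y" using z by (auto simp: M_def)
    note zp = NY[OF x zx] and zyp = NY[OF yp(1) zy]
    let ?T = "W \<inter> M x y \<inter> M y z \<inter> M x z"
    have T: "openin (dtop Y) ?T" by (intro openin_Int W(1) M(1) x y yp(1) zx zy)
    have zT: "z \<in> ?T" using W(2) z M(2)[OF yp(1) zy] M(2)[OF x zx] by simp
    interpret R: principal Gh "sub_diff Y (U' x)" "R x" using lift_object_principal[OF ob[OF x]] by simp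
    show "\<forall>\<^sub>F u in nhdsin (dtop Y) (last xs). c xs u = c' xs u * coboundary circle (Suc 0) b xs u"
    proof (rule eventually_nhdsin_open[OF T])
      show "last xs \<in> ?T" using zT by (simp add: xs)
      fix u assume u: "u \<in> ?T"
      then have uM: "u \<in> M x y" "u \<in> M y z" "u \<in> M x z" and uW: "u \<in> W" by auto
      have uV: "u \<in> V x y" "u \<in> V y z" "u \<in> V x z" "u \<in> V' x y" "u \<in> V' y z" "u \<in> V' x z" "u \<in> N x" "u \<in> N y" "u \<in> N z"
        using uM by (auto simp: M_def)
      note uY = NY[OF x uV(7)]
      have "u \<in> pts (sub_diff Y (U' x))" using uY by simp
      then obtain A \<rho> where "u \<in> A" and \<rho>: "dsmooth (sub_diff (sub_diff Y (U' x)) A) (tot (R x)) \<rho>" "\<And>u. u \<in> A \<Longrightarrow> proj (R x) (\<rho> u) = u"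
        by (rule R.local_section) (rule that)
      define r where "r = \<rho> u"
      have r: "r \<in> pts (tot (R x))" and pr: "proj (R x) r = u"
        using dsmooth_pts[OF \<rho>(1), of u] \<rho>(2)[of u] \<open>u \<in> A\<close> uY by (simp_all add: r_def)
      define r1 where "r1 = F' x y r"
      have r1: "r1 \<in> pts (tot (R y))" "proj (R y) r1 = u"
        using lift_isosD(1,2)[OF F'[OF x yp(3)] r] pr uV(4) by (simp_all add: r1_def)
      define r2 where "r2 = F' x z r"
      have r2: "r2 \<in> pts (tot (R z))" "proj (R z) r2 = u"
        using lift_isosD(1,2)[OF F'[OF x zp(3)] r] pr uV(6) by (simp_all add: r2_def)
      let ?w = "c' xs u"
      have w1: "cmod ?w = 1" using dsmooth_pts[OF cW, of u] uW uY(1) by simp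
      have wr: "gact (R x) (\<iota> ?w) r \<in> pts (tot (R x))" "proj (R x) (gact (R x) (\<iota> ?w) r) = u"
        using R.act_pts[OF iota_closed[OF w1] r] R.proj_act[OF iota_closed[OF w1] r] pr by simp_all
      have "F' y z r1 = F' x z (gact (R x) (\<iota> ?w) r)"
        using fun_cong[OF eq, of r] r pr uW uV wr r1
        by (simp add: Ob lifting_gerbe_simps compose_def r1_def[symmetric])
      also have "\<dots> = gact (R z) (\<iota> ?w) r2"
        unfolding r2_def using lift_isosD(4)[OF F'[OF x zp(3)] r _ iota_closed[OF w1]] pr uV(6) by simp
      finally have F2: "F' y z r1 = gact (R z) (\<iota> ?w) r2" .
      note kx = lift_coordinateD[OF k[OF x]] and ky = lift_coordinateD[OF k[OF yp(1)]] and kz = lift_coordinateD[OF k[OF zp(1)]]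
      have kc: "k x r \<in> carrier Gh" "k y r1 \<in> carrier Gh" "k z r2 \<in> carrier Gh"
        using kx(1)[OF r] ky(1)[OF r1(1)] kz(1)[OF r2(1)] pr r1(2) r2(2) uV by simp_all
      have kF2: "k z (F' y z r1) = \<iota> ?w \<cdot> k z r2"
        unfolding F2 using kz(3)[OF r2(1) _ iota_closed[OF w1]] r2(2) uV by simp
      have gc: "\<gamma> a e u \<in> carrier Gh" if "a \<in> pts Y" "e \<in> U a" "u \<in> V a e" for a e
        using dsmooth_pts[OF D(9)[OF that(1,2)], of u] uY(1) that(3) by simp
      have g: "\<gamma> x y u \<in> carrier Gh" "\<gamma> y z u \<in> carrier Gh" "\<gamma> x z u \<in> carrier Gh"
        using gc[OF x yp(2) uV(1)] gc[OF yp(1) zyp(2) uV(2)] gc[OF x zp(2) uV(3)] by simp_all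
      let ?p = "b [x, y] u" and ?q = "b [y, z] u" and ?m = "b [x, z] u" and ?c = "c [x, y, z] u"
      have n1: "cmod ?p = 1" "cmod ?q = 1" "cmod ?m = 1"
        using b(1)[OF x y uM(1)] b(1)[OF yp(1) zy uM(2)] b(1)[OF x zx uM(3)] by simp_all
      have c1: "cmod ?c = 1"
        using dsmooth_pts[OF D(11)[OF x yp(2) zV], of u] uV uY(1) by simp
      have e1: "k x r \<cdot> \<gamma> x y u = \<iota> ?p \<cdot> k y r1"
        using b(2)[OF x y r] pr uM(1) by (simp add: r1_def)
      have e2: "k y r1 \<cdot> \<gamma> y z u = \<iota> ?q \<cdot> (\<iota> ?w \<cdot> k z r2)"
        using b(2)[OF yp(1) zy r1(1)] r1(2) uM(2) kF2 by simp
      have e3: "k x r \<cdot> \<gamma> x z u = \<iota> ?m \<cdot> k z r2"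
        using b(2)[OF x zx r] pr uM(3) by (simp add: r2_def)
      have e4: "\<gamma> x y u \<cdot> \<gamma> y z u = \<iota> ?c \<cdot> \<gamma> x z u"
        by (rule D(12)[OF x yp(2) zV uV(1,2,3)])
      have "(k x r \<cdot> \<gamma> x y u) \<cdot> \<gamma> y z u = \<iota> ?p \<cdot> (k y r1 \<cdot> \<gamma> y z u)"
        unfolding e1 using kc g n1 by (simp add: gh.m_assoc)
      also have "\<dots> = \<iota> (?p * (?q * ?w)) \<cdot> k z r2"
        unfolding e2 using kc n1 w1 by (simp add: iota_mult norm_mult gh.m_assoc)
      finally have l: "(k x r \<cdot> \<gamma> x y u) \<cdot> \<gamma> y z u = \<iota> (?p * (?q * ?w)) \<cdot> k z r2" .
      have "(k x r \<cdot> \<gamma> x y u) \<cdot> \<gamma> y z u = (k x r \<cdot> \<iota> ?c) \<cdot> \<gamma> x z u"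
        using e4 kc g c1 by (simp add: gh.m_assoc)
      also have "\<dots> = \<iota> ?c \<cdot> (k x r \<cdot> \<gamma> x z u)"
        unfolding iota_central[OF c1 kc(1)] using kc g c1 by (simp add: gh.m_assoc)
      also have "\<dots> = \<iota> (?c * ?m) \<cdot> k z r2"
        unfolding e3 using kc n1 c1 by (simp add: iota_mult gh.m_assoc)
      finally have "\<iota> (?c * ?m) \<cdot> k z r2 = \<iota> (?p * (?q * ?w)) \<cdot> k z r2" using l by simp
      then have cm: "?c * ?m = ?p * (?q * ?w)"
        by (rule iota_cancel[rotated -1]) (use kc n1 c1 w1 in \<open>simp_all add: norm_mult\<close>)
      have cb: "coboundary circle (Suc 0) b [x, y, z] u = ?q * inverse ?m * ?p"
      proof (subst coboundary_circle)
        show "cmod (b (omit i [x, y, z]) u) = 1" if "i \<le> Suc (Suc 0)" for i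
        proof -
          consider "i = 0" | "i = Suc 0" | "i = Suc (Suc 0)" using \<open>i \<le> _\<close> by linarith
          then show ?thesis by cases (simp_all add: n1)
        qed
      qed simp
      have "?m \<noteq> 0" using n1(3) by auto
      then have "?c = ?c * ?m * inverse ?m" by simp
      also have "\<dots> = ?w * (?q * inverse ?m * ?p)" unfolding cm by (simp only: mult_ac)
      finally show "c xs u = c' xs u * coboundary circle (Suc 0) b xs u"
        unfolding cb[symmetric] xs .
    qed
  qed
  ultimately show ?thesis unfolding cohomologous_def by auto
qed

end

section \<open>The Dixmier--Douady class of the lifting gerbe\<close>

text \<open>All cocycles of the gerbe are cohomologous to \<open>c\<close>, and \<open>c\<close> is one of them, so the connecting
  morphism yields exactly the class of \<open>z\<close>.\<close>

lemma (in lifting_problem) dd_class_eq: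
  assumes cd: "cech_data Gh \<iota> \<pi> Y Q U s V \<gamma> c"
    and \<theta>: "\<theta> \<in> cochains Y real_dgroup 2" "germ_eq Y 2 (\<lambda>xs y. cis (2 * pi * \<theta> xs y)) c"
    and z: "z \<in> cochains Y int_dgroup 3" "germ_eq Y 3 (\<lambda>xs y. real_of_int (z xs y)) (coboundary real_dgroup 2 \<theta>)"
  shows "dd_class Y (lifting_gerbe Gh \<iota> \<pi> Y Q) = {z' \<in> cocycles Y int_dgroup 3. cohomologous Y int_dgroup 3 z z'}"
proof -
  have h: "gerbe_class Y (lifting_gerbe Gh \<iota> \<pi> Y Q) \<subseteq> cocycles Y circle (Suc (Suc 0))"
    by (auto simp: gerbe_class_def numeral_2_eq_2)
  from connecting_eq_class[OF pb.Y h cech_in_gerbe_class[OF cd] gerbe_class_cohomologous[OF cd]] \<theta> z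
  show ?thesis by (simp add: dd_class_def numeral_2_eq_2 numeral_3_eq_3)
qed

lemma cochain_int_diff:
  assumes Y: "diffeological_space Y" and "a \<in> cochains Y int_dgroup n" "b \<in> cochains Y int_dgroup n"
  shows "(\<lambda>xs y. a xs y - b xs y) \<in> cochains Y int_dgroup n"
  using cochain_real_diff[of "\<lambda>xs y. real_of_int (a xs y)" Y n "\<lambda>xs y. real_of_int (b xs y)"] assms
  by (simp add: cochain_int_iff[OF Y])

lemma cochain_int_zero: "diffeological_space Y \<Longrightarrow> (\<lambda>_ _. 0) \<in> cochains Y int_dgroup n"
  using cochain_real_sum[of Y "{}" "\<lambda>_ _ _. 0" n] by (simp add: cochain_int_iff)

lemma coboundary_int_diff:
  "coboundary int_dgroup n (\<lambda>xs y. a xs y - b xs y) xs y = coboundary int_dgroup n a xs y - coboundary int_dgroup n b xs y"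
  unfolding coboundary_int by (simp add: right_diff_distrib sum_subtractf del: sum.atMost_Suc)

lemma cohomologous_intI:
  "b \<in> cochains Y int_dgroup n \<Longrightarrow> germs Y (Suc n) (\<lambda>xs y. s xs y = t xs y + coboundary int_dgroup n b xs y) \<Longrightarrow>
    cohomologous Y int_dgroup (Suc n) s t"
  by (auto simp: cohomologous_def germ_eq_germs)

lemma cohomologous_intE:
  assumes "cohomologous Y int_dgroup (Suc n) s t"
  obtains b where "b \<in> cochains Y int_dgroup n" "germs Y (Suc n) (\<lambda>xs y. s xs y = t xs y + coboundary int_dgroup n b xs y)"
  using assms by (auto simp: cohomologous_def germ_eq_germs)

text \<open>Coboundaries commute with pullback, so cohomologous cocycles have cohomologous pullbacks.\<close>

lemma cohomology_pullback_class:
  assumes X: "diffeological_space X" and Y: "diffeological_space Y" and f: "dsmooth X Y f"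
    and z: "z \<in> cocycles Y int_dgroup (Suc n)"
  shows "cohomology_pullback X int_dgroup (Suc n) f {t \<in> cocycles Y int_dgroup (Suc n). cohomologous Y int_dgroup (Suc n) z t}
    = {s \<in> cocycles X int_dgroup (Suc n). cohomologous X int_dgroup (Suc n) (\<lambda>xs x. z (map f xs) (f x)) s}"
    (is "?L = ?R")
proof (intro equalityI subsetI)
  fix s assume "s \<in> ?L"
  then obtain t where s: "s \<in> cocycles X int_dgroup (Suc n)" and zt: "cohomologous Y int_dgroup (Suc n) z t"
    and st: "cohomologous X int_dgroup (Suc n) s (\<lambda>xs x. t (map f xs) (f x))"
    unfolding cohomology_pullback_def by blast
  obtain a where a: "a \<in> cochains Y int_dgroup n" "germs Y (Suc n) (\<lambda>xs y. z xs y = t xs y + coboundary int_dgroup n a xs y)"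
    by (rule cohomologous_intE[OF zt])
  obtain b where b: "b \<in> cochains X int_dgroup n" "germs X (Suc n) (\<lambda>xs x. s xs x = t (map f xs) (f x) + coboundary int_dgroup n b xs x)"
    by (rule cohomologous_intE[OF st])
  have "cohomologous X int_dgroup (Suc n) (\<lambda>xs x. z (map f xs) (f x)) s"
  proof (rule cohomologous_intI)
    show "(\<lambda>xs x. a (map f xs) (f x) - b xs x) \<in> cochains X int_dgroup n"
      by (rule cochain_int_diff[OF X cochain_map[OF X Y f a(1)] b(1)])
    show "germs X (Suc n) (\<lambda>xs x. z (map f xs) (f x) = s xs x + coboundary int_dgroup n (\<lambda>xs x. a (map f xs) (f x) - b xs x) xs x)"
      by (rule germs_mono[OF X germs_conj[OF germs_map[OF X Y f a(2)] b(2)]])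
        (simp add: coboundary_int_diff coboundary_map)
  qed
  with s show "s \<in> ?R" by simp
next
  fix s assume "s \<in> ?R"
  then have s: "s \<in> cocycles X int_dgroup (Suc n)" and zs: "cohomologous X int_dgroup (Suc n) (\<lambda>xs x. z (map f xs) (f x)) s" by auto
  obtain b where b: "b \<in> cochains X int_dgroup n" "germs X (Suc n) (\<lambda>xs x. z (map f xs) (f x) = s xs x + coboundary int_dgroup n b xs x)"
    by (rule cohomologous_intE[OF zs])
  have "cohomologous X int_dgroup (Suc n) s (\<lambda>xs x. z (map f xs) (f x))"
  proof (rule cohomologous_intI)
    show "(\<lambda>xs x. 0 - b xs x) \<in> cochains X int_dgroup n" by (rule cochain_int_diff[OF X cochain_int_zero[OF X] b(1)])
    show "germs X (Suc n) (\<lambda>xs x. s xs x = z (map f xs) (f x) + coboundary int_dgroup n (\<lambda>xs x. 0 - b xs x) xs x)"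
      unfolding coboundary_int_diff by (rule germs_mono[OF X b(2)]) (simp add: coboundary_int)
  qed
  moreover have "cohomologous Y int_dgroup (Suc n) z z"
  proof (rule cohomologous_intI[OF cochain_int_zero[OF Y]])
    have "germs Y (Suc n) (\<lambda>_ _. True)" by (simp add: germs_def nested_True)
    then show "germs Y (Suc n) (\<lambda>xs y. z xs y = z xs y + coboundary int_dgroup n (\<lambda>_ _. 0) xs y)"
      by (rule germs_mono[OF Y]) (simp add: coboundary_int)
  qed
  ultimately show "s \<in> ?L" unfolding cohomology_pullback_def using s z by blast
qed

text \<open>The pullback of transition data and of real and integral lifts computes both sides.\<close>

theorem dd_class_bundle_pullback:
  assumes ext: "central_extension G Gh \<iota> \<pi>" and Q: "principal G Y Q"
    and X: "diffeological_space X" and f: "dsmooth X Y f"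
  shows "cohomology_pullback X int_dgroup 3 f (dd_class Y (lifting_gerbe Gh \<iota> \<pi> Y Q)) \<in> cohomology X int_dgroup 3 \<and>
    cohomology_pullback X int_dgroup 3 f (dd_class Y (lifting_gerbe Gh \<iota> \<pi> Y Q)) =
      dd_class X (lifting_gerbe Gh \<iota> \<pi> X (bundle_pullback X f Q))"
proof -
  interpret Q: principal G Y Q by (rule Q)
  interpret LY: lifting_problem G Gh \<iota> \<pi> Y Q by unfold_locales (rule ext)
  have P: "principal G X (bundle_pullback X f Q)"
    by unfold_locales (rule Q.G, rule X, rule principal_bundle_pullback[OF X f Q])
  interpret P: principal G X "bundle_pullback X f Q" by (rule P)
  interpret LX: lifting_problem G Gh \<iota> \<pi> X "bundle_pullback X f Q" by unfold_locales
  obtain U s V \<gamma> c where cd: "cech_data Gh \<iota> \<pi> Y Q U s V \<gamma> c" using LY.exists_cech_data by (elim exE)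
  obtain \<theta> z where \<theta>: "\<theta> \<in> cochains Y real_dgroup 2" "germ_eq Y 2 (\<lambda>xs y. cis (2 * pi * \<theta> xs y)) c"
    and z: "z \<in> cochains Y int_dgroup (Suc 2)" "germ_eq Y (Suc 2) (\<lambda>xs y. real_of_int (z xs y)) (coboundary real_dgroup 2 \<theta>)"
    by (rule exists_integral_lift[OF Q.Y LY.cech_cocycle[OF cd]])
  note cdX = cech_data_pullback[OF X Q.Y f Q.tot cd]
  let ?c = "\<lambda>xs x. c (map f xs) (f x)" and ?\<theta> = "\<lambda>xs x. \<theta> (map f xs) (f x)" and ?z = "\<lambda>xs x. z (map f xs) (f x)"
  have \<theta>X: "?\<theta> \<in> cochains X real_dgroup 2" "germ_eq X 2 (\<lambda>xs y. cis (2 * pi * ?\<theta> xs y)) ?c"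
    using cochain_map[OF X Q.Y f \<theta>(1)] germs_map[OF X Q.Y f \<theta>(2)[unfolded germ_eq_germs]]
    by (simp_all add: germ_eq_germs)
  have zX: "?z \<in> cochains X int_dgroup (Suc 2)" "germ_eq X (Suc 2) (\<lambda>xs y. real_of_int (?z xs y)) (coboundary real_dgroup 2 ?\<theta>)"
    using cochain_map[OF X Q.Y f z(1)] germs_map[OF X Q.Y f z(2)[unfolded germ_eq_germs]]
    by (simp_all add: germ_eq_germs coboundary_map)
  have s3: "Suc 2 = 3" by simp
  have ddY: "dd_class Y (lifting_gerbe Gh \<iota> \<pi> Y Q) = {z' \<in> cocycles Y int_dgroup 3. cohomologous Y int_dgroup 3 z z'}"
    by (rule LY.dd_class_eq[OF cd \<theta> z[unfolded s3]])
  have ddX: "dd_class X (lifting_gerbe Gh \<iota> \<pi> X (bundle_pullback X f Q))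
      = {z' \<in> cocycles X int_dgroup 3. cohomologous X int_dgroup 3 ?z z'}"
    by (rule LX.dd_class_eq[OF cdX \<theta>X zX[unfolded s3]])
  have zc: "z \<in> cocycles Y int_dgroup (Suc 2)" by (rule integral_cocycle[OF Q.Y z])
  have zcX: "?z \<in> cocycles X int_dgroup 3" using integral_cocycle[OF X zX] by (simp only: s3)
  have eq: "cohomology_pullback X int_dgroup 3 f (dd_class Y (lifting_gerbe Gh \<iota> \<pi> Y Q))
      = dd_class X (lifting_gerbe Gh \<iota> \<pi> X (bundle_pullback X f Q))"
    using cohomology_pullback_class[OF X Q.Y f zc] unfolding ddX ddY s3 .
  have "dd_class X (lifting_gerbe Gh \<iota> \<pi> X (bundle_pullback X f Q)) =
      {(s, t). s \<in> cocycles X int_dgroup 3 \<and> t \<in> cocycles X int_dgroup 3 \<and> cohomologous X int_dgroup 3 s t} `` {?z}"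
    unfolding ddX using zcX by auto
  then have "dd_class X (lifting_gerbe Gh \<iota> \<pi> X (bundle_pullback X f Q)) \<in> cohomology X int_dgroup 3"
    unfolding cohomology_def by (simp only: quotientI[OF zcX])
  with eq show ?thesis by simp
qed

section \<open>The universal bundle\<close>

locale universal =
  fixes G :: "'g dgroup" assumes G: "diffeological_group G"
begin

sublocale group G by (rule diffeological_groupD[OF G])

lemma pts_G: "pts (dspace G) = carrier G" and dG: "diffeological_space (dspace G)"
  using diffeological_groupD[OF G] by simp_all

lemma equiv_fam_rel: "equiv (fams G) (fam_rel G)"
  by (rule equivI) (auto simp: fam_rel_def refl_on_def sym_on_def trans_on_def)

text \<open>Points of the total space are classes of families.  \<open>weight\<close> is independent of the representative;
  \<open>label\<close> is so only at the indices of nonzero weight.\<close>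

definition cls :: "'g fam \<Rightarrow> 'g fam set" where "cls p = fam_rel G `` {p}"
definition rep :: "'g fam set \<Rightarrow> 'g fam" where "rep e = (SOME p. p \<in> e)"
definition weight :: "'g fam set \<Rightarrow> nat \<Rightarrow> real" where "weight e = fst (rep e)"
definition label :: "'g fam set \<Rightarrow> nat \<Rightarrow> 'g" where "label e = snd (rep e)"

lemma fams_iff: "p \<in> fams G \<longleftrightarrow> finite {i. fst p i \<noteq> 0} \<and> (\<Sum>i | fst p i \<noteq> 0. (fst p i)\<^sup>2) = 1 \<and> (\<forall>i. snd p i \<in> carrier G)"
  by (auto simp: fams_def)

lemma mem_cls: "q \<in> cls p \<longleftrightarrow> p \<in> fams G \<and> q \<in> fams G \<and> fst p = fst q \<and> (\<forall>i. fst p i \<noteq> 0 \<longrightarrow> snd p i = snd q i)"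
  by (auto simp: cls_def fam_rel_def)

lemma cls_eq: "p \<in> fams G \<Longrightarrow> q \<in> fams G \<Longrightarrow> fst p = fst q \<Longrightarrow> (\<And>i. fst p i \<noteq> 0 \<Longrightarrow> snd p i = snd q i) \<Longrightarrow> cls p = cls q"
  unfolding cls_def by (rule equiv_class_eq[OF equiv_fam_rel]) (auto simp: fam_rel_def)

lemma pts_Esph: "pts (Esph G) = cls ` fams G"
  by (auto simp: Esph_def quotient_def cls_def)

lemma rep:
  assumes "e \<in> pts (Esph G)"
  shows "rep e \<in> fams G" "e = cls (rep e)"
proof -
  obtain p where p: "p \<in> fams G" "e = cls p" using assms by (auto simp: pts_Esph)
  have "p \<in> e" using p by (simp add: mem_cls)
  then have "rep e \<in> e" unfolding rep_def by (rule someI)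
  then have r: "rep e \<in> cls p" using p(2) by simp
  then show "rep e \<in> fams G" by (simp add: mem_cls)
  show "e = cls (rep e)" unfolding p(2)
    by (rule cls_eq) (use r p in \<open>auto simp: mem_cls\<close>)
qed

lemma weight_cls: "p \<in> fams G \<Longrightarrow> weight (cls p) = fst p"
  and label_cls: "p \<in> fams G \<Longrightarrow> fst p i \<noteq> 0 \<Longrightarrow> label (cls p) i = snd p i"
proof -
  have m: "rep (cls p) \<in> cls p" if "p \<in> fams G"
  proof -
    have "p \<in> cls p" using that by (simp add: mem_cls)
    then show ?thesis unfolding rep_def by (rule someI)
  qed
  show "p \<in> fams G \<Longrightarrow> weight (cls p) = fst p" using m by (simp add: mem_cls weight_def)
  show "p \<in> fams G \<Longrightarrow> fst p i \<noteq> 0 \<Longrightarrow> label (cls p) i = snd p i" using m by (simp add: mem_cls label_def)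
qed

lemma exists_weight:
  assumes "e \<in> pts (Esph G)"
  obtains i where "weight e i \<noteq> 0"
proof -
  have "rep e \<in> fams G" by (rule rep(1)[OF assms])
  then have "(\<Sum>i | weight e i \<noteq> 0. (weight e i)\<^sup>2) = 1" by (simp add: fams_iff weight_def)
  then have "{i. weight e i \<noteq> 0} \<noteq> {}" by (metis sum.empty zero_neq_one)
  then show thesis using that by blast
qed

lemma label_closed: "e \<in> pts (Esph G) \<Longrightarrow> label e i \<in> carrier G"
  using rep(1)[of e] by (simp add: fams_iff label_def)

lemma Esph_eqI:
  assumes "e \<in> pts (Esph G)" "e' \<in> pts (Esph G)" "weight e = weight e'" "\<And>i. weight e i \<noteq> 0 \<Longrightarrow> label e i = label e' i"
  shows "e = e'"
proof -
  have "cls (rep e) = cls (rep e')"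
    by (rule cls_eq[OF rep(1)[OF assms(1)] rep(1)[OF assms(2)]]) (use assms(3,4) in \<open>simp_all add: weight_def label_def\<close>)
  then show ?thesis using rep(2)[OF assms(1)] rep(2)[OF assms(2)] by simp
qed

abbreviation act :: "'g \<Rightarrow> 'g fam set \<Rightarrow> 'g fam set" where "act \<equiv> Esph_act G"

lemma translate_fams: "h \<in> carrier G \<Longrightarrow> p \<in> fams G \<Longrightarrow> (fst p, \<lambda>i. h \<otimes>\<^bsub>G\<^esub> snd p i) \<in> fams G"
  by (simp add: fams_iff)

lemma act_cls:
  assumes h: "h \<in> carrier G" and p: "p \<in> fams G"
  shows "act h (cls p) = cls (fst p, \<lambda>i. h \<otimes>\<^bsub>G\<^esub> snd p i)"
proof -
  have "act h (cls p) = (\<Union>q\<in>cls p. cls (fst q, \<lambda>i. h \<otimes>\<^bsub>G\<^esub> snd q i))"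
    unfolding Esph_act_def by (auto simp: cls_def split_beta)
  also have "\<dots> = (\<Union>q\<in>cls p. cls (fst p, \<lambda>i. h \<otimes>\<^bsub>G\<^esub> snd p i))"
  proof (rule SUP_cong[OF refl])
    fix q assume q: "q \<in> cls p"
    then have "q \<in> fams G" by (simp add: mem_cls)
    from translate_fams[OF h this] translate_fams[OF h p]
    show "cls (fst q, \<lambda>i. h \<otimes>\<^bsub>G\<^esub> snd q i) = cls (fst p, \<lambda>i. h \<otimes>\<^bsub>G\<^esub> snd p i)"
      by (rule cls_eq) (use q in \<open>auto simp: mem_cls\<close>)
  qed
  also have "\<dots> = cls (fst p, \<lambda>i. h \<otimes>\<^bsub>G\<^esub> snd p i)"
  proof -
    have "p \<in> cls p" using p by (simp add: mem_cls)
    then show ?thesis by auto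
  qed
  finally show ?thesis .
qed

lemma act:
  assumes h: "h \<in> carrier G" and e: "e \<in> pts (Esph G)"
  shows act_pts: "act h e \<in> pts (Esph G)" and weight_act: "weight (act h e) = weight e"
    and label_act: "\<And>i. weight e i \<noteq> 0 \<Longrightarrow> label (act h e) i = h \<otimes>\<^bsub>G\<^esub> label e i"
proof -
  note r = rep[OF e] and t = translate_fams[OF h rep(1)[OF e]]
  have a: "act h e = cls (weight e, \<lambda>i. h \<otimes>\<^bsub>G\<^esub> label e i)"
    using act_cls[OF h r(1)] r(2) by (simp add: weight_def label_def)
  have t': "(weight e, \<lambda>i. h \<otimes>\<^bsub>G\<^esub> label e i) \<in> fams G" using t by (simp add: weight_def label_def)
  show "act h e \<in> pts (Esph G)" unfolding a pts_Esph using t' by (rule imageI)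
  show "weight (act h e) = weight e" unfolding a weight_cls[OF t'] by simp
  show "label (act h e) i = h \<otimes>\<^bsub>G\<^esub> label e i" if "weight e i \<noteq> 0" for i
    unfolding a using label_cls[OF t', of i] that by simp
qed

lemma act_one: "e \<in> pts (Esph G) \<Longrightarrow> act \<one>\<^bsub>G\<^esub> e = e"
  by (rule Esph_eqI) (simp_all add: act label_closed)

lemma act_act: "g \<in> carrier G \<Longrightarrow> h \<in> carrier G \<Longrightarrow> e \<in> pts (Esph G) \<Longrightarrow> act g (act h e) = act (g \<otimes>\<^bsub>G\<^esub> h) e"
  by (rule Esph_eqI) (simp_all add: act label_closed m_assoc)

lemma act_eq_label:
  assumes "g \<in> carrier G" "e \<in> pts (Esph G)" "weight e i \<noteq> 0" "act g e = e'"
  shows "g = label e' i \<otimes>\<^bsub>G\<^esub> inv\<^bsub>G\<^esub> (label e i)"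
  using label_act[OF assms(1,2,3)] assms label_closed[OF assms(2), of i] by (simp add: m_assoc)

abbreviation orb :: "'g fam set \<Rightarrow> 'g fam set set" where "orb \<equiv> orbit_of G (Esph_act G)"

lemma orb_act:
  assumes g: "g \<in> carrier G" and e: "e \<in> pts (Esph G)"
  shows "orb (act g e) = orb e"
proof (intro equalityI subsetI)
  fix x assume "x \<in> orb (act g e)"
  then obtain h where "h \<in> carrier G" "x = act h (act g e)" by (auto simp: orbit_of_def)
  then show "x \<in> orb e" using act_act[OF _ g e] g by (auto simp: orbit_of_def)
next
  fix x assume "x \<in> orb e"
  then obtain h where h: "h \<in> carrier G" "x = act h e" by (auto simp: orbit_of_def)
  have "x = act (h \<otimes>\<^bsub>G\<^esub> inv\<^bsub>G\<^esub> g) (act g e)"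
    using act_act[of "h \<otimes>\<^bsub>G\<^esub> inv\<^bsub>G\<^esub> g" g e] h g e by (simp add: m_assoc)
  then show "x \<in> orb (act g e)" unfolding orbit_of_def by (rule image_eqI) (simp add: h g)
qed

lemma orb_eqD:
  assumes "e' \<in> pts (Esph G)" "orb e = orb e'"
  obtains g where "g \<in> carrier G" "e' = act g e"
proof -
  have "act \<one>\<^bsub>G\<^esub> e' \<in> orb e'" unfolding orbit_of_def by (rule imageI) simp
  then have "e' \<in> orb e" using act_one[OF assms(1)] assms(2) by simp
  then show thesis using that by (auto simp: orbit_of_def)
qed

lemma mem_orb: "e \<in> pts (Esph G) \<Longrightarrow> e \<in> orb e"
  using act_one[of e] unfolding orbit_of_def by (intro image_eqI[of _ _ "\<one>\<^bsub>G\<^esub>"]) simp_all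

subsection \<open>Plots of the total space\<close>

lemma diffeological_sphere_chart: "diffeological_space (sphere_chart G I)"
  unfolding sphere_chart_def
  by (intro diffeological_prod_diff diffeological_sub_diff diffeological_power_diff diffeological_real_diff dG)

lemma diffeological_Esph: "diffeological_space (Esph G)"
  unfolding Esph_def by (rule diffeological_final_diff) (rule diffeological_sphere_chart)

lemma pts_sphere_chart: "q \<in> pts (sphere_chart G I) \<longleftrightarrow>
    fst q \<in> extensional I \<and> (\<Sum>i\<in>I. (fst q i)\<^sup>2) = 1 \<and> snd q \<in> (\<Pi>\<^sub>E i\<in>I. carrier G)"
  by (cases q) (auto simp: sphere_chart_def pts_G PiE_def)

lemma plot_sphere_chart: "plot (sphere_chart G I) n U q \<longleftrightarrow> openin (Euclidean_space n) U \<and>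
    (\<forall>u\<in>U. q u \<in> pts (sphere_chart G I)) \<and> (\<forall>i\<in>I. smooth_fun n U (\<lambda>u. fst (q u) i)) \<and>
    (\<forall>i\<in>I. plot (dspace G) n U (\<lambda>u. snd (q u) i))"
  by (auto simp: sphere_chart_def plot_power_diff pts_G PiE_def image_subset_iff mem_Times_iff)

definition extend :: "nat set \<Rightarrow> 'g fam \<Rightarrow> 'g fam" where
  "extend I q = (\<lambda>i. if i \<in> I then fst q i else 0, \<lambda>i. if i \<in> I then snd q i else \<one>\<^bsub>G\<^esub>)"

lemma psi_cls: "psi G I q = cls (extend I q)"
  by (simp add: psi_def cls_def extend_def split_beta)

lemma extend_fams:
  assumes I: "finite I" and q: "q \<in> pts (sphere_chart G I)"
  shows "extend I q \<in> fams G"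
proof -
  let ?x = "fst (extend I q)"
  have s: "{i. ?x i \<noteq> 0} \<subseteq> I" by (auto simp: extend_def split: if_splits)
  have "(\<Sum>i | ?x i \<noteq> 0. (?x i)\<^sup>2) = (\<Sum>i\<in>I. (?x i)\<^sup>2)"
    by (rule sum.mono_neutral_left[OF I s]) simp
  also have "\<dots> = (\<Sum>i\<in>I. (fst q i)\<^sup>2)" by (rule sum.cong) (simp_all add: extend_def)
  also have "\<dots> = 1" using q by (simp add: pts_sphere_chart)
  finally have "(\<Sum>i | ?x i \<noteq> 0. (?x i)\<^sup>2) = 1" .
  moreover have "snd (extend I q) i \<in> carrier G" for i
    using q by (auto simp: extend_def pts_sphere_chart PiE_def)
  ultimately show ?thesis using finite_subset[OF s I] by (simp add: fams_iff)
qed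

lemma weight_psi: "finite I \<Longrightarrow> q \<in> pts (sphere_chart G I) \<Longrightarrow> weight (psi G I q) i = (if i \<in> I then fst q i else 0)"
  unfolding psi_cls by (simp add: weight_cls extend_fams) (simp add: extend_def)

lemma label_psi:
  assumes "finite I" "q \<in> pts (sphere_chart G I)" "weight (psi G I q) i \<noteq> 0"
  shows "i \<in> I" "label (psi G I q) i = snd q i"
proof -
  show i: "i \<in> I" using assms(3) weight_psi[OF assms(1,2)] by (simp split: if_splits)
  have "fst (extend I q) i \<noteq> 0" using assms(3) weight_psi[OF assms(1,2)] i by (simp add: extend_def)
  from label_cls[OF extend_fams[OF assms(1,2)] this]
  show "label (psi G I q) i = snd q i" unfolding psi_cls using i by (simp add: extend_def)
qed

lemma psi_surj:
  assumes e: "e \<in> pts (Esph G)"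
  obtains I q where "finite I" "q \<in> pts (sphere_chart G I)" "e = psi G I q"
proof -
  let ?I = "{i. weight e i \<noteq> 0}"
  let ?q = "(restrict (weight e) ?I, restrict (label e) ?I)"
  have r: "finite ?I" "(\<Sum>i\<in>?I. (weight e i)\<^sup>2) = 1" using rep(1)[OF e] by (simp_all add: fams_iff weight_def)
  have q: "?q \<in> pts (sphere_chart G ?I)" using r(2) label_closed[OF e] by (auto simp: pts_sphere_chart)
  have "e = psi G ?I ?q"
  proof (rule Esph_eqI[OF e])
    show "psi G ?I ?q \<in> pts (Esph G)" unfolding psi_cls pts_Esph by (rule imageI[OF extend_fams[OF r(1) q]])
    show w: "weight e = weight (psi G ?I ?q)" by (rule ext) (simp add: weight_psi[OF r(1) q])
    show "label e i = label (psi G ?I ?q) i" if "weight e i \<noteq> 0" for i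
      using label_psi(2)[OF r(1) q, of i] that w by simp
  qed
  then show thesis by (rule that[OF r(1) q])
qed

text \<open>A constant plot factors through the chart of the support of its value, so every plot lifts locally to some
  chart.\<close>

lemma plot_Esph: "plot (Esph G) n U p \<longleftrightarrow> openin (Euclidean_space n) U \<and>
    (\<forall>u\<in>U. \<exists>V I q. openin (Euclidean_space n) V \<and> u \<in> V \<and> V \<subseteq> U \<and> finite I \<and>
       plot (sphere_chart G I) n V q \<and> (\<forall>v\<in>V. p v = psi G I (q v)))" (is "?L \<longleftrightarrow> _ \<and> ?R")
proof (intro iffI conjI ballI)
  assume p: ?L
  have p': "openin (Euclidean_space n) U \<and> p ` U \<subseteq> fams G // fam_rel G \<and>
       (\<forall>u\<in>U. \<exists>V. openin (Euclidean_space n) V \<and> u \<in> V \<and> V \<subseteq> U \<and>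
          ((\<exists>y. \<forall>v\<in>V. p v = y) \<or>
           (\<exists>I\<in>{I. finite I}. \<exists>q. plot (sphere_chart G I) n V q \<and> (\<forall>v\<in>V. p v = psi G I (q v)))))"
    using p unfolding Esph_def plot_final_diff .
  show "openin (Euclidean_space n) U" by (rule conjunct1[OF p'])
  fix u assume u: "u \<in> U"
  from bspec[OF conjunct2[OF conjunct2[OF p']] u] obtain V where V: "openin (Euclidean_space n) V" "u \<in> V" "V \<subseteq> U"
    and or: "(\<exists>y. \<forall>v\<in>V. p v = y) \<or> (\<exists>I\<in>{I. finite I}. \<exists>q. plot (sphere_chart G I) n V q \<and> (\<forall>v\<in>V. p v = psi G I (q v)))"
    by (elim exE conjE)
  from or have "\<exists>I q. finite I \<and> plot (sphere_chart G I) n V q \<and> (\<forall>v\<in>V. p v = psi G I (q v))"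
  proof (elim disjE exE bexE)
    fix y assume y: "\<forall>v\<in>V. p v = y"
    have "y \<in> pts (Esph G)" using plot_pts[OF diffeological_Esph p u] bspec[OF y V(2)] by simp
    then obtain I q where "finite I" "q \<in> pts (sphere_chart G I)" "y = psi G I q" by (rule psi_surj)
    then show ?thesis using plot_const[OF diffeological_sphere_chart V(1), of q I] y
      by (intro exI[of _ I] exI[of _ "\<lambda>_. q"] conjI) simp_all
  next
    fix I q assume "I \<in> {I. finite I}" "plot (sphere_chart G I) n V q \<and> (\<forall>v\<in>V. p v = psi G I (q v))"
    then show ?thesis by (intro exI[of _ I] exI[of _ q]) simp
  qed
  then obtain I q where "finite I" "plot (sphere_chart G I) n V q" "\<forall>v\<in>V. p v = psi G I (q v)" by (elim exE conjE)
  then show "\<exists>V I q. openin (Euclidean_space n) V \<and> u \<in> V \<and> V \<subseteq> U \<and> finite I \<and>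
       plot (sphere_chart G I) n V q \<and> (\<forall>v\<in>V. p v = psi G I (q v))"
    using V by (intro exI[of _ V] exI[of _ I] exI[of _ q] conjI)
next
  assume R: "openin (Euclidean_space n) U \<and> ?R"
  have main: "p u \<in> fams G // fam_rel G \<and> (\<exists>V. openin (Euclidean_space n) V \<and> u \<in> V \<and> V \<subseteq> U \<and>
          ((\<exists>y. \<forall>v\<in>V. p v = y) \<or>
           (\<exists>I\<in>{I. finite I}. \<exists>q. plot (sphere_chart G I) n V q \<and> (\<forall>v\<in>V. p v = psi G I (q v)))))"
    if u: "u \<in> U" for u
  proof -
    from bspec[OF conjunct2[OF R] u] obtain V I q where V: "openin (Euclidean_space n) V" "u \<in> V" "V \<subseteq> U"
      and I: "finite I" and q: "plot (sphere_chart G I) n V q" "\<forall>v\<in>V. p v = psi G I (q v)" by (elim exE conjE)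
    have "q u \<in> pts (sphere_chart G I)" by (rule plot_pts[OF diffeological_sphere_chart q(1) V(2)])
    then have "p u \<in> fams G // fam_rel G"
      using extend_fams[OF I] bspec[OF q(2) V(2)] by (simp add: psi_cls cls_def quotientI)
    moreover have "\<exists>I\<in>{I. finite I}. \<exists>q. plot (sphere_chart G I) n V q \<and> (\<forall>v\<in>V. p v = psi G I (q v))"
      using I q by (intro bexI[of _ I] exI[of _ q] conjI) simp_all
    ultimately show ?thesis using V by (intro conjI exI[of _ V] disjI2)
  qed
  show ?L unfolding Esph_def plot_final_diff
    by (intro conjI ballI image_subsetI conjunct1[OF R] conjunct1[OF main] conjunct2[OF main])
qed

lemma plot_EsphE:
  assumes "plot (Esph G) n U p" "u \<in> U"
  obtains V I q where "openin (Euclidean_space n) V" "u \<in> V" "V \<subseteq> U" "finite I"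
    "plot (sphere_chart G I) n V q" "\<And>v. v \<in> V \<Longrightarrow> p v = psi G I (q v)" "\<And>v. v \<in> V \<Longrightarrow> q v \<in> pts (sphere_chart G I)"
proof -
  from bspec[OF conjunct2[OF assms(1)[unfolded plot_Esph]] assms(2)]
  obtain V I q where V: "openin (Euclidean_space n) V" "u \<in> V" "V \<subseteq> U" "finite I"
    and q: "plot (sphere_chart G I) n V q" "\<forall>v\<in>V. p v = psi G I (q v)" by (elim exE conjE)
  show thesis
    by (rule that[OF V q(1) bspec[OF q(2)] plot_pts[OF diffeological_sphere_chart q(1)]])
qed

lemma weight_open:
  assumes p: "plot (Esph G) n U p"
  shows "openin (Euclidean_space n) {u \<in> U. weight (p u) i \<noteq> 0}"
proof (subst openin_subopen, intro ballI)
  fix u assume "u \<in> {u \<in> U. weight (p u) i \<noteq> 0}"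
  then have u: "u \<in> U" "weight (p u) i \<noteq> 0" by auto
  obtain V I q where V: "openin (Euclidean_space n) V" "u \<in> V" "V \<subseteq> U" and I: "finite I"
    and q: "plot (sphere_chart G I) n V q" and pq: "\<And>v. v \<in> V \<Longrightarrow> p v = psi G I (q v)"
    and qp: "\<And>v. v \<in> V \<Longrightarrow> q v \<in> pts (sphere_chart G I)"
    by (rule plot_EsphE[OF p u(1)]) (rule that)
  have w: "weight (p v) i = fst (q v) i" if "v \<in> V" "i \<in> I" for v
    using weight_psi[OF I qp[OF that(1)], of i] pq[OF that(1)] that(2) by simp
  have i: "i \<in> I" using weight_psi[OF I qp[OF V(2)], of i] pq[OF V(2)] u(2) by (simp split: if_splits)
  have "smooth_fun n V (\<lambda>v. fst (q v) i)" using q i by (simp add: plot_sphere_chart)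
  then have "openin (Euclidean_space n) {v \<in> V. fst (q v) i \<in> - {0}}"
    by (rule smooth_fun_preimage_open) (rule open_Compl[OF closed_singleton])
  moreover have "{v \<in> V. fst (q v) i \<in> - {0}} \<subseteq> {u \<in> U. weight (p u) i \<noteq> 0}" using w[OF _ i] V(3) by auto
  moreover have "u \<in> {v \<in> V. fst (q v) i \<in> - {0}}" using w[OF V(2) i] V(2) u(2) by simp
  ultimately show "\<exists>T. openin (Euclidean_space n) T \<and> u \<in> T \<and> T \<subseteq> {u \<in> U. weight (p u) i \<noteq> 0}" by blast
qed

text \<open>Where the \<open>i\<close>-th weight does not vanish, \<open>i\<close> belongs to the index set of every chart in use, and the
  \<open>i\<close>-th label is read off from the chart.\<close>

lemma label_plot:
  assumes p: "plot (Esph G) n U p" and w: "\<And>u. u \<in> U \<Longrightarrow> weight (p u) i \<noteq> 0"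
  shows "plot (dspace G) n U (\<lambda>u. label (p u) i)"
proof (rule plot_local[OF dG plot_open[OF diffeological_Esph p]])
  fix u assume u: "u \<in> U"
  obtain V I q where V: "openin (Euclidean_space n) V" "u \<in> V" "V \<subseteq> U" and I: "finite I"
    and q: "plot (sphere_chart G I) n V q" and pq: "\<And>v. v \<in> V \<Longrightarrow> p v = psi G I (q v)"
    and qp: "\<And>v. v \<in> V \<Longrightarrow> q v \<in> pts (sphere_chart G I)"
    by (rule plot_EsphE[OF p u]) (rule that)
  have l: "i \<in> I" "label (p v) i = snd (q v) i" if "v \<in> V" for v
  proof -
    have "weight (psi G I (q v)) i \<noteq> 0" using w[of v] pq[OF that] that V(3) by auto
    from label_psi[OF I qp[OF that] this] show "i \<in> I" "label (p v) i = snd (q v) i" using pq[OF that] by simp_all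
  qed
  have "plot (dspace G) n V (\<lambda>v. snd (q v) i)" using q l(1)[OF V(2)] by (simp add: plot_sphere_chart)
  then have "plot (dspace G) n V (\<lambda>v. label (p v) i)" by (rule plot_cong[OF dG]) (rule l(2))
  then show "\<exists>V. openin (Euclidean_space n) V \<and> u \<in> V \<and> V \<subseteq> U \<and> plot (dspace G) n V (\<lambda>u. label (p u) i)"
    using V by (intro exI[of _ V] conjI)
qed

lemma act_plot:
  assumes g: "plot (dspace G) n U g" and p: "plot (Esph G) n U p"
  shows "plot (Esph G) n U (\<lambda>u. act (g u) (p u))"
  unfolding plot_Esph
proof (intro conjI ballI)
  show "openin (Euclidean_space n) U" by (rule plot_open[OF diffeological_Esph p])
  fix u assume u: "u \<in> U"
  obtain V I q where V: "openin (Euclidean_space n) V" "u \<in> V" "V \<subseteq> U" and I: "finite I"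
    and q: "plot (sphere_chart G I) n V q" and pq: "\<And>v. v \<in> V \<Longrightarrow> p v = psi G I (q v)"
    and qp: "\<And>v. v \<in> V \<Longrightarrow> q v \<in> pts (sphere_chart G I)"
    by (rule plot_EsphE[OF p u]) (rule that)
  define r where "r v = (fst (q v), \<lambda>i\<in>I. g v \<otimes>\<^bsub>G\<^esub> snd (q v) i)" for v
  have gV: "plot (dspace G) n V g" by (rule plot_subset[OF dG g V(1,3)])
  have gc: "g v \<in> carrier G" if "v \<in> V" for v by (rule gplot_carrier[OF G gV that])
  have rp: "r v \<in> pts (sphere_chart G I)" if "v \<in> V" for v
    using qp[OF that] gc[OF that] by (auto simp: pts_sphere_chart r_def)
  have "plot (dspace G) n V (\<lambda>v. snd (r v) i)" if i: "i \<in> I" for i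
  proof -
    have "plot (dspace G) n V (\<lambda>v. snd (q v) i)" using q i by (simp add: plot_sphere_chart)
    from gplot_mult[OF G gV this] show ?thesis using i by (simp add: r_def)
  qed
  then have r: "plot (sphere_chart G I) n V r" using q rp V(1) by (simp add: plot_sphere_chart r_def)
  have "act (g v) (p v) = psi G I (r v)" if v: "v \<in> V" for v
  proof -
    note f = extend_fams[OF I qp[OF v]]
    have "act (g v) (p v) = cls (fst (extend I (q v)), \<lambda>i. g v \<otimes>\<^bsub>G\<^esub> snd (extend I (q v)) i)"
      unfolding pq[OF v] psi_cls by (rule act_cls[OF gc[OF v] f])
    also have "\<dots> = cls (extend I (r v))"
      by (rule cls_eq[OF translate_fams[OF gc[OF v] f] extend_fams[OF I rp[OF v]]])
        (auto simp: extend_def r_def split: if_splits)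
    finally show ?thesis unfolding psi_cls .
  qed
  then show "\<exists>V I q. openin (Euclidean_space n) V \<and> u \<in> V \<and> V \<subseteq> U \<and> finite I \<and>
       plot (sphere_chart G I) n V q \<and> (\<forall>v\<in>V. act (g v) (p v) = psi G I (q v))"
    using V I r by (intro exI[of _ V] exI[of _ I] exI[of _ r] conjI ballI)
qed

lemma diffeological_Bsph: "diffeological_space (Bsph G)"
  unfolding Bsph_def by (rule diffeological_quotient_diff[OF diffeological_Esph])

lemma pts_Bsph: "pts (Bsph G) = orb ` pts (Esph G)"
  by (simp add: Bsph_def)

text \<open>The section over the classes with nonzero \<open>i\<close>-th weight: the representative whose \<open>i\<close>-th
  label is the neutral element.\<close>

definition normalise :: "nat \<Rightarrow> 'g fam set \<Rightarrow> 'g fam set" where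
  "normalise i e = act (inv\<^bsub>G\<^esub> (label e i)) e"

lemma normalise_act:
  assumes "g \<in> carrier G" "e \<in> pts (Esph G)" "weight e i \<noteq> 0"
  shows "normalise i (act g e) = normalise i e"
  unfolding normalise_def label_act[OF assms]
  using assms label_closed[OF assms(2), of i] by (simp add: act_act inv_mult_group m_assoc)

text \<open>Labels at an index of nonzero weight are equivariant and smooth.  Their quotients give the
  translations, and normalising them gives local sections.\<close>

lemma principal_universal_bundle: "principal_bundle G (Bsph G) (universal_bundle G)"
proof -
  let ?Q = "universal_bundle G"
  have Q: "tot ?Q = Esph G" "proj ?Q = orb" "gact ?Q = act" by (simp_all add: universal_bundle_def)
  show ?thesis
  proof (rule principal_bundleI[OF G diffeological_Bsph])
    show "diffeological_space (tot ?Q)" unfolding Q by (rule diffeological_Esph)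
    show "dsmooth (tot ?Q) (Bsph G) (proj ?Q)" unfolding Q Bsph_def by (rule dsmooth_quotient_map[OF diffeological_Esph])
    show "smooth_action G (tot ?Q) (gact ?Q)" unfolding Q smooth_action_def
    proof (intro conjI ballI)
      show "dsmooth (prod_diff (dspace G) (Esph G)) (Esph G) (\<lambda>(g, x). act g x)"
      proof (rule dsmoothI)
        show "(case r of (g, x) \<Rightarrow> act g x) \<in> pts (Esph G)" if "r \<in> pts (prod_diff (dspace G) (Esph G))" for r
          using that act_pts by (auto simp: pts_G)
        show "plot (Esph G) n U (\<lambda>u. case p u of (g, x) \<Rightarrow> act g x)" if "plot (prod_diff (dspace G) (Esph G)) n U p" for n U p
          using act_plot[of n U "\<lambda>u. fst (p u)" "\<lambda>u. snd (p u)"] that by (simp add: split_beta)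
      qed
    qed (simp_all add: act_one act_act)
    show "proj ?Q (gact ?Q g q) = proj ?Q q" if "g \<in> carrier G" "q \<in> pts (tot ?Q)" for g q
      using that unfolding Q by (rule orb_act)
    show "g = h" if g: "g \<in> carrier G" and h: "h \<in> carrier G" and q: "q \<in> pts (tot ?Q)" and eq: "gact ?Q g q = gact ?Q h q" for g h q
    proof -
      obtain i where i: "weight q i \<noteq> 0" using exists_weight q unfolding Q by blast
      have e: "act g q = act h q" using eq unfolding Q .
      have q': "q \<in> pts (Esph G)" using q unfolding Q .
      show ?thesis using act_eq_label[OF g q' i e] act_eq_label[OF h q' i refl] by simp
    qed
    show "\<exists>d. plot (dspace G) n U d \<and> (\<forall>u\<in>U. gact ?Q (d u) (p u) = p' u)"
      if p: "plot (tot ?Q) n U p" and p': "plot (tot ?Q) n U p'" and eq: "\<And>u. u \<in> U \<Longrightarrow> proj ?Q (p u) = proj ?Q (p' u)" for n U p p'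
    proof -
      note p = p[unfolded Q] and p' = p'[unfolded Q] and eq = eq[unfolded Q]
      have pp: "p u \<in> pts (Esph G)" "p' u \<in> pts (Esph G)" if "u \<in> U" for u
        using plot_pts[OF diffeological_Esph p that] plot_pts[OF diffeological_Esph p' that] .
      have "\<forall>u\<in>U. \<exists>g. g \<in> carrier G \<and> p' u = act g (p u)"
      proof
        fix u assume u: "u \<in> U"
        obtain g where "g \<in> carrier G" "p' u = act g (p u)" by (rule orb_eqD[OF pp(2)[OF u] eq[OF u]])
        then show "\<exists>g. g \<in> carrier G \<and> p' u = act g (p u)" by (intro exI[of _ g] conjI)
      qed
      then obtain d where "\<forall>u\<in>U. d u \<in> carrier G \<and> p' u = act (d u) (p u)" by (rule bchoice[elim_format]) (elim exE)
      then have d: "d u \<in> carrier G" "p' u = act (d u) (p u)" if "u \<in> U" for u using that by simp_all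
      have "plot (dspace G) n U d"
      proof (rule plot_local[OF dG plot_open[OF diffeological_Esph p]])
        fix u assume u: "u \<in> U"
        obtain i where i: "weight (p u) i \<noteq> 0" by (rule exists_weight[OF pp(1)[OF u]])
        let ?V = "{u \<in> U. weight (p u) i \<noteq> 0}"
        have V: "openin (Euclidean_space n) ?V" "?V \<subseteq> U" using weight_open[OF p] by auto
        have w': "weight (p' v) i \<noteq> 0" if "v \<in> ?V" for v
          using that weight_act[OF d(1) pp(1), of v v] d(2)[of v] by simp
        have "plot (dspace G) n ?V (\<lambda>v. label (p' v) i \<otimes>\<^bsub>G\<^esub> inv\<^bsub>G\<^esub> (label (p v) i))"
          by (intro gplot_mult[OF G] gplot_inv[OF G] label_plot plot_subset[OF diffeological_Esph p V]
              plot_subset[OF diffeological_Esph p' V] w') simp_all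
        then have "plot (dspace G) n ?V d"
        proof (rule plot_cong[OF dG])
          fix v assume "v \<in> ?V"
          then have v: "v \<in> U" "weight (p v) i \<noteq> 0" by auto
          show "d v = label (p' v) i \<otimes>\<^bsub>G\<^esub> inv\<^bsub>G\<^esub> (label (p v) i)"
            by (rule act_eq_label[OF d(1)[OF v(1)] pp(1)[OF v(1)] v(2) d(2)[OF v(1), symmetric]])
        qed
        then show "\<exists>V. openin (Euclidean_space n) V \<and> u \<in> V \<and> V \<subseteq> U \<and> plot (dspace G) n V d"
          using V u i by (intro exI[of _ ?V] conjI) simp_all
      qed
      then show ?thesis unfolding Q using d(2) by (intro exI[of _ d]) simp
    qed
    fix y assume "y \<in> pts (Bsph G)"
    then obtain e where e: "e \<in> pts (Esph G)" "y = orb e" by (auto simp: pts_Bsph)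
    obtain i where i: "weight e i \<noteq> 0" by (rule exists_weight[OF e(1)])
    define U where "U = orb ` {e \<in> pts (Esph G). weight e i \<noteq> 0}"
    have U_iff: "orb a \<in> U \<longleftrightarrow> weight a i \<noteq> 0" if a: "a \<in> pts (Esph G)" for a
    proof
      assume "orb a \<in> U"
      then obtain a' where a': "a' \<in> pts (Esph G)" "weight a' i \<noteq> 0" "orb a = orb a'" by (auto simp: U_def)
      obtain g where g: "g \<in> carrier G" "a' = act g a" by (rule orb_eqD[OF a'(1,3)])
      show "weight a i \<noteq> 0" using a'(2) weight_act[OF g(1) a] g(2) by simp
    next
      assume "weight a i \<noteq> 0" then show "orb a \<in> U" using a by (auto simp: U_def)
    qed
    define \<sigma> where "\<sigma> b = normalise i (SOME a. a \<in> b)" for b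
    have \<sigma>_orb: "\<sigma> (orb a) = normalise i a" if a: "a \<in> pts (Esph G)" "weight a i \<noteq> 0" for a
    proof -
      have "(SOME x. x \<in> orb a) \<in> orb a" by (rule someI[of _ a]) (rule mem_orb[OF a(1)])
      then obtain g where "g \<in> carrier G" "(SOME x. x \<in> orb a) = act g a" by (auto simp: orbit_of_def)
      then show ?thesis unfolding \<sigma>_def using normalise_act[OF _ a] by simp
    qed
    have norm: "normalise i a \<in> pts (Esph G)" "orb (normalise i a) = orb a" if "a \<in> pts (Esph G)" for a
      unfolding normalise_def using act_pts[OF inv_closed[OF label_closed[OF that]] that] orb_act[OF inv_closed[OF label_closed[OF that]] that] .
    have oU: "openin (dtop (Bsph G)) U" unfolding openin_dtop
    proof (intro conjI allI impI)
      show "U \<subseteq> pts (Bsph G)" by (auto simp: U_def pts_Bsph)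
      fix n W p assume "plot (Bsph G) n W p"
      then have p: "openin (Euclidean_space n) W \<and> (\<forall>u\<in>W. \<exists>V r. openin (Euclidean_space n) V \<and> u \<in> V \<and> V \<subseteq> W \<and> plot (Esph G) n V r \<and> (\<forall>v\<in>V. p v = orb (r v)))"
        unfolding Bsph_def plot_quotient_diff[OF diffeological_Esph] .
      show "openin (Euclidean_space n) {u \<in> W. p u \<in> U}"
      proof (subst openin_subopen, intro ballI)
        fix u assume u: "u \<in> {u \<in> W. p u \<in> U}"
        then have "u \<in> W" by simp
        from bspec[OF conjunct2[OF p] this] obtain V r where V: "openin (Euclidean_space n) V" "u \<in> V" "V \<subseteq> W"
          and r: "plot (Esph G) n V r" and pr: "\<forall>v\<in>V. p v = orb (r v)" by (elim exE conjE)
        have iff: "p v \<in> U \<longleftrightarrow> weight (r v) i \<noteq> 0" if "v \<in> V" for v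
          using U_iff[OF plot_pts[OF diffeological_Esph r that]] bspec[OF pr that] by simp
        have "{v \<in> V. weight (r v) i \<noteq> 0} \<subseteq> {u \<in> W. p u \<in> U}" using iff V(3) by auto
        moreover have "u \<in> {v \<in> V. weight (r v) i \<noteq> 0}" using iff[OF V(2)] u V(2) by simp
        ultimately show "\<exists>T. openin (Euclidean_space n) T \<and> u \<in> T \<and> T \<subseteq> {u \<in> W. p u \<in> U}"
          using weight_open[OF r, of i] by (intro exI[of _ "{v \<in> V. weight (r v) i \<noteq> 0}"] conjI)
      qed
    qed
    have \<sigma>sm: "dsmooth (sub_diff (Bsph G) U) (Esph G) \<sigma>"
    proof (rule dsmoothI)
      show "\<sigma> b \<in> pts (Esph G)" if "b \<in> pts (sub_diff (Bsph G) U)" for b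
      proof -
        have "b \<in> U" using that by simp
        then obtain a where "a \<in> pts (Esph G)" "weight a i \<noteq> 0" "b = orb a" by (auto simp: U_def)
        then show ?thesis using \<sigma>_orb norm(1) by simp
      qed
      fix n W p assume "plot (sub_diff (Bsph G) U) n W p"
      then have p: "plot (Bsph G) n W p" and pU: "\<And>w. w \<in> W \<Longrightarrow> p w \<in> U" by (auto simp: image_subset_iff)
      have p': "openin (Euclidean_space n) W \<and> (\<forall>u\<in>W. \<exists>V r. openin (Euclidean_space n) V \<and> u \<in> V \<and> V \<subseteq> W \<and> plot (Esph G) n V r \<and> (\<forall>v\<in>V. p v = orb (r v)))"
        using p unfolding Bsph_def plot_quotient_diff[OF diffeological_Esph] .
      show "plot (Esph G) n W (\<lambda>w. \<sigma> (p w))"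
      proof (rule plot_local[OF diffeological_Esph conjunct1[OF p']])
        fix w assume "w \<in> W"
        from bspec[OF conjunct2[OF p'] this] obtain V r where V: "openin (Euclidean_space n) V" "w \<in> V" "V \<subseteq> W"
          and r: "plot (Esph G) n V r" and pr: "\<forall>v\<in>V. p v = orb (r v)" by (elim exE conjE)
        have rp: "r v \<in> pts (Esph G)" if "v \<in> V" for v by (rule plot_pts[OF diffeological_Esph r that])
        have rw: "weight (r v) i \<noteq> 0" if "v \<in> V" for v
        proof -
          have "orb (r v) \<in> U" using pU[of v] bspec[OF pr that] V(3) that by auto
          then show ?thesis using U_iff[OF rp[OF that]] by simp
        qed
        have "plot (Esph G) n V (\<lambda>v. normalise i (r v))"
          unfolding normalise_def by (rule act_plot[OF gplot_inv[OF G label_plot[OF r rw]] r])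
        then have "plot (Esph G) n V (\<lambda>v. \<sigma> (p v))"
          by (rule plot_cong[OF diffeological_Esph]) (simp add: bspec[OF pr] \<sigma>_orb rp rw)
        then show "\<exists>V. openin (Euclidean_space n) V \<and> w \<in> V \<and> V \<subseteq> W \<and> plot (Esph G) n V (\<lambda>w. \<sigma> (p w))"
          using V by (intro exI[of _ V] conjI)
      qed
    qed
    have "\<forall>u\<in>U. orb (\<sigma> u) = u"
    proof
      fix u assume "u \<in> U"
      then obtain a where "a \<in> pts (Esph G)" "weight a i \<noteq> 0" "u = orb a" by (auto simp: U_def)
      then show "orb (\<sigma> u) = u" using \<sigma>_orb norm(2) by simp
    qed
    moreover have "y \<in> U" using e i by (auto simp: U_def)
    ultimately show "\<exists>U \<sigma>. openin (dtop (Bsph G)) U \<and> y \<in> U \<and> dsmooth (sub_diff (Bsph G) U) (tot ?Q) \<sigma> \<and> (\<forall>u\<in>U. proj ?Q (\<sigma> u) = u)"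
      unfolding Q using oU \<sigma>sm by (intro exI[of _ U] exI[of _ \<sigma>] conjI)
  qed
qed

end

theorem theorem11p12:
  fixes G :: "'g dgroup" and Gh :: "'h dgroup"
    and S :: "('v, 'g fam set) clifford_bundle"
    and D :: "('g fam set \<Rightarrow> 'v) \<Rightarrow> 'g fam set \<Rightarrow> 'v"
    and L :: "'g tvec \<Rightarrow> ('g fam set \<Rightarrow> 'v) \<Rightarrow> 'g fam set \<Rightarrow> 'v"
    and J P :: "'k::{real_inner, complete_space} \<Rightarrow> 'k"
    and A :: "'g tvec \<Rightarrow> 'k \<Rightarrow> 'k"
    and X :: "'x diffeology" and f :: "'x \<Rightarrow> 'g fam set set"
  assumes "regular_Lie_group G"
    and "clifford_module (Esph G) S"
    and "dirac_type (Esph G) S D"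
    and "equivariant_bundle G (Esph G) (Esph_act G) S b"
    and "lie_derivative G (Esph G) (Esph_act G) S b L"
    and "complex_structure J" and "polarization J P"
    and "defects_define G (Esph G) S L D J P \<Gamma> j A"
    and "u = 1 \<or> u = \<i>"
    and "\<And>\<xi> \<eta>. \<xi> \<in> lie_alg G \<Longrightarrow> \<eta> \<in> lie_alg G \<Longrightarrow>
           schwinger_cocycle J P A \<xi> \<eta> = u * complex_of_real (\<omega> \<xi> \<eta>)"
    and "lie_2_cocycle G \<omega>"
    and "central_extension G Gh \<iota> \<pi>"
    and "integrates G \<omega> Gh \<iota> \<pi>"
    and "diffeological_space X"
    and "dsmooth X (Bsph G) f"
  shows "cohomology_pullback X int_dgroup 3 f (schwinger_DD G Gh \<iota> \<pi>) \<in> cohomology X int_dgroup 3 \<and>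
    cohomology_pullback X int_dgroup 3 f (schwinger_DD G Gh \<iota> \<pi>) =
      dd_class X (lifting_gerbe Gh \<iota> \<pi> X (bundle_pullback X f (universal_bundle G)))"
proof -
  have G: "diffeological_group G"
    using \<open>central_extension G Gh \<iota> \<pi>\<close> by (simp add: central_extension_def diffeological_Lie_group_def)
  interpret universal G by (rule universal.intro[OF G])
  have "principal G (Bsph G) (universal_bundle G)"
    by (rule principal.intro[OF G diffeological_Bsph principal_universal_bundle])
  from dd_class_bundle_pullback[OF \<open>central_extension G Gh \<iota> \<pi>\<close> this \<open>diffeological_space X\<close> \<open>dsmooth X (Bsph G) f\<close>]
  show ?thesis unfolding schwinger_DD_def .
qed

end
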